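(* The parameterised problem $p\text{-}\mathrm{ALT}_3\text{-}\mathrm{SSS}$ is $\mathrm{A}[3]$-complete under fpt-reductions; that is, it belongs to $\mathrm{A}[3]$, and every parameterised problem in $\mathrm{A}[3]$ is fpt-reducible to it.
   Context: The decision problem $\mathrm{ALT}_3\text{-}\mathrm{SSS}$ is the set of all tuples $\langle A_1,k,A_2,l,A_3,m,t\rangle$ with finite sets $A_1,A_2,A_3\subseteq\mathbb N_0$ and $k,l,m,t\in\mathbb N_0$ such that there exists $A_1'\subseteq A_1$ with $|A_1'|=k$ such that for all $A_2'\subseteq A_2$ with $|A_2'|=l$ there exists $A_3'\subseteq A_3$ with $|A_3'|=m$ such that $\sum_{a\in A_1'}a+\sum_{a\in A_2'}a+\sum_{a\in A_3'}a=t$. Its parameterised version $p\text{-}\mathrm{ALT}_3\text{-}\mathrm{SSS}$ is the pair $(\mathrm{ALT}_3\text{-}\mathrm{SSS},\kappa)$ with parameterisation $\kappa(\langle A_1,k,A_2,l,A_3,m,t\rangle)=k+l+m$. A parameterisation over an alphabet $\Sigma$ is a polynomial-time computable function $\kappa:\Sigma^*\to\mathbb N^+$; a parameterised problem is a pair $(Q,\kappa)$ with $Q\subseteq\Sigma^*$. An fpt-reduction from $(A,\kappa)$ (with $A\subseteq\Sigma^*$) to $(B,\iota)$ (with $B\subseteq\Gamma^*$) is a function $f:\Sigma^*\to\Gamma^*$ such that for all $x$: $x\in A\iff f(x)\in B$; $f(x)$ is computable in time $g(\kappa(x))\cdot p(|x|)$ for some computable $g$ and polynomial $p$; and $\iota(f(x))\le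 h(\kappa(x))$ for some computable $h$. For $t\in\mathbb N_0$, $\Sigma_0=\Pi_0$ is the class of quantifier-free first-order formulas; $\Sigma_{t+1}$ consists of formulas $\exists x_1\cdots\exists x_n\,\varphi$ with $\varphi\in\Pi_t$, and $\Pi_{t+1}$ of formulas $\forall x_1\cdots\forall x_n\,\psi$ with $\psi\in\Sigma_t$. The parameterised model-checking problem $p\text{-}\mathrm{MC}(\Sigma_t)$ asks, given a finite structure $\mathcal A$ and a sentence $\varphi\in\Sigma_t$, whether $\mathcal A\models\varphi$, with parameter $|\varphi|$. For $t\in\mathbb N^+$, $\mathrm{A}[t]$ is the class of all parameterised problems that are fpt-reducible to $p\text{-}\mathrm{MC}(\Sigma_t)$.
   Formalization: Since parameterisations must take values in the positive integers while k+l+m is 0 when k=l=m=0, the parameter is taken to be max(1, k+l+m); words that encode no instance are no-instances with parameter 1. *)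

theory Defs
  imports Main "HOL-Computational_Algebra.Polynomial"
begin

section \<open>Deterministic multi-tape Turing machines\<close>

text \<open>
  Tapes are infinite in both directions. Symbol 0 is the blank; the letter \<open>a\<close> of a word
  is written on a tape as \<open>Suc a\<close>. The states are \<open>0, ..., states M\<close>, where 0 is the initial
  and \<open>states M\<close> the only halting state. Tape 0 carries the input, tape 1 the output.
  By \<open>wf_tm\<close>, only finitely many values of the transition function are relevant.
\<close>

datatype move = MLeft | MStay | MRight

fun offset :: "move \<Rightarrow> int" where
  "offset MLeft = -1"
| "offset MStay = 0"
| "offset MRight = 1"

record tm =
  tapes :: nat
  symbols :: nat
  states :: nat
  trans :: "nat \<Rightarrow> nat list \<Rightarrow> nat \<times> (nat \<times> move) list"

definition wf_tm :: "tm \<Rightarrow> bool" where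
  "wf_tm M \<longleftrightarrow> tapes M \<ge> 2 \<and> symbols M \<ge> 1 \<and>
     (\<forall>q < states M. \<forall>ss. length ss = tapes M \<and> set ss \<subseteq> {..<symbols M} \<longrightarrow>
        (case trans M q ss of (q', as) \<Rightarrow>
           q' \<le> states M \<and> length as = tapes M \<and> fst ` set as \<subseteq> {..<symbols M}))"

type_synonym tape = "(int \<Rightarrow> nat) \<times> int"

type_synonym config = "nat \<times> tape list"

fun read_tape :: "tape \<Rightarrow> nat" where
  "read_tape (t, h) = t h"

fun act_tape :: "nat \<times> move \<Rightarrow> tape \<Rightarrow> tape" where
  "act_tape (s, d) (t, h) = (t(h := s), h + offset d)"

fun tm_step :: "tm \<Rightarrow> config \<Rightarrow> config" where
  "tm_step M (q, ts) =
     (if q \<ge> states M then (q, ts)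
      else (case trans M q (map read_tape ts) of (q', as) \<Rightarrow> (q', map2 act_tape as ts)))"

definition tape_of_word :: "nat list \<Rightarrow> int \<Rightarrow> nat" where
  "tape_of_word w i = (if 0 \<le> i \<and> nat i < length w then Suc (w ! nat i) else 0)"

definition tm_init :: "tm \<Rightarrow> nat list \<Rightarrow> config" where
  "tm_init M w = (0, (tape_of_word w, 0) # replicate (tapes M - 1) (\<lambda>_. 0, 0))"

definition tm_outputs_within :: "tm \<Rightarrow> nat list \<Rightarrow> nat list \<Rightarrow> nat \<Rightarrow> bool" where
  "tm_outputs_within M x y T \<longleftrightarrow>
     (case (tm_step M ^^ T) (tm_init M x) of (q, ts) \<Rightarrow>
        q = states M \<and> fst (ts ! 1) = tape_of_word y)"

definition tm_for :: "nat set \<Rightarrow> tm \<Rightarrow> bool" where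
  "tm_for \<Sigma> M \<longleftrightarrow> wf_tm M \<and> (\<forall>a\<in>\<Sigma>. Suc a < symbols M)"

definition computable_in_time ::
  "nat set \<Rightarrow> (nat list \<Rightarrow> nat list) \<Rightarrow> (nat list \<Rightarrow> nat) \<Rightarrow> bool" where
  "computable_in_time \<Sigma> f T \<longleftrightarrow>
     (\<exists>M. tm_for \<Sigma> M \<and> (\<forall>x\<in>lists \<Sigma>. tm_outputs_within M x (f x) (T x)))"

text \<open>Binary representation, least significant bit first, without leading zeros.\<close>

fun bits :: "nat \<Rightarrow> nat list" where
  "bits n = (if n = 0 then [] else n mod 2 # bits (n div 2))"

declare bits.simps [simp del]

definition computable :: "(nat \<Rightarrow> nat) \<Rightarrow> bool" where
  "computable g \<longleftrightarrow>
     (\<exists>M. tm_for {0, 1} M \<and> (\<forall>n. \<exists>T. tm_outputs_within M (bits n) (bits (g n)) T))"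


section \<open>Parameterised problems and fpt-reductions\<close>

text \<open>Finite alphabets are represented, up to renaming of letters, by finite sets of naturals.\<close>

record param_problem =
  alphabet :: "nat set"
  yes_instances :: "nat list set"
  parameter :: "nat list \<Rightarrow> nat"

definition parameterisation :: "nat set \<Rightarrow> (nat list \<Rightarrow> nat) \<Rightarrow> bool" where
  "parameterisation \<Sigma> \<kappa> \<longleftrightarrow>
     (\<forall>x\<in>lists \<Sigma>. \<kappa> x > 0) \<and>
     (\<exists>p :: nat poly. computable_in_time \<Sigma> (\<lambda>x. bits (\<kappa> x)) (\<lambda>x. poly p (length x)))"

definition is_param_problem :: "param_problem \<Rightarrow> bool" where
  "is_param_problem P \<longleftrightarrow>
     finite (alphabet P) \<and> alphabet P \<noteq> {} \<and>
     yes_instances P \<subseteq> lists (alphabet P) \<and>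
     parameterisation (alphabet P) (parameter P)"

definition fpt_reduction ::
  "param_problem \<Rightarrow> param_problem \<Rightarrow> (nat list \<Rightarrow> nat list) \<Rightarrow> bool" where
  "fpt_reduction P Q f \<longleftrightarrow>
     f ` lists (alphabet P) \<subseteq> lists (alphabet Q) \<and>
     (\<forall>x\<in>lists (alphabet P). x \<in> yes_instances P \<longleftrightarrow> f x \<in> yes_instances Q) \<and>
     (\<exists>g (p :: nat poly). computable g \<and>
        computable_in_time (alphabet P) f (\<lambda>x. g (parameter P x) * poly p (length x))) \<and>
     (\<exists>h. computable h \<and>
        (\<forall>x\<in>lists (alphabet P). parameter Q (f x) \<le> h (parameter P x)))"

definition fpt_reducible :: "param_problem \<Rightarrow> param_problem \<Rightarrow> bool" where
  "fpt_reducible P Q \<longleftrightarrow> (\<exists>f. fpt_reduction P Q f)"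

definition fpt_complete :: "param_problem set \<Rightarrow> param_problem \<Rightarrow> bool" where
  "fpt_complete C P \<longleftrightarrow> P \<in> C \<and> (\<forall>Q\<in>C. fpt_reducible Q P)"


section \<open>Encoding of instances as words\<close>

text \<open>
  Instances are first written as trees with numbers at the leaves, and these as words over
  \<open>{0, ..., 4}\<close>: 0 and 1 are bits, 2 terminates a number, 3 and 4 are brackets.
\<close>

datatype tree = Num nat | Node "tree list"

fun enc :: "tree \<Rightarrow> nat list" where
  "enc (Num n) = bits n @ [2]"
| "enc (Node ts) = 3 # concat (map enc ts) @ [4]"

definition nums :: "nat list \<Rightarrow> tree" where
  "nums ns = Node (map Num ns)"

definition code_alphabet :: "nat set" where
  "code_alphabet = {0, 1, 2, 3, 4}"

lemma set_bits: "set (bits n) \<subseteq> {0, 1}"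
  by (induction n rule: bits.induct) (subst bits.simps, auto)

lemma enc_in_lists: "enc t \<in> lists code_alphabet"
proof (induction t rule: enc.induct)
  case (1 n)
  then show ?case using set_bits[of n] by (auto simp: code_alphabet_def)
next
  case (2 ts)
  then have "set (enc t) \<subseteq> code_alphabet" if "t \<in> set ts" for t using that by auto
  then show ?case by (force simp: code_alphabet_def)
qed

lemma bits_inj: "bits m = bits n \<Longrightarrow> m = n"
proof (induction m arbitrary: n rule: bits.induct)
  case (1 m)
  show ?case
  proof (cases "m = 0 \<or> n = 0")
    case True
    then show ?thesis using 1(2) by (auto simp: bits.simps[of m] bits.simps[of n] split: if_splits)
  next
    case False
    then have "m mod 2 = n mod 2" "bits (m div 2) = bits (n div 2)"
      using 1(2) by (auto simp: bits.simps[of m] bits.simps[of n])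
    with 1(1)[of "n div 2"] False have "m div 2 = n div 2" "m mod 2 = n mod 2" by auto
    then show ?thesis by (metis mult_div_mod_eq)
  qed
qed

lemma append_terminator:
  assumes "xs @ a # r = ys @ a # s" "a \<notin> set xs" "a \<notin> set ys"
  shows "xs = ys \<and> r = s"
  using assms by (induction xs arbitrary: ys) (auto simp: Cons_eq_append_conv)

lemma enc_hd: "\<exists>a u. enc t = a # u \<and> a \<noteq> 4"
proof (cases t)
  case (Num n)
  have "set (bits n @ [2]) \<subseteq> {0, 1, 2}" using set_bits[of n] by auto
  then show ?thesis using Num by (cases "bits n @ [2]") auto
qed auto

lemma enc_hd_Num: "enc (Num n) @ r \<noteq> 3 # s"
proof -
  have "set (bits n @ [2]) \<subseteq> {0, 1, 2}" using set_bits[of n] by auto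
  then show ?thesis by (cases "bits n @ [2 :: nat]") auto
qed

lemma enc_prefix_free: "enc t @ r = enc t' @ r' \<Longrightarrow> t = t' \<and> r = r'"
proof (induction t arbitrary: t' r r')
  case (Num n)
  show ?case
  proof (cases t')
    case (Num n')
    have "2 \<notin> set (bits n)" "2 \<notin> set (bits n')" using set_bits[of n] set_bits[of n'] by auto
    with Num Num.prems show ?thesis
      using append_terminator[of "bits n" 2 r "bits n'" r'] bits_inj by auto
  next
    case (Node ts)
    then show ?thesis using Num.prems enc_hd_Num[of n r] by auto
  qed
next
  case (Node ts)
  show ?case
  proof (cases t')
    case (Num n')
    then show ?thesis using Node.prems enc_hd_Num[of n' r'] by (metis append_Cons enc.simps(2))
  next
    case t': (Node ts')
    have *: "ts = us \<and> r = r'"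
      if "concat (map enc ts) @ 4 # r = concat (map enc us) @ 4 # r'"
        and "\<And>t t' r r'. t \<in> set ts \<Longrightarrow> enc t @ r = enc t' @ r' \<Longrightarrow> t = t' \<and> r = r'" for us
      using that
    proof (induction ts arbitrary: us)
      case Nil
      then show ?case
      proof (cases us)
        case (Cons u us')
        then show ?thesis using Nil.prems(1) enc_hd[of u] by auto
      qed simp
    next
      case (Cons t ts)
      show ?case
      proof (cases us)
        case Nil
        then show ?thesis using Cons.prems(1) enc_hd[of t] by auto
      next
        case (Cons u us')
        then have "enc t @ (concat (map enc ts) @ 4 # r) = enc u @ (concat (map enc us') @ 4 # r')"
          using Cons.prems(1) by simp
        then have "t = u" "concat (map enc ts) @ 4 # r = concat (map enc us') @ 4 # r'"
          using Cons.prems(2)[of t] by auto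
        then show ?thesis using Cons.IH[of us'] Cons.prems(2) Cons by auto
      qed
    qed
    show ?thesis using *[of ts'] Node.prems Node.IH t' by auto
  qed
qed

lemma enc_inject [simp]: "enc t = enc t' \<longleftrightarrow> t = t'"
  using enc_prefix_free[of t "[]" t' "[]"] by auto

lemma nums_inject [simp]: "nums xs = nums ys \<longleftrightarrow> xs = ys"
  by (auto simp: nums_def inj_def intro: map_injective)


section \<open>The problem \<open>p-ALT\<^sub>3-SSS\<close>\<close>

definition alt3_sss :: "(nat set \<times> nat \<times> nat set \<times> nat \<times> nat set \<times> nat \<times> nat) set" where
  "alt3_sss = {(A1, k, A2, l, A3, m, t).
     finite A1 \<and> finite A2 \<and> finite A3 \<and>
     (\<exists>B1 \<subseteq> A1. card B1 = k \<and>
       (\<forall>B2 \<subseteq> A2. card B2 = l \<longrightarrow>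
         (\<exists>B3 \<subseteq> A3. card B3 = m \<and> \<Sum>B1 + \<Sum>B2 + \<Sum>B3 = t)))}"

text \<open>A finite set is presented by listing its elements in any order without repetition.\<close>

definition enc_alt3 ::
  "nat list \<Rightarrow> nat \<Rightarrow> nat list \<Rightarrow> nat \<Rightarrow> nat list \<Rightarrow> nat \<Rightarrow> nat \<Rightarrow> nat list" where
  "enc_alt3 xs k ys l zs m t =
     enc (Node [nums xs, Num k, nums ys, Num l, nums zs, Num m, Num t])"

lemma enc_alt3_inject [simp]:
  "enc_alt3 xs k ys l zs m t = enc_alt3 xs' k' ys' l' zs' m' t' \<longleftrightarrow>
     xs = xs' \<and> k = k' \<and> ys = ys' \<and> l = l' \<and> zs = zs' \<and> m = m' \<and> t = t'"
  unfolding enc_alt3_def by (simp del: enc.simps)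

text \<open>
  Parameters are positive by definition, so \<open>k + l + m = 0\<close> is raised to 1. Words that do not
  encode an instance also get parameter 1.
\<close>

definition alt3_param :: "nat list \<Rightarrow> nat" where
  "alt3_param w =
     (if \<exists>xs k ys l zs m t. distinct xs \<and> distinct ys \<and> distinct zs \<and> w = enc_alt3 xs k ys l zs m t
      then THE n. \<exists>xs k ys l zs m t. w = enc_alt3 xs k ys l zs m t \<and> n = max 1 (k + l + m)
      else 1)"

lemma alt3_param_enc:
  assumes "distinct xs" "distinct ys" "distinct zs"
  shows "alt3_param (enc_alt3 xs k ys l zs m t) = max 1 (k + l + m)"
  using assms unfolding alt3_param_def by auto

definition p_alt3_sss :: param_problem where
  "p_alt3_sss =
     \<lparr>alphabet = code_alphabet,
      yes_instances = {enc_alt3 xs k ys l zs m t | xs k ys l zs m t.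
        distinct xs \<and> distinct ys \<and> distinct zs \<and>
        (set xs, k, set ys, l, set zs, m, t) \<in> alt3_sss},
      parameter = alt3_param\<rparr>"


section \<open>First-order model checking\<close>

text \<open>
  Vocabularies are finite and relational; the relation symbols are the positions in the list
  \<open>relations A\<close>, whose entries consist of the arity and the interpretation of the symbol.
\<close>

record fo_structure =
  universe :: "nat set"
  relations :: "(nat \<times> nat list set) list"

definition wf_structure :: "fo_structure \<Rightarrow> bool" where
  "wf_structure A \<longleftrightarrow> finite (universe A) \<and> universe A \<noteq> {} \<and>
     (\<forall>(r, R)\<in>set (relations A). r \<ge> 1 \<and> (\<forall>as\<in>R. length as = r \<and> set as \<subseteq> universe A))"

datatype form =
    Rel nat "nat list"
  | Equ nat nat
  | Neg form
  | Conj form form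
  | Disj form form
  | Exi nat form
  | Uni nat form

fun over :: "fo_structure \<Rightarrow> form \<Rightarrow> bool" where
  "over A (Rel i xs) \<longleftrightarrow> i < length (relations A) \<and> length xs = fst (relations A ! i)"
| "over A (Equ x y) \<longleftrightarrow> True"
| "over A (Neg \<phi>) \<longleftrightarrow> over A \<phi>"
| "over A (Conj \<phi> \<psi>) \<longleftrightarrow> over A \<phi> \<and> over A \<psi>"
| "over A (Disj \<phi> \<psi>) \<longleftrightarrow> over A \<phi> \<and> over A \<psi>"
| "over A (Exi x \<phi>) \<longleftrightarrow> over A \<phi>"
| "over A (Uni x \<phi>) \<longleftrightarrow> over A \<phi>"

fun free_vars :: "form \<Rightarrow> nat set" where
  "free_vars (Rel i xs) = set xs"
| "free_vars (Equ x y) = {x, y}"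
| "free_vars (Neg \<phi>) = free_vars \<phi>"
| "free_vars (Conj \<phi> \<psi>) = free_vars \<phi> \<union> free_vars \<psi>"
| "free_vars (Disj \<phi> \<psi>) = free_vars \<phi> \<union> free_vars \<psi>"
| "free_vars (Exi x \<phi>) = free_vars \<phi> - {x}"
| "free_vars (Uni x \<phi>) = free_vars \<phi> - {x}"

fun sat :: "fo_structure \<Rightarrow> (nat \<Rightarrow> nat) \<Rightarrow> form \<Rightarrow> bool" where
  "sat A v (Rel i xs) \<longleftrightarrow> map v xs \<in> snd (relations A ! i)"
| "sat A v (Equ x y) \<longleftrightarrow> v x = v y"
| "sat A v (Neg \<phi>) \<longleftrightarrow> \<not> sat A v \<phi>"
| "sat A v (Conj \<phi> \<psi>) \<longleftrightarrow> sat A v \<phi> \<and> sat A v \<psi>"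
| "sat A v (Disj \<phi> \<psi>) \<longleftrightarrow> sat A v \<phi> \<or> sat A v \<psi>"
| "sat A v (Exi x \<phi>) \<longleftrightarrow> (\<exists>a\<in>universe A. sat A (v(x := a)) \<phi>)"
| "sat A v (Uni x \<phi>) \<longleftrightarrow> (\<forall>a\<in>universe A. sat A (v(x := a)) \<phi>)"

definition models :: "fo_structure \<Rightarrow> form \<Rightarrow> bool" where
  "models A \<phi> \<longleftrightarrow> (\<forall>v. range v \<subseteq> universe A \<longrightarrow> sat A v \<phi>)"

fun quantifier_free :: "form \<Rightarrow> bool" where
  "quantifier_free (Rel i xs) \<longleftrightarrow> True"
| "quantifier_free (Equ x y) \<longleftrightarrow> True"
| "quantifier_free (Neg \<phi>) \<longleftrightarrow> quantifier_free \<phi>"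
| "quantifier_free (Conj \<phi> \<psi>) \<longleftrightarrow> quantifier_free \<phi> \<and> quantifier_free \<psi>"
| "quantifier_free (Disj \<phi> \<psi>) \<longleftrightarrow> quantifier_free \<phi> \<and> quantifier_free \<psi>"
| "quantifier_free (Exi x \<phi>) \<longleftrightarrow> False"
| "quantifier_free (Uni x \<phi>) \<longleftrightarrow> False"

fun is_Sigma :: "nat \<Rightarrow> form \<Rightarrow> bool" and is_Pi :: "nat \<Rightarrow> form \<Rightarrow> bool" where
  "is_Sigma 0 \<phi> \<longleftrightarrow> quantifier_free \<phi>"
| "is_Sigma (Suc t) \<phi> \<longleftrightarrow> (\<exists>xs \<psi>. \<phi> = foldr Exi xs \<psi> \<and> is_Pi t \<psi>)"
| "is_Pi 0 \<phi> \<longleftrightarrow> quantifier_free \<phi>"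
| "is_Pi (Suc t) \<phi> \<longleftrightarrow> (\<exists>xs \<psi>. \<phi> = foldr Uni xs \<psi> \<and> is_Sigma t \<psi>)"

fun form_tree :: "form \<Rightarrow> tree" where
  "form_tree (Rel i xs) = Node [Num 0, Num i, nums xs]"
| "form_tree (Equ x y) = Node [Num 1, Num x, Num y]"
| "form_tree (Neg \<phi>) = Node [Num 2, form_tree \<phi>]"
| "form_tree (Conj \<phi> \<psi>) = Node [Num 3, form_tree \<phi>, form_tree \<psi>]"
| "form_tree (Disj \<phi> \<psi>) = Node [Num 4, form_tree \<phi>, form_tree \<psi>]"
| "form_tree (Exi x \<phi>) = Node [Num 5, Num x, form_tree \<phi>]"
| "form_tree (Uni x \<phi>) = Node [Num 6, Num x, form_tree \<phi>]"

lemma form_tree_inject [simp]: "form_tree \<phi> = form_tree \<psi> \<longleftrightarrow> \<phi> = \<psi>"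
proof
  show "form_tree \<phi> = form_tree \<psi> \<Longrightarrow> \<phi> = \<psi>"
    by (induction \<phi> arbitrary: \<psi>) (case_tac \<psi>; simp)+
qed simp

definition form_size :: "form \<Rightarrow> nat" where
  "form_size \<phi> = length (enc (form_tree \<phi>))"

text \<open>
  Structures are encoded by listing all elements of the universe (so that the length of the code
  is at least the number of elements) and all tuples of each relation (rather than
  characteristic functions, whose size would be exponential in the arity).
\<close>

definition listed_structure :: "nat list \<Rightarrow> (nat \<times> nat list list) list \<Rightarrow> fo_structure" where
  "listed_structure us Rs =
     \<lparr>universe = set us, relations = map (\<lambda>(r, R). (r, set R)) Rs\<rparr>"

definition enc_mc :: "nat list \<Rightarrow> (nat \<times> nat list list) list \<Rightarrow> form \<Rightarrow> nat list" where
  "enc_mc us Rs \<phi> =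
     enc (Node [nums us,
                Node (map (\<lambda>(r, R). Node [Num r, Node (map nums R)]) Rs),
                form_tree \<phi>])"

definition mc_instance ::
  "nat \<Rightarrow> nat list \<Rightarrow> (nat \<times> nat list list) list \<Rightarrow> form \<Rightarrow> bool" where
  "mc_instance t us Rs \<phi> \<longleftrightarrow>
     distinct us \<and> (\<forall>(r, R)\<in>set Rs. distinct R) \<and>
     wf_structure (listed_structure us Rs) \<and> over (listed_structure us Rs) \<phi> \<and>
     free_vars \<phi> = {} \<and> is_Sigma t \<phi>"

lemma enc_mc_inject [simp]:
  "enc_mc us Rs \<phi> = enc_mc us' Rs' \<phi>' \<longleftrightarrow> us = us' \<and> Rs = Rs' \<and> \<phi> = \<phi>'"
proof -
  have "inj (map nums)" by (simp add: inj_def)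
  then have "inj (\<lambda>(r, R). Node [Num r, Node (map nums R)])" by (auto simp: inj_def)
  then show ?thesis by (auto simp: enc_mc_def inj_map_eq_map simp del: enc.simps)
qed

definition mc_param :: "nat \<Rightarrow> nat list \<Rightarrow> nat" where
  "mc_param t w =
     (if \<exists>us Rs \<phi>. mc_instance t us Rs \<phi> \<and> w = enc_mc us Rs \<phi>
      then THE n. \<exists>us Rs \<phi>. w = enc_mc us Rs \<phi> \<and> n = form_size \<phi>
      else 1)"

lemma mc_param_enc: "mc_instance t us Rs \<phi> \<Longrightarrow> mc_param t (enc_mc us Rs \<phi>) = form_size \<phi>"
  unfolding mc_param_def by auto

definition p_mc :: "nat \<Rightarrow> param_problem" where
  "p_mc t =
     \<lparr>alphabet = code_alphabet,
      yes_instances = {enc_mc us Rs \<phi> | us Rs \<phi>.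
        mc_instance t us Rs \<phi> \<and> models (listed_structure us Rs) \<phi>},
      parameter = mc_param t\<rparr>"

text \<open>\<open>A_class t\<close> is the class \<open>A[t]\<close>, for \<open>t \<ge> 1\<close>.\<close>

definition A_class :: "nat \<Rightarrow> param_problem set" where
  "A_class t = {P. is_param_problem P \<and> fpt_reducible P (p_mc t)}"

end

theory Submission
  imports Defs Complex_Main "HOL-Computational_Algebra.Primes"
begin

text \<open>
  Membership: a formula with blocks \<open>\<exists>\<forall>\<exists>\<close> guesses the elements of the three subsets. It cannot compute
  with the sum \<open>s\<close>, which is too large to be an element of a structure of polynomial size, and compares
  \<open>s\<close> with \<open>t\<close> modulo small numbers instead. A nonzero number below \<open>2 ^ L\<close> has at most \<open>L\<close> prime
  divisors, and there are at most \<open>L ^ m\<close> candidates for the third subset; hence if none of them works,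
  then \<open>m + 1\<close> moduli of polynomial size refute all of them at once. So the moduli can be
  quantified universally together with the second subset, before the third subset is known.

  Hardness: model checking for \<open>\<exists>\<forall>\<exists>\<close> formulas becomes a game of exact covers, where the number of
  moves depends only on the formula: values for the variables are chosen in turn, the truth values of
  the subformulas are added to the last block, and each subformula becomes a constraint that is given by
  polynomially many patterns. Written in a base without carries, exact covers are subset sums.

  Both reductions are composed of functions that are closed under recursion over lists with
  polynomially bounded values. Such functions are computed by programs on stacks, and those are
  translated to Turing machines. For the composition with an arbitrary fpt-reduction, the machine of the
  latter is simulated by the same programs.
\<close>

section \<open>From programs to Turing machines\<close>


text \<open>The difficulty of membership is the order of play. Moduli chosen by the existential
  player could conceal a difference, and moduli chosen against a known third subset would cost a
  fourth block of quantifiers. So one short list of moduli has to work against every third subset: a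
  good prime leaves at most one candidate in \<open>L\<close>, and \<open>m\<close> rounds reduce
  \<open>L ^ m\<close> candidates to one, which a last prime refutes. That there are enough primes
  of polynomial size follows from Leibniz' harmonic triangle, which bounds common multiples of
  \<open>1, ..., n\<close> from below. The difficulty of hardness is the second player, who may take
  any \<open>l\<close> numbers and is not bound to one value per variable. As this is the universal
  player, each such deviation must let the third player win; yet the third player then has to cover
  a set of keys that grows with the universe by a number of moves that depends on the parameter
  alone. Intervals of a fixed list of keys serve as these moves: \<open>l\<close> points cut the
  list into at most \<open>l + 1\<close> intervals.\<close>

datatype cmd =
    Act "nat list => (nat \<times> move) list"
  | Seq cmd cmd
  | Cond "nat list => bool" cmd cmd
  | Loop "nat list => bool" cmd

definition acts :: "(nat \<times> move) list => tape list => tape list" where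
  "acts as ts = map2 act_tape as ts"

text \<open>Every \<open>Seq\<close> and every evaluated test costs one step of its own, in which
  the machine only changes its state. With this convention the counts are exact and not only
  bounds.\<close>

inductive exec :: "cmd => tape list => nat => tape list => bool" where
  Act: "exec (Act F) ts 1 (acts (F (map read_tape ts)) ts)"
| Seq: "exec a ts t ts' ==> exec b ts' t' ts'' ==> exec (Seq a b) ts (t + t' + 1) ts''"
| Cond: "exec (if P (map read_tape ts) then a else b) ts t ts' ==> exec (Cond P a b) ts (t + 1) ts'"
| Loop_end: "\<not> P (map read_tape ts) ==> exec (Loop P a) ts 1 ts"
| Loop_step: "P (map read_tape ts) ==> exec a ts t ts' ==> exec (Loop P a) ts' t' ts'' ==>
    exec (Loop P a) ts (t + t' + 1) ts''"

text \<open>The functions inside commands are arbitrary, but over \<open>n\<close> tapes and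
  \<open>S\<close> symbols they amount to finite tables, so they can be absorbed into a transition
  function.\<close>

fun wf_cmd :: "nat => nat => cmd => bool" where
  "wf_cmd n S (Act F) \<longleftrightarrow> (\<forall>ss. length ss = n \<and> set ss \<subseteq> {..<S} \<longrightarrow>
     length (F ss) = n \<and> fst ` set (F ss) \<subseteq> {..<S})"
| "wf_cmd n S (Seq a b) \<longleftrightarrow> wf_cmd n S a \<and> wf_cmd n S b"
| "wf_cmd n S (Cond P a b) \<longleftrightarrow> wf_cmd n S a \<and> wf_cmd n S b"
| "wf_cmd n S (Loop P a) \<longleftrightarrow> wf_cmd n S a"

definition stay :: "nat list => (nat \<times> move) list" where
  "stay ss = map (\<lambda>s. (s, MStay)) ss"

lemma length_stay [simp]: "length (stay ss) = length ss"
  by (simp add: stay_def)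

lemma fst_stay [simp]: "fst ` set (stay ss) = set ss"
  by (force simp: stay_def)

lemma length_acts [simp]: "length (acts as ts) = min (length as) (length ts)"
  by (simp add: acts_def)

lemma acts_stay [simp]: "acts (stay (map read_tape ts)) ts = ts"
proof -
  have "act_tape (read_tape t, MStay) t = t" for t by (cases t) auto
  then show ?thesis by (intro nth_equalityI) (auto simp: acts_def stay_def)
qed

text \<open>The states of the machine are the lists of commands that can remain to be executed.\<close>

fun next_cmds :: "cmd list => nat list => cmd list \<times> (nat \<times> move) list" where
  "next_cmds [] ss = ([], stay ss)"
| "next_cmds (Act F # k) ss = (k, F ss)"
| "next_cmds (Seq a b # k) ss = (a # b # k, stay ss)"
| "next_cmds (Cond P a b # k) ss = ((if P ss then a else b) # k, stay ss)"
| "next_cmds (Loop P a # k) ss = ((if P ss then a # Loop P a # k else k), stay ss)"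

definition cmds_step :: "cmd list \<times> tape list => cmd list \<times> tape list" where
  "cmds_step = (\<lambda>(k, ts). case next_cmds k (map read_tape ts) of (k', as) => (k', acts as ts))"

lemma exec_cmds_step: "exec c ts t ts' ==> (cmds_step ^^ t) (c # k, ts) = (k, ts')"
proof (induction arbitrary: k rule: exec.induct)
  case (Act F ts)
  then show ?case by (simp add: cmds_step_def)
next
  case (Seq a ts t ts' b t' ts'')
  have "(cmds_step ^^ (t + t' + 1)) (Seq a b # k, ts) = (cmds_step ^^ (t' + t)) (a # b # k, ts)"
    by (simp add: cmds_step_def funpow_swap1 add.commute)
  also have "\<dots> = (k, ts'')" by (simp add: funpow_add Seq.IH)
  finally show ?case .
next
  case (Cond P ts a b t ts')
  have "(cmds_step ^^ (t + 1)) (Cond P a b # k, ts)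
      = (cmds_step ^^ t) ((if P (map read_tape ts) then a else b) # k, ts)"
    by (simp add: cmds_step_def funpow_swap1)
  then show ?case by (simp only: Cond.IH)
next
  case (Loop_end P ts a)
  then show ?case by (simp add: cmds_step_def)
next
  case (Loop_step P ts a t ts' t' ts'')
  have "(cmds_step ^^ (t + t' + 1)) (Loop P a # k, ts) = (cmds_step ^^ (t' + t)) (a # Loop P a # k, ts)"
    using Loop_step.hyps by (simp add: cmds_step_def funpow_swap1 add.commute)
  also have "\<dots> = (k, ts'')" by (simp add: funpow_add Loop_step.IH)
  finally show ?case .
qed

text \<open>The list \<open>k\<close> is the continuation. A loop returns to its own residual
  \<open>Loop P a # k\<close>, which keeps the set finite although runs are unbounded.\<close>

fun residuals :: "cmd => cmd list => cmd list set" where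
  "residuals (Act F) k = {Act F # k}"
| "residuals (Seq a b) k = insert (Seq a b # k) (residuals a (b # k) \<union> residuals b k)"
| "residuals (Cond P a b) k = insert (Cond P a b # k) (residuals a k \<union> residuals b k)"
| "residuals (Loop P a) k = insert (Loop P a # k) (residuals a (Loop P a # k))"

lemma finite_residuals: "finite (residuals c k)"
  by (induction c arbitrary: k) auto

lemma self_residuals: "c # k \<in> residuals c k"
  by (cases c) auto

lemma next_residuals:
  "r \<in> residuals c k ==> fst (next_cmds r ss) \<in> insert k (residuals c k)"
proof (induction c arbitrary: k)
  case (Seq a b)
  consider "r = Seq a b # k" | "r \<in> residuals a (b # k)" | "r \<in> residuals b k" using Seq.prems by auto
  then show ?case
    by cases (use Seq.IH self_residuals[of b k] self_residuals[of a "b # k"] in \<open>fastforce+\<close>)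
next
  case (Cond P a b)
  then show ?case using Cond.IH(1)[of k] Cond.IH(2)[of k] self_residuals[of a k] self_residuals[of b k] by auto
next
  case (Loop P a)
  then show ?case using Loop.IH(1)[of "Loop P a # k"] self_residuals[of a "Loop P a # k"]
    by (cases "r = Loop P a # k") auto
qed auto

lemma residuals_wf:
  assumes "wf_cmd n S c" "list_all (wf_cmd n S) k" "r \<in> residuals c k"
  shows "list_all (wf_cmd n S) r"
  using assms
proof (induction c arbitrary: k)
  case (Seq a b)
  consider "r = Seq a b # k" | "r \<in> residuals a (b # k)" | "r \<in> residuals b k" using Seq.prems(3) by auto
  then show ?case
    by cases (use Seq.prems Seq.IH(1)[of "b # k"] Seq.IH(2)[of k] in \<open>simp_all\<close>)
next
  case (Cond P a b)
  consider "r = Cond P a b # k" | "r \<in> residuals a k" | "r \<in> residuals b k" using Cond.prems(3) by auto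
  then show ?case
    by cases (use Cond.prems Cond.IH(1)[of k] Cond.IH(2)[of k] in \<open>simp_all\<close>)
next
  case (Loop P a)
  consider "r = Loop P a # k" | "r \<in> residuals a (Loop P a # k)" using Loop.prems(3) by auto
  then show ?case
    by cases (use Loop.prems Loop.IH[of "Loop P a # k"] in \<open>simp_all\<close>)
qed simp

lemma next_cmds_wf:
  assumes "list_all (wf_cmd n S) r" "length ss = n" "set ss \<subseteq> {..<S}"
  shows "length (snd (next_cmds r ss)) = n \<and> fst ` set (snd (next_cmds r ss)) \<subseteq> {..<S}"
  using assms by (induction r ss rule: next_cmds.induct) auto

lemma compile_cmd:
  assumes wf: "wf_cmd n S c" and n: "n \<ge> 2" and S: "S \<ge> 1"
  shows "\<exists>M. wf_tm M \<and> tapes M = n \<and> symbols M = S \<and>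
    (\<forall>ts t ts'. exec c ts t ts' \<longrightarrow> (tm_step M ^^ t) (0, ts) = (states M, ts'))"
proof -
  define R where "R = insert [] (residuals c [])"
  have R_next: "fst (next_cmds r ss) \<in> R" if "r \<in> R" for r ss
    using that next_residuals[of r c "[]" ss] by (auto simp: R_def)
  have R_wf: "list_all (wf_cmd n S) r" if "r \<in> R" for r
    using that residuals_wf[OF wf, of "[]" r] by (auto simp: R_def)
  have "finite (R - {[], [c]})" by (simp add: R_def finite_residuals)
  from finite_distinct_list[OF this]
  obtain rs where rs: "set rs = R - {[], [c]}" "distinct rs" by (elim exE conjE)
  \<comment> \<open>The positions in \<open>ks\<close> become the states. The machine model fixes 0
    as the initial and \<open>states M\<close> as the halting state, hence \<open>[c]\<close> has to
    come first and the empty list last.\<close>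
  define ks where "ks = [c] # rs @ [[]]"
  have ks: "set ks = R" "distinct ks"
  proof -
    have "[c] \<in> R" "[] \<in> R" using self_residuals[of c "[]"] by (simp_all add: R_def)
    then show "set ks = R" "distinct ks" using rs by (auto simp add: ks_def)
  qed
  define N where "N = length rs + 1"
  have N: "length ks = Suc N" "ks ! N = []" "ks ! 0 = [c]" by (auto simp: ks_def N_def nth_append)
  define code where "code k = (THE i. i < length ks \<and> ks ! i = k)" for k
  have code: "code k < length ks \<and> ks ! code k = k" if "k \<in> R" for k
  proof -
    have "\<exists>!i. i < length ks \<and> ks ! i = k"
      using that ks by (metis distinct_Ex1)
    from theI'[OF this] show ?thesis unfolding code_def .
  qed
  have code_nth: "code (ks ! i) = i" if "i < length ks" for i
    using that code[of "ks ! i"] ks by (metis nth_eq_iff_index_eq nth_mem)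
  define M where "M = \<lparr>tapes = n, symbols = S, states = N,
    trans = (\<lambda>q ss. case next_cmds (ks ! q) ss of (k', as) => (code k', as))\<rparr>"
  have "wf_tm M"
  proof -
    have "code (fst (next_cmds (ks ! q) ss)) \<le> N \<and> length (snd (next_cmds (ks ! q) ss)) = n \<and>
       fst ` set (snd (next_cmds (ks ! q) ss)) \<subseteq> {..<S}"
      if "q < N" "length ss = n" "set ss \<subseteq> {..<S}" for q ss
    proof -
      have q: "ks ! q \<in> R" using that N ks by (metis less_SucI nth_mem)
      show ?thesis
        using code[OF R_next[OF q, of ss]] N next_cmds_wf[OF R_wf[OF q] that(2,3)] by auto
    qed
    then show ?thesis using n S by (simp add: wf_tm_def M_def case_prod_unfold)
  qed
  moreover have step: "tm_step M (code k, ts) = (case cmds_step (k, ts) of (k', ts') => (code k', ts'))"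
    if "k \<in> R" for k ts
  proof (cases "k = []")
    case True
    then have "code k = N" using code_nth[of N] N by auto
    then show ?thesis using True by (simp add: M_def cmds_step_def)
  next
    case False
    have *: "code k < length ks" "ks ! code k = k" using code[OF that] by simp_all
    have "code k \<noteq> N" using *(2) N(2) False by metis
    then have "code k < N" using *(1) N(1) by linarith
    then show ?thesis using *(2)
      by (simp add: M_def cmds_step_def acts_def case_prod_unfold)
  qed
  have steps: "fst ((cmds_step ^^ t) (k, ts)) \<in> R \<and> (tm_step M ^^ t) (code k, ts) =
      (case (cmds_step ^^ t) (k, ts) of (k', ts') => (code k', ts'))"
    if "k \<in> R" for k ts t
  proof (induction t)
    case (Suc t)
    obtain k' ts' where *: "(cmds_step ^^ t) (k, ts) = (k', ts')" by (cases "(cmds_step ^^ t) (k, ts)")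
    then have "k' \<in> R" using Suc by auto
    then have "(tm_step M ^^ Suc t) (code k, ts) = tm_step M (code k', ts')" using Suc * by simp
    also have "\<dots> = (case cmds_step (k', ts') of (k', ts') => (code k', ts'))"
      using step[OF \<open>k' \<in> R\<close>] .
    finally show ?case using * R_next[OF \<open>k' \<in> R\<close>, of "map read_tape ts'"]
      by (simp add: cmds_step_def case_prod_unfold)
  qed (use that in simp)
  have "(tm_step M ^^ t) (0, ts) = (states M, ts')" if "exec c ts t ts'" for ts t ts'
  proof -
    have "[c] \<in> R" by (simp add: R_def self_residuals)
    moreover have "code [c] = 0" using code_nth[of 0] N by simp
    moreover have "code [] = N" using code_nth[of N] N by simp
    ultimately show ?thesis
      using conjunct2[OF steps[of "[c]" t ts]] by (simp add: M_def exec_cmds_step[OF that])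
  qed
  ultimately show ?thesis by (intro exI[of _ M]) (simp add: M_def)
qed

section \<open>Programs on stacks and their execution on tapes\<close>

datatype sc =
    Push nat nat
  | Pop nat
  | Copy nat nat
  | Emit nat
  | SSeq sc sc
  | SIf nat "nat option => bool" sc sc
  | SWhile nat "nat option => bool" sc

fun top_of :: "nat list => nat option" where
  "top_of [] = None"
| "top_of (a # w) = Some a"

text \<open>The numbers of steps are those of the translation \<open>cmd_of\<close> below.\<close>

inductive sexec :: "sc => (nat => nat list) => nat => (nat => nat list) => bool" where
  Push: "sexec (Push r a) st 3 (st(r := a # st r))"
| Pop: "sexec (Pop r) st 1 (st(r := tl (st r)))"
| Copy: "st r \<noteq> [] ==> r \<noteq> r' ==> sexec (Copy r r') st 3 (st(r' := hd (st r) # st r'))"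
| Emit: "sexec (Emit a) st 1 (st(1 := st 1 @ [a]))"
| SSeq: "sexec a st t st' ==> sexec b st' t' st'' ==> sexec (SSeq a b) st (t + t' + 1) st''"
| SIf: "sexec (if P (top_of (st r)) then a else b) st t st' ==> sexec (SIf r P a b) st (t + 1) st'"
| SWhile_end: "\<not> P (top_of (st r)) ==> sexec (SWhile r P a) st 1 st"
| SWhile_step: "P (top_of (st r)) ==> sexec a st t st' ==> sexec (SWhile r P a) st' t' st'' ==>
    sexec (SWhile r P a) st (t + t' + 1) st''"

definition act_at :: "nat => (nat list => nat \<times> move) => cmd" where
  "act_at r f = Act (\<lambda>ss. (stay ss)[r := f ss])"

definition symbol :: "nat => nat option" where
  "symbol s = (case s of 0 => None | Suc a => Some a)"

text \<open>A push takes two actions, because an action writes before it moves: the first one only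
  brings the head to the free cell. \<open>Copy\<close> reads its source in the second action, when
  the source is still unchanged.\<close>

fun cmd_of :: "sc => cmd" where
  "cmd_of (Push r a) = Seq (act_at r (\<lambda>ss. (ss ! r, MLeft))) (act_at r (\<lambda>ss. (Suc a, MStay)))"
| "cmd_of (Pop r) = act_at r (\<lambda>ss. (0, MRight))"
| "cmd_of (Copy r r') = Seq (act_at r' (\<lambda>ss. (ss ! r', MLeft))) (act_at r' (\<lambda>ss. (ss ! r, MStay)))"
| "cmd_of (Emit a) = act_at 1 (\<lambda>ss. (Suc a, MRight))"
| "cmd_of (SSeq a b) = Seq (cmd_of a) (cmd_of b)"
| "cmd_of (SIf r P a b) = Cond (\<lambda>ss. P (symbol (ss ! r))) (cmd_of a) (cmd_of b)"
| "cmd_of (SWhile r P a) = Loop (\<lambda>ss. P (symbol (ss ! r))) (cmd_of a)"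

fun sc_ok :: "nat set => nat => sc => bool" where
  "sc_ok I S (Push r a) \<longleftrightarrow> r \<in> I \<and> Suc a < S"
| "sc_ok I S (Pop r) \<longleftrightarrow> r \<in> I"
| "sc_ok I S (Copy r r') \<longleftrightarrow> r \<in> I \<and> r' \<in> I"
| "sc_ok I S (Emit a) \<longleftrightarrow> Suc a < S"
| "sc_ok I S (SSeq a b) \<longleftrightarrow> sc_ok I S a \<and> sc_ok I S b"
| "sc_ok I S (SIf r P a b) \<longleftrightarrow> r \<in> I \<and> sc_ok I S a \<and> sc_ok I S b"
| "sc_ok I S (SWhile r P a) \<longleftrightarrow> r \<in> I \<and> sc_ok I S a"

lemma sc_ok_mono: "sc_ok I S c ==> I \<subseteq> I' ==> S \<le> S' ==> sc_ok I' S' c"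
  by (induction c) auto

text \<open>The top lies under the head and the stack extends to the right, with blanks elsewhere.
  Only the position relative to the head is fixed, since there is no end mark to return to.\<close>

definition stack_tape :: "nat list => tape => bool" where
  "stack_tape w p \<longleftrightarrow> fst p = (\<lambda>i. tape_of_word w (i - snd p))"

text \<open>Tape 1 is the output and grows to the right, with its head behind the last letter. Its
  position is absolute, because the output is required to begin in cell 0.\<close>

definition stacks :: "nat set => (nat => nat list) => tape list => bool" where
  "stacks I st ts \<longleftrightarrow> 1 < length ts \<and> ts ! 1 = (tape_of_word (st 1), int (length (st 1))) \<and>
     (\<forall>r\<in>I. r \<noteq> 1 \<and> r < length ts \<and> stack_tape (st r) (ts ! r))"

lemma read_stack_tape: "stack_tape w p ==> symbol (read_tape p) = top_of w"
  by (cases p; cases w) (auto simp: stack_tape_def tape_of_word_def symbol_def)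

lemma read_stack_tape_Cons: "stack_tape w p ==> w \<noteq> [] ==> read_tape p = Suc (hd w)"
  by (cases p; cases w) (auto simp: stack_tape_def tape_of_word_def)

lemma act_push:
  assumes "stack_tape w p"
  shows "stack_tape (a # w) (act_tape (Suc a, MStay) (act_tape (read_tape p, MLeft) p))"
proof -
  obtain t h where p: "p = (t, h)" by (cases p)
  have "(t(h - 1 := Suc a)) i = tape_of_word (a # w) (i - (h - 1))" for i
  proof -
    have "i = h - 1 \<or> i < h - 1 \<or> (\<exists>n. i = h + int n)"
      by (metis add.commute diff_add_cancel linorder_neqE_linordered_idom nonneg_int_cases zle_diff1_eq diff_ge_0_iff_ge zless_imp_add1_zle)
    then show ?thesis using assms p
      by (auto simp: stack_tape_def tape_of_word_def nat_add_distrib nth_Cons' algebra_simps)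
  qed
  then show ?thesis by (auto simp: p stack_tape_def)
qed

lemma act_pop:
  assumes "stack_tape w p"
  shows "stack_tape (tl w) (act_tape (0, MRight) p)"
proof -
  obtain t h where p: "p = (t, h)" by (cases p)
  have "(t(h := 0)) i = tape_of_word (tl w) (i - (h + 1))" for i
  proof (cases "i > h")
    case True
    then obtain n where "i = h + 1 + int n" by (metis zless_iff_Suc_zadd of_nat_Suc add.commute add.left_commute)
    then show ?thesis using assms p
      by (auto simp: stack_tape_def tape_of_word_def nth_tl nat_add_distrib)
  next
    case False
    then show ?thesis using assms p by (auto simp: stack_tape_def tape_of_word_def)
  qed
  then show ?thesis by (auto simp: p stack_tape_def)
qed

lemma act_emit:
  "act_tape (Suc a, MRight) (tape_of_word w, int (length w))
     = (tape_of_word (w @ [a]), int (length (w @ [a])))"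
  by (auto simp: tape_of_word_def nth_append fun_eq_iff)

lemma exec_act_at:
  "exec (act_at r f) ts 1 (ts[r := act_tape (f (map read_tape ts)) (ts ! r)])"
proof -
  have *: "acts ((stay (map read_tape ts))[r := x]) ts = ts[r := act_tape x (ts ! r)]" for x
  proof (cases "r < length ts")
    case True
    have "acts ((stay (map read_tape ts))[r := x]) ts = (acts (stay (map read_tape ts)) ts)[r := act_tape x (ts ! r)]"
      unfolding acts_def by (metis case_prod_conv list_update_id map_update zip_update)
    then show ?thesis by simp
  qed (simp add: list_update_beyond)
  show ?thesis
    using exec.Act[of "\<lambda>ss. (stay ss)[r := f ss]" ts] unfolding act_at_def * .
qed

lemma exec_Seq_1_1: "exec a ts 1 ts' ==> exec b ts' 1 ts'' ==> exec (Seq a b) ts 3 ts''"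
  using exec.Seq[of a ts 1 ts' b 1 ts''] by (simp add: numeral_3_eq_3)

lemma stacks_update:
  assumes "stacks I st ts" "r \<in> I" "stack_tape w p"
  shows "stacks I (st(r := w)) (ts[r := p])"
  using assms by (auto simp: stacks_def nth_list_update)

lemma sexec_exec:
  assumes "sexec c st t st'" "sc_ok I S c" "stacks I st ts"
  shows "\<exists>ts'. exec (cmd_of c) ts t ts' \<and> stacks I st' ts' \<and> length ts' = length ts"
  using assms
proof (induction arbitrary: ts rule: sexec.induct)
  case (Push r a st)
  then have r: "r \<in> I" "r < length ts" "stack_tape (st r) (ts ! r)" by (auto simp: stacks_def)
  let ?p = "act_tape (read_tape (ts ! r), MLeft) (ts ! r)"
  have "exec (cmd_of (Push r a)) ts 3 ((ts[r := ?p])[r := act_tape (Suc a, MStay) (ts[r := ?p] ! r)])"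
    using r exec_act_at[of r "\<lambda>ss. (ss ! r, MLeft)" ts] exec_act_at[of r "\<lambda>ss. (Suc a, MStay)" "ts[r := ?p]"]
    by (auto intro!: exec_Seq_1_1)
  moreover have "stacks I (st(r := a # st r)) (ts[r := act_tape (Suc a, MStay) ?p])"
    by (intro stacks_update Push r act_push)
  ultimately show ?case using r
    by (intro exI[of _ "ts[r := act_tape (Suc a, MStay) ?p]"]) (simp del: fun_upd_apply)
next
  case (Pop r st)
  then have r: "r \<in> I" "r < length ts" "stack_tape (st r) (ts ! r)" by (auto simp: stacks_def)
  then have "stacks I (st(r := tl (st r))) (ts[r := act_tape (0, MRight) (ts ! r)])"
    by (intro stacks_update Pop act_pop)
  then show ?case using exec_act_at[of r "\<lambda>ss. (0, MRight)" ts]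
    by (intro exI[of _ "ts[r := act_tape (0, MRight) (ts ! r)]"]) (simp del: fun_upd_apply)
next
  case (Copy st r r')
  then have r: "r' \<in> I" "r' < length ts" "stack_tape (st r') (ts ! r')"
    and r1: "r < length ts" "read_tape (ts ! r) = Suc (hd (st r))"
    by (auto simp: stacks_def read_stack_tape_Cons)
  let ?p = "act_tape (read_tape (ts ! r'), MLeft) (ts ! r')"
  have "exec (cmd_of (Copy r r')) ts 3
      ((ts[r' := ?p])[r' := act_tape (Suc (hd (st r)), MStay) (ts[r' := ?p] ! r')])"
    using r r1 exec_act_at[of r' "\<lambda>ss. (ss ! r', MLeft)" ts]
      exec_act_at[of r' "\<lambda>ss. (ss ! r, MStay)" "ts[r' := ?p]"] Copy.hyps
    by (auto intro!: exec_Seq_1_1)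
  moreover have "stacks I (st(r' := hd (st r) # st r')) (ts[r' := act_tape (Suc (hd (st r)), MStay) ?p])"
    by (intro stacks_update Copy r act_push)
  ultimately show ?case using r
    by (intro exI[of _ "ts[r' := act_tape (Suc (hd (st r)), MStay) ?p]"]) (simp del: fun_upd_apply)
next
  case (Emit a st)
  have "stacks I (st(1 := st 1 @ [a])) (ts[1 := act_tape (Suc a, MRight) (ts ! 1)])"
    using Emit act_emit[of a "st 1"] unfolding stacks_def by (auto simp: nth_list_update)
  then show ?case using exec_act_at[of 1 "\<lambda>ss. (Suc a, MRight)" ts]
    by (intro exI[of _ "ts[1 := act_tape (Suc a, MRight) (ts ! 1)]"]) (simp del: fun_upd_apply)
next
  case (SSeq a st t st' b t' st'')
  from SSeq.IH(1)[of ts] SSeq.prems obtain ts' where 1: "exec (cmd_of a) ts t ts'"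
    "stacks I st' ts'" "length ts' = length ts" by auto
  from SSeq.IH(2)[of ts'] SSeq.prems 1 obtain ts'' where "exec (cmd_of b) ts' t' ts''"
    "stacks I st'' ts''" "length ts'' = length ts'" by auto
  then show ?case using 1 exec.Seq[OF 1(1)] by (intro exI[of _ ts'']) simp
next
  case (SIf P st r a b t st')
  have *: "symbol (map read_tape ts ! r) = top_of (st r)"
    using SIf.prems by (auto simp: stacks_def read_stack_tape)
  have "sc_ok I S (if P (top_of (st r)) then a else b)" using SIf.prems by simp
  from SIf.IH[OF this SIf.prems(2)] obtain ts' where
    ts': "exec (cmd_of (if P (top_of (st r)) then a else b)) ts t ts'"
    "stacks I st' ts'" "length ts' = length ts" by auto
  have "exec (cmd_of (SIf r P a b)) ts (t + 1) ts'"
    unfolding cmd_of.simps by (rule exec.Cond) (use ts'(1) * in \<open>simp split: if_splits\<close>)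
  then show ?case using ts' by (intro exI[of _ ts']) simp
next
  case (SWhile_end P st r a)
  have "symbol (map read_tape ts ! r) = top_of (st r)"
    using SWhile_end.prems by (auto simp: stacks_def read_stack_tape)
  then have "exec (cmd_of (SWhile r P a)) ts 1 ts"
    unfolding cmd_of.simps by (intro exec.Loop_end) (use SWhile_end.hyps in simp)
  then show ?case using SWhile_end.prems by (intro exI[of _ ts]) simp
next
  case (SWhile_step P st r a t st' t' st'')
  have *: "symbol (map read_tape ts ! r) = top_of (st r)"
    using SWhile_step.prems by (auto simp: stacks_def read_stack_tape)
  have "sc_ok I S a" using SWhile_step.prems by simp
  from SWhile_step.IH(1)[OF this SWhile_step.prems(2)] obtain ts' where
    ts': "exec (cmd_of a) ts t ts'" "stacks I st' ts'" "length ts' = length ts" by auto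
  from SWhile_step.IH(2)[OF SWhile_step.prems(1) ts'(2)] obtain ts'' where
    ts'': "exec (cmd_of (SWhile r P a)) ts' t' ts''" "stacks I st'' ts''" "length ts'' = length ts'" by auto
  have "exec (cmd_of (SWhile r P a)) ts (t + t' + 1) ts''"
    unfolding cmd_of.simps
    by (rule exec.Loop_step) (use SWhile_step.hyps(1) * ts'(1) ts''(1) in \<open>simp_all\<close>)
  then show ?case using ts' ts'' by (intro exI[of _ ts'']) simp
qed

lemma wf_cmd_of:
  assumes "sc_ok I S c" "\<forall>r\<in>I. r < n" "1 < n" "0 < S"
  shows "wf_cmd n S (cmd_of c)"
proof -
  have *: "wf_cmd n S (act_at r f)"
    if "\<And>ss. length ss = n ==> set ss \<subseteq> {..<S} ==> fst (f ss) < S" for r f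
  proof -
    have "fst ` set ((stay ss)[r := f ss]) \<subseteq> insert (fst (f ss)) (set ss)" for ss
      using set_update_subset_insert[of "stay ss" r "f ss"] fst_stay[of ss] by (metis image_insert image_mono)
    then show ?thesis using that unfolding act_at_def wf_cmd.simps by fastforce
  qed
  have **: "ss ! r < S" if "set ss \<subseteq> {..<S}" "r < length ss" for ss :: "nat list" and r
    using that nth_mem by blast
  show ?thesis using assms by (induction c) (auto intro!: * **)
qed

text \<open>Upper bounds instead of exact numbers of steps, so that branches of different length can
  be estimated together.\<close>

definition runs :: "sc => (nat => nat list) => nat => (nat => nat list) => bool" where
  "runs c st T st' \<longleftrightarrow> (\<exists>t\<le>T. sexec c st t st')"

lemma runs_mono: "runs c st T st' ==> T \<le> T' ==> runs c st T' st'"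
  unfolding runs_def using le_trans by blast

lemma runs_Push: "st' = st(r := a # st r) ==> 3 \<le> T ==> runs (Push r a) st T st'"
  unfolding runs_def using sexec.Push by blast

lemma runs_Pop: "st' = st(r := tl (st r)) ==> 1 \<le> T ==> runs (Pop r) st T st'"
  unfolding runs_def using sexec.Pop by blast

lemma runs_Copy:
  "st r \<noteq> [] ==> r \<noteq> r' ==> st' = st(r' := hd (st r) # st r') ==> 3 \<le> T ==> runs (Copy r r') st T st'"
  unfolding runs_def using sexec.Copy by blast

lemma runs_Emit: "st' = st(1 := st 1 @ [a]) ==> 1 \<le> T ==> runs (Emit a) st T st'"
  unfolding runs_def using sexec.Emit by blast

lemma runs_SSeq:
  assumes "runs a st T st'" "runs b st' T' st''" "T + T' + 1 \<le> T''"
  shows "runs (SSeq a b) st T'' st''"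
proof -
  obtain t t' where "t \<le> T" "sexec a st t st'" "t' \<le> T'" "sexec b st' t' st''"
    using assms by (auto simp: runs_def)
  then show ?thesis using assms(3) sexec.SSeq unfolding runs_def
    by (intro exI[of _ "t + t' + 1"]) auto
qed

lemma runs_SIf:
  assumes "P (top_of (st r)) ==> runs a st T st'" "\<not> P (top_of (st r)) ==> runs b st T st'" "T + 1 \<le> T'"
  shows "runs (SIf r P a b) st T' st'"
proof -
  obtain t where "t \<le> T" "sexec (if P (top_of (st r)) then a else b) st t st'"
    using assms(1,2) by (cases "P (top_of (st r))") (auto simp: runs_def)
  then show ?thesis using assms(3) sexec.SIf unfolding runs_def
    by (intro exI[of _ "t + 1"]) auto
qed

lemma runs_SWhile_end:
  "\<not> P (top_of (st r)) ==> st' = st ==> 1 \<le> T ==> runs (SWhile r P a) st T st'"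
  unfolding runs_def using sexec.SWhile_end by blast

lemma runs_SWhile_step:
  assumes "P (top_of (st r))" "runs a st T st'" "runs (SWhile r P a) st' T' st''" "T + T' + 1 \<le> T''"
  shows "runs (SWhile r P a) st T'' st''"
proof -
  obtain t t' where "t \<le> T" "sexec a st t st'" "t' \<le> T'" "sexec (SWhile r P a) st' t' st''"
    using assms by (auto simp: runs_def)
  then show ?thesis using assms(1,4) sexec.SWhile_step unfolding runs_def
    by (intro exI[of _ "t + t' + 1"]) auto
qed

lemma sexec_length:
  "sexec c st t st' ==> length (st' r) \<le> length (st r) + t"
  by (induction rule: sexec.induct) auto

lemma runs_length: "runs c st T st' ==> length (st' r) \<le> length (st r) + T"
  unfolding runs_def using sexec_length le_trans nat_add_left_cancel_le by blast

fun loopfree :: "sc => bool" where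
  "loopfree (SSeq a b) \<longleftrightarrow> loopfree a \<and> loopfree b"
| "loopfree (SIf r P a b) \<longleftrightarrow> loopfree a \<and> loopfree b"
| "loopfree (SWhile r P a) \<longleftrightarrow> False"
| "loopfree _ \<longleftrightarrow> True"

fun cost :: "sc => nat" where
  "cost (Push r a) = 3"
| "cost (Pop r) = 1"
| "cost (Copy r r') = 3"
| "cost (Emit a) = 1"
| "cost (SSeq a b) = cost a + cost b + 1"
| "cost (SIf r P a b) = max (cost a) (cost b) + 1"
| "cost (SWhile r P a) = 0"

fun effect :: "sc => (nat => nat list) => (nat => nat list)" where
  "effect (Push r a) st = st(r := a # st r)"
| "effect (Pop r) st = st(r := tl (st r))"
| "effect (Copy r r') st = st(r' := hd (st r) # st r')"
| "effect (Emit a) st = st(1 := st 1 @ [a])"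
| "effect (SSeq a b) st = effect b (effect a st)"
| "effect (SIf r P a b) st = (if P (top_of (st r)) then effect a st else effect b st)"
| "effect (SWhile r P a) st = st"

fun safe :: "sc => (nat => nat list) => bool" where
  "safe (Copy r r') st \<longleftrightarrow> st r \<noteq> [] \<and> r \<noteq> r'"
| "safe (SSeq a b) st \<longleftrightarrow> safe a st \<and> safe b (effect a st)"
| "safe (SIf r P a b) st \<longleftrightarrow> (if P (top_of (st r)) then safe a st else safe b st)"
| "safe _ st \<longleftrightarrow> True"

text \<open>Symbolic execution for programs without loops: \<open>effect\<close> is evaluated by
  simplification, and \<open>safe\<close> collects the side conditions of \<open>Copy\<close>. Only
  loops then require induction.\<close>

lemma runs_loopfree:
  assumes "loopfree c" "safe c st" "st' = effect c st" "cost c \<le> T"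
  shows "runs c st T st'"
proof -
  have "runs c st (cost c) (effect c st)" using assms(1,2)
  proof (induction c arbitrary: st)
    case (SSeq a b)
    have "runs (SSeq a b) st (cost a + cost b + 1) (effect b (effect a st))"
      using SSeq.prems by (intro runs_SSeq[OF SSeq.IH(1) SSeq.IH(2)]) auto
    then show ?case by simp
  next
    case (SIf r P a b)
    show ?case
      by (rule runs_SIf[of P st r a "max (cost a) (cost b)" _ b])
        (use SIf.prems in \<open>auto intro!: runs_mono[OF SIf.IH(1)] runs_mono[OF SIf.IH(2)]\<close>)
  qed (auto intro: runs_Push runs_Pop runs_Copy runs_Emit)
  then show ?thesis using assms runs_mono by blast
qed

section \<open>Binary trees on a stack\<close>

datatype dat = Lf | Br dat dat

text \<open>The preorder code is prefix-free, so several data can lie on one stack without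
  separators, and a program can ignore what lies below its argument.\<close>

fun ser :: "dat => nat list" where
  "ser Lf = [0]"
| "ser (Br l r) = 1 # ser l @ ser r"

lemma set_ser: "set (ser d) \<subseteq> {0, 1}"
  by (induction d) auto

lemma ser_prefix_free: "ser d @ r = ser d' @ r' ==> d = d' \<and> r = r'"
proof (induction d arbitrary: d' r r')
  case Lf
  then show ?case by (cases d') auto
next
  case (Br a b)
  show ?case
  proof (cases d')
    case Lf
    then show ?thesis using Br.prems by simp
  next
    case d': (Br a' b')
    then have "ser a @ (ser b @ r) = ser a' @ (ser b' @ r')" using Br.prems by simp
    then have "a = a' \<and> ser b @ r = ser b' @ r'" by (rule Br.IH(1))
    then show ?thesis using Br.IH(2)[of r b' r'] d' by simp
  qed
qed

lemma ser_inject [simp]: "ser d = ser d' \<longleftrightarrow> d = d'"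
  using ser_prefix_free[of d "[]" d' "[]"] by auto

text \<open>Detects the end of a preorder code. Stack 4 holds in unary the number of subtrees that
  are still to be read: a symbol 0 completes one of them, and a symbol 1 replaces one by
  two.\<close>

definition stash_loop :: sc where
  "stash_loop = SWhile 4 (\<lambda>t. t = Some 1) (SSeq (Pop 4) (SIf 2 (\<lambda>t. t = Some 1)
     (SSeq (Copy 2 3) (SSeq (Pop 2) (SSeq (Push 4 1) (Push 4 1)))) (SSeq (Copy 2 3) (Pop 2))))"

lemma runs_SWhile_loopfree:
  assumes "P (top_of (st r))" "loopfree a" "safe a st" "effect a st = st1"
    and "runs (SWhile r P a) st1 T st'" "cost a + T + 1 \<le> T'"
  shows "runs (SWhile r P a) st T' st'"
proof (rule runs_SWhile_step)
  show "runs a st (cost a) st1" using assms by (intro runs_loopfree) auto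
qed (use assms in auto)

text \<open>Phrased for the rest of the run: if the loop can be completed after the datum
  \<open>d\<close>, it can be completed from before it. This allows the induction to pass through
  both subtrees within a single loop.\<close>

lemma stash_loop:
  assumes "runs stash_loop (st(2 := r, 3 := rev (ser d) @ u, 4 := v)) T st'"
  shows "runs stash_loop (st(2 := ser d @ r, 3 := u, 4 := 1 # v)) (T + 20 * length (ser d)) st'"
  using assms
proof (induction d arbitrary: r u v T)
  case Lf
  show ?case unfolding stash_loop_def
    by (rule runs_SWhile_loopfree[OF _ _ _ _ Lf.prems[unfolded stash_loop_def]]) (auto simp: fun_eq_iff)
next
  case (Br a b)
  have "runs stash_loop (st(2 := ser b @ r, 3 := rev (ser a) @ 1 # u, 4 := 1 # v)) (T + 20 * length (ser b)) st'"
    by (rule Br.IH(2)) (use Br.prems in simp)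
  then have "runs stash_loop (st(2 := ser a @ ser b @ r, 3 := 1 # u, 4 := 1 # 1 # v))
      (T + 20 * length (ser b) + 20 * length (ser a)) st'"
    by (rule Br.IH(1))
  then show ?case unfolding stash_loop_def
    by (rule runs_SWhile_loopfree[rotated 4]) (auto simp: fun_eq_iff)
qed

text \<open>The symbol 2 does not occur in codes and marks the lower end of the stored word on stack
  3. The 0 on stack 4 ends the loop.\<close>

definition stash :: sc where
  "stash = SSeq (SSeq (Push 3 2) (SSeq (Push 4 0) (Push 4 1))) (SSeq stash_loop (Pop 4))"

lemma stash:
  assumes "st 2 = ser d @ r"
  shows "runs stash st (20 * length (ser d) + 20) (st(2 := r, 3 := rev (ser d) @ 2 # st 3))"
proof -
  have 1: "runs (SSeq (Push 3 2) (SSeq (Push 4 0) (Push 4 1))) st 11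
      (st(2 := ser d @ r, 3 := 2 # st 3, 4 := 1 # 0 # st 4))"
    by (rule runs_loopfree) (use assms in \<open>auto simp: fun_eq_iff\<close>)
  have "runs stash_loop (st(2 := ser d @ r, 3 := 2 # st 3, 4 := 1 # 0 # st 4)) (1 + 20 * length (ser d))
      (st(2 := r, 3 := rev (ser d) @ 2 # st 3, 4 := 0 # st 4))"
    by (rule stash_loop, unfold stash_loop_def, rule runs_SWhile_end) auto
  then have 2: "runs (SSeq stash_loop (Pop 4)) (st(2 := ser d @ r, 3 := 2 # st 3, 4 := 1 # 0 # st 4)) (4 + 20 * length (ser d))
      (st(2 := r, 3 := rev (ser d) @ 2 # st 3))"
    by (rule runs_SSeq[OF _ runs_Pop[OF _ order.refl]]) (auto simp: fun_eq_iff)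
  show ?thesis unfolding stash_def
    by (rule runs_SSeq[OF 1 2]) simp
qed

definition move :: "nat => nat => sc" where
  "move a b = SSeq (SWhile a (\<lambda>t. t \<noteq> Some 2) (SSeq (Copy a b) (Pop a))) (Pop a)"

lemma move:
  assumes "st a = w @ 2 # u" "2 \<notin> set w" "a \<noteq> b"
  shows "runs (move a b) st (10 * length w + 10) (st(a := u, b := rev w @ st b))"
proof -
  have "runs (SWhile a (\<lambda>t. t \<noteq> Some 2) (SSeq (Copy a b) (Pop a))) st (10 * length w + 1)
     (st(a := 2 # u, b := rev w @ st b))" using assms
  proof (induction w arbitrary: st)
    case Nil
    then show ?case by (intro runs_SWhile_end) (auto simp: fun_eq_iff)
  next
    case (Cons x w)
    have "runs (SWhile a (\<lambda>t. t \<noteq> Some 2) (SSeq (Copy a b) (Pop a))) (st(a := w @ 2 # u, b := x # st b)) (10 * length w + 1)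
     ((st(a := w @ 2 # u, b := x # st b))(a := 2 # u, b := rev w @ (st(a := w @ 2 # u, b := x # st b)) b))"
      by (rule Cons.IH) (use Cons.prems in auto)
    then show ?case
      by (rule runs_SWhile_loopfree[rotated 4, THEN back_subst[where P = "runs _ _ _"]])
        (use Cons.prems in \<open>auto simp: fun_eq_iff\<close>)
  qed
  then show ?thesis unfolding move_def
    by (rule runs_SSeq[OF _ runs_Pop[OF _ order.refl]]) (use assms(3) in \<open>auto simp: fun_eq_iff\<close>)
qed

definition move2 :: "nat => nat => nat => sc" where
  "move2 a b c = SSeq (SWhile a (\<lambda>t. t \<noteq> Some 2) (SSeq (SSeq (Copy a b) (Copy a c)) (Pop a))) (Pop a)"

lemma move2:
  assumes "st a = w @ 2 # u" "2 \<notin> set w" "a \<noteq> b" "a \<noteq> c" "b \<noteq> c"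
  shows "runs (move2 a b c) st (10 * length w + 10) (st(a := u, b := rev w @ st b, c := rev w @ st c))"
proof -
  let ?W = "SWhile a (\<lambda>t. t \<noteq> Some 2) (SSeq (SSeq (Copy a b) (Copy a c)) (Pop a))"
  have "runs ?W st (10 * length w + 1) (st(a := 2 # u, b := rev w @ st b, c := rev w @ st c))" using assms
  proof (induction w arbitrary: st)
    case Nil
    then show ?case by (intro runs_SWhile_end) (auto simp: fun_eq_iff)
  next
    case (Cons x w)
    let ?st = "st(a := w @ 2 # u, b := x # st b, c := x # st c)"
    have "runs ?W ?st (10 * length w + 1) (?st(a := 2 # u, b := rev w @ ?st b, c := rev w @ ?st c))"
      by (rule Cons.IH) (use Cons.prems in auto)
    then show ?case
      by (rule runs_SWhile_loopfree[rotated 4, THEN back_subst[where P = "runs _ _ _"]])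
        (use Cons.prems in \<open>auto simp: fun_eq_iff\<close>)
  qed
  then show ?thesis unfolding move2_def
    by (rule runs_SSeq[OF _ runs_Pop[OF _ order.refl]]) (use assms in \<open>auto simp: fun_eq_iff\<close>)
qed

definition discard :: "nat => sc" where
  "discard a = SSeq (SWhile a (\<lambda>t. t \<noteq> Some 2) (Pop a)) (Pop a)"

lemma discard:
  assumes "st a = w @ 2 # u" "2 \<notin> set w"
  shows "runs (discard a) st (10 * length w + 10) (st(a := u))"
proof -
  have "runs (SWhile a (\<lambda>t. t \<noteq> Some 2) (Pop a)) st (10 * length w + 1) (st(a := 2 # u))" using assms
  proof (induction w arbitrary: st)
    case Nil
    then show ?case by (intro runs_SWhile_end) (auto simp: fun_eq_iff)
  next
    case (Cons x w)
    have "runs (SWhile a (\<lambda>t. t \<noteq> Some 2) (Pop a)) (st(a := w @ 2 # u)) (10 * length w + 1)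
     ((st(a := w @ 2 # u))(a := 2 # u))"
      by (rule Cons.IH) (use Cons.prems in auto)
    then show ?case
      by (rule runs_SWhile_loopfree[rotated 4, THEN back_subst[where P = "runs _ _ _"]])
        (use Cons.prems in \<open>auto simp: fun_eq_iff\<close>)
  qed
  then show ?thesis unfolding discard_def
    by (rule runs_SSeq[OF _ runs_Pop[OF _ order.refl]]) (auto simp: fun_eq_iff)
qed

lemma marker_notin_ser [simp]: "2 \<notin> set (ser d)"
  using set_ser[of d] by auto

definition drop_dat :: sc where
  "drop_dat = SSeq stash (discard 3)"

lemma drop_dat:
  assumes "st 2 = ser d @ r"
  shows "runs drop_dat st (40 * length (ser d) + 40) (st(2 := r))"
proof -
  have "runs (discard 3) (st(2 := r, 3 := rev (ser d) @ 2 # st 3)) (10 * length (rev (ser d)) + 10)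
      ((st(2 := r, 3 := rev (ser d) @ 2 # st 3))(3 := st 3))"
    by (rule discard[of _ _ "rev (ser d)"]) auto
  moreover have "(st(2 := r, 3 := rev (ser d) @ 2 # st 3))(3 := st 3) = st(2 := r)" by (auto simp: fun_eq_iff)
  ultimately show ?thesis unfolding drop_dat_def
    by (intro runs_SSeq[OF stash[of st d r, OF assms]]) auto
qed

definition unstash :: sc where
  "unstash = move 3 2"

lemma unstash:
  assumes "st 3 = rev (ser d) @ 2 # u"
  shows "runs unstash st (10 * length (ser d) + 10) (st(2 := ser d @ st 2, 3 := u))"
  using move[of st 3 "rev (ser d)" u 2] assms by (simp add: unstash_def fun_upd_twist)

text \<open>A transfer between stacks reverses a word. The second copy therefore goes from stack 3
  over 4 and 3 to 2, which restores its order.\<close>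

definition dup :: sc where
  "dup = SSeq stash (SSeq (Push 4 2) (SSeq (move2 3 2 4) (SSeq (Push 3 2) (SSeq (move 4 3) unstash))))"

lemma dup:
  assumes "st 2 = ser d @ r"
  shows "runs dup st (60 * length (ser d) + 100) (st(2 := ser d @ ser d @ r))"
proof -
  let ?s = "ser d"
  let ?st1 = "st(2 := r, 3 := rev ?s @ 2 # st 3)"
  let ?st2 = "st(2 := r, 3 := rev ?s @ 2 # st 3, 4 := 2 # st 4)"
  let ?st3 = "st(2 := ?s @ r, 4 := ?s @ 2 # st 4)"
  let ?st4 = "st(2 := ?s @ r, 3 := 2 # st 3, 4 := ?s @ 2 # st 4)"
  let ?st5 = "st(2 := ?s @ r, 3 := rev ?s @ 2 # st 3)"
  have 1: "runs stash st (20 * length ?s + 20) ?st1" by (rule stash[of st d r, OF assms])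
  have 2: "runs (Push 4 2) ?st1 3 ?st2" by (rule runs_Push) auto
  have 3: "runs (move2 3 2 4) ?st2 (10 * length ?s + 10) ?st3"
    by (rule back_subst[where P = "runs _ _ _", OF move2[of _ _ "rev ?s" "st 3", THEN runs_mono]])
      (auto simp: fun_eq_iff)
  have 4: "runs (Push 3 2) ?st3 3 ?st4" by (rule runs_Push) (auto simp: fun_eq_iff)
  have 5: "runs (move 4 3) ?st4 (10 * length ?s + 10) ?st5"
    by (rule back_subst[where P = "runs _ _ _", OF move[of _ _ "?s" "st 4", THEN runs_mono]])
      (auto simp: fun_eq_iff)
  have 6: "runs unstash ?st5 (10 * length ?s + 10) (st(2 := ser d @ ser d @ r))"
    by (rule back_subst[where P = "runs _ _ _", OF unstash[of _ d "st 3", THEN runs_mono]])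
      (auto simp: fun_eq_iff)
  show ?thesis unfolding dup_def
    by (rule runs_SSeq[OF 1 runs_SSeq[OF 2 runs_SSeq[OF 3 runs_SSeq[OF 4 runs_SSeq[OF 5 6 le_refl] le_refl] le_refl] le_refl]]) simp
qed

text \<open>There is no empty command; for the empty word, a push followed by a pop takes its
  place.\<close>

fun push_all :: "nat => nat list => sc" where
  "push_all r [] = SIf r (\<lambda>t. False) (Pop r) (SSeq (Push r 0) (Pop r))"
| "push_all r (a # w) = SSeq (push_all r w) (Push r a)"

lemma push_all: "runs (push_all r w) st (cost (push_all r w)) (st(r := w @ st r))"
proof (rule runs_loopfree)
  show "loopfree (push_all r w)" by (induction w) auto
  show "safe (push_all r w) st" by (induction w) auto
  have "effect (push_all r w) st = st(r := w @ st r)" by (induction w) (simp_all add: fun_upd_same del: fun_upd_apply)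
  then show "st(r := w @ st r) = effect (push_all r w) st" by simp
qed simp

text \<open>Replaces a datum by the list of symbols of its code, with \<open>Br Lf Lf\<close> for the symbol 1.\<close>

fun tokens :: "nat list => dat" where
  "tokens [] = Lf"
| "tokens (a # w) = Br (if a = 1 then Br Lf Lf else Lf) (tokens w)"

definition tokenise :: sc where
  "tokenise = SSeq stash (SSeq (Push 2 0) (SSeq (SWhile 3 (\<lambda>t. t \<noteq> Some 2)
     (SSeq (SIf 3 (\<lambda>t. t = Some 1) (SSeq (Push 2 0) (SSeq (Push 2 0) (SSeq (Push 2 1) (Push 2 1))))
        (SSeq (Push 2 0) (Push 2 1))) (Pop 3))) (Pop 3)))"

lemma tokenise:
  assumes "st 2 = ser d @ r"
  shows "runs tokenise st (80 * length (ser d) + 80) (st(2 := ser (tokens (ser d)) @ r))"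
proof -
  let ?B = "SSeq (SIf 3 (\<lambda>t. t = Some 1) (SSeq (Push 2 0) (SSeq (Push 2 0) (SSeq (Push 2 1) (Push 2 1))))
        (SSeq (Push 2 0) (Push 2 1))) (Pop 3)"
  let ?W = "SWhile 3 (\<lambda>t. t \<noteq> Some 2) ?B"
  have W: "runs ?W (st(2 := ser (tokens v) @ r, 3 := rev w @ 2 # st 3)) (20 * length w + 1)
      (st(2 := ser (tokens (w @ v)) @ r, 3 := 2 # st 3))" if "2 \<notin> set w" for w v
    using that
  proof (induction w arbitrary: v rule: rev_induct)
    case Nil
    then show ?case by (intro runs_SWhile_end) (auto simp: fun_eq_iff)
  next
    case (snoc x w)
    have "runs ?W (st(2 := ser (tokens (x # v)) @ r, 3 := rev w @ 2 # st 3)) (20 * length w + 1)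
      (st(2 := ser (tokens (w @ x # v)) @ r, 3 := 2 # st 3))"
      by (rule snoc.IH) (use snoc.prems in auto)
    then have "runs ?W (st(2 := ser (tokens v) @ r, 3 := rev (w @ [x]) @ 2 # st 3)) (20 * length (w @ [x]) + 1)
      (st(2 := ser (tokens (w @ x # v)) @ r, 3 := 2 # st 3))"
      by (rule runs_SWhile_loopfree[rotated 4]) (use snoc.prems in \<open>auto simp: fun_eq_iff\<close>)
    then show ?case by (simp del: fun_upd_apply)
  qed
  let ?st1 = "st(2 := r, 3 := rev (ser d) @ 2 # st 3)"
  have 1: "runs stash st (20 * length (ser d) + 20) ?st1" by (rule stash[of st d r, OF assms])
  have 2: "runs (Push 2 0) ?st1 3 (st(2 := ser (tokens []) @ r, 3 := rev (ser d) @ 2 # st 3))"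
    by (rule runs_Push) (auto simp: fun_eq_iff)
  have 3: "runs (Pop 3) (st(2 := ser (tokens (ser d @ [])) @ r, 3 := 2 # st 3)) 1 (st(2 := ser (tokens (ser d)) @ r))"
    by (rule runs_Pop) (auto simp: fun_eq_iff)
  show ?thesis unfolding tokenise_def
    by (rule runs_SSeq[OF 1 runs_SSeq[OF 2 runs_SSeq[OF W 3 le_refl] le_refl]]) auto
qed

section \<open>Polynomial-time functions on coded data\<close>


text \<open>Powers of \<open>S x + 2\<close> stand for arbitrary polynomials. As the base is at
  least 2, constants, sums and products are absorbed by the exponent.\<close>

definition pbound :: "('a => nat) => ('a => nat) => bool" where
  "pbound T S \<longleftrightarrow> (\<exists>k. \<forall>x. T x \<le> (S x + 2) ^ k)"

lemma pboundI: "(\<And>x. T x \<le> (S x + 2) ^ k) ==> pbound T S"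
  unfolding pbound_def by blast

lemma pbound_mono: "pbound T' S ==> (\<And>x. T x \<le> T' x) ==> pbound T S"
  unfolding pbound_def using le_trans by blast

lemma pbound_const [simp, intro]: "pbound (\<lambda>x. c) S"
proof (rule pboundI)
  fix x
  have "c \<le> 2 ^ c" using less_exp[of c] by simp
  also have "\<dots> \<le> (S x + 2) ^ c" by (rule power_mono) auto
  finally show "c \<le> (S x + 2) ^ c" .
qed

lemma pbound_self [simp, intro]: "pbound S S"
  by (rule pboundI[where k = 1]) simp

lemma pbound_add [intro]:
  assumes "pbound T S" "pbound T' S"
  shows "pbound (\<lambda>x. T x + T' x) S"
proof -
  obtain k k' where k: "T x \<le> (S x + 2) ^ k" "T' x \<le> (S x + 2) ^ k'" for x
    using assms by (auto simp: pbound_def)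
  show ?thesis
  proof (rule pboundI)
    fix x
    have "T x \<le> (S x + 2) ^ (k + k')" "T' x \<le> (S x + 2) ^ (k + k')"
      using k[of x] power_increasing[of k "k + k'" "S x + 2"] power_increasing[of k' "k + k'" "S x + 2"]
      by linarith+
    then have "T x + T' x \<le> 2 * (S x + 2) ^ (k + k')" by simp
    also have "\<dots> \<le> (S x + 2) * (S x + 2) ^ (k + k')" by (rule mult_right_mono) auto
    finally show "T x + T' x \<le> (S x + 2) ^ Suc (k + k')" by simp
  qed
qed

lemma pbound_mult [intro]:
  assumes "pbound T S" "pbound T' S"
  shows "pbound (\<lambda>x. T x * T' x) S"
proof -
  obtain k k' where k: "T x \<le> (S x + 2) ^ k" "T' x \<le> (S x + 2) ^ k'" for x
    using assms by (auto simp: pbound_def)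
  show ?thesis
    by (rule pboundI[where k = "k + k'"]) (use k mult_le_mono in \<open>simp add: power_add\<close>)
qed

lemma pbound_trans:
  assumes "pbound T S" "pbound S R"
  shows "pbound T R"
proof -
  obtain k k' where k: "T x \<le> (S x + 2) ^ k" "S x \<le> (R x + 2) ^ k'" for x
    using assms by (auto simp: pbound_def)
  show ?thesis
  proof (rule pboundI)
    fix x
    have "S x + 2 \<le> (R x + 2) ^ k' + 2" using k by simp
    also have "\<dots> \<le> (R x + 2) ^ k' * 2 + (R x + 2) ^ k' * 2" using one_le_power[of "Suc (Suc (R x))" k'] by (simp, linarith)
    also have "\<dots> = (R x + 2) ^ k' * 2 ^ 2" by simp
    also have "\<dots> \<le> (R x + 2) ^ k' * (R x + 2) ^ 2" by (intro mult_left_mono power_mono) auto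
    finally have "S x + 2 \<le> (R x + 2) ^ (k' + 2)" by (simp only: power_add)
    then have "(S x + 2) ^ k \<le> ((R x + 2) ^ (k' + 2)) ^ k" by (rule power_mono) simp
    then show "T x \<le> (R x + 2) ^ ((k' + 2) * k)" unfolding power_mult by (rule le_trans[OF k(1)])
  qed
qed

lemma pbound_compose: "pbound T S ==> pbound (\<lambda>x. T (g x)) (\<lambda>x. S (g x))"
  unfolding pbound_def by blast

lemma pbound_power [intro]: "pbound T S ==> pbound (\<lambda>x. T x ^ n) S"
  by (induction n) auto

lemmas pbound_intros = pbound_add pbound_mult pbound_power pbound_const pbound_self

section \<open>Types with codes, and functions on them\<close>

class coded =
  fixes dat_of :: "'a => dat"
  assumes dat_of_inject: "dat_of x = dat_of y ==> x = y"

lemma dat_of_eq [simp]: "dat_of x = dat_of y \<longleftrightarrow> x = y"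
  using dat_of_inject by blast

definition sz :: "'a::coded => nat" where
  "sz x = length (ser (dat_of x))"

instantiation dat :: coded
begin
definition "dat_of_dat (d :: dat) = d"
instance by standard (simp add: dat_of_dat_def)
end

instantiation bool :: coded
begin
definition "dat_of_bool b = (if b then Br Lf Lf else Lf)"
instance by standard (auto simp: dat_of_bool_def split: if_splits)
end

instantiation prod :: (coded, coded) coded
begin
definition "dat_of_prod = (\<lambda>(x, y). Br (dat_of x) (dat_of y))"
instance by standard (auto simp: dat_of_prod_def)
end

text \<open>Natural numbers are coded in unary. They serve as lengths, positions and small
  parameters, and may drive recursions; numbers of arbitrary size are kept as lists of bits.\<close>

fun dat_of_nat_fun :: "nat => dat" where
  "dat_of_nat_fun 0 = Lf"
| "dat_of_nat_fun (Suc n) = Br Lf (dat_of_nat_fun n)"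

instantiation nat :: coded
begin
definition "dat_of_nat = dat_of_nat_fun"
instance
proof
  show "dat_of m = dat_of n ==> m = n" for m n :: nat
    unfolding dat_of_nat_def
  proof (induction m arbitrary: n)
    case 0
    then show ?case by (cases n) auto
  next
    case (Suc m)
    then show ?case by (cases n) auto
  qed
qed
end

fun dat_of_list_fun :: "'a::coded list => dat" where
  "dat_of_list_fun [] = Lf"
| "dat_of_list_fun (x # xs) = Br (dat_of x) (dat_of_list_fun xs)"

instantiation list :: (coded) coded
begin
definition "dat_of_list = dat_of_list_fun"
instance
proof
  show "dat_of xs = dat_of ys ==> xs = ys" for xs ys :: "'a list"
    unfolding dat_of_list_def
  proof (induction xs arbitrary: ys)
    case Nil
    then show ?case by (cases ys) auto
  next
    case (Cons x xs)
    then show ?case by (cases ys) auto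
  qed
qed
end

lemma dat_of_simps [simp]:
  "dat_of True = Br Lf Lf" "dat_of False = Lf" "dat_of (x, y) = Br (dat_of x) (dat_of y)"
  "dat_of (0::nat) = Lf" "dat_of (Suc n) = Br Lf (dat_of n)"
  "dat_of ([] :: 'a::coded list) = Lf" "dat_of (a # xs) = Br (dat_of a) (dat_of (xs :: 'a list))"
  "dat_of (d :: dat) = d"
  by (simp_all add: dat_of_bool_def dat_of_prod_def dat_of_nat_def dat_of_list_def dat_of_dat_def)

lemma sz_simps [simp]:
  "sz True = 3" "sz False = 1" "sz (x, y) = 1 + sz x + sz y"
  "sz (0::nat) = 1" "sz (Suc n) = 2 + sz n"
  "sz ([] :: 'a::coded list) = 1" "sz (a # xs) = 1 + sz a + sz (xs :: 'a list)"
  by (simp_all add: sz_def)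

lemma sz_nat [simp]: "sz (n::nat) = 2 * n + 1"
  by (induction n) auto

lemma sz_pos: "sz x > 0"
  by (cases "dat_of x") (auto simp: sz_def)

lemma length_le_sz: "length xs \<le> sz xs"
  by (induction xs) auto

lemma sz_append: "sz (xs @ ys) = sz xs + sz ys - 1"
proof (induction xs)
  case (Cons a xs)
  then show ?case using sz_pos[of ys] by simp
qed simp

lemma sz_rev [simp]: "sz (rev xs) = sz xs"
  by (induction xs) (auto simp: sz_append)

text \<open>The program replaces the datum on top of stack 2, whatever lies below, and restores all
  other stacks. This frame condition is what makes programs composable. Four tape symbols suffice:
  the blank, the bits and the marker 2.\<close>

definition ptime :: "('a::coded => 'b::coded) => bool" where
  "ptime f \<longleftrightarrow> (\<exists>c T. sc_ok {2, 3, 4} 4 c \<and> pbound T sz \<and>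
     (\<forall>x st r. st 2 = ser (dat_of x) @ r \<longrightarrow> runs c st (T x) (st(2 := ser (dat_of (f x)) @ r))))"

lemma ptimeI:
  assumes "sc_ok {2, 3, 4} 4 c" "pbound T sz"
    "\<And>x st r. st 2 = ser (dat_of x) @ r ==> runs c st (T x) (st(2 := ser (dat_of (f x)) @ r))"
  shows "ptime f"
  using assms unfolding ptime_def by blast

lemma ptimeE:
  assumes "ptime f"
  obtains c T where "sc_ok {2, 3, 4} 4 c" "pbound T sz"
    "\<And>x st r. st 2 = ser (dat_of x) @ r ==> runs c st (T x) (st(2 := ser (dat_of (f x)) @ r))"
  using assms unfolding ptime_def by blast

text \<open>A step pushes at most one symbol, so the time bounds the size of the result.\<close>

lemma ptime_sz:
  assumes "ptime f"
  shows "pbound (\<lambda>x. sz (f x)) sz"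
proof -
  obtain c T where c: "pbound T sz"
    "\<And>x st r. st 2 = ser (dat_of x) @ r ==> runs c st (T x) (st(2 := ser (dat_of (f x)) @ r))"
    using ptimeE[OF assms] by metis
  have "sz (f x) \<le> sz x + T x" for x
    using runs_length[OF c(2)[of "\<lambda>_. ser (dat_of x)" x "[]"], of 2] by (simp add: sz_def)
  then show ?thesis
    by (rule pbound_mono[rotated]) (intro pbound_intros c(1))
qed

lemma ptime_compose:
  fixes f :: "'b::coded => 'c::coded" and g :: "'a::coded => 'b"
  assumes "ptime f" "ptime g"
  shows "ptime (\<lambda>x. f (g x))"
proof -
  obtain c T where c: "sc_ok {2, 3, 4} 4 c" "pbound T sz"
    "\<And>x st r. st 2 = ser (dat_of x) @ r ==> runs c st (T x) (st(2 := ser (dat_of (f x)) @ r))"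
    using ptimeE[OF assms(1)] by metis
  obtain c' T' where c': "sc_ok {2, 3, 4} 4 c'" "pbound T' sz"
    "\<And>x st r. st 2 = ser (dat_of x) @ r ==> runs c' st (T' x) (st(2 := ser (dat_of (g x)) @ r))"
    using ptimeE[OF assms(2)] by metis
  show ?thesis
  proof (rule ptimeI)
    show "sc_ok {2, 3, 4} 4 (SSeq c' c)" using c c' by simp
    have "pbound (\<lambda>x. T (g x)) sz"
      using pbound_trans[OF pbound_compose[OF c(2)] ptime_sz[OF assms(2)]] .
    then show "pbound (\<lambda>x. T' x + T (g x) + 1) sz" using c'(2) by (intro pbound_intros)
    fix x :: 'a and st r assume "st (2::nat) = ser (dat_of x) @ r"
    then show "runs (SSeq c' c) st (T' x + T (g x) + 1) (st(2 := ser (dat_of (f (g x))) @ r))"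
      using runs_SSeq[OF c'(3)[of st x r] c(3)[of "st(2 := ser (dat_of (g x)) @ r)" "g x" r] order.refl] by simp
  qed
qed

text \<open>The closure rules form a calculus that follows the syntax of a term:
  \<open>intro ptime\<close> proves that a function is computable in polynomial time by decomposing
  its definition.\<close>

named_theorems ptime

lemmas [ptime] = ptime_sz pbound_add pbound_mult pbound_const

lemma ptime_id [ptime]: "ptime (\<lambda>x. x)"
proof (rule ptimeI)
  show "sc_ok {2, 3, 4} 4 (SSeq (Push 2 0) (Pop 2))" by simp
  show "pbound (\<lambda>x. 5) sz" by simp
  fix x :: 'a and st r assume "st (2::nat) = ser (dat_of x) @ r"
  then show "runs (SSeq (Push 2 0) (Pop 2)) st 5 (st(2 := ser (dat_of x) @ r))"
    by (intro runs_loopfree) auto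
qed

lemma sc_ok_programs:
  "sc_ok {2, 3, 4} 4 stash" "sc_ok {2, 3, 4} 4 unstash" "sc_ok {2, 3, 4} 4 drop_dat"
  "sc_ok {2, 3, 4} 4 dup" "sc_ok {2, 3, 4} 4 tokenise"
  "set w \<subseteq> {0, 1} ==> sc_ok {2, 3, 4} 4 (push_all 2 w)"
  by (simp_all add: stash_def unstash_def drop_dat_def dup_def tokenise_def stash_loop_def
      move_def move2_def discard_def) (induction w, auto)

lemma ptime_const [ptime]: "ptime (\<lambda>x. c)"
proof (rule ptimeI)
  let ?c = "SSeq drop_dat (push_all 2 (ser (dat_of c)))"
  show "sc_ok {2, 3, 4} 4 ?c" using sc_ok_programs set_ser by simp
  let ?T = "\<lambda>x::'a. 40 * sz x + 40 + cost (push_all 2 (ser (dat_of c))) + 1"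
  show "pbound ?T sz" by (intro pbound_intros)
  fix x :: 'a and st r assume "st (2::nat) = ser (dat_of x) @ r"
  then show "runs ?c st (?T x) (st(2 := ser (dat_of c) @ r))"
    using runs_SSeq[OF drop_dat[of st "dat_of x" r] push_all[of 2 "ser (dat_of c)" "st(2 := r)"] order.refl]
    by (simp add: sz_def)
qed

lemma ptime_Pair [ptime]:
  fixes f :: "'a::coded => 'b::coded" and g :: "'a => 'c::coded"
  assumes "ptime f" "ptime g"
  shows "ptime (\<lambda>x. (f x, g x))"
proof -
  obtain c T where c: "sc_ok {2, 3, 4} 4 c" "pbound T sz"
    "\<And>x st r. st 2 = ser (dat_of x) @ r ==> runs c st (T x) (st(2 := ser (dat_of (f x)) @ r))"
    using ptimeE[OF assms(1)] by metis
  obtain c' T' where c': "sc_ok {2, 3, 4} 4 c'" "pbound T' sz"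
    "\<And>x st r. st 2 = ser (dat_of x) @ r ==> runs c' st (T' x) (st(2 := ser (dat_of (g x)) @ r))"
    using ptimeE[OF assms(2)] by metis
  \<comment> \<open>One copy of the argument is parked on stack 3 while \<open>c'\<close> runs on
    the other. The second component is computed first, because it has to lie below the first
    one.\<close>
  let ?c = "SSeq dup (SSeq stash (SSeq c' (SSeq unstash (SSeq c (Push 2 1)))))"
  let ?T = "\<lambda>x. 90 * sz x + T x + T' x + 140"
  show ?thesis
  proof (rule ptimeI)
    show "sc_ok {2, 3, 4} 4 ?c" using c c' sc_ok_programs by simp
    show "pbound ?T sz" by (intro pbound_intros c(2) c'(2))
    fix x :: 'a and st r assume st: "st (2::nat) = ser (dat_of x) @ r"
    let ?s = "ser (dat_of x)"
    let ?st1 = "st(2 := ?s @ ?s @ r)"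
    let ?st2 = "st(2 := ?s @ r, 3 := rev ?s @ 2 # st 3)"
    let ?st3 = "st(2 := ser (dat_of (g x)) @ r, 3 := rev ?s @ 2 # st 3)"
    let ?st4 = "st(2 := ?s @ ser (dat_of (g x)) @ r)"
    let ?st5 = "st(2 := ser (dat_of (f x)) @ ser (dat_of (g x)) @ r)"
    have 1: "runs dup st (60 * sz x + 100) ?st1" using dup[of st "dat_of x" r] st by (simp add: sz_def)
    have 2: "runs stash ?st1 (20 * sz x + 20) ?st2"
      using stash[of ?st1 "dat_of x" "?s @ r"] by (simp add: sz_def)
    have 3: "runs c' ?st2 (T' x) ?st3"
      using c'(3)[of ?st2 x r] by (simp add: fun_upd_twist)
    have 4: "runs unstash ?st3 (10 * sz x + 10) ?st4"
      using unstash[of ?st3 "dat_of x" "st 3"] by (simp add: sz_def fun_upd_twist fun_upd_idem)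
    have 5: "runs c ?st4 (T x) ?st5"
      using c(3)[of ?st4 x "ser (dat_of (g x)) @ r"] by simp
    have 6: "runs (Push 2 1) ?st5 3 (st(2 := ser (dat_of (f x, g x)) @ r))"
      by (rule runs_Push) auto
    show "runs ?c st (?T x) (st(2 := ser (dat_of (f x, g x)) @ r))"
      by (rule runs_SSeq[OF 1 runs_SSeq[OF 2 runs_SSeq[OF 3 runs_SSeq[OF 4 runs_SSeq[OF 5 6 le_refl] le_refl] le_refl] le_refl]]) simp
  qed
qed

lemma ptime_fst_fun: "ptime fst"
proof (rule ptimeI)
  let ?c = "SSeq (Pop 2) (SSeq stash (SSeq drop_dat unstash))"
  let ?T = "\<lambda>x::('a::coded\<times>'b::coded). 80 * sz x + 80"
  show "sc_ok {2, 3, 4} 4 ?c" using sc_ok_programs by simp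
  show "pbound ?T sz" by (intro pbound_intros)
  fix x :: "'a \<times> 'b" and st r assume st: "st (2::nat) = ser (dat_of x) @ r"
  obtain a b where x: "x = (a, b)" by (cases x)
  let ?st1 = "st(2 := ser (dat_of a) @ ser (dat_of b) @ r)"
  let ?st2 = "st(2 := ser (dat_of b) @ r, 3 := rev (ser (dat_of a)) @ 2 # st 3)"
  let ?st3 = "st(2 := r, 3 := rev (ser (dat_of a)) @ 2 # st 3)"
  have 1: "runs (Pop 2) st 1 ?st1" by (rule runs_Pop) (use st x in auto)
  have 2: "runs stash ?st1 (20 * sz a + 20) ?st2"
    using stash[of ?st1 "dat_of a" "ser (dat_of b) @ r"] by (simp add: sz_def)
  have 3: "runs drop_dat ?st2 (40 * sz b + 40) ?st3"
    using drop_dat[of ?st2 "dat_of b" r] by (simp add: sz_def fun_upd_twist)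
  have 4: "runs unstash ?st3 (10 * sz a + 10) (st(2 := ser (dat_of (fst x)) @ r))"
    using unstash[of ?st3 "dat_of a" "st 3"] by (simp add: x sz_def fun_upd_twist fun_upd_idem)
  show "runs ?c st (?T x) (st(2 := ser (dat_of (fst x)) @ r))"
    by (rule runs_SSeq[OF 1 runs_SSeq[OF 2 runs_SSeq[OF 3 4 le_refl] le_refl]]) (simp add: x)
qed

lemma ptime_snd_fun: "ptime snd"
proof (rule ptimeI)
  let ?c = "SSeq (Pop 2) drop_dat"
  let ?T = "\<lambda>x::('a::coded\<times>'b::coded). 40 * sz x + 80"
  show "sc_ok {2, 3, 4} 4 ?c" using sc_ok_programs by simp
  show "pbound ?T sz" by (intro pbound_intros)
  fix x :: "'a \<times> 'b" and st r assume st: "st (2::nat) = ser (dat_of x) @ r"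
  obtain a b where x: "x = (a, b)" by (cases x)
  let ?st1 = "st(2 := ser (dat_of a) @ ser (dat_of b) @ r)"
  have 1: "runs (Pop 2) st 1 ?st1" by (rule runs_Pop) (use st x in auto)
  have 2: "runs drop_dat ?st1 (40 * sz a + 40) (st(2 := ser (dat_of (snd x)) @ r))"
    using drop_dat[of ?st1 "dat_of a" "ser (dat_of b) @ r"] by (simp add: x sz_def)
  show "runs ?c st (?T x) (st(2 := ser (dat_of (snd x)) @ r))"
    by (rule runs_SSeq[OF 1 2]) (simp add: x)
qed

lemmas ptime_fst [ptime] = ptime_compose[OF ptime_fst_fun]
lemmas ptime_snd [ptime] = ptime_compose[OF ptime_snd_fun]

text \<open>Case distinction on the shape of \<open>dat_of (l x)\<close>; all concrete ones below are instances.\<close>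

lemma ptime_cases:
  fixes l :: "'x::coded => 'l::coded" and c :: "('h::coded \<times> 't::coded) \<times> 'x => 'r::coded"
  assumes l: "ptime l" and n: "ptime n" and c: "ptime c"
    and F: "\<And>x. dat_of (l x) = Lf \<and> F x = n x \<or>
      (\<exists>h t. dat_of (l x) = Br (dat_of h) (dat_of t) \<and> F x = c ((h, t), x))"
  shows "ptime F"
proof -
  obtain cn Tn where cn: "sc_ok {2, 3, 4} 4 cn" "pbound Tn sz"
    "\<And>x st r. st 2 = ser (dat_of x) @ r ==> runs cn st (Tn x) (st(2 := ser (dat_of (n x)) @ r))"
    using ptimeE[OF n] by metis
  obtain cc Tc where cc: "sc_ok {2, 3, 4} 4 cc" "pbound Tc sz"
    "\<And>x st r. st 2 = ser (dat_of x) @ r ==> runs cc st (Tc x) (st(2 := ser (dat_of (c x)) @ r))"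
    using ptimeE[OF c] by metis
  obtain cl Tl where cl: "sc_ok {2, 3, 4} 4 cl" "pbound Tl sz"
    "\<And>x st r. st 2 = ser (dat_of x) @ r ==> runs cl st (Tl x) (st(2 := ser (dat_of (l x, x)) @ r))"
    using ptimeE[OF ptime_Pair[OF l ptime_id]] by metis
  \<comment> \<open>Removing the symbol of the pair \<open>(l x, x)\<close> uncovers the first
    symbol of \<open>l x\<close>, which tells the two shapes apart. In the case \<open>Br\<close>,
    putting the symbol back yields the code of \<open>((h, t), x)\<close> without further
    work.\<close>
  let ?c = "SSeq cl (SSeq (Pop 2) (SIf 2 (\<lambda>t. t = Some 1) (SSeq (Push 2 1) cc) (SSeq (Pop 2) cn)))"
  obtain k where k: "Tc p \<le> (sz p + 2) ^ k" for p using cc(2) unfolding pbound_def by blast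
  define T where "T x = Tl x + Tn x + (sz (l x, x) + 2) ^ k + 20" for x
  show ?thesis
  proof (rule ptimeI)
    show "sc_ok {2, 3, 4} 4 ?c" using cn cc cl by simp
    have "pbound (\<lambda>x. sz (l x, x)) sz" using ptime_sz[OF ptime_Pair[OF l ptime_id]] .
    then have *: "pbound (\<lambda>x. (sz (l x, x) + 2) ^ k) sz" by (intro pbound_power pbound_add pbound_const)
    show "pbound T sz" unfolding T_def by (intro pbound_add cn(2) cl(2) * pbound_const)
    fix x :: 'x and st r assume st: "st (2::nat) = ser (dat_of x) @ r"
    let ?st1 = "st(2 := ser (dat_of (l x, x)) @ r)"
    let ?st2 = "st(2 := ser (dat_of (l x)) @ ser (dat_of x) @ r)"
    let ?st' = "st(2 := ser (dat_of (F x)) @ r)"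
    have 1: "runs cl st (Tl x) ?st1" by (rule cl(3)[of st x r, OF st])
    have 2: "runs (Pop 2) ?st1 1 ?st2" by (rule runs_Pop) auto
    have 3: "runs (SIf 2 (\<lambda>t. t = Some 1) (SSeq (Push 2 1) cc) (SSeq (Pop 2) cn)) ?st2
        (Tn x + (sz (l x, x) + 2) ^ k + 10) ?st'"
    proof (rule runs_SIf)
      assume *: "top_of (?st2 2) = Some 1"
      then obtain h t where ht: "dat_of (l x) = Br (dat_of h) (dat_of t)" "F x = c ((h, t), x)"
        using F[of x] by auto
      have "Tc ((h, t), x) \<le> (sz (l x, x) + 2) ^ k"
        using k[of "((h, t), x)"] ht by (simp add: sz_def)
      then have "runs cc (st(2 := ser (dat_of ((h, t), x)) @ r)) ((sz (l x, x) + 2) ^ k) ?st'"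
        using cc(3)[of "st(2 := ser (dat_of ((h, t), x)) @ r)" "((h, t), x)" r, THEN runs_mono] ht by simp
      then show "runs (SSeq (Push 2 1) cc) ?st2 (Tn x + (sz (l x, x) + 2) ^ k + 5) ?st'"
        by (intro runs_SSeq[OF runs_Push[OF refl order.refl]]) (auto simp: ht)
    next
      assume *: "top_of (?st2 2) \<noteq> Some 1"
      then have Lf: "dat_of (l x) = Lf" "F x = n x" using F[of x] by auto
      then have "runs cn (st(2 := ser (dat_of x) @ r)) (Tn x) ?st'"
        using cn(3)[of "st(2 := ser (dat_of x) @ r)" x r] by simp
      then show "runs (SSeq (Pop 2) cn) ?st2 (Tn x + (sz (l x, x) + 2) ^ k + 5) ?st'"
        by (intro runs_SSeq[OF runs_Pop[OF refl order.refl]]) (auto simp: Lf)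
    qed simp
    show "runs ?c st (T x) ?st'"
      by (rule runs_SSeq[OF 1 runs_SSeq[OF 2 3 le_refl]]) (simp add: T_def)
  qed
qed

text \<open>Programs see only codes. Constructors whose values have the code of a pair or a list are
  thereby computed by the programs for pairs and lists.\<close>

lemma ptime_recode:
  fixes f :: "'x::coded => 'a::coded" and g :: "'x => 'b::coded"
  assumes "ptime f" "\<And>x. dat_of (g x) = dat_of (f x)"
  shows "ptime g"
  using assms unfolding ptime_def by simp

lemma ptime_Cons [ptime]:
  assumes "ptime f" "ptime g"
  shows "ptime (\<lambda>x. f x # g x)"
  by (rule ptime_recode[OF ptime_Pair[OF assms]]) simp

lemma ptime_Suc [ptime]:
  assumes "ptime f"
  shows "ptime (\<lambda>x. Suc (f x))"
  by (rule ptime_recode[OF ptime_Pair[OF ptime_const[of Lf] assms]]) simp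

lemma ptime_if [ptime]:
  fixes f :: "'x::coded => 'a::coded"
  assumes "ptime b" "ptime f" "ptime g"
  shows "ptime (\<lambda>x. if b x then f x else g x)"
proof (rule ptime_cases[OF assms(1,3)])
  show "ptime (\<lambda>p :: (dat \<times> dat) \<times> 'x. f (snd p))"
    by (rule ptime_compose[OF assms(2) ptime_snd_fun])
  show "dat_of (b x) = Lf \<and> (if b x then f x else g x) = g x \<or>
         (\<exists>(h::dat) (t::dat). dat_of (b x) = Br (dat_of h) (dat_of t) \<and> (if b x then f x else g x) = f (snd ((h, t), x)))" for x
    by simp
qed

lemma ptime_case_list [ptime]:
  fixes l :: "'x::coded => 'a::coded list" and n :: "'x => 'b::coded"
  assumes "ptime l" "ptime n" "ptime (\<lambda>p. c (snd p) (fst (fst p)) (snd (fst p)))"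
  shows "ptime (\<lambda>x. case l x of [] => n x | a # t => c x a t)"
proof (rule ptime_cases[OF assms])
  fix x
  show "dat_of (l x) = Lf \<and> (case l x of [] => n x | a # t => c x a t) = n x \<or>
         (\<exists>h t. dat_of (l x) = Br (dat_of h) (dat_of t) \<and> (case l x of [] => n x | a # t => c x a t)
            = c (snd ((h, t), x)) (fst (fst ((h, t), x))) (snd (fst ((h, t), x))))"
    by (cases "l x") auto
qed

lemma ptime_Not [ptime]:
  assumes "ptime f" shows "ptime (\<lambda>x. \<not> f x)"
proof -
  have "ptime (\<lambda>x. if f x then False else True)" by (intro ptime assms)
  moreover have "(\<lambda>x. if f x then False else True) = (\<lambda>x. \<not> f x)" by auto
  ultimately show ?thesis by simp
qed

lemma ptime_conj [ptime]:
  assumes "ptime f" "ptime g" shows "ptime (\<lambda>x. f x \<and> g x)"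
proof -
  have "ptime (\<lambda>x. if f x then g x else False)" by (intro ptime assms)
  moreover have "(\<lambda>x. if f x then g x else False) = (\<lambda>x. f x \<and> g x)" by auto
  ultimately show ?thesis by simp
qed

lemma ptime_disj [ptime]:
  assumes "ptime f" "ptime g" shows "ptime (\<lambda>x. f x \<or> g x)"
proof -
  have "ptime (\<lambda>x. if f x then True else g x)" by (intro ptime assms)
  moreover have "(\<lambda>x. if f x then True else g x) = (\<lambda>x. f x \<or> g x)" by auto
  ultimately show ?thesis by simp
qed

text \<open>Iterating a polynomial-time step could blow up the state exponentially. Therefore every
  use has to supply a polynomial bound \<open>B\<close> for the states after all prefixes of the
  list.\<close>

lemma ptime_foldl:
  fixes xs :: "'x::coded => 'a::coded list" and init :: "'x => 's::coded" and f :: "'x => 's => 'a => 's"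
  assumes f: "ptime (\<lambda>p. f (fst p) (fst (snd p)) (snd (snd p)))"
    and xs: "ptime xs" and init: "ptime init" and B: "pbound B sz"
    and bound: "\<And>x ys zs. xs x = ys @ zs ==> sz (foldl (f x) (init x) ys) \<le> B x"
  shows "ptime (\<lambda>x. foldl (f x) (init x) (xs x))"
proof -
  define body where "body st = (case fst st of [] => st | a # l =>
     (l, (fst (snd st), f (fst (snd st)) (snd (snd st)) a)))" for st :: "'a list \<times> 'x \<times> 's"
  have body: "ptime body"
    unfolding body_def
    by (intro ptime ptime_compose[OF f, of "\<lambda>p. (fst (snd (snd p)), snd (snd (snd p)), fst (fst p))", simplified])
  obtain c T where c: "sc_ok {2, 3, 4} 4 c" "pbound T sz"
    "\<And>x st r. st 2 = ser (dat_of x) @ r ==> runs c st (T x) (st(2 := ser (dat_of (body x)) @ r))"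
    using ptimeE[OF body] by metis
  obtain k where k: "T st \<le> (sz st + 2) ^ k" for st using c(2) unfolding pbound_def by blast
  \<comment> \<open>Between the iterations the symbol of the outer pair is missing, so the top
    symbol shows whether the remaining list is empty. It is put back before \<open>c\<close> is
    run.\<close>
  let ?W = "SWhile 2 (\<lambda>t. t = Some 1) (SSeq (Push 2 1) (SSeq c (Pop 2)))"
  let ?c = "SSeq (Pop 2) (SSeq ?W (Push 2 1))"
  have loop: "runs ?W (st(2 := ser (dat_of l) @ ser (dat_of (x, s)) @ r)) (length l * (M + 10) + 1)
      (st(2 := 0 # ser (dat_of (x, foldl (f x) s l)) @ r))"
    if "\<And>ys zs. l = ys @ zs ==> T (zs, (x, foldl (f x) s ys)) \<le> M" for l x s st r M
    using that
  proof (induction l arbitrary: s)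
    case Nil
    then show ?case by (intro runs_SWhile_end) auto
  next
    case (Cons a l)
    let ?st1 = "st(2 := ser (dat_of (a # l, x, s)) @ r)"
    let ?st2 = "st(2 := ser (dat_of (l, x, f x s a)) @ r)"
    let ?st3 = "st(2 := ser (dat_of l) @ ser (dat_of (x, f x s a)) @ r)"
    have "T (a # l, x, s) \<le> M" using Cons.prems[of "[]" "a # l"] by simp
    then have 2: "runs c ?st1 M ?st2"
      using c(3)[of ?st1 "(a # l, x, s)" r, THEN runs_mono] by (simp add: body_def)
    have 1: "runs (Push 2 1) (st(2 := ser (dat_of (a # l)) @ ser (dat_of (x, s)) @ r)) 3 ?st1"
      by (rule runs_Push) auto
    have 3: "runs (Pop 2) ?st2 1 ?st3" by (rule runs_Pop) auto
    have 4: "runs ?W ?st3 (length l * (M + 10) + 1) (st(2 := 0 # ser (dat_of (x, foldl (f x) (f x s a) l)) @ r))"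
    proof (rule Cons.IH)
      show "T (zs, x, foldl (f x) (f x s a) ys) \<le> M" if "l = ys @ zs" for ys zs
        using Cons.prems[of "a # ys" zs] that by simp
    qed
    show ?case
      by (rule runs_SWhile_step[OF _ runs_SSeq[OF 1 runs_SSeq[OF 2 3 le_refl] le_refl] 4[THEN back_subst[where P = "runs _ _ _"]]]) auto
  qed
  define M where "M x = (sz (xs x) + sz x + B x + 4) ^ k" for x
  have T: "T (zs, (x, foldl (f x) (init x) ys)) \<le> M x" if "xs x = ys @ zs" for x ys zs
  proof -
    have "sz zs \<le> sz (xs x)" using that sz_append[of ys zs] sz_pos[of ys] by simp
    then have "sz (zs, x, foldl (f x) (init x) ys) + 2 \<le> sz (xs x) + sz x + B x + 4"
      using bound[OF that] by simp
    then show ?thesis unfolding M_def using k power_mono le_trans by blast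
  qed
  have L: "ptime (\<lambda>x. ([] :: 'a list, x, foldl (f x) (init x) (xs x)))"
  proof -
    obtain c' T' where c': "sc_ok {2, 3, 4} 4 c'" "pbound T' sz"
      "\<And>x st r. st 2 = ser (dat_of x) @ r ==> runs c' st (T' x) (st(2 := ser (dat_of (xs x, x, init x)) @ r))"
      using ptimeE[OF ptime_Pair[OF xs ptime_Pair[OF ptime_id init]]] by metis
    show ?thesis
    proof (rule ptimeI)
      show "sc_ok {2, 3, 4} 4 (SSeq c' ?c)" using c c' by simp
      have "pbound (\<lambda>x. sz (xs x)) sz" using xs by (rule ptime_sz)
      then have 1: "pbound (\<lambda>x. sz (xs x) * (M x + 10)) sz"
        unfolding M_def using B by (intro pbound_add pbound_mult pbound_power pbound_self pbound_const)
      show "pbound (\<lambda>x. T' x + (sz (xs x) * (M x + 10)) + 20) sz"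
        by (intro pbound_add 1 c'(2) pbound_const)
      fix x :: 'x and st r assume st: "st (2::nat) = ser (dat_of x) @ r"
      let ?st1 = "st(2 := ser (dat_of (xs x, x, init x)) @ r)"
      let ?st2 = "st(2 := ser (dat_of (xs x)) @ ser (dat_of (x, init x)) @ r)"
      let ?st3 = "st(2 := 0 # ser (dat_of (x, foldl (f x) (init x) (xs x))) @ r)"
      let ?st' = "st(2 := ser (dat_of ([] :: 'a list, x, foldl (f x) (init x) (xs x))) @ r)"
      have 1: "runs c' st (T' x) ?st1" by (rule c'(3)[of st x r, OF st])
      have 2: "runs (Pop 2) ?st1 1 ?st2" by (rule runs_Pop) auto
      have 3: "runs ?W ?st2 (length (xs x) * (M x + 10) + 1) ?st3" by (rule loop) (rule T)
      have 4: "runs (Push 2 1) ?st3 3 ?st'" by (rule runs_Push) auto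
      have "length (xs x) * (M x + 10) \<le> sz (xs x) * (M x + 10)"
        by (intro mult_right_mono length_le_sz) auto
      then show "runs (SSeq c' ?c) st (T' x + (sz (xs x) * (M x + 10)) + 20) ?st'"
        by (intro runs_SSeq[OF 1 runs_SSeq[OF 2 runs_SSeq[OF 3 4 le_refl] le_refl]]) linarith
    qed
  qed
  show ?thesis using ptime_snd[OF ptime_snd[OF L]] by simp
qed

lemma ptime_rev [ptime]:
  fixes xs :: "'x::coded => 'a::coded list"
  assumes "ptime xs" shows "ptime (\<lambda>x. rev (xs x))"
proof -
  have foldl_Cons: "foldl (\<lambda>s a. a # s) s ys = rev ys @ s" for s ys :: "'a list"
    by (induction ys arbitrary: s) auto
  have "ptime (\<lambda>x. foldl (\<lambda>s a. a # s) [] (xs x))"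
  proof (rule ptime_foldl[where B = "\<lambda>x. sz (xs x)"])
    show "sz (foldl (\<lambda>s a. a # s) [] ys) \<le> sz (xs x)" if "xs x = ys @ zs" for x ys zs
      using that sz_append[of ys zs] sz_pos[of zs] by (simp add: foldl_Cons)
  qed (intro ptime assms ptime_sz)+
  then show ?thesis by (simp add: foldl_Cons)
qed

lemma ptime_foldr:
  fixes xs :: "'x::coded => 'a::coded list" and init :: "'x => 's::coded" and f :: "'x => 'a => 's => 's"
  assumes f: "ptime (\<lambda>p. f (fst p) (snd (snd p)) (fst (snd p)))"
    and xs: "ptime xs" and init: "ptime init" and B: "pbound B sz"
    and bound: "\<And>x ys zs. xs x = ys @ zs ==> sz (foldr (f x) zs (init x)) \<le> B x"
  shows "ptime (\<lambda>x. foldr (f x) (xs x) (init x))"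
proof -
  have "ptime (\<lambda>x. foldl (\<lambda>s a. f x a s) (init x) (rev (xs x)))"
  proof (rule ptime_foldl[OF f ptime_rev[OF xs] init B])
    fix x ys zs assume "rev (xs x) = ys @ zs"
    then have "xs x = rev zs @ rev ys" by (metis rev_append rev_rev_ident)
    then show "sz (foldl (\<lambda>s a. f x a s) (init x) ys) \<le> B x"
      using bound[of x "rev zs" "rev ys"] by (simp add: foldr_conv_foldl)
  qed
  then show ?thesis by (simp add: foldr_conv_foldl)
qed

lemma sz_elem: "a \<in> set xs ==> sz a \<le> sz xs"
  by (induction xs) auto

lemma sz_list_le: "(\<And>a. a \<in> set xs ==> sz a \<le> M) ==> sz xs \<le> length xs * (M + 1) + 1"
proof (induction xs)
  case (Cons a xs)
  have "sz a \<le> M" "sz xs \<le> length xs * (M + 1) + 1" using Cons by auto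
  then show ?case by simp
qed simp

lemma ptime_apply2:
  fixes f :: "'a::coded => 'b::coded => 'c::coded"
  assumes "ptime (\<lambda>p. f (fst p) (snd p))" "ptime g" "ptime h"
  shows "ptime (\<lambda>x. f (g x) (h x))"
  using ptime_compose[OF assms(1) ptime_Pair[OF assms(2,3)]] by simp

lemma ptime_apply3:
  fixes f :: "'a::coded => 'b::coded => 'c::coded => 'd::coded"
  assumes "ptime (\<lambda>p. f (fst p) (fst (snd p)) (snd (snd p)))" "ptime g" "ptime h" "ptime k"
  shows "ptime (\<lambda>x. f (g x) (h x) (k x))"
  using ptime_compose[OF assms(1) ptime_Pair[OF assms(2) ptime_Pair[OF assms(3,4)]]] by simp

lemma ptime_map [ptime]:
  fixes xs :: "'x::coded => 'a::coded list" and f :: "'x => 'a => 'b::coded"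
  assumes "ptime xs" "ptime (\<lambda>p. f (fst p) (snd p))"
  shows "ptime (\<lambda>x. map (f x) (xs x))"
proof -
  obtain k where k: "sz (f x a) \<le> (sz (x, a) + 2) ^ k" for x a
    using ptime_sz[OF assms(2)] unfolding pbound_def by (metis fst_conv snd_conv)
  let ?M = "\<lambda>x. (sz x + sz (xs x) + 3) ^ k"
  have M: "sz (f x a) \<le> ?M x" if "a \<in> set (xs x)" for x a
    using k[of x a] power_mono[of "sz (x, a) + 2" "sz x + sz (xs x) + 3" k] sz_elem[OF that] by simp
  have foldr_map: "foldr (\<lambda>a s. f x a # s) ys [] = map (f x) ys" for x ys
    by (induction ys) auto
  have "ptime (\<lambda>x. foldr (\<lambda>a s. f x a # s) (xs x) [])"
  proof (rule ptime_foldr[where B = "\<lambda>x. sz (xs x) * (?M x + 1) + 1"])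
    show "ptime (\<lambda>p. f (fst p) (snd (snd p)) # (fst (snd p) :: 'b list))"
      by (intro ptime_Cons ptime_apply2[OF assms(2)] ptime)
    show "pbound (\<lambda>x. sz (xs x) * (?M x + 1) + 1) sz"
      by (intro pbound_add pbound_mult pbound_power pbound_const pbound_self ptime_sz[OF assms(1)])
    fix x ys zs assume xs: "xs x = ys @ zs"
    have "sz (map (f x) zs) \<le> length zs * (?M x + 1) + 1"
      using sz_list_le[of "map (f x) zs" "?M x"] M[of _ x] xs by auto
    also have "\<dots> \<le> sz (xs x) * (?M x + 1) + 1"
      using length_le_sz[of "xs x"] xs by (intro add_right_mono mult_right_mono) auto
    finally show "sz (foldr (\<lambda>a s. f x a # s) zs []) \<le> sz (xs x) * (?M x + 1) + 1"
      by (simp add: foldr_map)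
  qed (intro ptime assms)+
  then show ?thesis by (simp add: foldr_map)
qed

lemma sz_bool_le: "sz (b::bool) \<le> 3"
  by (cases b) auto

lemma sz_le_append: "sz ys \<le> sz (xs @ ys)" "sz xs \<le> sz (xs @ ys)"
  using sz_append[of xs ys] sz_pos[of xs] sz_pos[of ys] by linarith+

lemma ptime_append [ptime]:
  fixes xs ys :: "'x::coded => 'a::coded list"
  assumes "ptime xs" "ptime ys"
  shows "ptime (\<lambda>x. xs x @ ys x)"
proof -
  have foldr_Cons: "foldr (\<lambda>a s. a # s) us vs = us @ vs" for us vs :: "'a list" by (induction us) auto
  have "ptime (\<lambda>x. foldr (\<lambda>a s. a # s) (xs x) (ys x))"
  proof (rule ptime_foldr[where B = "\<lambda>x. sz (xs x) + sz (ys x)"])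
    fix x us vs assume "xs x = us @ vs"
    then show "sz (foldr (\<lambda>a s. a # s) vs (ys x)) \<le> sz (xs x) + sz (ys x)"
      using sz_le_append[of vs us] by (simp add: foldr_Cons sz_append)
  qed (intro ptime assms)+
  then show ?thesis by (simp add: foldr_Cons)
qed

lemma ptime_concat [ptime]:
  fixes xs :: "'x::coded => 'a::coded list list"
  assumes "ptime xs"
  shows "ptime (\<lambda>x. concat (xs x))"
proof -
  have foldr_append: "foldr (\<lambda>a s. a @ s) us [] = concat us" for us :: "'a list list" by (induction us) auto
  have sz_concat: "sz (concat us) \<le> sz us" for us :: "'a list list"
    by (induction us) (auto simp: sz_append)
  have "ptime (\<lambda>x. foldr (\<lambda>a s. a @ s) (xs x) [])"
  proof (rule ptime_foldr[where B = "\<lambda>x. sz (xs x)"])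
    fix x us vs assume "xs x = us @ vs"
    then show "sz (foldr (\<lambda>a s. a @ s) vs []) \<le> sz (xs x)"
      using sz_le_append(1)[of vs us] sz_concat[of vs] by (simp add: foldr_append)
  qed (intro ptime assms)+
  then show ?thesis by (simp add: foldr_append)
qed

lemma ptime_filter [ptime]:
  fixes xs :: "'x::coded => 'a::coded list"
  assumes "ptime xs" "ptime (\<lambda>p. P (fst p) (snd p))"
  shows "ptime (\<lambda>x. filter (P x) (xs x))"
proof -
  have foldr_filter: "foldr (\<lambda>a s. if P x a then a # s else s) us [] = filter (P x) us" for x us
    by (induction us) auto
  have sz_filter: "sz (filter Q us) \<le> sz us" for Q and us :: "'a list" by (induction us) auto
  have "ptime (\<lambda>x. foldr (\<lambda>a s. if P x a then a # s else s) (xs x) [])"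
  proof (rule ptime_foldr[where B = "\<lambda>x. sz (xs x)"])
    fix x us vs assume "xs x = us @ vs"
    then show "sz (foldr (\<lambda>a s. if P x a then a # s else s) vs []) \<le> sz (xs x)"
      using sz_le_append(1)[of vs us] sz_filter[of "P x" vs] by (simp add: foldr_filter)
  next
    show "ptime (\<lambda>p. if P (fst p) (snd (snd p)) then snd (snd p) # fst (snd p) else fst (snd p))"
      by (intro ptime ptime_apply2[OF assms(2)])
  qed (intro ptime assms)+
  then show ?thesis by (simp add: foldr_filter)
qed

lemma ptime_list_all [ptime]:
  fixes xs :: "'x::coded => 'a::coded list"
  assumes "ptime xs" "ptime (\<lambda>p. P (fst p) (snd p))"
  shows "ptime (\<lambda>x. list_all (P x) (xs x))"
proof -
  have "ptime (\<lambda>x. case filter (\<lambda>a. \<not> P x a) (xs x) of [] => True | a # t => False)"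
    by (intro ptime assms)
  moreover have "(case filter (\<lambda>a. \<not> P x a) us of [] => True | a # t => False) = list_all (P x) us" for x us
    by (induction us) auto
  ultimately show ?thesis by simp
qed

lemma ptime_list_ex [ptime]:
  fixes xs :: "'x::coded => 'a::coded list"
  assumes "ptime xs" "ptime (\<lambda>p. P (fst p) (snd p))"
  shows "ptime (\<lambda>x. list_ex (P x) (xs x))"
proof -
  have "ptime (\<lambda>x. \<not> list_all (\<lambda>a. \<not> P x a) (xs x))"
    by (intro ptime assms)
  then show ?thesis by (simp add: list_all_iff list_ex_iff)
qed

lemma ptime_length [ptime]:
  fixes xs :: "'x::coded => 'a::coded list"
  assumes "ptime xs"
  shows "ptime (\<lambda>x. length (xs x))"
proof -
  have foldr_Suc: "foldr (\<lambda>a s. Suc s) us 0 = length us" for us :: "'a list" by (induction us) auto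
  have "ptime (\<lambda>x. foldr (\<lambda>a s. Suc s) (xs x) 0)"
  proof (rule ptime_foldr[where B = "\<lambda>x. 2 * sz (xs x) + 1"])
    fix x us vs assume "xs x = us @ vs"
    then show "sz (foldr (\<lambda>a s. Suc s) vs 0) \<le> 2 * sz (xs x) + 1"
      using sz_le_append(1)[of vs us] length_le_sz[of vs] by (simp add: foldr_Suc)
  qed (intro ptime assms pbound_add pbound_mult pbound_const ptime_sz)+
  then show ?thesis by (simp add: foldr_Suc)
qed

text \<open>The code of \<open>n\<close> is at the same time the code of a list of \<open>n\<close>
  leaves. So recursion over numbers is recursion over lists.\<close>

lemma ptime_replicate_Lf: "ptime n ==> ptime (\<lambda>x. replicate (n x) Lf)"
proof (erule ptime_recode)
  have "dat_of (replicate m Lf) = dat_of m" for m by (induction m) auto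
  then show "dat_of (replicate (n x) Lf) = dat_of (n x)" for x .
qed

lemma ptime_funpow:
  fixes f :: "'x::coded => 's::coded => 's"
  assumes f: "ptime (\<lambda>p. f (fst p) (snd p))" and n: "ptime n" and init: "ptime init" and B: "pbound B sz"
    and bound: "\<And>x i. i \<le> n x ==> sz ((f x ^^ i) (init x)) \<le> B x"
  shows "ptime (\<lambda>x. (f x ^^ n x) (init x))"
proof -
  have *: "foldl (\<lambda>s a. f x s) s us = (f x ^^ length us) s" for x s and us :: "dat list"
    by (induction us arbitrary: s) (auto simp: funpow_swap1)
  have "ptime (\<lambda>x. foldl (\<lambda>s a. f x s) (init x) (replicate (n x) Lf))"
  proof (rule ptime_foldl[where B = B])
    fix x us vs assume "replicate (n x) Lf = us @ vs"
    then have "length us \<le> n x" by (metis length_append length_replicate le_add1)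
    then show "sz (foldl (\<lambda>s a. f x s) (init x) us) \<le> B x" using bound by (simp add: *)
  next
    show "ptime (\<lambda>p :: 'x \<times> 's \<times> dat. f (fst p) (fst (snd p)))"
      by (intro ptime_apply2[OF f] ptime)
  qed (intro init ptime_replicate_Lf n B)+
  then show ?thesis by (simp add: *)
qed

lemma ptime_replicate [ptime]:
  assumes "ptime n" "ptime a" shows "ptime (\<lambda>x. replicate (n x) (a x))"
proof -
  have "ptime (\<lambda>x. map (\<lambda>u. a x) (replicate (n x) Lf))"
    by (intro ptime ptime_replicate_Lf assms ptime_compose[OF assms(2)])
  then show ?thesis by simp
qed

text \<open>Equality is decided on the token lists of the codes.\<close>

definition toks :: "'a::coded => bool list" where
  "toks x = map (\<lambda>a. a = 1) (ser (dat_of x))"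

lemma ptime_toks: "ptime toks"
proof (rule ptimeI)
  show "sc_ok {2, 3, 4} 4 tokenise" by (rule sc_ok_programs)
  show "pbound (\<lambda>x::'a. 80 * sz x + 80) sz" by (intro pbound_intros)
  have *: "dat_of (map (\<lambda>a. a = 1) w) = tokens w" for w :: "nat list"
    by (induction w) auto
  fix x :: 'a and st r assume "st (2::nat) = ser (dat_of x) @ r"
  then show "runs tokenise st (80 * sz x + 80) (st(2 := ser (dat_of (toks x)) @ r))"
    using tokenise[of st "dat_of x" r] by (simp add: sz_def toks_def * del: One_nat_def)
qed

lemma toks_inject: "toks x = toks y \<longleftrightarrow> x = y"
proof
  assume "toks x = toks y"
  then have "map (\<lambda>a. a = 1) (ser (dat_of x)) = map (\<lambda>a. a = (1::nat)) (ser (dat_of y))"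
    by (simp add: toks_def)
  then have "ser (dat_of x) = ser (dat_of y)"
  proof (rule map_inj_on)
    have "inj_on (\<lambda>a. a = (1::nat)) {0, 1}" by (auto simp: inj_on_def)
    then show "inj_on (\<lambda>a. a = (1::nat)) (set (ser (dat_of x)) \<union> set (ser (dat_of y)))"
      by (rule inj_on_subset) (use set_ser in simp)
  qed
  then show "x = y" by simp
qed simp

text \<open>The state consists of the part of the other list that is still to be compared and of a
  flag. The lists are equal if the flag survives and nothing is left over.\<close>

definition match_step :: "bool list \<times> bool => bool => bool list \<times> bool" where
  "match_step s a = (case fst s of [] => ([], False) | b # r => (r, if a then snd s \<and> b else snd s \<and> \<not> b))"

lemma foldl_match:
  "fst (foldl match_step (ys, ok) xs) = drop (length xs) ys"
  "snd (foldl match_step (ys, ok) xs) \<longleftrightarrow> ok \<and> length xs \<le> length ys \<and> take (length xs) ys = xs"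
proof (induction xs arbitrary: ys ok)
  case (Cons a xs)
  { case 1 then show ?case using Cons by (cases ys) (auto simp: match_step_def) }
  { case 2 then show ?case using Cons by (cases ys) (auto simp: match_step_def) }
qed auto

lemma ptime_eq [ptime]:
  fixes f :: "'x::coded => 'a::coded"
  assumes "ptime f" "ptime g"
  shows "ptime (\<lambda>x. f x = g x)"
proof -
  let ?F = "\<lambda>x. foldl match_step (toks (g x), True) (toks (f x))"
  have toks: "ptime (\<lambda>x. toks (f x))" "ptime (\<lambda>x. toks (g x))"
    using assms ptime_compose[OF ptime_toks] by blast+
  have "ptime ?F"
  proof (rule ptime_foldl[where B = "\<lambda>x. sz (toks (g x)) + 4"])
    show "ptime (\<lambda>p :: 'x \<times> (bool list \<times> bool) \<times> bool. match_step (fst (snd p)) (snd (snd p)))"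
      unfolding match_step_def by (intro ptime)
    show "sz (foldl match_step (toks (g x), True) ys) \<le> sz (toks (g x)) + 4" for x ys
    proof -
      have "sz (drop (length ys) (toks (g x))) \<le> sz (toks (g x))"
        using sz_le_append(1)[of "drop (length ys) (toks (g x))" "take (length ys) (toks (g x))"] by simp
      then show ?thesis
        using foldl_match(1)[of "toks (g x)" True ys] sz_bool_le[of "snd (foldl match_step (toks (g x), True) ys)"]
        by (cases "foldl match_step (toks (g x), True) ys") auto
    qed
  qed (intro ptime toks pbound_add pbound_const ptime_sz)+
  then have "ptime (\<lambda>x. snd (?F x) \<and> (case fst (?F x) of [] => True | a # t => False))"
    by (intro ptime)
  moreover have "(snd (?F x) \<and> (case fst (?F x) of [] => True | a # t => False)) \<longleftrightarrow> f x = g x" for x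
  proof -
    have "(case drop n w of [] => True | a # t => False) \<longleftrightarrow> length w \<le> n" for n and w :: "bool list"
      by (cases "drop n w") (simp_all, metis drop_eq_Nil list.distinct(1))
    moreover have "length v \<le> length w \<and> take (length v) w = v \<and> length w \<le> length v \<longleftrightarrow> v = w" for v w :: "bool list"
      by (metis order_refl take_all)
    ultimately show ?thesis by (simp add: foldl_match toks_inject)
  qed
  ultimately show ?thesis by simp
qed

lemma ptime_member [ptime]:
  assumes "ptime a" "ptime xs"
  shows "ptime (\<lambda>x. a x \<in> set (xs x))"
proof -
  have "ptime (\<lambda>x. list_ex (\<lambda>b. b = a x) (xs x))"
    by (intro ptime assms ptime_compose[OF assms(1)])
  then show ?thesis by (simp add: list_ex_iff)
qed

lemma ptime_remdups [ptime]:
  fixes xs :: "'x::coded => 'a::coded list"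
  assumes "ptime xs"
  shows "ptime (\<lambda>x. remdups (xs x))"
proof -
  have foldr_remdups: "foldr (\<lambda>a s. if a \<in> set s then s else a # s) us [] = remdups us" for us :: "'a list"
    by (induction us) auto
  have sz_remdups: "sz (remdups us) \<le> sz us" for us :: "'a list" by (induction us) auto
  have "ptime (\<lambda>x. foldr (\<lambda>a s. if a \<in> set s then s else a # s) (xs x) [])"
  proof (rule ptime_foldr[where B = "\<lambda>x. sz (xs x)"])
    fix x us vs assume "xs x = us @ vs"
    then show "sz (foldr (\<lambda>a s. if a \<in> set s then s else a # s) vs []) \<le> sz (xs x)"
      using sz_le_append(1)[of vs us] sz_remdups[of vs] by (simp add: foldr_remdups)
  qed (intro ptime assms)+
  then show ?thesis by (simp add: foldr_remdups)
qed

lemma ptime_distinct [ptime]: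
  assumes "ptime xs" shows "ptime (\<lambda>x. distinct (xs x))"
proof -
  have "ptime (\<lambda>x. remdups (xs x) = xs x)" by (intro ptime assms)
  then show ?thesis by (simp add: remdups_id_iff_distinct)
qed

lemma ptime_plus [ptime]:
  fixes f :: "'x::coded => nat"
  assumes "ptime f" "ptime g" shows "ptime (\<lambda>x. f x + g x)"
proof -
  have "ptime (\<lambda>x. length (replicate (f x) Lf @ replicate (g x) Lf))" by (intro ptime assms)
  then show ?thesis by simp
qed

lemma ptime_times [ptime]:
  fixes f :: "'x::coded => nat"
  assumes "ptime f" "ptime g" shows "ptime (\<lambda>x. f x * g x)"
proof -
  have *: "length (concat (replicate m w)) = m * length w" for m and w :: "dat list"
    by (induction m) auto
  have "ptime (\<lambda>x. length (concat (replicate (f x) (replicate (g x) Lf))))" by (intro ptime assms)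
  then show ?thesis by (simp add: *)
qed

lemma ptime_drop [ptime]:
  fixes xs :: "'x::coded => 'a::coded list"
  assumes "ptime n" "ptime xs" shows "ptime (\<lambda>x. drop (n x) (xs x))"
proof -
  have tl_funpow: "(tl ^^ i) us = drop i us" for i and us :: "'a list"
    by (induction i) (auto simp: drop_Suc tl_drop)
  have "ptime (\<lambda>p :: 'x \<times> 'a list. case snd p of [] => [] | a # t => t)" by (intro ptime)
  moreover have "(\<lambda>p :: 'x \<times> 'a list. case snd p of [] => [] | a # t => t) = (\<lambda>p. tl (snd p))"
    by (auto simp: fun_eq_iff split: list.split)
  ultimately have tl: "ptime (\<lambda>p :: 'x \<times> 'a list. tl (snd p))" by simp
  have "ptime (\<lambda>x. (tl ^^ n x) (xs x))"
  proof (rule ptime_funpow[OF tl assms, where B = "\<lambda>x. sz (xs x)"])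
    show "sz ((tl ^^ i) (xs x)) \<le> sz (xs x)" for x i
      using sz_le_append(1)[of "drop i (xs x)" "take i (xs x)"] by (simp add: tl_funpow)
  qed (intro ptime_sz assms)
  then show ?thesis by (simp add: tl_funpow)
qed

lemma ptime_diff [ptime]:
  fixes f :: "'x::coded => nat"
  assumes "ptime f" "ptime g" shows "ptime (\<lambda>x. f x - g x)"
proof -
  have "ptime (\<lambda>x. length (drop (g x) (replicate (f x) Lf)))" by (intro ptime assms)
  then show ?thesis by simp
qed

lemma ptime_le [ptime]:
  fixes f :: "'x::coded => nat"
  assumes "ptime f" "ptime g" shows "ptime (\<lambda>x. f x \<le> g x)"
proof -
  have "ptime (\<lambda>x. f x - g x = 0)" by (intro ptime assms)
  then show ?thesis by simp
qed

lemma ptime_less [ptime]: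
  fixes f :: "'x::coded => nat"
  assumes "ptime f" "ptime g" shows "ptime (\<lambda>x. f x < g x)"
proof -
  have "ptime (\<lambda>x. Suc (f x) \<le> g x)" by (intro ptime assms)
  then show ?thesis by (simp add: Suc_le_eq)
qed

lemma ptime_take [ptime]:
  fixes xs :: "'x::coded => 'a::coded list"
  assumes "ptime n" "ptime xs" shows "ptime (\<lambda>x. take (n x) (xs x))"
proof -
  have "ptime (\<lambda>x. rev (drop (length (xs x) - n x) (rev (xs x))))" by (intro ptime assms)
  moreover have "rev (drop (length us - m) (rev us)) = take m us" for us :: "'a list" and m
    by (cases "m \<le> length us") (auto simp: rev_drop)
  ultimately show ?thesis by simp
qed

lemma ptime_upt [ptime]:
  assumes "ptime n" shows "ptime (\<lambda>x. [0..<n x])"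
proof -
  have *: "((\<lambda>l. l @ [length l]) ^^ m) [] = [0..<m]" for m by (induction m) auto
  have "ptime (\<lambda>x. ((\<lambda>l. l @ [length l]) ^^ n x) [])"
  proof (rule ptime_funpow[where B = "\<lambda>x. sz (n x) * (sz (n x) + 1) + 1"])
    fix x i assume i: "i \<le> n x"
    have "sz [0..<i] \<le> length [0..<i] * (sz (n x) + 1) + 1" by (rule sz_list_le) (use i in auto)
    also have "\<dots> \<le> sz (n x) * (sz (n x) + 1) + 1" using i by (intro add_right_mono mult_right_mono) auto
    finally show "sz (((\<lambda>l. l @ [length l]) ^^ i) []) \<le> sz (n x) * (sz (n x) + 1) + 1" by (simp only: *)
  qed (intro ptime assms pbound_add pbound_mult pbound_const ptime_sz)+
  then show ?thesis by (simp add: *)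
qed

text \<open>Lookup with a default value, since \<open>nth\<close> is unspecified beyond the end of a list.\<close>

definition nth_or :: "'a => 'a list => nat => 'a" where
  "nth_or d xs i = (if i < length xs then xs ! i else d)"

lemma ptime_nth_or [ptime]:
  assumes "ptime d" "ptime xs" "ptime i" shows "ptime (\<lambda>x. nth_or (d x) (xs x) (i x))"
proof -
  have "ptime (\<lambda>x. case drop (i x) (xs x) of [] => d x | a # t => a)" by (intro ptime assms)
  moreover have "(case drop (i x) (xs x) of [] => d x | a # t => a) = nth_or (d x) (xs x) (i x)" for x
    by (auto simp: nth_or_def hd_drop_conv_nth[symmetric] split: list.split)
  ultimately show ?thesis by simp
qed

lemma ptime_takeWhile [ptime]:
  fixes xs :: "'x::coded => 'a::coded list"
  assumes "ptime xs" "ptime (\<lambda>p. P (fst p) (snd p))"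
  shows "ptime (\<lambda>x. takeWhile (P x) (xs x))"
proof -
  have foldr_takeWhile: "foldr (\<lambda>a s. if P x a then a # s else []) us [] = takeWhile (P x) us" for x us
    by (induction us) auto
  have sz_takeWhile: "sz (takeWhile Q us) \<le> sz us" for Q and us :: "'a list" by (induction us) auto
  have "ptime (\<lambda>x. foldr (\<lambda>a s. if P x a then a # s else []) (xs x) [])"
  proof (rule ptime_foldr[where B = "\<lambda>x. sz (xs x)"])
    fix x us vs assume "xs x = us @ vs"
    then show "sz (foldr (\<lambda>a s. if P x a then a # s else []) vs []) \<le> sz (xs x)"
      using sz_le_append(1)[of vs us] sz_takeWhile[of "P x" vs] by (simp add: foldr_takeWhile)
  next
    show "ptime (\<lambda>p. if P (fst p) (snd (snd p)) then snd (snd p) # fst (snd p) else [])"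
      by (intro ptime ptime_apply2[OF assms(2)])
  qed (intro ptime assms)+
  then show ?thesis by (simp add: foldr_takeWhile)
qed

lemma ptime_mod [ptime]:
  fixes f :: "'x::coded => nat"
  assumes "ptime f" "ptime g" shows "ptime (\<lambda>x. f x mod g x)"
proof -
  \<comment> \<open>A counter that is reset at \<open>n\<close>. For \<open>n = 0\<close> it is
    never reset, in accordance with \<open>m mod 0 = m\<close>.\<close>
  let ?s = "\<lambda>n r. if Suc r = n then 0 else Suc r"
  have *: "(?s n ^^ m) 0 = m mod n" for m n :: nat
    by (induction m) (auto simp: mod_Suc)
  have "ptime (\<lambda>x. (?s (g x) ^^ f x) 0)"
  proof (rule ptime_funpow[where B = "\<lambda>x. sz (f x)"])
    show "sz ((?s (g x) ^^ i) 0) \<le> sz (f x)" if "i \<le> f x" for x i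
      unfolding * using that mod_less_eq_dividend[of i "g x"] by (simp del: mod_less_eq_dividend)
  qed (intro ptime assms ptime_sz ptime_compose[OF assms(2)])+
  then show ?thesis by (simp add: *)
qed

section \<open>Arithmetic on binary numbers\<close>

definition bit_of :: "nat => nat" where
  "bit_of b = (if b = 0 then 0 else 1)"

lemma ptime_bit_of [ptime]: "ptime f ==> ptime (\<lambda>x. bit_of (f x))"
  unfolding bit_of_def by (intro ptime)

primrec val :: "nat list => nat" where
  "val [] = 0"
| "val (b # bs) = bit_of b + 2 * val bs"

text \<open>Normal form: zeros at the end of the list are the leading zeros, since the least
  significant bit comes first. Every nonzero letter counts as the bit 1, which makes the functions
  total on words.\<close>

primrec trim :: "nat list => nat list" where
  "trim [] = []"
| "trim (b # bs) = (if b = 0 \<and> trim bs = [] then [] else bit_of b # trim bs)"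

lemma bits_double: "a \<le> 1 ==> a + 2 * n \<noteq> 0 ==> bits (a + 2 * n) = a # bits n"
  by (subst bits.simps) (auto simp: le_Suc_eq)

lemma bits_eq_Nil [simp]: "bits n = [] \<longleftrightarrow> n = 0"
  by (subst bits.simps) auto

lemma bits_0 [simp]: "bits 0 = []"
  by simp

lemma bits_val: "bits (val bs) = trim bs"
proof (induction bs)
  case (Cons b bs)
  show ?case
  proof (cases "b = 0 \<and> trim bs = []")
    case True
    then have "val bs = 0" using Cons by (metis bits_eq_Nil)
    then show ?thesis using True by (simp add: bit_of_def)
  next
    case False
    have "trim bs \<noteq> [] ==> val bs \<noteq> 0" using Cons by (metis bits_eq_Nil)
    then have "bit_of b + 2 * val bs \<noteq> 0" using False by (auto simp: bit_of_def)
    then show ?thesis using False Cons bits_double[of "bit_of b" "val bs"]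
      by (auto simp: bit_of_def)
  qed
qed simp

lemma val_bits [simp]: "val (bits n) = n"
proof (induction n rule: bits.induct)
  case (1 n)
  show ?case
  proof (cases "n = 0")
    case False
    then have "val (bits n) = bit_of (n mod 2) + 2 * val (bits (n div 2))" by (subst bits.simps) simp
    moreover have "bit_of (n mod 2) = n mod 2" by (auto simp: bit_of_def)
    ultimately show ?thesis using 1 False by simp
  qed simp
qed

lemma bits_le_1: "b \<in> set (bits n) ==> b \<le> 1"
  using set_bits[of n] by auto

lemma sz_bits: "sz (bits n) \<le> 4 * length (bits n) + 1"
  using sz_list_le[of "bits n" 3] bits_le_1[of _ n] by fastforce

lemma val_less: "val bs < 2 ^ length bs"
  by (induction bs) (auto simp: bit_of_def)

lemma less_exp_bits: "n < 2 ^ length (bits n)"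
  using val_less[of "bits n"] by simp

lemma bits_unary: "bits (2 ^ j - 1) = replicate j 1"
proof -
  have "val (replicate j 1) = 2 ^ j - 1"
  proof (induction j)
    case (Suc j)
    have "Suc (2 * (2 ^ j - 1)) = 2 * 2 ^ j - (1::nat)"
      using one_le_power[of "2::nat" j] by linarith
    then show ?case using Suc by (simp add: bit_of_def)
  qed simp
  moreover have "trim (replicate j 1) = replicate j 1" by (induction j) (auto simp: bit_of_def)
  ultimately show ?thesis using bits_val by metis
qed

lemma ptime_trim [ptime]:
  assumes "ptime f" shows "ptime (\<lambda>x. trim (f x))"
proof -
  have foldr_trim: "foldr (\<lambda>b r. if b = 0 \<and> r = [] then [] else bit_of b # r) bs [] = trim bs" for bs
    by (induction bs) auto
  have sz_trim: "sz (trim bs) \<le> sz bs" for bs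
    by (induction bs) (auto simp: bit_of_def)
  have "ptime (\<lambda>x. foldr (\<lambda>b r. if b = 0 \<and> r = [] then [] else bit_of b # r) (f x) [])"
  proof (rule ptime_foldr[where B = "\<lambda>x. sz (f x)"])
    fix x us vs assume "f x = us @ vs"
    then show "sz (foldr (\<lambda>b r. if b = 0 \<and> r = [] then [] else bit_of b # r) vs []) \<le> sz (f x)"
      using sz_le_append(1)[of vs us] sz_trim[of vs] by (simp add: foldr_trim)
  qed (intro ptime assms ptime_sz)+
  then show ?thesis by (simp add: foldr_trim)
qed

primrec inc :: "nat list => nat list" where
  "inc [] = [1]"
| "inc (b # bs) = (if b = 0 then 1 # bs else 0 # inc bs)"

lemma bits_Suc: "bits (Suc n) = inc (bits n)"
proof (induction n rule: bits.induct)
  case (1 n)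
  show ?case
  proof (cases "n = 0")
    case True
    then show ?thesis by (simp add: bits.simps)
  next
    case False
    then have n: "bits n = n mod 2 # bits (n div 2)" by (subst bits.simps) simp
    show ?thesis
    proof (cases "n mod 2 = 0")
      case True
      then have "Suc n = 1 + 2 * (n div 2)" by presburger
      then show ?thesis using bits_double[of 1 "n div 2"] n True by simp
    next
      case odd: False
      then have "Suc n = 0 + 2 * Suc (n div 2)" by presburger
      then have "bits (Suc n) = 0 # bits (Suc (n div 2))" using bits_double[of 0 "Suc (n div 2)"] by simp
      then show ?thesis using 1 False n odd by simp
    qed
  qed
qed

lemma sz_inc: "sz (inc bs) \<le> sz bs + 4"
  by (induction bs) auto

lemma ptime_inc [ptime]:
  fixes f :: "'x::coded => nat list"
  assumes "ptime f" shows "ptime (\<lambda>x. inc (f x))"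
proof -
  \<comment> \<open>The recursion of \<open>inc\<close> refers to the tail itself besides its image,
    so the fold carries both.\<close>
  let ?F = "\<lambda>b s. (b # fst s, if b = 0 then 1 # fst s else 0 # snd s)"
  have *: "foldr ?F bs ([], [1]) = (bs, inc bs)" for bs
    by (induction bs) auto
  have "ptime (\<lambda>x. foldr ?F (f x) ([], [1]))"
  proof (rule ptime_foldr[where B = "\<lambda>x. 2 * sz (f x) + 5"])
    show "ptime (\<lambda>p :: 'x \<times> (nat list \<times> nat list) \<times> nat. ?F (snd (snd p)) (fst (snd p)))"
      by (intro ptime)
    fix x us vs assume "f x = us @ vs"
    then show "sz (foldr ?F vs ([], [1])) \<le> 2 * sz (f x) + 5"
      using sz_le_append(1)[of vs us] sz_inc[of vs] unfolding * by simp
  qed (intro ptime assms)+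
  then have "ptime (\<lambda>x. snd (foldr ?F (f x) ([], [1])))" by (rule ptime_snd)
  then show ?thesis unfolding * by simp
qed

lemma ptime_bits [ptime]:
  fixes f :: "'x::coded => nat"
  assumes "ptime f" shows "ptime (\<lambda>x. bits (f x))"
proof -
  have *: "(inc ^^ n) [] = bits n" for n by (induction n) (auto simp: bits_Suc)
  have "ptime (\<lambda>x. (inc ^^ f x) [])"
  proof (rule ptime_funpow[where B = "\<lambda>x. 4 * sz (f x) + 1"])
    have sz: "sz ((inc ^^ i) []) \<le> 4 * i + 1" for i
    proof (induction i)
      case (Suc i)
      then show ?case using sz_inc[of "(inc ^^ i) []"] by simp
    qed simp
    show "sz ((inc ^^ i) []) \<le> 4 * sz (f x) + 1" if "i \<le> f x" for x i
      using sz[of i] that by simp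
  qed (intro ptime assms)+
  then show ?thesis by (simp add: *)
qed

text \<open>Schoolbook addition; the state consists of the carry and the digits found so far.\<close>

definition add_step :: "nat list => nat list => nat \<times> nat list => nat => nat \<times> nat list" where
  "add_step xs ys s i = (let d = fst s + bit_of (nth_or 0 xs i) + bit_of (nth_or 0 ys i) in
     (if d < 2 then 0 else 1, snd s @ [d mod 2]))"

text \<open>Beyond the ends of the lists the digits are read as 0. The extra position leaves room
  for the last carry, so that the final carry is 0.\<close>

definition add_bits :: "nat list => nat list => nat list" where
  "add_bits xs ys = trim (snd (foldl (add_step xs ys) (0, []) [0..<Suc (length xs + length ys)]))"

lemma val_append: "val (xs @ ys) = val xs + 2 ^ length xs * val ys"
  by (induction xs) auto

lemma val_take_Suc: "val (take (Suc i) xs) = val (take i xs) + 2 ^ i * bit_of (nth_or 0 xs i)"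
proof (cases "i < length xs")
  case True
  then show ?thesis by (simp add: take_Suc_conv_app_nth val_append nth_or_def)
qed (simp add: nth_or_def bit_of_def)

lemma add_step_invariant:
  assumes "foldl (add_step xs ys) (0, []) [0..<i] = (c, ds)"
  shows "c \<le> 1 \<and> length ds = i \<and> set ds \<subseteq> {0, 1} \<and> val ds + 2 ^ i * c = val (take i xs) + val (take i ys)"
  using assms
proof (induction i arbitrary: c ds)
  case (Suc i)
  obtain c' ds' where s: "foldl (add_step xs ys) (0, []) [0..<i] = (c', ds')"
    by (rule prod.exhaust)
  note IH = Suc.IH[OF s]
  define d where "d = c' + bit_of (nth_or 0 xs i) + bit_of (nth_or 0 ys i)"
  have cds: "c = (if d < 2 then 0 else 1)" "ds = ds' @ [d mod 2]"
    using Suc.prems s by (simp_all add: add_step_def[of _ _ "(c', ds')"] d_def Let_def)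
  have "d \<le> 3" using IH by (auto simp: d_def bit_of_def)
  then have d: "d = d mod 2 + 2 * c" by (auto simp: cds le_Suc_eq numeral_3_eq_3)
  have "bit_of (d mod 2) = d mod 2" by (auto simp: bit_of_def)
  then have "val ds + 2 ^ Suc i * c = val ds' + 2 ^ i * (d mod 2 + 2 * c)"
    using IH by (simp add: cds(2) val_append algebra_simps)
  also have "\<dots> = val ds' + 2 ^ i * d" by (rule arg_cong[OF d[symmetric]])
  also have "\<dots> = val (take (Suc i) xs) + val (take (Suc i) ys)"
    using IH by (simp add: val_take_Suc d_def algebra_simps)
  finally show ?case using IH cds by auto
qed simp

lemma add_bits: "add_bits xs ys = bits (val xs + val ys)"
proof -
  let ?i = "Suc (length xs + length ys)"
  obtain c ds where s: "foldl (add_step xs ys) (0, []) [0..<?i] = (c, ds)"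
    by (rule prod.exhaust)
  note inv = add_step_invariant[OF s]
  have "val xs < 2 ^ (length xs + length ys)" "val ys < 2 ^ (length xs + length ys)"
    by (rule less_le_trans[OF val_less], simp)+
  then have "val ds + 2 ^ ?i * c < 2 ^ ?i" using inv by simp
  then have "c = 0" by (cases c) auto
  then have "val ds = val xs + val ys" using inv by simp
  then show ?thesis using s bits_val[of ds] by (simp add: add_bits_def)
qed

lemma ptime_add_bits [ptime]:
  fixes f :: "'x::coded => nat list"
  assumes "ptime f" "ptime g" shows "ptime (\<lambda>x. add_bits (f x) (g x))"
proof -
  let ?n = "\<lambda>x. Suc (length (f x) + length (g x))"
  have "ptime (\<lambda>x. foldl (add_step (f x) (g x)) (0, []) [0..<?n x])"
  proof (rule ptime_foldl[where B = "\<lambda>x. (length (f x) + length (g x) + 1) * 4 + 5"])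
    show "ptime (\<lambda>p. add_step (f (fst p)) (g (fst p)) (fst (snd p)) (snd (snd p)))"
      unfolding add_step_def Let_def by (intro ptime ptime_compose[OF assms(1)] ptime_compose[OF assms(2)])
    show "pbound (\<lambda>x. (length (f x) + length (g x) + 1) * 4 + 5) sz"
      by (intro pbound_add pbound_mult pbound_const pbound_mono[OF ptime_sz[OF assms(1)] length_le_sz]
          pbound_mono[OF ptime_sz[OF assms(2)] length_le_sz])
    fix x us vs assume u: "[0..<?n x] = us @ vs"
    then have us: "us = [0..<length us]" "length us \<le> ?n x"
      by (metis append_eq_conv_conj take_upt le_add1 length_append length_upt diff_zero add_0)+
    obtain c ds where s: "foldl (add_step (f x) (g x)) (0, []) [0..<length us] = (c, ds)"
      by (rule prod.exhaust)
    note inv = add_step_invariant[OF s]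
    have "sz ds \<le> length ds * 4 + 1" using sz_list_le[of ds 3] inv by fastforce
    then show "sz (foldl (add_step (f x) (g x)) (0, []) us) \<le> (length (f x) + length (g x) + 1) * 4 + 5"
      using inv us s by simp
  qed (intro ptime assms)+
  then show ?thesis unfolding add_bits_def by (intro ptime)
qed

text \<open>Horner's scheme. Reduction in every step keeps the intermediate values small enough for
  unary numbers.\<close>

definition residue :: "nat list => nat => nat" where
  "residue bs q = foldr (\<lambda>b r. (bit_of b + 2 * r) mod q) bs 0"

lemma residue: "residue bs q = val bs mod q"
  unfolding residue_def
proof (induction bs)
  case (Cons b bs)
  then show ?case by (simp, metis mod_add_right_eq mod_mult_right_eq)
qed simp

text \<open>The modulus is given as a successor: modulo 0 the result would be the number itself,
  whose unary code is exponentially long.\<close>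

lemma ptime_residue [ptime]:
  fixes f :: "'x::coded => nat list"
  assumes "ptime f" "ptime q" shows "ptime (\<lambda>x. residue (f x) (Suc (q x)))"
  unfolding residue_def
proof (rule ptime_foldr[where B = "\<lambda>x. 2 * sz (q x) + 3"])
  show "ptime (\<lambda>p. (bit_of (snd (snd p)) + 2 * fst (snd p)) mod Suc (q (fst p)))"
    by (intro ptime ptime_compose[OF assms(2)])
  fix x us vs
  have "residue vs (Suc (q x)) \<le> q x" unfolding residue using mod_less_divisor[of "Suc (q x)" "val vs"] by simp
  then show "sz (foldr (\<lambda>b r. (bit_of b + 2 * r) mod Suc (q x)) vs 0) \<le> 2 * sz (q x) + 3"
    unfolding residue_def[symmetric] by simp
qed (intro ptime assms)+

section \<open>Trees as data\<close>

fun dat_of_tree_fun :: "tree => dat" where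
  "dat_of_tree_fun (Num n) = Br (dat_of (bits n)) Lf"
| "dat_of_tree_fun (Node ts) = Br Lf (Br (foldr (\<lambda>t d. Br (dat_of_tree_fun t) d) ts Lf) Lf)"

instantiation tree :: coded
begin
definition "dat_of_tree = dat_of_tree_fun"
instance
proof
  have list: "us = vs" if "foldr (\<lambda>t d. Br (dat_of_tree_fun t) d) us Lf = foldr (\<lambda>t d. Br (dat_of_tree_fun t) d) vs Lf"
    and "\<And>u v. u \<in> set us ==> dat_of_tree_fun u = dat_of_tree_fun v ==> u = v" for us vs
    using that
  proof (induction us arbitrary: vs)
    case Nil
    then show ?case by (cases vs) auto
  next
    case (Cons u us)
    then show ?case by (cases vs) auto
  qed
  show "dat_of s = dat_of t ==> s = t" for s t :: tree
    unfolding dat_of_tree_def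
  proof (induction s arbitrary: t)
    case (Num n)
    then show ?case by (cases t) (auto dest: bits_inj)
  next
    case (Node us)
    then show ?case
    proof (cases t)
      case (Node vs)
      then show ?thesis using Node.prems Node.IH list[of us vs] by auto
    qed auto
  qed
qed
end

text \<open>The numbers at the leaves are kept in binary, since they may be exponentially large. A
  tree has the code of a pair of a bit list and a list with at most one entry, the list of children;
  so its constructors and destructors come from those of pairs and lists.\<close>

lemma dat_of_tree [simp]:
  "dat_of (Num n) = Br (dat_of (bits n)) Lf" "dat_of (Node ts) = Br Lf (Br (dat_of ts) Lf)"
proof -
  have "foldr (\<lambda>t d. Br (dat_of_tree_fun t) d) ts Lf = dat_of ts"
    by (induction ts) (auto simp: dat_of_tree_def)
  then show "dat_of (Num n) = Br (dat_of (bits n)) Lf" "dat_of (Node ts) = Br Lf (Br (dat_of ts) Lf)"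
    by (simp_all add: dat_of_tree_def)
qed

lemma sz_tree [simp]: "sz (Num n) = sz (bits n) + 2" "sz (Node ts) = sz ts + 4"
  by (simp_all add: sz_def)

text \<open>Codes of trees are at most linear in the words of the trees, which will bound the state
  of the parser.\<close>

lemma sz_le_enc: "sz t + 1 \<le> 4 * length (enc t)"
proof (induction t rule: enc.induct)
  case (1 n)
  then show ?case using sz_bits[of n] by simp
next
  case (2 ts)
  then have "sz ts \<le> 4 * length (concat (map enc ts)) + 1"
  proof (induction ts)
    case (Cons t ts)
    have "sz t + 1 \<le> 4 * length (enc t)" "sz ts \<le> 4 * length (concat (map enc ts)) + 1"
      using Cons by auto
    then show ?case by simp
  qed simp
  then show ?case by simp
qed

definition num_bits :: "tree => nat list" where
  "num_bits t = (case t of Num n => bits n | Node ts => [])"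

definition kids :: "tree => tree list" where
  "kids t = (case t of Num n => [] | Node ts => ts)"

definition is_num :: "tree => bool" where
  "is_num t = (case t of Num n => True | Node ts => False)"

lemma tree_destructors [simp]:
  "num_bits (Num n) = bits n" "num_bits (Node ts) = []" "kids (Num n) = []" "kids (Node ts) = ts"
  "is_num (Num n)" "\<not> is_num (Node ts)"
  by (simp_all add: num_bits_def kids_def is_num_def)

lemma ptime_tree_destructors [ptime]:
  assumes "ptime f"
  shows "ptime (\<lambda>x. num_bits (f x))" "ptime (\<lambda>x. kids (f x))" "ptime (\<lambda>x. is_num (f x))"
proof -
  define pair where "pair t = (num_bits t, case t of Num n => [] | Node ts => [ts])" for t
  have "dat_of (pair t) = dat_of t" for t
    by (cases t) (auto simp: pair_def)
  then have *: "ptime (\<lambda>x. pair (f x))" by (intro ptime_recode[OF assms])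
  from ptime_fst[OF *] show "ptime (\<lambda>x. num_bits (f x))" by (simp add: pair_def)
  have "concat (snd (pair t)) = kids t" "(snd (pair t) = []) = is_num t" for t
    by (cases t; simp add: pair_def)+
  moreover have "ptime (\<lambda>x. concat (snd (pair (f x))))" "ptime (\<lambda>x. snd (pair (f x)) = [])"
    by (intro ptime *)+
  ultimately show "ptime (\<lambda>x. kids (f x))" "ptime (\<lambda>x. is_num (f x))" by simp_all
qed

lemma ptime_Node [ptime]: "ptime f ==> ptime (\<lambda>x. Node (f x))"
  by (rule ptime_recode[of "\<lambda>x. ([] :: nat list, [f x])"]) (intro ptime, simp_all)

lemma ptime_Num_val [ptime]: "ptime f ==> ptime (\<lambda>x. Num (val (f x)))"
  by (rule ptime_recode[of "\<lambda>x. (trim (f x), [] :: nat list)"]) (intro ptime, simp_all add: bits_val)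

lemma ptime_Num [ptime]: "ptime f ==> ptime (\<lambda>x. Num (f x))"
  by (rule ptime_recode[of "\<lambda>x. (bits (f x), [] :: nat list)"]) (intro ptime, simp_all)

section \<open>Passage between words on tapes and codes\<close>

fun push_symbol :: "nat => sc" where
  "push_symbol 0 = push_all 2 []"
| "push_symbol (Suc K) = SIf 3 (\<lambda>t. t = Some K) (push_all 2 (1 # ser (dat_of K))) (push_symbol K)"

text \<open>On the tape a letter is a single symbol, in a code it is a unary number. The word passes
  through stack 3, because the code of a list has to be built from its end.\<close>

definition load :: "nat => sc" where
  "load K = SSeq (SWhile 5 (\<lambda>t. t \<noteq> None) (SSeq (Copy 5 3) (Pop 5)))
     (SSeq (Push 2 0) (SWhile 3 (\<lambda>t. t \<noteq> None) (SSeq (push_symbol K) (Pop 3))))"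

lemma push_all_loopfree: "loopfree (push_all r w)" "safe (push_all r w) st"
    "effect (push_all r w) st = st(r := w @ st r)"
proof -
  show "loopfree (push_all r w)" by (induction w) auto
  show "safe (push_all r w) st" by (induction w) auto
  show "effect (push_all r w) st = st(r := w @ st r)"
    by (induction w) (simp_all add: fun_upd_same del: fun_upd_apply)
qed

lemma push_symbol: "loopfree (push_symbol K)" "safe (push_symbol K) st"
  "st 3 = a # w ==> a < K ==> effect (push_symbol K) st = st(2 := 1 # ser (dat_of a) @ st 2)"
proof -
  show "loopfree (push_symbol K)" by (induction K) (auto simp: push_all_loopfree)
  show "safe (push_symbol K) st" by (induction K) (auto simp: push_all_loopfree simp del: push_all.simps)
  show "st 3 = a # w ==> a < K ==> effect (push_symbol K) st = st(2 := 1 # ser (dat_of a) @ st 2)"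
    by (induction K) (auto simp: push_all_loopfree less_Suc_eq simp del: push_all.simps)
qed

lemma load:
  assumes "y \<in> lists {..<K}" "st 5 = y" "st 2 = []" "st 3 = []"
  shows "runs (load K) st (length y * (cost (push_symbol K) + 20) + 20) (st(5 := [], 2 := ser (dat_of y)))"
proof -
  let ?W1 = "SWhile 5 (\<lambda>t. t \<noteq> None) (SSeq (Copy 5 3) (Pop 5))"
  let ?W2 = "SWhile 3 (\<lambda>t. t \<noteq> None) (SSeq (push_symbol K) (Pop 3))"
  let ?C = "cost (push_symbol K)"
  have W1: "runs ?W1 (st(5 := u, 3 := v)) (6 * length u + 1) (st(5 := [], 3 := rev u @ v))" for u v
  proof (induction u arbitrary: v)
    case Nil
    then show ?case by (intro runs_SWhile_end) auto
  next
    case (Cons a u)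
    show ?case
      by (rule runs_SWhile_loopfree[OF _ _ _ _ Cons.IH[of "a # v", THEN back_subst[where P = "runs _ _ _"]]])
        (auto simp: fun_eq_iff)
  qed
  have W2: "runs ?W2 (st(5 := [], 3 := rev u, 2 := ser (dat_of v))) (length u * (?C + 5) + 1)
      (st(5 := [], 3 := [], 2 := ser (dat_of (u @ v))))" if "set u \<subseteq> {..<K}" for u v
    using that
  proof (induction u arbitrary: v rule: rev_induct)
    case Nil
    then show ?case by (intro runs_SWhile_end) auto
  next
    case (snoc a u)
    let ?st = "st(5 := [], 3 := rev (u @ [a]), 2 := ser (dat_of v))"
    have "effect (push_symbol K) ?st = ?st(2 := 1 # ser (dat_of a) @ ?st 2)"
      by (rule push_symbol(3)[of _ a "rev u"]) (use snoc.prems in auto)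
    then have *: "effect (SSeq (push_symbol K) (Pop 3)) ?st = st(5 := [], 3 := rev u, 2 := ser (dat_of (a # v)))"
      by (auto simp: fun_eq_iff)
    have "runs ?W2 (st(5 := [], 3 := rev u, 2 := ser (dat_of (a # v)))) (length u * (?C + 5) + 1)
      (st(5 := [], 3 := [], 2 := ser (dat_of (u @ a # v))))" by (rule snoc.IH) (use snoc.prems in auto)
    then have "runs ?W2 ?st (length (u @ [a]) * (?C + 5) + 1) (st(5 := [], 3 := [], 2 := ser (dat_of (u @ a # v))))"
      by (rule runs_SWhile_loopfree[rotated 4]) (use * push_symbol in auto)
    then show ?case by (simp del: fun_upd_apply)
  qed
  have 1: "runs ?W1 st (6 * length y + 1) (st(5 := [], 3 := rev y))"
    using W1[of y "[]"] assms by (simp add: fun_upd_idem)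
  have 2: "runs (Push 2 0) (st(5 := [], 3 := rev y)) 3 (st(5 := [], 3 := rev y, 2 := ser (dat_of ([] :: nat list))))"
    by (rule runs_Push) (use assms in auto)
  have 3: "runs ?W2 (st(5 := [], 3 := rev y, 2 := ser (dat_of ([] :: nat list)))) (length y * (?C + 5) + 1)
      (st(5 := [], 2 := ser (dat_of y)))"
    using W2[of y "[]"] assms by (auto simp: fun_upd_idem)
  show ?thesis unfolding load_def
    by (rule runs_SSeq[OF 1 runs_SSeq[OF 2 3 le_refl]]) (simp add: algebra_simps)
qed

text \<open>\<open>Emit\<close> writes a fixed letter. The unary number is therefore counted in the
  control, by \<open>K\<close> nested tests, where \<open>j\<close> is the part read so far.\<close>

fun emit_symbol :: "nat => nat => sc" where
  "emit_symbol 0 j = SSeq (Pop 2) (Emit j)"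
| "emit_symbol (Suc K) j = SIf 2 (\<lambda>t. t = Some 1) (SSeq (Pop 2) (SSeq (Pop 2) (emit_symbol K (Suc j))))
     (SSeq (Pop 2) (Emit j))"

lemma emit_symbol:
  "loopfree (emit_symbol K j)" "safe (emit_symbol K j) st"
  "st 2 = ser (dat_of a) @ r ==> a \<le> K ==> effect (emit_symbol K j) st = st(2 := r, 1 := st 1 @ [j + a])"
proof -
  show "loopfree (emit_symbol K j)" by (induction K arbitrary: j) auto
  show "safe (emit_symbol K j) st" by (induction K arbitrary: j st) auto
  show "st 2 = ser (dat_of a) @ r ==> a \<le> K ==> effect (emit_symbol K j) st = st(2 := r, 1 := st 1 @ [j + a])"
  proof (induction K arbitrary: j st a)
    case 0
    then show ?case by (auto simp: fun_eq_iff)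
  next
    case (Suc K)
    show ?case
    proof (cases a)
      case 0
      then show ?thesis using Suc by (auto simp: fun_eq_iff)
    next
      case (Suc a')
      then have "effect (emit_symbol K (Suc j)) (st(2 := ser (dat_of a') @ r))
        = (st(2 := ser (dat_of a') @ r))(2 := r, 1 := (st(2 := ser (dat_of a') @ r)) 1 @ [Suc j + a'])"
        using Suc.prems by (intro Suc.IH) auto
      then show ?thesis using Suc Suc.prems by (auto simp: fun_eq_iff)
    qed
  qed
qed

definition unload :: "nat => sc" where
  "unload K = SWhile 2 (\<lambda>t. t = Some 1) (SSeq (Pop 2) (emit_symbol K 0))"

lemma unload:
  assumes "z \<in> lists {..K}" "st 2 = ser (dat_of z)"
  shows "runs (unload K) st (length z * (cost (emit_symbol K 0) + 5) + 1) (st(2 := [0], 1 := st 1 @ z))"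
  using assms
proof (induction z arbitrary: st)
  case Nil
  then show ?case unfolding unload_def by (intro runs_SWhile_end) (auto simp: fun_eq_iff)
next
  case (Cons a z)
  let ?st = "st(2 := ser (dat_of a) @ ser (dat_of z))"
  have a: "a \<le> K" "z \<in> lists {..K}" using Cons.hyps Cons.prems(1) by auto
  have 1: "effect (emit_symbol K 0) ?st = ?st(2 := ser (dat_of z), 1 := ?st 1 @ [0 + a])"
    by (rule emit_symbol(3)) (use a in auto)
  have 2: "effect (Pop 2) st = ?st" using Cons.prems by (auto simp: fun_eq_iff)
  have *: "effect (SSeq (Pop 2) (emit_symbol K 0)) st = st(2 := ser (dat_of z), 1 := st 1 @ [a])"
    unfolding effect.simps(5) 2 1 by (auto simp: fun_eq_iff)
  have "runs (unload K) (st(2 := ser (dat_of z), 1 := st 1 @ [a])) (length z * (cost (emit_symbol K 0) + 5) + 1)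
     ((st(2 := ser (dat_of z), 1 := st 1 @ [a]))(2 := [0], 1 := (st(2 := ser (dat_of z), 1 := st 1 @ [a])) 1 @ z))"
    by (rule Cons.IH) (use a in auto)
  then have "runs (unload K) (st(2 := ser (dat_of z), 1 := st 1 @ [a])) (length z * (cost (emit_symbol K 0) + 5) + 1)
     (st(2 := [0], 1 := st 1 @ a # z))"
    by (rule back_subst[where P = "runs _ _ _"]) (auto simp: fun_eq_iff)
  then show ?case unfolding unload_def
    by (rule runs_SWhile_loopfree[rotated 4, OF _ _ _ _ _ *]) (use Cons.prems emit_symbol in auto)
qed

lemma stack_program:
  fixes F :: "nat list => nat list"
  assumes F: "ptime F" and K: "\<And>y. y \<in> lists {..<K} ==> F y \<in> lists {..K}"
  shows "\<exists>c k S. sc_ok {2, 3, 4, 5} S c \<and> (\<forall>y\<in>lists {..<K}. \<exists>st'.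
    runs c ((\<lambda>_. [])(5 := y)) ((length y + 2) ^ k) st' \<and> st' 1 = F y)"
proof -
  obtain c T where c: "sc_ok {2, 3, 4} 4 c" "pbound T sz"
    "\<And>x st r. st 2 = ser (dat_of x) @ r ==> runs c st (T x) (st(2 := ser (dat_of (F x)) @ r))"
    using ptimeE[OF F] by metis
  let ?c = "SSeq (load K) (SSeq c (unload K))"
  let ?S = "K + 4"
  have "sc_ok {2, 3, 4, 5} ?S (push_all 2 w)" if "set w \<subseteq> {0, 1}" for w
    using sc_ok_mono[OF sc_ok_programs(6)[OF that]] by auto
  then have push: "sc_ok {2, 3, 4, 5} ?S (push_symbol i)" for i
    using set_ser by (induction i) (auto simp del: push_all.simps)
  have "sc_ok {2, 3, 4, 5} ?S (emit_symbol i j)" if "i + j \<le> K" for i j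
    using that by (induction i arbitrary: j) auto
  then have ok: "sc_ok {2, 3, 4, 5} ?S ?c"
    using push sc_ok_mono[OF c(1), of "{2, 3, 4, 5}" ?S] by (auto simp: load_def unload_def)
  define B where "B y = (length y * (cost (push_symbol K) + 20) + 20) + T y +
     (sz (F y) * (cost (emit_symbol K 0) + 5) + 5)" for y
  have "pbound B sz" unfolding B_def
    by (intro pbound_add pbound_mult pbound_const c(2) ptime_sz[OF F] pbound_mono[OF pbound_self length_le_sz])
  then obtain k where k: "B y \<le> (sz y + 2) ^ k" for y unfolding pbound_def by blast
  have "pbound (\<lambda>y :: nat list. (length y * (2 * K + 2) + 3) ^ k) length"
    by (intro pbound_add pbound_mult pbound_const pbound_power pbound_self)
  then obtain k' where k': "(length y * (2 * K + 2) + 3) ^ k \<le> (length y + 2) ^ k'" for y :: "nat list"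
    unfolding pbound_def by blast
  have "\<exists>st'. runs ?c ((\<lambda>_. [])(5 := y)) ((length y + 2) ^ k') st' \<and> st' 1 = F y"
    if y: "y \<in> lists {..<K}" for y
  proof -
    let ?st0 = "(\<lambda>_. [])(5 := y) :: nat => nat list"
    let ?st1 = "?st0(5 := [], 2 := ser (dat_of y))"
    let ?st2 = "?st1(2 := ser (dat_of (F y)))"
    have 1: "runs (load K) ?st0 (length y * (cost (push_symbol K) + 20) + 20) ?st1"
      by (rule load[OF y]) auto
    have 2: "runs c ?st1 (T y) ?st2"
      using c(3)[of ?st1 y "[]"] by simp
    have 3: "runs (unload K) ?st2 (length (F y) * (cost (emit_symbol K 0) + 5) + 1) (?st2(2 := [0], 1 := ?st2 1 @ F y))"
      by (rule unload[OF K[OF y]]) auto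
    have "length (F y) * (cost (emit_symbol K 0) + 5) \<le> sz (F y) * (cost (emit_symbol K 0) + 5)"
      by (intro mult_right_mono length_le_sz) auto
    then have *: "runs ?c ?st0 (B y) (?st2(2 := [0], 1 := ?st2 1 @ F y))"
      by (intro runs_SSeq[OF 1 runs_SSeq[OF 2 3 le_refl]]) (unfold B_def, linarith)
    \<comment> \<open>A letter below \<open>K\<close> contributes at most \<open>2 * K + 2\<close>
      to the size, so bounds in the size of the code become bounds in the length of the
      word.\<close>
    have "sz y \<le> length y * (2 * K + 2) + 1"
      using sz_list_le[of y "2 * K + 1"] y by fastforce
    then have "(sz y + 2) ^ k \<le> (length y * (2 * K + 2) + 3) ^ k" by (intro power_mono) auto
    then have "B y \<le> (length y + 2) ^ k'" using k[of y] k'[of y] by linarith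
    then show ?thesis using runs_mono[OF *] by (intro exI[of _ "?st2(2 := [0], 1 := ?st2 1 @ F y)"]) auto
  qed
  then show ?thesis using ok by blast
qed

section \<open>Composition of reductions\<close>


lemma tm_halted: "q \<ge> states M ==> (tm_step M ^^ n) (q, ts) = (q, ts)"
  by (induction n) auto

lemma tm_outputs_within_mono:
  assumes "tm_outputs_within M x y T" "T \<le> T'"
  shows "tm_outputs_within M x y T'"
proof -
  obtain q ts where qts: "(tm_step M ^^ T) (tm_init M x) = (q, ts)" by (rule prod.exhaust)
  then have "q = states M" "fst (ts ! 1) = tape_of_word y"
    using assms(1) by (auto simp: tm_outputs_within_def)
  moreover have "(tm_step M ^^ T') (tm_init M x) = (tm_step M ^^ (T' - T)) ((tm_step M ^^ T) (tm_init M x))"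
    using assms(2) by (metis funpow_add comp_apply le_add_diff_inverse2)
  ultimately show ?thesis by (simp add: tm_outputs_within_def qts tm_halted)
qed

lemma wf_tmD:
  assumes "wf_tm M" "q < states M" "length ss = tapes M" "set ss \<subseteq> {..<symbols M}" "trans M q ss = (q', as)"
  shows "q' \<le> states M \<and> length as = tapes M \<and> fst ` set as \<subseteq> {..<symbols M}"
proof -
  have "\<forall>q < states M. \<forall>ss. length ss = tapes M \<and> set ss \<subseteq> {..<symbols M} \<longrightarrow>
       (case trans M q ss of (q', as) =>
         q' \<le> states M \<and> length as = tapes M \<and> fst ` set as \<subseteq> {..<symbols M})"
    using assms(1) unfolding wf_tm_def by (elim conjE)
  from this[rule_format, OF assms(2) conjI[OF assms(3,4)]] show ?thesis by (simp add: assms(5))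
qed

definition tape_symbols :: "nat => tape list => bool" where
  "tape_symbols S ts \<longleftrightarrow> (\<forall>t\<in>set ts. range (fst t) \<subseteq> {..<S})"

lemma tape_symbols_read:
  assumes "tape_symbols S ts" shows "set (map read_tape ts) \<subseteq> {..<S}"
proof -
  have "read_tape t < S" if "t \<in> set ts" for t
  proof -
    have "range (fst t) \<subseteq> {..<S}" using assms that by (simp add: tape_symbols_def)
    then show ?thesis by (cases t) auto
  qed
  then show ?thesis by auto
qed

lemma tape_symbols_step:
  assumes M: "wf_tm M" and ts: "tape_symbols (symbols M) ts" "length ts = tapes M" and q: "q < states M"
    and step: "tm_step M (q, ts) = (q', ts')"
  shows "q' \<le> states M \<and> tape_symbols (symbols M) ts' \<and> length ts' = tapes M"
proof -
  obtain as where as: "trans M q (map read_tape ts) = (q', as)" "ts' = map2 act_tape as ts"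
    using step q by (auto split: prod.splits)
  have "set (map read_tape ts) \<subseteq> {..<symbols M}" using ts(1) by (rule tape_symbols_read)
  then have "q' \<le> states M \<and> length as = tapes M \<and> fst ` set as \<subseteq> {..<symbols M}"
    using wf_tmD[OF M q _ _ as(1)] ts(2) by simp
  moreover have "tape_symbols (symbols M) ts'" unfolding tape_symbols_def
  proof
    fix t assume "t \<in> set ts'"
    then obtain a u where au: "a \<in> set as" "u \<in> set ts" "t = act_tape a u"
      unfolding as(2) by (force dest: set_zip_leftD set_zip_rightD)
    have "fst a < symbols M" using calculation au(1) by blast
    moreover have "range (fst u) \<subseteq> {..<symbols M}" using ts(1) au(2) by (simp add: tape_symbols_def)
    ultimately show "range (fst t) \<subseteq> {..<symbols M}" unfolding au(3) by (cases a; cases u) auto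
  qed
  ultimately show ?thesis using ts by (simp add: as(2))
qed

text \<open>
  The simulating machine keeps tape 0 of \<open>M\<close> on its tape 0, the output tape of \<open>M\<close> on tape 5, the
  state of \<open>M\<close> as a symbol on tape 6, and the other tapes of \<open>M\<close> from tape 8 on. Tape 7 counts the
  simulated steps in unary; the count is needed to find the beginning of the output of \<open>M\<close> again.
\<close>

definition sim_act :: "tm => cmd" where
  "sim_act M = Act (\<lambda>ss. let r = ss ! 0 # ss ! 5 # drop 8 ss in
     if ss ! 6 < states M \<and> set r \<subseteq> {..<symbols M} \<and> length ss = tapes M + 6
     then (case trans M (ss ! 6) r of (q', as) =>
       [as ! 0] @ stay (take 4 (drop 1 ss)) @ [as ! 1, (q', MStay), (1, MRight)] @ drop 2 as)
     else stay ss)"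

definition sim_loop :: "tm => cmd" where
  "sim_loop M = Loop (\<lambda>ss. ss ! 6 < states M) (sim_act M)"

definition marks :: "nat => int => nat" where
  "marks T i = (if 0 \<le> i \<and> i < int T then 1 else 0)"

definition sim_tapes :: "nat => tape list => nat => tape list => tape list => bool" where
  "sim_tapes q us T bs ts \<longleftrightarrow> (\<exists>f. f 0 = q \<and> length bs = 4 \<and>
     ts = [us ! 0] @ bs @ [us ! 1, (f, 0), (marks T, int T)] @ drop 2 us)"

lemma sim_act:
  assumes M: "wf_tm M" and us: "tape_symbols (symbols M) us" "length us = tapes M" and q: "q < states M"
    and step: "tm_step M (q, us) = (q', us')" and ts: "sim_tapes q us T bs ts"
  shows "\<exists>ts'. exec (sim_act M) ts 1 ts' \<and> sim_tapes q' us' (Suc T) bs ts'"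
proof -
  obtain f where f: "f 0 = q" "length bs = 4"
    "ts = [us ! 0] @ bs @ [us ! 1, (f, 0), (marks T, int T)] @ drop 2 us"
    using ts by (auto simp: sim_tapes_def)
  obtain as where as: "trans M q (map read_tape us) = (q', as)" "us' = map2 act_tape as us"
    using step q by (auto split: prod.splits)
  obtain u0 u1 ur where us_eq: "us = u0 # u1 # ur"
    using us(2) M unfolding wf_tm_def by (metis One_nat_def Suc_1 Suc_le_length_iff)
  obtain b1 b2 b3 b4 where bs: "bs = [b1, b2, b3, b4]"
    using f(2) by (auto simp: numeral_eq_Suc length_Suc_conv)
  have ts_eq: "ts = [u0, b1, b2, b3, b4, u1, (f, 0), (marks T, int T)] @ ur"
    by (simp add: f us_eq bs)
  have sub: "set (map read_tape us) \<subseteq> {..<symbols M}" using us(1) by (rule tape_symbols_read)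
  then have "length as = Suc (Suc (length ur))"
    using wf_tmD[OF M q _ _ as(1)] us(2) us_eq by simp
  then obtain a0 a1 ar where as_eq: "as = a0 # a1 # ar" "length ar = length ur"
    by (auto simp: length_Suc_conv)
  let ?ss = "map read_tape ts"
  let ?F = "\<lambda>ss. let r = ss ! 0 # ss ! 5 # drop 8 ss in
     if ss ! 6 < states M \<and> set r \<subseteq> {..<symbols M} \<and> length ss = tapes M + 6
     then (case trans M (ss ! 6) r of (q', as) =>
       [as ! 0] @ stay (take 4 (drop 1 ss)) @ [as ! 1, (q', MStay), (1, MRight)] @ drop 2 as)
     else stay ss"
  have ss: "?ss ! 0 # ?ss ! 5 # drop 8 ?ss = map read_tape us" "?ss ! 6 = q" "length ?ss = tapes M + 6"
    "take 4 (drop 1 ?ss) = map read_tape bs"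
    using us(2) by (simp_all add: ts_eq us_eq f(1) bs)
  have F: "?F ?ss = [a0] @ stay (map read_tape bs) @ [a1, (q', MStay), (1, MRight)] @ ar"
    unfolding Let_def ss using q sub as(1) by (simp add: as_eq)
  have "acts (?F ?ss) ts = [act_tape a0 u0] @ acts (stay (map read_tape bs)) bs @
      [act_tape a1 u1, act_tape (q', MStay) (f, 0), act_tape (1, MRight) (marks T, int T)] @ acts ar ur"
    unfolding F by (simp add: acts_def ts_eq bs stay_def)
  also have "\<dots> = [us' ! 0] @ bs @ [us' ! 1, (f(0 := q'), 0), (marks (Suc T), int (Suc T))] @ drop 2 us'"
    by (simp add: as us_eq as_eq acts_def[of ar] marks_def fun_eq_iff)
  finally have "sim_tapes q' us' (Suc T) bs (acts (?F ?ss) ts)"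
    unfolding sim_tapes_def using f(2) by (intro exI[of _ "f(0 := q')"]) simp
  then show ?thesis unfolding sim_act_def using exec.Act[of ?F ts] by blast
qed

text \<open>Besides the simulation itself, the induction records two facts about the output tape of
  \<open>M\<close> after \<open>T'\<close> steps: the head is at most \<open>T'\<close> cells away
  from the origin, and all cells from \<open>T'\<close> on are blank. The first serves to find the
  output again, the second bounds its length.\<close>

lemma sim_loop:
  assumes M: "wf_tm M" and us: "tape_symbols (symbols M) us" "length us = tapes M" and q: "q \<le> states M"
    and run: "(tm_step M ^^ n) (q, us) = (states M, us')" and ts: "sim_tapes q us T bs ts"
    and head: "\<bar>snd (us ! 1)\<bar> \<le> int T" "\<And>i. i \<ge> int T ==> fst (us ! 1) i = 0"
  shows "\<exists>ts' T'. T' \<le> T + n \<and> exec (sim_loop M) ts (2 * (T' - T) + 1) ts' \<and> T \<le> T' \<and>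
     sim_tapes (states M) us' T' bs ts' \<and> \<bar>snd (us' ! 1)\<bar> \<le> int T' \<and> (\<forall>i \<ge> int T'. fst (us' ! 1) i = 0)"
  using assms(2-)
proof (induction n arbitrary: q us T ts)
  case 0
  then have "\<not> map read_tape ts ! 6 < states M"
    by (auto simp: sim_tapes_def nth_append)
  then have "exec (sim_loop M) ts 1 ts" unfolding sim_loop_def by (rule exec.Loop_end)
  then show ?case using 0 by (intro exI[of _ ts] exI[of _ T]) auto
next
  case (Suc n)
  show ?case
  proof (cases "q < states M")
    case False
    then have "\<not> map read_tape ts ! 6 < states M"
      using Suc.prems by (auto simp: sim_tapes_def nth_append)
    then have "exec (sim_loop M) ts 1 ts" unfolding sim_loop_def by (rule exec.Loop_end)
    moreover have "q = states M" "us' = us" using False Suc.prems tm_halted[of M q "Suc n" us] by auto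
    ultimately show ?thesis using Suc.prems by (intro exI[of _ ts] exI[of _ T]) auto
  next
    case True
    obtain q1 us1 where step: "tm_step M (q, us) = (q1, us1)" by (rule prod.exhaust)
    note inv = tape_symbols_step[OF M Suc.prems(1,2) True step]
    have run: "(tm_step M ^^ n) (q1, us1) = (states M, us')"
      using Suc.prems(4) step by (simp add: funpow_swap1)
    obtain ts1 where ts1: "exec (sim_act M) ts 1 ts1" "sim_tapes q1 us1 (Suc T) bs ts1"
      using sim_act[OF M Suc.prems(1,2) True step Suc.prems(5)] by blast
    obtain a u where au: "us1 ! 1 = act_tape a (us ! 1)"
    proof -
      obtain as where as: "us1 = map2 act_tape as us"
        using step True by (auto split: prod.splits)
      moreover have "2 \<le> length us1" using inv M by (auto simp: wf_tm_def)
      ultimately have "us1 ! 1 = act_tape (as ! 1) (us ! 1)" by auto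
      then show ?thesis using that by blast
    qed
    have "\<bar>snd (us1 ! 1)\<bar> \<le> int (Suc T) \<and> (\<forall>i \<ge> int (Suc T). fst (us1 ! 1) i = 0)"
    proof -
      obtain s d t h where "a = (s, d)" "us ! 1 = (t, h)" by (metis surj_pair)
      then show ?thesis using Suc.prems(6,7) by (cases d) (auto simp: au[unfolded One_nat_def])
    qed
    then obtain ts' T' where ts': "T' \<le> Suc T + n" "exec (sim_loop M) ts1 (2 * (T' - Suc T) + 1) ts'"
      "Suc T \<le> T'" "sim_tapes (states M) us' T' bs ts'" "\<bar>snd (us' ! 1)\<bar> \<le> int T'"
      "\<forall>i \<ge> int T'. fst (us' ! 1) i = 0"
      using Suc.IH[of us1 q1 "Suc T" ts1] inv run ts1(2) by blast
    have "map read_tape ts ! 6 < states M"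
      using Suc.prems(5) True by (auto simp: sim_tapes_def nth_append)
    then have "exec (sim_loop M) ts (1 + (2 * (T' - Suc T) + 1) + 1) ts'"
      using ts1(1) ts'(2) unfolding sim_loop_def by (rule exec.Loop_step)
    moreover have "1 + (2 * (T' - Suc T) + 1) + 1 = 2 * (T' - T) + 1" using ts'(3) by simp
    ultimately show ?thesis using ts' by (intro exI[of _ ts'] exI[of _ T']) auto
  qed
qed

definition shift :: "move => move => cmd" where
  "shift d d' = Seq (act_at 5 (\<lambda>ss. (ss ! 5, d))) (act_at 7 (\<lambda>ss. (ss ! 7, d')))"

lemma shift:
  assumes "ts ! 5 = (w, p)" "ts ! 7 = (g, c)" "7 < length ts"
  shows "exec (shift d d') ts 3 (ts[5 := (w, p + offset d), 7 := (g, c + offset d')])"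
proof -
  have "exec (act_at 5 (\<lambda>ss. (ss ! 5, d))) ts 1 (ts[5 := (w, p + offset d)])"
    using exec_act_at[of 5 "\<lambda>ss. (ss ! 5, d)" ts] assms by simp
  moreover have "exec (act_at 7 (\<lambda>ss. (ss ! 7, d'))) (ts[5 := (w, p + offset d)]) 1
     (ts[5 := (w, p + offset d), 7 := (g, c + offset d')])"
    using exec_act_at[of 7 "\<lambda>ss. (ss ! 7, d')" "ts[5 := (w, p + offset d)]"] assms by simp
  ultimately show ?thesis unfolding shift_def by (rule exec_Seq_1_1)
qed

definition scan :: "(nat => bool) => move => move => cmd" where
  "scan Q d d' = Loop (\<lambda>ss. ss ! 7 = 1 \<and> Q (ss ! 5)) (shift d d')"

text \<open>\<open>pos m\<close> is the position on tape 7 when \<open>m\<close> further steps are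
  allowed. Leaving it general covers both directions in which this tape is traversed.\<close>

lemma scan:
  assumes pos: "\<And>m. m < n ==> g (pos (Suc m)) = (1::nat) \<and> pos (Suc m) + offset d' = pos m" "g (pos 0) \<noteq> 1"
    and ts: "ts ! 5 = (w, p)" "ts ! 7 = (g, pos n)" "7 < length ts"
  shows "\<exists>j\<le>n. exec (scan Q d d') ts (4 * j + 1) (ts[5 := (w, p + int j * offset d), 7 := (g, pos (n - j))]) \<and>
     (\<forall>i<j. Q (w (p + int i * offset d))) \<and> (j = n \<or> \<not> Q (w (p + int j * offset d)))"
  using assms
proof (induction n arbitrary: p ts)
  case 0
  then have "exec (scan Q d d') ts 1 ts" unfolding scan_def by (intro exec.Loop_end) auto
  moreover have "ts = ts[5 := (w, p), 7 := (g, pos 0)]" using 0 by (metis list_update_id)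
  ultimately show ?case by (intro exI[of _ 0]) auto
next
  case (Suc n)
  show ?case
  proof (cases "Q (w p)")
    case False
    then have "exec (scan Q d d') ts 1 ts" unfolding scan_def using Suc.prems by (intro exec.Loop_end) auto
    moreover have "ts = ts[5 := (w, p), 7 := (g, pos (Suc n))]" using Suc.prems by (metis list_update_id)
    ultimately show ?thesis using False by (intro exI[of _ 0]) auto
  next
    case True
    let ?ts = "ts[5 := (w, p + offset d), 7 := (g, pos n)]"
    have "exec (shift d d') ts 3 ?ts"
      using shift[of ts w p g "pos (Suc n)" d d'] Suc.prems(1)[of n] Suc.prems(3-) by auto
    moreover obtain j where j: "j \<le> n" "exec (scan Q d d') ?ts (4 * j + 1)
        (?ts[5 := (w, p + offset d + int j * offset d), 7 := (g, pos (n - j))])"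
      "\<forall>i<j. Q (w (p + offset d + int i * offset d))" "j = n \<or> \<not> Q (w (p + offset d + int j * offset d))"
      using Suc.IH[of ?ts "p + offset d"] Suc.prems by auto
    moreover have "map read_tape ts ! 7 = 1 \<and> Q (map read_tape ts ! 5)"
      using Suc.prems(1)[of n] Suc.prems(3-) True by simp
    ultimately have "exec (scan Q d d') ts (3 + (4 * j + 1) + 1)
       (?ts[5 := (w, p + offset d + int j * offset d), 7 := (g, pos (n - j))])"
      unfolding scan_def by (intro exec.Loop_step)
    moreover have "?ts[5 := (w, p + offset d + int j * offset d), 7 := (g, pos (n - j))] =
       ts[5 := (w, p + int (Suc j) * offset d), 7 := (g, pos (Suc n - Suc j))]"
      by (simp add: list_update_swap algebra_simps)
    moreover have "Q (w (p + int i * offset d))" if "i < Suc j" for i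
      using that j(3) True by (cases i) (auto simp: algebra_simps)
    ultimately show ?thesis using j by (intro exI[of _ "Suc j"]) (auto simp: algebra_simps)
  qed
qed

text \<open>The head on tape 5 is at most \<open>T\<close> cells away from cell 0, and the marks on
  tape 7 can measure \<open>T\<close> cells at a time. Both heads move left by \<open>T\<close>,
  which brings the head on tape 5 to cell 0 or before it. Two passes over the marks then allow up to
  \<open>2 * T\<close> steps to the right in search of a nonblank cell. Letters are nonzero on the
  tape, so the first such cell is the beginning of the word; for the empty word the search ends with
  the marks.\<close>

definition rewind :: cmd where
  "rewind = Seq (shift MStay MLeft) (Seq (scan (\<lambda>s. True) MLeft MLeft) (Seq (shift MStay MRight)
     (Seq (scan (\<lambda>s. s = 0) MRight MRight) (Seq (shift MStay MLeft) (scan (\<lambda>s. s = 0) MRight MLeft)))))"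

lemma stack_tape_found:
  assumes "\<And>i. p1 \<le> i ==> i < p3 ==> tape_of_word y i = 0" "p1 \<le> 0" "tape_of_word y p3 \<noteq> 0 \<or> p3 \<ge> 0"
  shows "stack_tape y (tape_of_word y, p3)"
proof (cases "y = []")
  case True
  then show ?thesis by (simp add: stack_tape_def tape_of_word_def fun_eq_iff)
next
  case False
  then have "tape_of_word y 0 \<noteq> 0" by (simp add: tape_of_word_def)
  then have "p3 \<le> 0" using assms(1)[of 0] assms(2) by linarith
  moreover have "p3 \<ge> 0" using assms(3) by (auto simp: tape_of_word_def split: if_splits)
  ultimately show ?thesis by (simp add: stack_tape_def)
qed

lemma rewind:
  assumes w: "w = tape_of_word y" and p: "\<bar>p\<bar> \<le> int T"
    and ts: "ts ! 5 = (w, p)" "ts ! 7 = (marks T, int T)" "7 < length ts"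
  shows "\<exists>t ts'. t \<le> 12 * T + 20 \<and> exec rewind ts t ts' \<and> length ts' = length ts \<and>
     (\<forall>i. i \<noteq> 5 \<and> i \<noteq> 7 \<longrightarrow> ts' ! i = ts ! i) \<and> stack_tape y (ts' ! 5)"
proof -
  let ?g = "marks T"
  let ?s = "\<lambda>p c. ts[5 := (w, p), 7 := (?g, c)]"
  have s: "?s p c ! 5 = (w, p)" "?s p c ! 7 = (?g, c)" "7 < length (?s p c)"
    "(?s p c)[5 := (w, p'), 7 := (?g, c')] = ?s p' c'" for p c p' c'
    using ts(3) by (simp_all add: list_update_swap)
  have "ts = ?s p (int T)" using ts by (metis list_update_id)
  then have 1: "exec (shift MStay MLeft) ts 3 (?s p (int T - 1))"
    using shift[OF ts, of MStay MLeft] by simp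
  have 2: "exec (scan (\<lambda>s. True) MLeft MLeft) (?s p (int T - 1)) (4 * T + 1) (?s (p - int T) (- 1))"
    using scan[of T ?g "\<lambda>m. int m - 1" MLeft "?s p (int T - 1)" w p "\<lambda>s. True" MLeft] s
    by (auto simp: marks_def)
  have 3: "exec (shift MStay MRight) (?s (p - int T) (- 1)) 3 (?s (p - int T) 0)"
    using shift[of "?s (p - int T) (- 1)" w "p - int T" ?g "- 1" MStay MRight] s by simp
  have "\<exists>j\<le>T. exec (scan (\<lambda>s. s = 0) MRight MRight) (?s (p - int T) 0) (4 * j + 1)
      ((?s (p - int T) 0)[5 := (w, p - int T + int j * offset MRight), 7 := (?g, int T - int (T - j))]) \<and>
      (\<forall>i<j. w (p - int T + int i * offset MRight) = 0) \<and> (j = T \<or> w (p - int T + int j * offset MRight) \<noteq> 0)"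
    by (rule scan) (use s in \<open>auto simp: marks_def of_nat_diff\<close>)
  then obtain j where j: "j \<le> T" "exec (scan (\<lambda>s. s = 0) MRight MRight) (?s (p - int T) 0) (4 * j + 1) (?s (p - int T + int j) (int j))"
    "\<forall>i<j. w (p - int T + int i) = 0" "j = T \<or> w (p - int T + int j) \<noteq> 0"
    unfolding s(4) by (elim exE conjE) (simp add: of_nat_diff)
  let ?p = "p - int T + int j"
  have 5: "exec (shift MStay MLeft) (?s ?p (int j)) 3 (?s ?p (int j - 1))"
    using shift[of "?s ?p (int j)" w ?p ?g "int j" MStay MLeft] s by simp
  have "\<exists>j'\<le>j. exec (scan (\<lambda>s. s = 0) MRight MLeft) (?s ?p (int j - 1)) (4 * j' + 1)
      ((?s ?p (int j - 1))[5 := (w, ?p + int j' * offset MRight), 7 := (?g, int (j - j') - 1)]) \<and>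
      (\<forall>i<j'. w (?p + int i * offset MRight) = 0) \<and> (j' = j \<or> w (?p + int j' * offset MRight) \<noteq> 0)"
    by (rule scan) (use s j(1) in \<open>auto simp: marks_def of_nat_diff\<close>)
  then obtain j' where j': "j' \<le> j" "exec (scan (\<lambda>s. s = 0) MRight MLeft) (?s ?p (int j - 1)) (4 * j' + 1)
      (?s (?p + int j') (int (j - j') - 1))"
    "\<forall>i<j'. w (?p + int i) = 0" "j' = j \<or> w (?p + int j') \<noteq> 0"
    unfolding s(4) by (elim exE conjE) simp
  let ?ts' = "?s (?p + int j') (int (j - j') - 1)"
  have "exec rewind ts (3 + (4 * T + 1 + (3 + (4 * j + 1 + (3 + (4 * j' + 1) + 1) + 1) + 1) + 1) + 1) ?ts'"
    unfolding rewind_def by (intro exec.Seq[OF 1] exec.Seq[OF 2] exec.Seq[OF 3] exec.Seq[OF j(2)] exec.Seq[OF 5] j'(2))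
  moreover have "stack_tape y (w, ?p + int j')"
    unfolding w
  proof (rule stack_tape_found[of "p - int T"])
    fix i assume i: "p - int T \<le> i" "i < ?p + int j'"
    show "tape_of_word y i = 0"
    proof (cases "i < ?p")
      case True
      then have "i = p - int T + int (nat (i - (p - int T)))" "nat (i - (p - int T)) < j" using i by auto
      then show ?thesis using j(3) w by metis
    next
      case False
      then have "i = ?p + int (nat (i - ?p))" "nat (i - ?p) < j'" using i by auto
      then show ?thesis using j'(3) w by metis
    qed
  next
    show "tape_of_word y (?p + int j') \<noteq> 0 \<or> 0 \<le> ?p + int j'"
    proof (cases "j = T")
      case True
      then show ?thesis using j'(4) w p by auto
    next
      case False
      then have "w ?p \<noteq> 0" using j(4) by simp
      then have "j' = 0" using j'(3) by (metis add.right_neutral neq0_conv of_nat_0)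
      then show ?thesis using \<open>w ?p \<noteq> 0\<close> w by simp
    qed
  qed (use p in auto)
  ultimately show ?thesis using ts(3) j(1) j'(1)
    by (intro exI[of _ "3 + (4 * T + 1 + (3 + (4 * j + 1 + (3 + (4 * j' + 1) + 1) + 1) + 1) + 1) + 1"] exI[of _ ?ts']) auto
qed

lemma wf_act_at:
  assumes "\<And>ss. length ss = n ==> set ss \<subseteq> {..<S} ==> fst (f ss) < S"
  shows "wf_cmd n S (act_at r f)"
proof -
  have "fst ` set ((stay ss)[r := f ss]) \<subseteq> insert (fst (f ss)) (set ss)" for ss
    using set_update_subset_insert[of "stay ss" r "f ss"] fst_stay[of ss] by (metis image_insert image_mono)
  then show ?thesis using assms unfolding act_at_def wf_cmd.simps by fastforce
qed

text \<open>Over the enlarged alphabet there are lists of symbols on which nothing is known about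
  \<open>trans M\<close>. There the guard in \<open>sim_act\<close> makes the machine stay.\<close>

lemma wf_sim_act:
  assumes M: "wf_tm M" and S: "symbols M \<le> S" "states M < S" "1 < S"
  shows "wf_cmd (tapes M + 6) S (sim_act M)"
  unfolding sim_act_def wf_cmd.simps
proof (intro allI impI, unfold Let_def)
  fix ss assume ss: "length ss = tapes M + 6 \<and> set ss \<subseteq> {..<S}"
  let ?r = "ss ! 0 # ss ! 5 # drop 8 ss"
  let ?c = "ss ! 6 < states M \<and> set ?r \<subseteq> {..<symbols M} \<and> length ss = tapes M + 6"
  let ?res = "if ?c then (case trans M (ss ! 6) ?r of (q', as) =>
       [as ! 0] @ stay (take 4 (drop 1 ss)) @ [as ! 1, (q', MStay), (1, MRight)] @ drop 2 as) else stay ss"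
  show "length ?res = tapes M + 6 \<and> fst ` set ?res \<subseteq> {..<S}"
  proof (cases ?c)
    case True
    obtain q' as where as: "trans M (ss ! 6) ?r = (q', as)" by (rule prod.exhaust)
    have two: "2 \<le> tapes M" using M by (simp add: wf_tm_def)
    then have "length ?r = tapes M" using ss by simp
    then have *: "q' \<le> states M \<and> length as = tapes M \<and> fst ` set as \<subseteq> {..<symbols M}"
      using wf_tmD[OF M _ _ _ as] True by simp
    then have mem: "fst a < S" if "a \<in> set as" for a using that S by force
    have "fst (as ! 0) < S" "fst (as ! 1) < S" using * two by (auto intro!: mem)
    moreover have "fst ` set (drop 2 as) \<subseteq> {..<S}" using mem set_drop_subset by fastforce
    moreover have "set (take 4 (drop 1 ss)) \<subseteq> {..<S}" using ss by (meson set_drop_subset set_take_subset subset_trans)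
    ultimately show ?thesis using True as * two ss S by (simp add: image_Un)
  qed (use ss in auto)
qed

text \<open>The time is polynomial in the time \<open>T\<close> of the given run and not in the
  length of the input. This is the form that suits fpt-reductions, whose running time is not
  polynomial in the input.\<close>

lemma compose_machine:
  fixes F :: "nat list => nat list"
  assumes M: "tm_for \<Sigma> M" and F: "ptime F" and \<Gamma>: "finite \<Gamma>" "finite \<Gamma>'" "F ` lists \<Gamma> \<subseteq> lists \<Gamma>'"
  shows "\<exists>M' k. tm_for \<Sigma> M' \<and> (\<forall>x\<in>lists \<Sigma>. \<forall>y\<in>lists \<Gamma>. \<forall>T. tm_outputs_within M x y T \<longrightarrow>
     tm_outputs_within M' x (F y) ((T + 2) ^ k))"
proof -
  \<comment> \<open>Outside \<open>lists \<Gamma>\<close> nothing is known about the letters of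
    \<open>F y\<close>. Replacing these values by the empty word bounds all letters, as the output
    routine demands.\<close>
  define F' where "F' y = (if list_all (\<lambda>a. list_ex (\<lambda>b. a = b) (sorted_list_of_set \<Gamma>)) y then F y else [])" for y
  have F'_ptime: "ptime F'" unfolding F'_def by (intro ptime F)
  have F': "F' y = F y" if "y \<in> lists \<Gamma>" for y
    using that \<Gamma>(1) by (auto simp: F'_def list_all_iff list_ex_iff)
  have F'_out: "F' y \<in> lists \<Gamma>'" for y
  proof (cases "y \<in> lists \<Gamma>")
    case True
    then show ?thesis using F' \<Gamma>(3) by auto
  next
    case False
    then have "F' y = []" using \<Gamma>(1) by (auto simp: F'_def list_all_iff list_ex_iff)
    then show ?thesis by simp
  qed
  obtain K where "\<forall>a\<in>\<Gamma> \<union> \<Gamma>'. a < K" using \<Gamma>(1,2) finite_nat_set_iff_bounded[of "\<Gamma> \<union> \<Gamma>'"] by auto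
  then have K: "y \<in> lists \<Gamma> ==> y \<in> lists {..<K}" "F' y \<in> lists {..K}" for y
    using F'_out[of y] by (auto simp: less_imp_le)
  obtain c k S0 where c: "sc_ok {2, 3, 4, 5} S0 c"
    and c_runs: "\<And>y. y \<in> lists {..<K} ==> \<exists>\<sigma>'. runs c ((\<lambda>_. [])(5 := y)) ((length y + 2) ^ k) \<sigma>' \<and> \<sigma>' 1 = F' y"
    using stack_program[OF F'_ptime, of K] K by blast
  have wf: "wf_tm M" and two: "2 \<le> tapes M" and one: "1 \<le> symbols M" using M by (auto simp: tm_for_def wf_tm_def)
  define S where "S = symbols M + states M + S0 + 2"
  define prog where "prog = Seq (sim_loop M) (Seq rewind (cmd_of c))"
  have "wf_cmd (tapes M + 6) S prog"
  proof -
    have "wf_cmd (tapes M + 6) S (sim_loop M)"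
      unfolding sim_loop_def using wf_sim_act[OF wf, of S] by (simp add: S_def)
    moreover have "wf_cmd (tapes M + 6) S (cmd_of c)"
      by (rule wf_cmd_of[OF sc_ok_mono[OF c, of "{2, 3, 4, 5}" S]]) (use two in \<open>auto simp: S_def\<close>)
    moreover have "wf_cmd (tapes M + 6) S (act_at i (\<lambda>ss. (ss ! j, d)))" if "j < tapes M + 6" for i j d
    proof (rule wf_act_at)
      fix ss :: "nat list" assume ss: "length ss = tapes M + 6" "set ss \<subseteq> {..<S}"
      then have "ss ! j \<in> set ss" using that by simp
      then show "fst (ss ! j, d) < S" using ss(2) by auto
    qed
    ultimately show ?thesis using two by (simp add: prog_def rewind_def scan_def shift_def)
  qed
  then obtain M' where M': "wf_tm M'" "tapes M' = tapes M + 6" "symbols M' = S"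
    "\<And>ts t ts'. exec prog ts t ts' ==> (tm_step M' ^^ t) (0, ts) = (states M', ts')"
    using compile_cmd[of "tapes M + 6" S prog] by (auto simp: S_def)
  have "tm_for \<Sigma> M'" using M M' by (auto simp: tm_for_def S_def)
  moreover
  have "pbound (\<lambda>T. 2 * T + (12 * T + 20) + (T + 2) ^ k + 3) (\<lambda>T. T)"
    by (intro pbound_intros)
  then obtain k' where k': "2 * T + (12 * T + 20) + (T + 2) ^ k + 3 \<le> (T + 2) ^ k'" for T :: nat
    unfolding pbound_def by blast
  have "tm_outputs_within M' x (F y) ((T + 2) ^ k')"
    if x: "x \<in> lists \<Sigma>" and y: "y \<in> lists \<Gamma>" and out: "tm_outputs_within M x y T" for x y T
  proof -
    define b :: tape where "b = (\<lambda>_. 0, 0)"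
    define us where "us = (tape_of_word x, 0) # replicate (tapes M - 1) b"
    obtain n where n: "tapes M = Suc (Suc n)" using two by (metis Suc_le_D numeral_2_eq_2 Suc_le_mono)
    obtain us' where run: "(tm_step M ^^ T) (0, us) = (states M, us')" "fst (us' ! 1) = tape_of_word y"
      using out by (auto simp: tm_outputs_within_def tm_init_def us_def b_def split: prod.splits)
    define ts where "ts = (tape_of_word x, 0) # replicate (tapes M' - 1) b"
    \<comment> \<open>The blank is the symbol 0. On tape 6 it represents the initial state and on
      tape 7 the count 0, so the simulation can start on blank tapes.\<close>
    have init: "sim_tapes 0 us 0 (replicate 4 b) ts"
      unfolding sim_tapes_def
      by (intro exI[of _ "\<lambda>_. 0"]) (auto simp: us_def ts_def M'(2) n b_def marks_def fun_eq_iff numeral_eq_Suc)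
    have sym: "tape_symbols (symbols M) us"
    proof -
      have "tape_of_word x i < symbols M" for i
      proof (cases "0 \<le> i \<and> nat i < length x")
        case True
        then have "x ! nat i \<in> \<Sigma>" using x nth_mem by auto
        then show ?thesis using M True by (auto simp: tape_of_word_def tm_for_def)
      next
        case False
        then show ?thesis using one by (auto simp: tape_of_word_def)
      qed
      then show ?thesis using one by (auto simp: tape_symbols_def us_def b_def)
    qed
    have len: "length us = tapes M" by (simp add: us_def n)
    obtain ts1 T' where ts1: "T' \<le> 0 + T" "exec (sim_loop M) ts (2 * (T' - 0) + 1) ts1"
      "sim_tapes (states M) us' T' (replicate 4 b) ts1" "\<bar>snd (us' ! 1)\<bar> \<le> int T'"
      "\<forall>i \<ge> int T'. fst (us' ! 1) i = 0"
      using sim_loop[OF wf sym len _ run(1) init] by (auto simp: us_def n b_def)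
    obtain f where f: "ts1 = [us' ! 0] @ replicate 4 b @ [us' ! 1, (f, 0), (marks T', int T')] @ drop 2 us'"
      using ts1(3) by (auto simp: sim_tapes_def)
    have rd: "ts1 ! 5 = (tape_of_word y, snd (us' ! 1))" "ts1 ! 7 = (marks T', int T')" "7 < length ts1"
      "ts1 ! 1 = b" "ts1 ! 2 = b" "ts1 ! 3 = b" "ts1 ! 4 = b"
      using run(2) by (auto simp: f numeral_eq_Suc prod_eq_iff)
    obtain t ts2 where ts2: "t \<le> 12 * T' + 20" "exec rewind ts1 t ts2" "length ts2 = length ts1"
     "\<forall>i. i \<noteq> 5 \<and> i \<noteq> 7 \<longrightarrow> ts2 ! i = ts1 ! i" "stack_tape y (ts2 ! 5)"
      using rewind[OF refl ts1(4) rd(1-3)] by blast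
    have "stacks {2, 3, 4, 5} ((\<lambda>_. [])(5 := y)) ts2"
      using ts2 rd unfolding stacks_def by (auto simp: b_def stack_tape_def tape_of_word_def)
    moreover obtain \<sigma>' t' where \<sigma>': "t' \<le> (length y + 2) ^ k" "sexec c ((\<lambda>_. [])(5 := y)) t' \<sigma>'" "\<sigma>' 1 = F' y"
      using c_runs[OF K(1)[OF y]] by (auto simp: runs_def)
    ultimately obtain ts3 where ts3: "exec (cmd_of c) ts2 t' ts3" "stacks {2, 3, 4, 5} \<sigma>' ts3"
      using sexec_exec[OF \<sigma>'(2) c] by blast
    let ?t = "2 * (T' - 0) + 1 + (t + t' + 1) + 1"
    have "exec prog ts ?t ts3"
      unfolding prog_def by (intro exec.Seq[OF ts1(2)] exec.Seq[OF ts2(2)] ts3(1))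
    then have "(tm_step M' ^^ ?t) (0, ts) = (states M', ts3)" by (rule M'(4))
    moreover have "tm_init M' x = (0, ts)" by (simp add: tm_init_def ts_def b_def)
    moreover have "ts3 ! 1 = (tape_of_word (F y), int (length (F y)))"
      using ts3(2) \<sigma>'(3) F'[OF y] by (simp add: stacks_def)
    ultimately have "tm_outputs_within M' x (F y) ?t"
      unfolding tm_outputs_within_def by (simp only: prod.case fst_conv simp_thms)
    moreover have "?t \<le> (T + 2) ^ k'"
    proof -
      \<comment> \<open>The word \<open>y\<close> has been written in \<open>T'\<close> steps, so
        the time of the second program is bounded in terms of \<open>T\<close>.\<close>
      have "length y \<le> T'"
      proof (rule ccontr)
        assume "\<not> length y \<le> T'"
        then have "tape_of_word y (int T') \<noteq> 0" by (simp add: tape_of_word_def)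
        then show False using ts1(5) run(2) by auto
      qed
      then have "(length y + 2) ^ k \<le> (T + 2) ^ k" using ts1(1) by (intro power_mono) auto
      then show ?thesis using ts1(1) ts2(1) \<sigma>'(1) k'[of T] by linarith
    qed
    ultimately show ?thesis by (rule tm_outputs_within_mono)
  qed
  ultimately show ?thesis by blast
qed

text \<open>A machine for the identity. Composition with it turns \<open>compose_machine\<close>
  into a statement on functions of the input itself.\<close>

definition copy_tm :: "nat => tm" where
  "copy_tm S = \<lparr>tapes = 2, symbols = S, states = 1,
     trans = (\<lambda>q ss. if ss ! 0 = 0 then (1, stay ss) else (0, [(ss ! 0, MRight), (ss ! 0, MRight)]))\<rparr>"

lemma copy_tm:
  assumes "finite \<Sigma>"
  shows "\<exists>S. tm_for \<Sigma> (copy_tm S) \<and> (\<forall>x\<in>lists \<Sigma>. tm_outputs_within (copy_tm S) x x (length x + 1))"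
proof -
  obtain K where K: "\<forall>a\<in>\<Sigma>. a < K" using assms finite_nat_set_iff_bounded by auto
  let ?M = "copy_tm (K + 2)"
  have "ss ! 0 < S" if "length ss = 2" "set ss \<subseteq> {..<S}" for ss :: "nat list" and S
    using that nth_mem[of 0 ss] by (simp add: subset_iff)
  then have "tm_for \<Sigma> ?M"
    using K unfolding tm_for_def wf_tm_def copy_tm_def by (auto split: if_splits)
  moreover have "tm_outputs_within ?M x x (length x + 1)" for x
  proof -
    let ?c = "\<lambda>n. (0, [(tape_of_word x, int n), (tape_of_word (take n x), int n)])"
    have step: "tm_step ?M (?c n) = ?c (Suc n)" if "n < length x" for n
    proof -
      have "(tape_of_word (take n x))(int n := Suc (x ! n)) = tape_of_word (take (Suc n) x)"
        using that by (auto simp: tape_of_word_def fun_eq_iff nth_append take_Suc_conv_app_nth)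
      then show ?thesis using that
        by (simp add: copy_tm_def tape_of_word_def[of x] fun_eq_iff)
    qed
    have "(tm_step ?M ^^ n) (?c 0) = ?c n" if "n \<le> length x" for n
      using that
    proof (induction n)
      case (Suc n)
      then show ?case using step[of n] by (simp only: funpow.simps comp_apply)
    qed simp
    then have "(tm_step ?M ^^ (length x + 1)) (?c 0) = tm_step ?M (?c (length x))" by simp
    also have "\<dots> = (1, [(tape_of_word x, int (length x)), (tape_of_word x, int (length x))])"
    proof -
      have "tape_of_word x (int (length x)) = 0" by (simp add: tape_of_word_def)
      then show ?thesis by (auto simp: copy_tm_def stay_def)
    qed
    finally have run: "(tm_step ?M ^^ (length x + 1)) (?c 0) =
       (1, [(tape_of_word x, int (length x)), (tape_of_word x, int (length x))])" .
    have "tm_init ?M x = ?c 0" by (simp add: tm_init_def copy_tm_def tape_of_word_def fun_eq_iff)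
    then show ?thesis unfolding tm_outputs_within_def using run by (simp add: copy_tm_def)
  qed
  ultimately show ?thesis by blast
qed

lemma ptime_computable_in_time:
  assumes "ptime F" "finite \<Sigma>" "finite \<Gamma>" "F ` lists \<Sigma> \<subseteq> lists \<Gamma>"
  shows "\<exists>M k. tm_for \<Sigma> M \<and> (\<forall>x\<in>lists \<Sigma>. tm_outputs_within M x (F x) ((length x + 3) ^ k))"
proof -
  obtain S where S: "tm_for \<Sigma> (copy_tm S)" "\<forall>x\<in>lists \<Sigma>. tm_outputs_within (copy_tm S) x x (length x + 1)"
    using copy_tm[OF assms(2)] by blast
  obtain M k where "tm_for \<Sigma> M" "\<forall>x\<in>lists \<Sigma>. \<forall>y\<in>lists \<Sigma>. \<forall>T. tm_outputs_within (copy_tm S) x y T \<longrightarrow>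
     tm_outputs_within M x (F y) ((T + 2) ^ k)"
    using compose_machine[OF S(1) assms] by blast
  then show ?thesis using S(2) by (intro exI[of _ M] exI[of _ k]) (auto simp: add.commute numeral_3_eq_3)
qed

section \<open>Time and parameter bounds of composed reductions\<close>

lemma poly_power_bound: "poly ([:3, 1:] ^ k :: nat poly) n = (n + 3) ^ k"
  by (simp add: poly_power add.commute)

lemma bits_in_lists: "bits n \<in> lists {0, 1}"
  using set_bits[of n] by auto

text \<open>Composition calls for computable bounds above the powers of a computable
  \<open>g\<close>. Powers of 2 are convenient because the bits of \<open>2 ^ e\<close> are
  \<open>e\<close> zeros followed by a one: with \<open>e\<close> linear in the length of the bits
  of \<open>g n\<close>, this word arises from that of \<open>g n\<close> by a simple operation on
  lists.\<close>

lemma computable_exp_bits: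
  assumes "computable g"
  shows "computable (\<lambda>n. 2 ^ (d * (length (bits (g n)) + 1)))"
proof -
  let ?F = "\<lambda>w :: nat list. replicate (d * (length w + 1)) 0 @ [1 :: nat]"
  have F: "ptime ?F" by (intro ptime)
  have bits_exp: "bits (2 ^ e) = replicate e 0 @ [1]" for e
  proof (induction e)
    case 0
    then show ?case by (simp add: bits.simps)
  next
    case (Suc e)
    then show ?case using bits_double[of 0 "2 ^ e"] by simp
  qed
  obtain M where M: "tm_for {0, 1} M" "\<And>n. \<exists>T. tm_outputs_within M (bits n) (bits (g n)) T"
    using assms by (auto simp: computable_def)
  have "?F ` lists {0, 1} \<subseteq> lists {0, 1}" by auto
  then obtain M' k where M': "tm_for {0, 1} M'" "\<forall>x\<in>lists {0, 1}. \<forall>y\<in>lists {0, 1}. \<forall>T. tm_outputs_within M x y T \<longrightarrow>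
     tm_outputs_within M' x (?F y) ((T + 2) ^ k)"
    using compose_machine[OF M(1) F, of "{0, 1}" "{0, 1}"] by auto
  have "\<exists>T. tm_outputs_within M' (bits n) (bits (2 ^ (d * (length (bits (g n)) + 1)))) T" for n
    using M(2)[of n] M'(2) bits_in_lists unfolding bits_exp by blast
  then show ?thesis unfolding computable_def using M'(1) by blast
qed

lemma computable_id: "computable (\<lambda>n. n)"
proof -
  obtain S where "tm_for {0, 1} (copy_tm S)" "\<forall>x\<in>lists {0, 1}. tm_outputs_within (copy_tm S) x x (length x + 1)"
    using copy_tm[of "{0, 1}"] by auto
  then show ?thesis unfolding computable_def using bits_in_lists by blast
qed

lemma power_le_exp_bits: "(g + 2) ^ d \<le> 2 ^ (d * (length (bits g) + 1))"
proof -
  have "g + 2 \<le> 2 * 2 ^ length (bits g)" using less_exp_bits[of g] by linarith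
  then have "(g + 2) ^ d \<le> (2 * 2 ^ length (bits g)) ^ d" by (rule power_mono) simp
  also have "\<dots> = 2 ^ (d * (length (bits g) + 1))" by (simp only: power_mult mult.commute[of d] Suc_eq_plus1[symmetric] power_Suc)
  finally show ?thesis .
qed

lemma fpt_reducible_compose:
  assumes P: "fpt_reducible P Q" and F: "ptime F" and fin: "finite (alphabet Q)" "finite (alphabet R)"
    and out: "F ` lists (alphabet Q) \<subseteq> lists (alphabet R)"
    and iff: "\<And>w. w \<in> lists (alphabet Q) ==> w \<in> yes_instances Q \<longleftrightarrow> F w \<in> yes_instances R"
    and par: "\<And>w. w \<in> lists (alphabet Q) ==> parameter R (F w) \<le> (parameter Q w + 2) ^ d"
  shows "fpt_reducible P R"
proof -
  obtain f where red: "fpt_reduction P Q f" using P unfolding fpt_reducible_def by (elim exE)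
  note red' = red[unfolded fpt_reduction_def]
  have f1: "f ` lists (alphabet P) \<subseteq> lists (alphabet Q)"
    and f2: "\<forall>x\<in>lists (alphabet P). x \<in> yes_instances P \<longleftrightarrow> f x \<in> yes_instances Q"
    by (rule conjunct1[OF red'], rule conjunct1[OF conjunct2[OF red']])
  obtain g p where f3: "computable g"
    and f4: "computable_in_time (alphabet P) f (\<lambda>x. g (parameter P x) * poly (p :: nat poly) (length x))"
    using conjunct1[OF conjunct2[OF conjunct2[OF red']]] by (elim conjE exE)
  obtain h where f5: "computable h" and f6: "\<forall>x\<in>lists (alphabet P). parameter Q (f x) \<le> h (parameter P x)"
    using conjunct2[OF conjunct2[OF conjunct2[OF red']]] by (elim conjE exE)
  obtain M where M: "tm_for (alphabet P) M"
    "\<forall>x\<in>lists (alphabet P). tm_outputs_within M x (f x) (g (parameter P x) * poly p (length x))"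
    using f4 unfolding computable_in_time_def by blast
  obtain M' k where M': "tm_for (alphabet P) M'"
    "\<forall>x\<in>lists (alphabet P). \<forall>y\<in>lists (alphabet Q). \<forall>T. tm_outputs_within M x y T \<longrightarrow>
     tm_outputs_within M' x (F y) ((T + 2) ^ k)"
    using compose_machine[OF M(1) F fin out] by blast
  define g' :: "nat => nat" where "g' n = 2 ^ (k * (length (bits (g n)) + 1))" for n
  define h' :: "nat => nat" where "h' n = 2 ^ (d * (length (bits (h n)) + 1))" for n
  have time: "tm_outputs_within M' x (F (f x)) (g' (parameter P x) * poly ((p + [:2:]) ^ k) (length x))"
    if x: "x \<in> lists (alphabet P)" for x
  proof -
    let ?g = "g (parameter P x)" and ?p = "poly p (length x)"
    \<comment> \<open>This splits the power of the old time bound into a factor that depends on the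
      parameter alone and one that depends on the length alone.\<close>
    have "?g * ?p + 2 \<le> (?g + 2) * (?p + 2)" by (simp add: algebra_simps)
    then have "(?g * ?p + 2) ^ k \<le> ((?g + 2) * (?p + 2)) ^ k" by (rule power_mono) simp
    also have "\<dots> = (?g + 2) ^ k * poly ((p + [:2:]) ^ k) (length x)"
      unfolding power_mult_distrib by (simp add: poly_power add.commute)
    also have "\<dots> \<le> g' (parameter P x) * poly ((p + [:2:]) ^ k) (length x)"
      unfolding g'_def using power_le_exp_bits by (rule mult_right_mono) simp
    finally have le: "(?g * ?p + 2) ^ k \<le> g' (parameter P x) * poly ((p + [:2:]) ^ k) (length x)" .
    have "tm_outputs_within M' x (F (f x)) ((?g * ?p + 2) ^ k)"
      using M'(2) M(2) x f1 by blast
    then show ?thesis using le by (rule tm_outputs_within_mono)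
  qed
  have par': "parameter R (F (f x)) \<le> h' (parameter P x)" if x: "x \<in> lists (alphabet P)" for x
  proof -
    have "parameter R (F (f x)) \<le> (parameter Q (f x) + 2) ^ d" using par f1 x by blast
    also have "\<dots> \<le> (h (parameter P x) + 2) ^ d" using bspec[OF f6 x] by (intro power_mono) auto
    also have "\<dots> \<le> h' (parameter P x)" unfolding h'_def by (rule power_le_exp_bits)
    finally show ?thesis .
  qed
  have "fpt_reduction P R (\<lambda>x. F (f x))"
    unfolding fpt_reduction_def
  proof (intro conjI)
    show "(\<lambda>x. F (f x)) ` lists (alphabet P) \<subseteq> lists (alphabet R)" using f1 out by blast
    show "\<forall>x\<in>lists (alphabet P). x \<in> yes_instances P \<longleftrightarrow> F (f x) \<in> yes_instances R"
      using f1 f2 iff by blast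
    have "computable g'" unfolding g'_def by (rule computable_exp_bits[OF f3])
    moreover have "computable_in_time (alphabet P) (\<lambda>x. F (f x))
        (\<lambda>x. g' (parameter P x) * poly ((p + [:2:]) ^ k) (length x))"
      unfolding computable_in_time_def using M'(1) time by blast
    ultimately show "\<exists>g (p :: nat poly). computable g \<and>
        computable_in_time (alphabet P) (\<lambda>x. F (f x)) (\<lambda>x. g (parameter P x) * poly p (length x))" by blast
    have "computable h'" unfolding h'_def by (rule computable_exp_bits[OF f5])
    then show "\<exists>h. computable h \<and> (\<forall>x\<in>lists (alphabet P). parameter R (F (f x)) \<le> h (parameter P x))"
      using par' by blast
  qed
  then show ?thesis unfolding fpt_reducible_def by blast
qed

text \<open>Composition with the identity, regarded as an fpt-reduction from \<open>P\<close> to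
  itself. Its parameter factor is only required to be computable and at least 1.\<close>

lemma fpt_reducible_ptime:
  assumes F: "ptime F" and fin: "finite (alphabet P)" "finite (alphabet R)"
    and out: "F ` lists (alphabet P) \<subseteq> lists (alphabet R)"
    and iff: "\<And>w. w \<in> lists (alphabet P) ==> w \<in> yes_instances P \<longleftrightarrow> F w \<in> yes_instances R"
    and par: "\<And>w. w \<in> lists (alphabet P) ==> parameter R (F w) \<le> (parameter P w + 2) ^ d"
  shows "fpt_reducible P R"
proof (rule fpt_reducible_compose[OF _ assms])
  obtain S where S: "tm_for (alphabet P) (copy_tm S)"
    "\<forall>x\<in>lists (alphabet P). tm_outputs_within (copy_tm S) x x (length x + 1)"
    using copy_tm[OF fin(1)] by blast
  have one: "1 \<le> (2::nat) ^ (1 * (length (bits n) + 1))" for n by (rule one_le_power) simp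
  have le: "length x + 1 \<le> 2 ^ (1 * (length (bits (parameter P x)) + 1)) * poly [:1, 1:] (length x)" for x
    using mult_right_mono[OF one, of "length x + 1" "parameter P x"] by simp
  have "tm_outputs_within (copy_tm S) x x (2 ^ (1 * (length (bits (parameter P x)) + 1)) * poly [:1, 1:] (length x))"
    if "x \<in> lists (alphabet P)" for x
    using S(2) that tm_outputs_within_mono[OF _ le] by blast
  then have "computable_in_time (alphabet P) (\<lambda>x. x)
     (\<lambda>x. 2 ^ (1 * (length (bits (parameter P x)) + 1)) * poly [:1, 1:] (length x))"
    unfolding computable_in_time_def using S(1) by blast
  then have "\<exists>g (p :: nat poly). computable g \<and>
        computable_in_time (alphabet P) (\<lambda>x. x) (\<lambda>x. g (parameter P x) * poly p (length x))"
    using computable_exp_bits[OF computable_id, of 1]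
    by (intro exI[of _ "\<lambda>n. 2 ^ (1 * (length (bits n) + 1))"] exI[of _ "[:1, 1:]"] conjI)
  moreover have "\<exists>h. computable h \<and> (\<forall>x\<in>lists (alphabet P). parameter P x \<le> h (parameter P x))"
    using computable_id by blast
  ultimately have "fpt_reduction P P (\<lambda>x. x)"
    unfolding fpt_reduction_def by (intro conjI) simp_all
  then show "fpt_reducible P P" unfolding fpt_reducible_def by blast
qed

text \<open>
  Words are parsed from right to left. The state is the stack of the lists of trees that have been
  read since the closing brackets that are still open; the empty stack signals failure.
\<close>

definition parse_step :: "nat => tree list list => tree list list" where
  "parse_step a s = (case s of [] => [] | ts # st =>
     if a = 2 then (Num 0 # ts) # st
     else if a = 4 then [] # ts # st
     else if a = 3 then (case st of [] => [] | us # st' => (Node ts # us) # st')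
     else if a \<le> 1 then (case ts of [] => [] | t # ts' =>
       if is_num t \<and> \<not> (a = 0 \<and> num_bits t = []) then (Num (val (a # num_bits t)) # ts') # st else [])
     else [])"

lemma parse_step_simps [simp]:
  "parse_step a [] = []"
  "parse_step 2 (ts # st) = (Num 0 # ts) # st"
  "parse_step 4 (ts # st) = [] # ts # st"
  "parse_step 3 (ts # us # st) = (Node ts # us) # st"
  by (simp_all add: parse_step_def)

text \<open>Recovers from a state of the parser the suffix that has been read. As long as no failure
  occurs, this gives the correctness of the parser and bounds the size of its state.\<close>

fun unparse :: "tree list list => nat list" where
  "unparse [] = []"
| "unparse [ts] = concat (map enc ts)"
| "unparse (ts # st) = concat (map enc ts) @ 4 # unparse st"

lemma unparse_prepend:
  assumes "enc t' = a # enc t"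
  shows "unparse ((t' # ts) # st) = a # unparse ((t # ts) # st)"
  using assms by (cases st) auto

lemma is_numE: "is_num t ==> (\<And>n. t = Num n ==> P) ==> P"
  by (cases t) auto

text \<open>A bit \<open>a\<close> in front of the number \<open>n\<close> produces
  \<open>a + 2 * n\<close>, because the least significant bit comes first. A 0 directly before the
  terminator is rejected, since it would be a leading zero.\<close>

lemma unparse_parse_step:
  assumes "parse_step a st \<noteq> []"
  shows "unparse (parse_step a st) = a # unparse st"
proof -
  obtain ts st' where st: "st = ts # st'" using assms by (cases st) (auto simp: parse_step_def)
  consider "a = 2" | "a = 4" | "a = 3" | "a \<le> 1" using assms st by (auto simp: parse_step_def split: if_splits)
  then show ?thesis
  proof cases
    case 1
    then show ?thesis by (cases st') (auto simp: parse_step_def st)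
  next
    case 2
    then show ?thesis by (auto simp: parse_step_def st)
  next
    case 3
    then obtain us st'' where st': "st' = us # st''" using assms st by (cases st') (auto simp: parse_step_def)
    then show ?thesis using 3 by (cases st'') (auto simp: parse_step_def st)
  next
    case 4
    then obtain t ts' where ts: "ts = t # ts'" using assms st by (cases ts) (auto simp: parse_step_def)
    have t: "is_num t" "\<not> (a = 0 \<and> num_bits t = [])"
      using assms 4 by (auto simp: parse_step_def st ts split: if_splits)
    then obtain n where n: "t = Num n" by (auto elim: is_numE)
    have "val (a # bits n) = a + 2 * n" using 4 by (auto simp: bit_of_def)
    then have "enc (Num (val (a # num_bits t))) = a # enc t"
      using t 4 bits_double[of a n] by (auto simp: n)
    then show ?thesis using 4 t unparse_prepend by (auto simp: parse_step_def st ts)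
  qed
qed

lemma unparse_parse: "foldr parse_step w [[]] \<noteq> [] ==> unparse (foldr parse_step w [[]]) = w"
proof (induction w)
  case (Cons a w)
  then have *: "foldr parse_step w [[]] \<noteq> []" by auto
  then have "unparse (parse_step a (foldr parse_step w [[]])) = a # unparse (foldr parse_step w [[]])"
    using Cons.prems by (intro unparse_parse_step) simp
  then show ?case using Cons.IH[OF *] by simp
qed simp

lemma parse_bits: "foldr parse_step (bits n) ((Num 0 # ts) # st) = (Num n # ts) # st"
proof (induction n rule: bits.induct)
  case (1 n)
  show ?case
  proof (cases "n = 0")
    case False
    then have b: "bits n = n mod 2 # bits (n div 2)" by (subst bits.simps) simp
    then have "\<not> (n mod 2 = 0 \<and> bits (n div 2) = [])" using False by auto
    moreover have "val (n mod 2 # bits (n div 2)) = n" using val_bits[of n] by (simp only: b)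
    ultimately have "parse_step (n mod 2) ((Num (n div 2) # ts) # st) = (Num n # ts) # st"
      by (auto simp: parse_step_def)
    then show ?thesis using 1 False by (simp add: b)
  qed simp
qed

lemma parse_enc: "foldr parse_step (enc t) (ts # st) = (t # ts) # st"
proof (induction t arbitrary: ts st)
  case (Num n)
  then show ?case using parse_bits[of n ts st] by simp
next
  case (Node us)
  have "foldr parse_step (concat (map enc vs)) (vs' # st) = (vs @ vs') # st"
    if "set vs \<subseteq> set us" for vs vs' st
    using that Node.IH by (induction vs arbitrary: vs') auto
  from this[of us "[]" "ts # st"] show ?case by simp
qed

definition parse :: "nat list => tree list" where
  "parse w = (case foldr parse_step w [[]] of [] => [] | ts # st => if st = [] \<and> length ts = 1 then ts else [])"

lemma parse_iff: "parse w = [t] \<longleftrightarrow> w = enc t"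
proof
  assume "parse w = [t]"
  then have "foldr parse_step w [[]] = [[t]]" by (auto simp: parse_def split: list.splits if_splits)
  then show "w = enc t" using unparse_parse[of w] by simp
next
  assume "w = enc t"
  then show "parse w = [t]" using parse_enc[of t "[]" "[]"] by (simp add: parse_def)
qed

lemma parse_cases: "parse w = [] \<or> (\<exists>t. parse w = [t] \<and> w = enc t)"
proof (cases "parse w")
  case (Cons t ts)
  then have "parse w = [t]" by (auto simp: parse_def split: list.splits if_splits)
  then show ?thesis using parse_iff by blast
qed simp

lemma sz_le_concat_enc: "sz ts \<le> 4 * length (concat (map enc ts)) + 1"
proof (induction ts)
  case (Cons t ts)
  then show ?case using sz_le_enc[of t] by simp
qed simp

lemma sz_unparse: "st \<noteq> [] ==> sz st \<le> 4 * length (unparse st) + 4"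
proof (induction st rule: unparse.induct)
  case (2 ts)
  then show ?case using sz_le_concat_enc[of ts] by simp
next
  case (3 ts us st)
  then show ?case using sz_le_concat_enc[of ts] by simp
qed simp

lemma ptime_parse [ptime]:
  assumes "ptime f" shows "ptime (\<lambda>x. parse (f x))"
proof -
  have "ptime (\<lambda>x. foldr parse_step (f x) [[]])"
  proof (rule ptime_foldr[where B = "\<lambda>x. 4 * sz (f x) + 4"])
    show "ptime (\<lambda>p. parse_step (snd (snd p)) (fst (snd p)))"
      unfolding parse_step_def by (intro ptime)
    fix x us vs assume f: "f x = us @ vs"
    show "sz (foldr parse_step vs [[]]) \<le> 4 * sz (f x) + 4"
    proof (cases "foldr parse_step vs [[]] = []")
      case False
      then have "sz (foldr parse_step vs [[]]) \<le> 4 * length vs + 4"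
        using sz_unparse[OF False] unparse_parse[OF False] by simp
      also have "\<dots> \<le> 4 * sz (f x) + 4" using length_le_sz[of "f x"] f by simp
      finally show ?thesis .
    qed (simp del: foldr.simps)
  qed (intro ptime assms)+
  then show ?thesis unfolding parse_def by (intro ptime)
qed

section \<open>Moduli that separate numbers\<close>


text \<open>The rule by which an entry of the harmonic triangle arises as a difference of two
  others. The binomial coefficients are replaced by reals that satisfy the two absorption
  identities.\<close>

lemma difference_of_reciprocals:
  fixes a b c :: real
  assumes "a > 0" "b > 0" "c > 0" "k > 0" "m > 0" "k * c = m' * a" "k * (b + c) = m * b"
  shows "N / (m' * a) - N / (m * b) = N / (m * c)"
proof -
  have "N / (m' * a) - N / (m * b) = N / (k * c) - N / (k * (b + c))" by (simp only: assms)
  also have "\<dots> = (N * b) / (c * (k * (b + c)))" using assms(1-4) by (simp add: divide_simps) algebra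
  also have "\<dots> = N / (m * c)" unfolding assms(7) using assms(1-5) by simp
  finally show ?thesis .
qed

text \<open>The reciprocals of \<open>n * ((n - 1) choose k)\<close> are the entries of Leibniz' harmonic triangle.\<close>

lemma harmonic_triangle:
  assumes "k < n" "\<And>i. 1 \<le> i ==> i \<le> n ==> i dvd N"
  shows "n * ((n - 1) choose k) dvd N"
proof -
  have "\<exists>z::int. real N / real (n * ((n - 1) choose k)) = of_int z"
    using assms
  proof (induction k arbitrary: n)
    case 0
    then have "n dvd N" by simp
    then obtain q where "N = n * q" by (elim dvdE)
    then show ?case using 0 by (intro exI[of _ "int q"]) simp
  next
    case (Suc k)
    define m where "m = n - 2"
    have n: "n = Suc (Suc m)" "k \<le> m" using Suc.prems(1) by (auto simp: m_def)
    obtain z1 :: int where z1: "real N / real (Suc m * (m choose k)) = of_int z1"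
      using Suc.IH[of "Suc m"] Suc.prems n by auto
    obtain z2 :: int where z2: "real N / real (n * (Suc m choose k)) = of_int z2"
      using Suc.IH[of n] Suc.prems n by auto
    let ?a = "real (m choose k)" and ?b = "real (Suc m choose k)" and ?c = "real (Suc m choose Suc k)"
    have pos: "?a > 0" "?b > 0" "?c > 0" using n(2) by (simp_all only: of_nat_0_less_iff zero_less_binomial_iff)
    have e1: "real (Suc k) * ?c = real (Suc m) * ?a"
      using Suc_times_binomial_eq[of m k] by (metis of_nat_mult mult.commute)
    have e2: "real (Suc k) * (?b + ?c) = real (Suc (Suc m)) * ?b"
      using Suc_times_binomial_eq[of "Suc m" k] by (metis of_nat_mult of_nat_add binomial_Suc_Suc mult.commute)
    have "real N / (real (Suc m) * ?a) - real N / (real (Suc (Suc m)) * ?b) = real N / (real (Suc (Suc m)) * ?c)"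
      using pos e1 e2 by (intro difference_of_reciprocals[where k = "real (Suc k)"]) auto
    then have "real N / real (n * (Suc m choose Suc k)) = of_int (z1 - z2)"
      using z1 z2 unfolding n(1) of_int_diff of_nat_mult by (simp only:)
    then show ?case using n by (intro exI[of _ "z1 - z2"]) simp
  qed
  then obtain z :: int where z: "real N / real (n * ((n - 1) choose k)) = of_int z" by blast
  have "n * ((n - 1) choose k) > 0" using assms(1) by simp
  then have "real N = real (n * ((n - 1) choose k)) * of_int z"
    using z by (simp add: field_simps)
  then have "int N = int (n * ((n - 1) choose k)) * z" by (metis of_int_eq_iff of_int_mult of_int_of_nat_eq)
  then show ?thesis by (metis dvd_triv_left int_dvd_int_iff)
qed

text \<open>The \<open>n\<close> numbers \<open>n * ((n - 1) choose k)\<close> all divide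
  \<open>N\<close>, and they add up to \<open>n * 2 ^ (n - 1)\<close>.\<close>

lemma common_multiple_ge:
  assumes "n \<ge> 1" "N > 0" "\<And>i. 1 \<le> i ==> i \<le> n ==> i dvd N"
  shows "2 ^ (n - 1) \<le> (N::nat)"
proof -
  have "n * 2 ^ (n - 1) = (\<Sum>k\<le>n - 1. n * ((n - 1) choose k))"
    by (simp add: choose_row_sum sum_distrib_left[symmetric])
  also have "\<dots> \<le> (\<Sum>k\<le>n - 1. N)"
    using assms by (intro sum_mono dvd_imp_le harmonic_triangle) auto
  also have "\<dots> = n * N" using assms(1) by simp
  finally show ?thesis using assms(1) by simp
qed

text \<open>The least common multiple of \<open>1, ..., n\<close> is the product over the primes
  \<open>p\<close> of the largest power of \<open>p\<close> up to \<open>n\<close>. Combined with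
  the lower bound for common multiples, the estimate bounds the number of primes from below.\<close>

lemma common_multiple_primes:
  assumes "n \<ge> 1"
  obtains N :: nat where "N > 0" "\<And>i. 1 \<le> i ==> i \<le> n ==> i dvd N"
    "N \<le> n ^ card {p. prime p \<and> p \<le> n}"
proof -
  let ?P = "{p::nat. prime p \<and> p \<le> n}"
  have fin: "finite ?P" by simp
  define e where "e p = Max {e. p ^ e \<le> n}" for p :: nat
  have fin_e: "finite {e. p ^ e \<le> n}" if "prime p" for p :: nat
  proof (rule finite_subset)
    show "{e. p ^ e \<le> n} \<subseteq> {..n}"
    proof
      fix e assume "e \<in> {e. p ^ e \<le> n}"
      moreover have "e < p ^ e" using that prime_ge_2_nat[OF that] by (intro power_gt_expt) simp
      ultimately show "e \<in> {..n}" by simp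
    qed
  qed simp
  have e_le: "p ^ e p \<le> n" if "prime p" for p
  proof -
    have "0 \<in> {e. p ^ e \<le> n}" using assms by simp
    then have "e p \<in> {e. p ^ e \<le> n}" unfolding e_def using Max_in[OF fin_e[OF that]] by blast
    then show ?thesis by simp
  qed
  define N where "N = (\<Prod>p\<in>?P. p ^ e p)"
  show ?thesis
  proof
    show "N > 0" unfolding N_def by (intro prod_pos) (auto simp: prime_gt_0_nat)
    have "N \<le> (\<Prod>p\<in>?P. n)" unfolding N_def by (intro prod_mono) (auto simp: e_le)
    then show "N \<le> n ^ card ?P" by simp
    fix i assume i: "1 \<le> i" "i \<le> n"
    have "i = (\<Prod>p\<in>prime_factors i. p ^ multiplicity p i)"
      using i by (simp add: prime_factorization_nat)
    also have "\<dots> dvd (\<Prod>p\<in>prime_factors i. p ^ e p)"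
    proof (rule prod_dvd_prod)
      fix p assume p: "p \<in> prime_factors i"
      then have "prime p" by auto
      have "p ^ multiplicity p i \<le> i" using i multiplicity_dvd[of p i] by (intro dvd_imp_le) simp_all
      then have "p ^ multiplicity p i \<le> n" using i by simp
      then have "multiplicity p i \<le> e p" unfolding e_def using fin_e[OF \<open>prime p\<close>] by (intro Max_ge) auto
      then show "p ^ multiplicity p i dvd p ^ e p" by (rule le_imp_power_dvd)
    qed
    also have "\<dots> dvd N" unfolding N_def
    proof (rule prod_dvd_prod_subset[OF fin])
      have "p \<le> n" if "p dvd i" for p using that i dvd_imp_le[of p i] by simp
      then show "prime_factors i \<subseteq> ?P" by (auto simp: prime_factors_dvd)
    qed
    finally show "i dvd N" .
  qed
qed

text \<open>Otherwise \<open>2 ^ (n - 1) \<le> n ^ (L * L)\<close> for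
  \<open>n = 16 * L ^ 3\<close>. As \<open>n \<le> 2 ^ (4 + 3 * L)\<close>, this forces
  \<open>n - 1 \<le> 4 * L ^ 2 + 3 * L ^ 3\<close>, which is at most \<open>7 * L ^ 3\<close>. The
  third power pays for \<open>L ^ 2\<close> primes at a logarithm of order \<open>L\<close>; the
  factor 16 leaves a margin.\<close>

lemma many_primes:
  assumes "L \<ge> 1"
  shows "L * L < card {p::nat. prime p \<and> p \<le> 16 * L ^ 3}"
proof (rule ccontr)
  let ?n = "16 * L ^ 3"
  assume "\<not> ?thesis"
  then have le: "card {p::nat. prime p \<and> p \<le> ?n} \<le> L * L" by simp
  have n: "1 \<le> ?n" using assms by simp
  obtain N where N: "N > 0" "\<And>i. 1 \<le> i ==> i \<le> ?n ==> i dvd N" "N \<le> ?n ^ card {p. prime p \<and> p \<le> ?n}"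
    using common_multiple_primes[OF n] by blast
  have "2 ^ (?n - 1) \<le> N" using common_multiple_ge[OF n N(1,2)] by blast
  also have "\<dots> \<le> ?n ^ (L * L)" using N(3) power_increasing[OF le n] by linarith
  also have "\<dots> \<le> (2 ^ (4 + 3 * L)) ^ (L * L)"
  proof (rule power_mono)
    have "L ^ 3 \<le> (2 ^ L) ^ 3" using less_exp[of L] by (intro power_mono) auto
    then show "?n \<le> 2 ^ (4 + 3 * L)" by (simp add: power_add power_mult[symmetric] mult.commute)
  qed simp
  also have "\<dots> = 2 ^ ((4 + 3 * L) * (L * L))" by (simp add: power_mult)
  finally have "?n - 1 \<le> (4 + 3 * L) * (L * L)" by simp
  moreover have "L * L \<le> L ^ 3" using assms by (simp add: power3_eq_cube)
  moreover have "1 \<le> L ^ 3" using assms by simp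
  moreover have "(4 + 3 * L) * (L * L) = 4 * (L * L) + 3 * L ^ 3" by (simp add: algebra_simps power3_eq_cube)
  ultimately show False by linarith
qed

text \<open>The product of distinct prime divisors of \<open>D\<close> is at most \<open>D\<close>,
  and each factor is at least 2.\<close>

lemma few_prime_divisors:
  assumes "0 < D" "D < 2 ^ L"
  shows "card {p::nat. prime p \<and> p \<le> n \<and> p dvd D} \<le> L"
proof -
  let ?P = "{p::nat. prime p \<and> p \<le> n \<and> p dvd D}"
  have "?P \<subseteq> prime_factors D" using assms(1) by (auto simp: prime_factors_dvd)
  then have "(\<Prod>p\<in>?P. p) dvd (\<Prod>p\<in>prime_factors D. p)" by (intro prod_dvd_prod_subset) auto
  also have "\<dots> dvd (\<Prod>p\<in>prime_factors D. p ^ multiplicity p D)"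
    by (intro prod_dvd_prod) (auto simp: prime_factors_multiplicity intro: dvd_power)
  also have "\<dots> = D" using assms(1) by (simp add: prime_factorization_nat[symmetric])
  finally have "(\<Prod>p\<in>?P. p) \<le> D" using assms(1) by (rule dvd_imp_le)
  moreover have "(\<Prod>p\<in>?P. 2) \<le> (\<Prod>p\<in>?P. p)"
    by (intro prod_mono) (auto intro: prime_ge_2_nat)
  ultimately have "2 ^ card ?P \<le> D" by simp
  then have "2 ^ card ?P < (2::nat) ^ L" using assms(2) by (rule le_less_trans)
  then show ?thesis by (simp only: power_less_imp_less_exp[of "2::nat"] less_imp_le one_less_numeral_iff semiring_norm)
qed

text \<open>By averaging, some modulus eliminates all but a fraction \<open>1 / L\<close> of the remaining numbers.\<close>

lemma separating_moduli:
  fixes F P :: "nat set"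
  assumes P: "finite P" "L * L < card P" and L: "L \<ge> 1"
    and F: "finite F" "card F \<le> L ^ m" "\<And>D. D \<in> F ==> card {p \<in> P. p dvd D} \<le> L"
  shows "\<exists>qs. length qs = Suc m \<and> set qs \<subseteq> P \<and> (\<forall>D\<in>F. \<exists>q\<in>set qs. \<not> q dvd D)"
  using F
proof (induction m arbitrary: F)
  case 0
  show ?case
  proof (cases "F = {}")
    case True
    obtain p where "p \<in> P" using P(2) by fastforce
    then show ?thesis using True by (intro exI[of _ "[p]"]) auto
  next
    case False
    then obtain D where D: "F = {D}" using 0 by (metis One_nat_def card_0_eq card_1_singletonE le_Suc_eq le_zero_eq power_0)
    have "L < card P" using P(2) L by (metis le_square order_le_less_trans)
    moreover have "card {p \<in> P. p dvd D} \<le> L" using 0(3) D by simp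
    ultimately have "{p \<in> P. p dvd D} \<noteq> P" by auto
    then obtain p where "p \<in> P" "\<not> p dvd D" by auto
    then show ?thesis using D by (intro exI[of _ "[p]"]) auto
  qed
next
  case (Suc m)
  have "\<exists>p\<in>P. card {D \<in> F. p dvd D} \<le> L ^ m"
  proof (rule ccontr)
    assume "\<not> ?thesis"
    then have "L ^ m + 1 \<le> card {D \<in> F. p dvd D}" if "p \<in> P" for p using that by force
    \<comment> \<open>Double counting of the pairs of a prime and a number that it divides. From
      above, each number has at most \<open>L\<close> divisors in \<open>P\<close>; with
      \<open>L * L < card P\<close> the two counts are incompatible.\<close>
    then have "card P * (L ^ m + 1) \<le> (\<Sum>p\<in>P. card {D \<in> F. p dvd D})"
      by (intro sum_bounded_below[where 'a = nat, simplified]) 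
    also have "\<dots> = (\<Sum>D\<in>F. card {p \<in> P. p dvd D})"
      using sum_multicount_gen[of P F "\<lambda>p D. p dvd D" "\<lambda>D. card {p \<in> P. p dvd D}"] P(1) Suc.prems(1) by simp
    also have "\<dots> \<le> card F * L" using Suc.prems(3) sum_bounded_above[of F "\<lambda>D. card {p \<in> P. p dvd D}" L] by simp
    also have "\<dots> \<le> L ^ Suc m * L" using Suc.prems(2) by (rule mult_right_mono) simp
    also have "\<dots> = (L * L) * L ^ m" by simp
    also have "\<dots> \<le> card P * L ^ m" using P(2) by (intro mult_right_mono) auto
    finally show False using P(2) by simp
  qed
  then obtain p where p: "p \<in> P" "card {D \<in> F. p dvd D} \<le> L ^ m" by blast
  then obtain qs where qs: "length qs = Suc m" "set qs \<subseteq> P" "\<forall>D\<in>{D \<in> F. p dvd D}. \<exists>q\<in>set qs. \<not> q dvd D"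
    using Suc.IH[of "{D \<in> F. p dvd D}"] Suc.prems by auto
  then show ?case using p by (intro exI[of _ "p # qs"]) auto
qed

lemma separating_residues:
  assumes L: "L \<ge> 1" and F: "finite F" "card F \<le> L ^ m" "\<And>D. D \<in> F ==> 0 < D \<and> D < 2 ^ L"
  shows "\<exists>qs :: nat list. length qs = Suc m \<and> (\<forall>q\<in>set qs. 1 \<le> q \<and> q \<le> 16 * L ^ 3) \<and> (\<forall>D\<in>F. \<exists>q\<in>set qs. \<not> q dvd D)"
proof -
  let ?P = "{p::nat. prime p \<and> p \<le> 16 * L ^ 3}"
  have "card {p \<in> ?P. p dvd D} \<le> L" if "D \<in> F" for D
    using few_prime_divisors[of D L "16 * L ^ 3"] F(3)[OF that] by (simp add: conj_assoc)
  then obtain qs where "length qs = Suc m" "set qs \<subseteq> ?P" "\<forall>D\<in>F. \<exists>q\<in>set qs. \<not> q dvd D"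
    using separating_moduli[OF _ many_primes[OF L] L F(1,2)] by auto
  then show ?thesis by (intro exI[of _ qs]) (auto simp: prime_gt_0_nat Suc_leI)
qed

section \<open>From subset sums to model checking\<close>


lemma sat_Exis:
  "sat A w (foldr Exi xs \<phi>) \<longleftrightarrow>
    (\<exists>f. (\<forall>x\<in>set xs. f x \<in> universe A) \<and> sat A (\<lambda>x. if x \<in> set xs then f x else w x) \<phi>)"
proof (induction xs arbitrary: w)
  case (Cons x xs)
  have "sat A w (foldr Exi (x # xs) \<phi>) \<longleftrightarrow> (\<exists>a\<in>universe A. \<exists>f. (\<forall>y\<in>set xs. f y \<in> universe A) \<and>
      sat A (\<lambda>y. if y \<in> set xs then f y else (w(x := a)) y) \<phi>)"
    by (simp add: Cons)
  also have "\<dots> \<longleftrightarrow> (\<exists>f. (\<forall>y\<in>set (x # xs). f y \<in> universe A) \<and>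
      sat A (\<lambda>y. if y \<in> set (x # xs) then f y else w y) \<phi>)" (is "?l \<longleftrightarrow> ?r")
  proof
    assume ?l
    then obtain a f where "a \<in> universe A" "\<forall>y\<in>set xs. f y \<in> universe A"
      "sat A (\<lambda>y. if y \<in> set xs then f y else (w(x := a)) y) \<phi>" by blast
    moreover have "(\<lambda>y. if y \<in> set xs then f y else (w(x := a)) y) =
        (\<lambda>y. if y \<in> set (x # xs) then if y \<in> set xs then f y else a else w y)" by (auto simp: fun_eq_iff)
    \<comment> \<open>If \<open>x\<close> occurs again in \<open>xs\<close>, the inner quantifier
      wins and the value \<open>a\<close> is discarded.\<close>
    ultimately show ?r by (intro exI[of _ "\<lambda>y. if y \<in> set xs then f y else a"]) auto
  next
    assume ?r
    then obtain f where "\<forall>y\<in>set (x # xs). f y \<in> universe A"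
      "sat A (\<lambda>y. if y \<in> set (x # xs) then f y else w y) \<phi>" by blast
    moreover have "(\<lambda>y. if y \<in> set xs then f y else (w(x := f x)) y) =
        (\<lambda>y. if y \<in> set (x # xs) then f y else w y)" by (auto simp: fun_eq_iff)
    ultimately show ?l by (intro bexI[of _ "f x"] exI[of _ f]) auto
  qed
  finally show ?case .
qed simp

lemma sat_Unis:
  "sat A w (foldr Uni xs \<phi>) \<longleftrightarrow>
    (\<forall>f. (\<forall>x\<in>set xs. f x \<in> universe A) \<longrightarrow> sat A (\<lambda>x. if x \<in> set xs then f x else w x) \<phi>)"
proof -
  have "sat A w (foldr Uni xs \<phi>) \<longleftrightarrow> \<not> sat A w (foldr Exi xs (Neg \<phi>))"
    by (induction xs arbitrary: w) auto
  then show ?thesis by (auto simp: sat_Exis)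
qed

text \<open>Variables and elements of the universe get the names \<open>2 ^ j - 1\<close>, which are unary in binary.\<close>

definition nm :: "nat => nat" where
  "nm j = 2 ^ j - 1"

lemma inj_nm: "inj nm"
proof (rule injI)
  fix i j assume "nm i = nm j"
  moreover have "1 \<le> (2::nat) ^ i" "1 \<le> (2::nat) ^ j" by simp_all
  ultimately have "(2::nat) ^ i = 2 ^ j" unfolding nm_def by linarith
  then show "i = j" by simp
qed

lemma nm_eq [simp]: "nm i = nm j \<longleftrightarrow> i = j"
  using inj_nm by (auto dest: injD)

lemma map_nm_eq [simp]: "map nm is = map nm js \<longleftrightarrow> is = js"
  by (metis inj_nm inj_map_eq_map)

definition override :: "(nat => nat) => nat list => (nat => nat) => nat => nat" where
  "override w js f = (\<lambda>x. if x \<in> nm ` set js then nm (f (inv nm x)) else w x)"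

lemma override_nm: "override w js f (nm j) = (if j \<in> set js then nm (f j) else w (nm j))"
  by (auto simp: override_def inv_f_f[OF inj_nm])

lemma sat_Exis_nm:
  assumes "universe A = nm ` {..<U}"
  shows "sat A w (foldr (\<lambda>j. Exi (nm j)) js \<phi>) \<longleftrightarrow> (\<exists>f. (\<forall>j\<in>set js. f j < U) \<and> sat A (override w js f) \<phi>)"
proof -
  have foldr: "foldr (\<lambda>j. Exi (nm j)) js \<phi> = foldr Exi (map nm js) \<phi>" by (simp add: foldr_map comp_def)
  show ?thesis unfolding foldr sat_Exis
  proof
    assume "\<exists>f. (\<forall>x\<in>set (map nm js). f x \<in> universe A) \<and> sat A (\<lambda>x. if x \<in> set (map nm js) then f x else w x) \<phi>"
    then obtain f where f: "\<forall>x\<in>set (map nm js). f x \<in> universe A"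
      "sat A (\<lambda>x. if x \<in> set (map nm js) then f x else w x) \<phi>" by blast
    define f' where "f' j = inv nm (f (nm j))" for j
    have f': "nm (f' j) = f (nm j) \<and> f' j < U" if "j \<in> set js" for j
      using f(1) that assms by (auto simp: f'_def inv_f_f[OF inj_nm])
    have "(\<lambda>x. if x \<in> set (map nm js) then f x else w x) = override w js f'"
      by (auto simp: override_def fun_eq_iff inv_f_f[OF inj_nm] f')
    then show "\<exists>f. (\<forall>j\<in>set js. f j < U) \<and> sat A (override w js f) \<phi>" using f(2) f' by auto
  next
    assume "\<exists>f. (\<forall>j\<in>set js. f j < U) \<and> sat A (override w js f) \<phi>"
    then obtain f where f: "\<forall>j\<in>set js. f j < U" "sat A (override w js f) \<phi>" by blast
    moreover have "override w js f = (\<lambda>x. if x \<in> set (map nm js) then nm (f (inv nm x)) else w x)"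
      by (simp add: override_def)
    ultimately show "\<exists>f. (\<forall>x\<in>set (map nm js). f x \<in> universe A) \<and> sat A (\<lambda>x. if x \<in> set (map nm js) then f x else w x) \<phi>"
      using assms by (intro exI[of _ "\<lambda>x. nm (f (inv nm x))"]) (auto simp: inv_f_f[OF inj_nm])
  qed
qed

lemma sat_Unis_nm:
  assumes "universe A = nm ` {..<U}"
  shows "sat A w (foldr (\<lambda>j. Uni (nm j)) js \<phi>) \<longleftrightarrow> (\<forall>f. (\<forall>j\<in>set js. f j < U) \<longrightarrow> sat A (override w js f) \<phi>)"
proof -
  have "sat A w (foldr (\<lambda>j. Uni (nm j)) js \<phi>) \<longleftrightarrow> \<not> sat A w (foldr (\<lambda>j. Exi (nm j)) js (Neg \<phi>))"
    by (induction js arbitrary: w) auto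
  then show ?thesis by (auto simp: sat_Exis_nm[OF assms])
qed

text \<open>
  The formula is generated over an arbitrary algebra of formulas, so that the same function produces
  both the formula and its code. The variables are: the chosen elements of the three sets,
  \<open>m + 1\<close> moduli (quantified with the second set), and the partial sums for each modulus.
\<close>

record 'f algebra =
  rel :: "nat => nat list => 'f"
  equ :: "nat => nat => 'f"
  neg :: "'f => 'f"
  con :: "'f => 'f => 'f"
  dis :: "'f => 'f => 'f"
  exi :: "nat => 'f => 'f"
  uni :: "nat => 'f => 'f"

text \<open>Built from \<open>map\<close> and \<open>[0..<n]\<close>, for which closure rules of
  \<open>ptime\<close> are available.\<close>

definition range_from :: "nat => nat => nat list" where
  "range_from a n = map (\<lambda>i. a + i) [0..<n]"

lemma set_range_from [simp]: "set (range_from a n) = {a..<a + n}"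
proof
  show "{a..<a + n} \<subseteq> set (range_from a n)"
  proof
    fix i assume "i \<in> {a..<a + n}"
    then have "i = a + (i - a)" "i - a < n" by auto
    then show "i \<in> set (range_from a n)" unfolding range_from_def by force
  qed
qed (auto simp: range_from_def)

text \<open>The numbering follows the blocks: \<open>k\<close> elements, then \<open>l\<close>
  elements and \<open>m + 1\<close> moduli, then \<open>m\<close> elements and the partial sums.
  Since the moduli stand between the second and the third group of elements, \<open>summand\<close>
  shifts the indices of the latter by \<open>Suc m\<close>.\<close>

definition modulus :: "nat => nat => nat => nat" where
  "modulus k l i = k + l + i"

definition partial :: "nat => nat => nat => nat => nat => nat" where
  "partial k l m i j = k + l + Suc m + m + (i * Suc (k + l + m) + j)"

definition summand :: "nat => nat => nat => nat => nat" where
  "summand k l m j = (if j < k + l then j else j + Suc m)"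

definition distinct_gen :: "'f algebra => nat list => 'f list" where
  "distinct_gen a js = concat (map (\<lambda>i. map (\<lambda>j. neg a (equ a i j)) (filter (\<lambda>j. i < j) js)) js)"

definition members_gen :: "'f algebra => nat => nat list => 'f list" where
  "members_gen a r js = map (\<lambda>j. rel a r [j]) js @ distinct_gen a js"

definition chains_gen :: "'f algebra => nat => nat => nat => 'f list" where
  "chains_gen a k l m = concat (map (\<lambda>i. rel a 5 [partial k l m i 0] #
     rel a 4 [modulus k l i, partial k l m i (k + l + m)] #
     map (\<lambda>j. rel a 3 [modulus k l i, partial k l m i j, summand k l m j, partial k l m i (Suc j)])
       [0..<k + l + m]) [0..<Suc m])"

text \<open>The conditions on the first subset stand outside the implication and those on the third
  one inside, so an illegal choice of the second subset is won by the existential player. The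
  neutral element \<open>tt\<close> uses the variable of modulus 0, which is bound for all
  \<open>k\<close>, \<open>l\<close>, \<open>m\<close>.\<close>

definition matrix_gen :: "'f algebra => nat => nat => nat => 'f" where
  "matrix_gen a k l m = (let tt = equ a (modulus k l 0) (modulus k l 0) in
     con a (foldr (con a) (members_gen a 0 [0..<k]) tt)
       (dis a (neg a (foldr (con a) (members_gen a 1 (range_from k l)) tt))
         (foldr (con a) (members_gen a 2 (range_from (k + l + Suc m) m) @ chains_gen a k l m) tt)))"

definition formula_gen :: "'f algebra => nat => nat => nat => 'f" where
  "formula_gen a k l m = foldr (exi a) [0..<k] (foldr (uni a) (range_from k (l + Suc m))
     (foldr (exi a) (range_from (k + l + Suc m) (m + Suc m * Suc (k + l + m))) (matrix_gen a k l m)))"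

definition form_algebra :: "form algebra" where
  "form_algebra = \<lparr>rel = (\<lambda>r js. Rel r (map nm js)), equ = (\<lambda>i j. Equ (nm i) (nm j)), neg = Neg,
     con = Conj, dis = Disj, exi = (\<lambda>j. Exi (nm j)), uni = (\<lambda>j. Uni (nm j))\<rparr>"

lemma form_algebra_simps [simp]:
  "rel form_algebra r js = Rel r (map nm js)" "equ form_algebra i j = Equ (nm i) (nm j)"
  "neg form_algebra = Neg" "con form_algebra = Conj" "dis form_algebra = Disj"
  "exi form_algebra = (\<lambda>j. Exi (nm j))" "uni form_algebra = (\<lambda>j. Uni (nm j))"
  by (simp_all add: form_algebra_def)

text \<open>Elements of the universe have three roles: positions in the list of numbers, residues,
  and moduli, where \<open>q\<close> stands for the modulus \<open>Suc q\<close>. The relation is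
  the graph of adding one of the numbers modulo \<open>Suc q\<close>; it is a table of polynomial
  size although the numbers are large.\<close>

definition sum_tuples :: "nat list list => nat => nat list list" where
  "sum_tuples a U = concat (map (\<lambda>q. concat (map (\<lambda>s. map (\<lambda>e. [q, s, e, (s + residue (nth_or [] a e) (Suc q)) mod Suc q])
     [0..<length a]) [0..<U])) [0..<U])"

text \<open>The lists \<open>a\<close>, \<open>b\<close>, \<open>c\<close> contain the binary representations of the elements of the three sets.\<close>

definition sss_relations :: "nat list list => nat list list => nat list list => nat list => nat => (nat \<times> nat list list) list" where
  "sss_relations a b c t U =
     [(1, map (\<lambda>i. [i]) [0..<length a]),
      (1, map (\<lambda>i. [i]) (range_from (length a) (length b))),
      (1, map (\<lambda>i. [i]) (range_from (length a + length b) (length c))),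
      (4, remdups (sum_tuples (a @ b @ c) U)),
      (2, remdups (map (\<lambda>q. [q, residue t (Suc q)]) [0..<U])),
      (1, [[0]])]"

definition sss_structure :: "nat list list => nat list list => nat list list => nat list => nat => fo_structure" where
  "sss_structure a b c t U = listed_structure (map nm [0..<U])
     (map (\<lambda>(r, X). (r, map (map nm) X)) (sss_relations a b c t U))"

lemma set_sum_tuples:
  "set (sum_tuples a U) = {[q, s, e, (s + val (a ! e)) mod Suc q] |q s e. q < U \<and> s < U \<and> e < length a}"
proof -
  have "(s + residue (nth_or [] a e) (Suc q)) mod Suc q = (s + val (a ! e)) mod Suc q" if "e < length a" for s e q
    using that by (simp add: residue nth_or_def mod_add_right_eq)
  then show ?thesis by (fastforce simp: sum_tuples_def)
qed

lemma universe_sss [simp]: "universe (sss_structure a b c t U) = nm ` {..<U}"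
  by (auto simp: sss_structure_def listed_structure_def)

lemma conjs_sat: "sat A w (foldr Conj \<phi>s \<psi>) \<longleftrightarrow> (\<forall>\<phi>\<in>set \<phi>s. sat A w \<phi>) \<and> sat A w \<psi>"
  by (induction \<phi>s) auto

lemma distinct_gen_sat:
  assumes "\<And>j. w (nm j) = nm (F j)"
  shows "(\<forall>\<phi>\<in>set (distinct_gen form_algebra js). sat A w \<phi>) \<longleftrightarrow> inj_on F (set js)"
proof -
  have "(\<forall>\<phi>\<in>set (distinct_gen form_algebra js). sat A w \<phi>) \<longleftrightarrow> (\<forall>i\<in>set js. \<forall>j\<in>set js. i < j \<longrightarrow> F i \<noteq> F j)"
    by (auto simp: distinct_gen_def assms)
  also have "\<dots> \<longleftrightarrow> inj_on F (set js)"
    by (auto simp: inj_on_def) (metis linorder_neqE_nat)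
  finally show ?thesis .
qed

lemma sss_rel_sat:
  assumes w: "\<And>j. w (nm j) = nm (F j)" and r: "r < 6"
  shows "sat (sss_structure a b c t U) w (Rel r (map nm js)) \<longleftrightarrow> map F js \<in> set (snd (sss_relations a b c t U ! r))"
proof -
  have "length (sss_relations a b c t U) = 6" by (simp add: sss_relations_def)
  then have "snd (relations (sss_structure a b c t U) ! r) = map nm ` set (snd (sss_relations a b c t U ! r))"
    using r by (simp add: sss_structure_def listed_structure_def case_prod_unfold)
  moreover have "map w (map nm js) = map nm (map F js)" by (simp add: w)
  ultimately show ?thesis unfolding sat.simps by (simp only: inj_image_mem_iff[OF inj_mapI[OF inj_nm]])
qed

definition members_of :: "(nat => nat) => nat => nat => nat => nat => bool" where
  "members_of F p k d n \<longleftrightarrow> (\<forall>j\<in>{p..<p + k}. d \<le> F j \<and> F j < d + n) \<and> inj_on F {p..<p + k}"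

lemma matrix_sat:
  assumes w: "\<And>j. w (nm j) = nm (F j)" and F: "\<And>j. F j < U"
  shows "sat (sss_structure a b c t U) w (matrix_gen form_algebra k l m) \<longleftrightarrow>
    members_of F 0 k 0 (length a) \<and> (members_of F k l (length a) (length b) \<longrightarrow>
      members_of F (k + l + Suc m) m (length a + length b) (length c) \<and>
      (\<forall>i\<le>m. F (partial k l m i 0) = 0 \<and>
        F (partial k l m i (k + l + m)) = val t mod Suc (F (modulus k l i)) \<and>
        (\<forall>j<k + l + m. F (summand k l m j) < length a + length b + length c \<and>
          F (partial k l m i (Suc j)) = (F (partial k l m i j) + val ((a @ b @ c) ! F (summand k l m j)))
            mod Suc (F (modulus k l i)))))"
proof -
  let ?A = "sss_structure a b c t U"
  note rel = sss_rel_sat[of w F _ a b c t U, OF w]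
  have r0: "sat ?A w (Rel 0 [nm j]) \<longleftrightarrow> F j < length a" for j
    using rel[of 0 "[j]"] by (auto simp: sss_relations_def simp del: sat.simps)
  have r1: "sat ?A w (Rel 1 [nm j]) \<longleftrightarrow> length a \<le> F j \<and> F j < length a + length b" for j
    using rel[of 1 "[j]"] by (auto simp: sss_relations_def image_iff simp del: sat.simps)
  have r2: "sat ?A w (Rel 2 [nm j]) \<longleftrightarrow> length a + length b \<le> F j \<and> F j < length a + length b + length c" for j
    using rel[of 2 "[j]"] by (auto simp: sss_relations_def image_iff simp del: sat.simps)
  have r5: "sat ?A w (Rel 5 [nm j]) \<longleftrightarrow> F j = 0" for j
    using rel[of 5 "[j]"] by (auto simp: sss_relations_def simp del: sat.simps)
  have r4: "sat ?A w (Rel 4 [nm i, nm j]) \<longleftrightarrow> F j = val t mod Suc (F i)" for i j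
    using rel[of 4 "[i, j]"] F by (auto simp: sss_relations_def residue simp del: sat.simps)
  have r3: "sat ?A w (Rel 3 [nm q, nm s, nm e, nm s']) \<longleftrightarrow> F e < length a + length b + length c \<and>
      F s' = (F s + val ((a @ b @ c) ! F e)) mod Suc (F q)" for q s e s'
    using rel[of 3 "[q, s, e, s']"] F by (auto simp: sss_relations_def set_sum_tuples simp del: sat.simps)
  have 1: "(\<forall>\<phi>\<in>set (members_gen form_algebra 0 [0..<k]). sat ?A w \<phi>) \<longleftrightarrow> members_of F 0 k 0 (length a)"
    unfolding members_gen_def set_append ball_Un distinct_gen_sat[of w F, OF w]
    by (auto simp: r0 members_of_def simp del: sat.simps)
  have 2: "(\<forall>\<phi>\<in>set (members_gen form_algebra 1 (range_from k l)). sat ?A w \<phi>) \<longleftrightarrow>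
      members_of F k l (length a) (length b)"
    unfolding members_gen_def set_append ball_Un distinct_gen_sat[of w F, OF w]
    by (auto simp: r1[unfolded One_nat_def] members_of_def simp del: sat.simps)
  have 3: "(\<forall>\<phi>\<in>set (members_gen form_algebra 2 (range_from (k + l + Suc m) m)). sat ?A w \<phi>) \<longleftrightarrow>
      members_of F (k + l + Suc m) m (length a + length b) (length c)"
    unfolding members_gen_def set_append ball_Un distinct_gen_sat[of w F, OF w]
    by (auto simp: r2 members_of_def simp del: sat.simps)
  have 4: "(\<forall>\<phi>\<in>set (chains_gen form_algebra k l m). sat ?A w \<phi>) \<longleftrightarrow>
      (\<forall>i\<le>m. F (partial k l m i 0) = 0 \<and>
        F (partial k l m i (k + l + m)) = val t mod Suc (F (modulus k l i)) \<and>
        (\<forall>j<k + l + m. F (summand k l m j) < length a + length b + length c \<and>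
          F (partial k l m i (Suc j)) = (F (partial k l m i j) + val ((a @ b @ c) ! F (summand k l m j)))
            mod Suc (F (modulus k l i))))"
  proof -
    have ball: "(\<forall>i\<in>set [0..<Suc n]. P i) = (\<forall>i\<le>n. P i)" "(\<forall>i\<in>set [0..<n]. P i) = (\<forall>i<n. P i)" for P n
      by (auto simp: less_Suc_eq_le simp del: upt_Suc)
    have concat: "(\<forall>\<phi>\<in>set (concat (map f js)). P \<phi>) = (\<forall>j\<in>set js. \<forall>\<phi>\<in>set (f j). P \<phi>)" for f js and P :: "form => bool"
      by auto
    show ?thesis unfolding chains_gen_def concat
      by (simp add: r3 r4 r5 ball del: sat.simps upt_Suc set_upt) (simp only: less_Suc_eq_le)
  qed
  show ?thesis
    unfolding matrix_gen_def Let_def form_algebra_simps sat.simps conjs_sat set_append ball_Un 1 2 3 4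
    by simp
qed

lemma partial_sums_mod:
  assumes "g 0 = 0" "\<And>j. j < n ==> g (Suc j) = (g j + u j) mod q" "j \<le> n"
  shows "g j mod q = (\<Sum>i<j. u i) mod (q::nat)"
  using assms(3)
proof (induction j)
  case (Suc j)
  then have "g (Suc j) mod q = (g j + u j) mod q" using assms(2)[of j] by simp
  also have "\<dots> = (g j mod q + u j) mod q" by (rule mod_add_left_eq[symmetric])
  also have "\<dots> = ((\<Sum>i<j. u i) mod q + u j) mod q" using Suc by simp
  also have "\<dots> = ((\<Sum>i<j. u i) + u j) mod q" by (rule mod_add_left_eq)
  finally show ?case by simp
qed (use assms in simp)

lemma sum_summand:
  "(\<Sum>j<k + l + m. h (summand k l m j)) = (\<Sum>i<k. h (0 + i)) + (\<Sum>i<l. h (k + i)) + (\<Sum>i<m. h (k + l + Suc m + i))"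
  for h :: "nat => nat"
proof -
  have split: "(\<Sum>j<n + n'. g j) = (\<Sum>j<n. g j) + (\<Sum>i<n'. g (n + i))" for g :: "nat => nat" and n n'
    by (induction n') auto
  show ?thesis unfolding split by (simp add: summand_def add_ac)
qed

text \<open>Describes one of the three sets within the concatenated list \<open>v\<close>, from
  position \<open>d\<close> on. A subset with \<open>k\<close> elements corresponds to an injective
  choice of \<open>k\<close> positions in this range, in any order.\<close>

locale segment =
  fixes v xs :: "nat list" and d :: nat
  assumes dist: "distinct xs" and seg: "\<And>i. i < length xs ==> v ! (d + i) = xs ! i"
begin

lemma members_subset:
  assumes "members_of F p k d (length xs)"
  shows "\<exists>B \<subseteq> set xs. card B = k \<and> \<Sum>B = (\<Sum>i<k. v ! F (p + i))"
proof -
  let ?g = "\<lambda>i. v ! F (p + i)"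
  have F: "d \<le> F (p + i) \<and> F (p + i) < d + length xs" if "i < k" for i
    using assms that by (auto simp: members_of_def)
  have g: "?g i = xs ! (F (p + i) - d) \<and> F (p + i) - d < length xs" if "i < k" for i
    using seg[of "F (p + i) - d"] F[OF that] by auto
  have inj: "inj_on ?g {..<k}"
  proof (rule inj_onI)
    fix i j assume ij: "i \<in> {..<k}" "j \<in> {..<k}" "?g i = ?g j"
    then have "F (p + i) - d = F (p + j) - d" using g dist by (simp add: nth_eq_iff_index_eq)
    then have "F (p + i) = F (p + j)" using F ij by (metis eq_diff_iff lessThan_iff)
    then have "p + i = p + j" using assms ij inj_onD[of F "{p..<p + k}" "p + i" "p + j"] by (simp add: members_of_def)
    then show "i = j" by simp
  qed
  have "?g ` {..<k} \<subseteq> set xs" using g by auto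
  moreover have "card (?g ` {..<k}) = k" using inj by (simp add: card_image)
  moreover have "\<Sum>(?g ` {..<k}) = (\<Sum>i<k. ?g i)" using inj by (simp add: sum.reindex)
  ultimately show ?thesis by blast
qed

lemma subset_members:
  assumes "B \<subseteq> set xs" "card B = k"
  shows "\<exists>f. (\<forall>i. f i < d + length xs + 1) \<and> (\<forall>i<k. f i < d + length xs) \<and> (\<forall>F. (\<forall>i<k. F (p + i) = f i) \<longrightarrow>
    members_of F p k d (length xs) \<and> (\<Sum>i<k. v ! F (p + i)) = \<Sum>B)"
proof -
  have fin: "finite B" using assms(1) finite_subset by blast
  obtain h where h: "bij_betw h {..<k} B"
    using ex_bij_betw_nat_finite[OF fin] assms(2) by (auto simp: atLeast0LessThan)
  have "\<forall>i<k. \<exists>j<length xs. xs ! j = h i"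
  proof (intro allI impI)
    fix i assume "i < k"
    then have "h i \<in> set xs" using h assms(1) by (auto simp: bij_betw_def)
    then show "\<exists>j<length xs. xs ! j = h i" by (simp add: in_set_conv_nth)
  qed
  then obtain e where e: "\<forall>i<k. e i < length xs \<and> xs ! e i = h i" by metis
  define f where "f i = (if i < k then d + e i else 0)" for i
  have "members_of F p k d (length xs) \<and> (\<Sum>i<k. v ! F (p + i)) = \<Sum>B" if F: "\<forall>i<k. F (p + i) = f i" for F
  proof
    have F': "F j = d + e (j - p)" if "j \<in> {p..<p + k}" for j
      using F[rule_format, of "j - p"] that by (auto simp: f_def)
    have "inj_on F {p..<p + k}"
    proof (rule inj_onI)
      fix i j assume ij: "i \<in> {p..<p + k}" "j \<in> {p..<p + k}" "F i = F j"
      then have "e (i - p) = e (j - p)" using F'[OF ij(1)] F'[OF ij(2)] by simp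
      moreover have "xs ! e (i - p) = h (i - p)" "xs ! e (j - p) = h (j - p)" using e ij by auto
      ultimately have "h (i - p) = h (j - p)" by simp
      then have "i - p = j - p" using h ij by (auto simp: bij_betw_def inj_on_def)
      then show "i = j" using ij by auto
    qed
    moreover have "d \<le> F j \<and> F j < d + length xs" if "j \<in> {p..<p + k}" for j
      using F'[OF that] e that by auto
    ultimately show "members_of F p k d (length xs)" by (auto simp: members_of_def)
    have "(\<Sum>i<k. v ! F (p + i)) = (\<Sum>i<k. h i)" using F e seg by (intro sum.cong) (auto simp: f_def)
    also have "\<dots> = \<Sum>B" using sum.reindex_bij_betw[OF h, of "\<lambda>x. x"] by simp
    finally show "(\<Sum>i<k. v ! F (p + i)) = \<Sum>B" .
  qed
  moreover have "\<forall>i<k. f i < d + length xs" using e by (auto simp: f_def)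
  moreover have "\<forall>i. f i < d + length xs + 1" using e by (auto simp: f_def less_SucI)
  ultimately show ?thesis by blast
qed

end

lemma sum_list_val_less: "Suc (sum_list (map val as)) \<le> 2 ^ length (concat as)"
proof (induction as)
  case (Cons b as)
  have "Suc (sum_list (map val (b # as))) \<le> Suc (val b) * Suc (sum_list (map val as))" by simp
  also have "\<dots> \<le> 2 ^ length b * 2 ^ length (concat as)"
    using Cons val_less[of b] by (intro mult_mono) auto
  finally show ?case by (simp add: power_add)
qed simp

lemma subset_sum_le:
  assumes "distinct xs" "B \<subseteq> set xs"
  shows "\<Sum>B \<le> sum_list (xs :: nat list)"
proof -
  have "\<Sum>B \<le> \<Sum>(set xs)" using assms(2) by (intro sum_mono2) auto
  then show ?thesis using sum_list_distinct_conv_sum_set[OF assms(1), of "\<lambda>x. x"] by simp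
qed

lemma card_subsets_le: "finite A ==> card {B. B \<subseteq> A \<and> card B = m} \<le> card A ^ m"
  by (simp add: n_subsets) (metis binomial_eq_0_iff binomial_le_pow linorder_not_le zero_le)

text \<open>\<open>L\<close> exceeds the total number of bits, so all sums and the target are below
  \<open>2 ^ L\<close>; it also exceeds the number of elements of the third set, so there are at
  most \<open>L ^ m\<close> candidates. \<open>U\<close> is the bound for the moduli from
  \<open>separating_residues\<close> and leaves room for the positions.\<close>

theorem sss_formula:
  assumes dist: "distinct (map val a)" "distinct (map val b)" "distinct (map val c)"
    and L: "L = length (concat (a @ b @ c)) + length (a @ b @ c) + length t + 1" and U: "U = 16 * L ^ 3"
  shows "models (sss_structure a b c t U) (formula_gen form_algebra k l m) \<longleftrightarrow>
    (val ` set a, k, val ` set b, l, val ` set c, m, val t) \<in> alt3_sss"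
proof -
  let ?A = "sss_structure a b c t U"
  let ?xs = "[0..<k]" and ?ys = "range_from k (l + Suc m)"
    and ?zs = "range_from (k + l + Suc m) (m + Suc m * Suc (k + l + m))"
  let ?z = "k + l + Suc m" and ?K = "k + l + m" and ?n = "length a + length b" and ?N = "length a + length b + length c"
  let ?\<phi> = "formula_gen form_algebra k l m" and ?a = "set (map val a)" and ?b = "set (map val b)" and ?c = "set (map val c)"
  define v where "v = map val (a @ b @ c)"
  define M where "M F \<longleftrightarrow> members_of F 0 k 0 (length a) \<and> (members_of F k l (length a) (length b) \<longrightarrow>
      members_of F (?z) m (?n) (length c) \<and>
      (\<forall>i\<le>m. F (partial k l m i 0) = 0 \<and>
        F (partial k l m i (?K)) = val t mod Suc (F (modulus k l i)) \<and>
        (\<forall>j<?K. F (summand k l m j) < ?N \<and>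
          F (partial k l m i (Suc j)) = (F (partial k l m i j) + val ((a @ b @ c) ! F (summand k l m j)))
            mod Suc (F (modulus k l i)))))" for F
  \<comment> \<open>The assignment after the three blocks, where inner blocks take precedence. Over
    the variables outside of all blocks, given by \<open>w\<close>, the definition of
    \<open>models\<close> ranges universally.\<close>
  define comb where "comb f1 f2 f3 w j = (if j \<in> set ?zs then f3 j else if j \<in> set ?ys then f2 j
     else if j \<in> set ?xs then f1 j else inv nm (w (nm j)))" for f1 f2 f3 w and j :: nat
  interpret s1: segment v "map val a" 0
    by unfold_locales (use dist in \<open>auto simp: v_def nth_append\<close>)
  interpret s2: segment v "map val b" "length a"
    by unfold_locales (use dist in \<open>auto simp: v_def nth_append\<close>)
  interpret s3: segment v "map val c" "?n"
    by unfold_locales (use dist in \<open>auto simp: v_def nth_append\<close>)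
  have L1: "L \<ge> 1" by (simp add: L)
  have LU: "L \<le> U" unfolding U using L1 self_le_power[of L 3] by simp
  have lens: "?N < U" using LU by (simp add: L)
  have game: "models ?A ?\<phi> \<longleftrightarrow>
     (\<forall>w. range w \<subseteq> nm ` {..<U} \<longrightarrow> (\<exists>f1. (\<forall>j\<in>set ?xs. f1 j < U) \<and>
       (\<forall>f2. (\<forall>j\<in>set ?ys. f2 j < U) \<longrightarrow> (\<exists>f3. (\<forall>j\<in>set ?zs. f3 j < U) \<and> M (comb f1 f2 f3 w)))))"
  proof -
    have eq: "sat ?A (override (override (override w ?xs f1) ?ys f2) ?zs f3) (matrix_gen form_algebra k l m) \<longleftrightarrow> M (comb f1 f2 f3 w)"
      if "range w \<subseteq> nm ` {..<U}" "\<forall>j\<in>set ?xs. f1 j < U" "\<forall>j\<in>set ?ys. f2 j < U" "\<forall>j\<in>set ?zs. f3 j < U" for w f1 f2 f3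
    proof -
      let ?w = "override (override (override w ?xs f1) ?ys f2) ?zs f3"
      have w: "w (nm j) = nm (inv nm (w (nm j))) \<and> inv nm (w (nm j)) < U" for j
        using that(1) by (auto simp: inv_f_f[OF inj_nm] dest!: subsetD[of _ _ "w (nm j)"])
      have 1: "?w (nm j) = nm (comb f1 f2 f3 w j)" for j
        using w[of j] by (simp add: override_nm comb_def)
      have 2: "comb f1 f2 f3 w j < U" for j
        using w[of j] that(2-) by (auto simp: comb_def)
      show ?thesis unfolding M_def by (rule matrix_sat[of ?w "comb f1 f2 f3 w" U a b c t k l m, OF 1 2])
    qed
    show ?thesis
      unfolding models_def formula_gen_def form_algebra_simps universe_sss sat_Exis_nm[OF universe_sss] sat_Unis_nm[OF universe_sss]
      by (rule all_cong, rule ex_cong, rule all_cong, rule ex_cong, rule eq)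
  qed
  have comb_xs: "comb f1 f2 f3 w j = f1 j" if "j < k" for f1 f2 f3 w j
    using that by (simp add: comb_def)
  have comb_ys: "comb f1 f2 f3 w j = f2 j" if "k \<le> j" "j < ?z" for f1 f2 f3 w j
    using that by (simp add: comb_def)
  have comb_zs: "comb f1 f2 f3 w j = f3 j" if "?z \<le> j" "j < ?z + (m + Suc m * Suc (?K))" for f1 f2 f3 w j
    using that by (simp add: comb_def)
  have partial_less: "partial k l m i j < ?z + (m + Suc m * Suc (?K))" if "i \<le> m" "j \<le> ?K" for i j
  proof -
    have "i * Suc (?K) \<le> m * Suc (?K)" using that(1) by (rule mult_right_mono) simp
    then show ?thesis using that(2) by (simp add: partial_def)
  qed
  have vlt: "v ! i = val ((a @ b @ c) ! i)" if "i < ?N" for i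
    using that by (simp only: v_def nth_map length_append add.assoc)
  have len_map: "length (map val a) = length a" "length (map val b) = length b" "length (map val c) = length c" by simp_all
  note members_subset = s1.members_subset[unfolded len_map] s2.members_subset[unfolded len_map] s3.members_subset[unfolded len_map]
  note subset_members = s1.subset_members[unfolded len_map] s2.subset_members[unfolded len_map] s3.subset_members[unfolded len_map]
  have summand_less: "F (summand k l m j) < ?N"
    if "members_of F 0 k 0 (length a)" "members_of F k l (length a) (length b)"
      "members_of F (?z) m (?n) (length c)" "j < ?K" for F j
  proof -
    consider "j < k" | "k \<le> j" "j < k + l" | "k + l \<le> j" by linarith
    then show ?thesis
    proof cases
      case 1
      then have "F j < length a" using that(1) by (auto simp: members_of_def)
      then show ?thesis using 1 by (simp add: summand_def)
    next
      case 2
      then have "F j < ?n" using that(2) by (auto simp: members_of_def)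
      then show ?thesis using 2 by (simp add: summand_def)
    next
      case 3
      then have "j + Suc m \<in> {?z..<?z + m}" using that(4) by auto
      then have "F (j + Suc m) < ?N" using that(3) unfolding members_of_def by blast
      then show ?thesis using 3 by (simp add: summand_def)
    qed
  qed
  show ?thesis
  proof
    assume "models ?A ?\<phi>"
    then have game': "\<exists>f1. (\<forall>j\<in>set ?xs. f1 j < U) \<and>
       (\<forall>f2. (\<forall>j\<in>set ?ys. f2 j < U) \<longrightarrow> (\<exists>f3. (\<forall>j\<in>set ?zs. f3 j < U) \<and> M (comb f1 f2 f3 (\<lambda>_. nm 0))))"
      using lens unfolding game by (elim allE[of _ "\<lambda>_. nm 0"] impE) auto
    then obtain f1 where f1: "\<And>f2. \<forall>j\<in>set ?ys. f2 j < U ==> \<exists>f3. M (comb f1 f2 f3 (\<lambda>_. nm 0))"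
      by blast
    let ?w = "\<lambda>_. nm 0"
    \<comment> \<open>Any reply of the universal player shows that \<open>f1\<close> selects a legal
      first subset; the constant 0 is taken.\<close>
    have "\<exists>f3. M (comb f1 (\<lambda>_. 0) f3 ?w)" using f1 lens by auto
    then obtain f3 where "members_of (comb f1 (\<lambda>_. 0) f3 ?w) 0 k 0 (length a)" unfolding M_def by blast
    from members_subset(1)[OF this] obtain B1 where B1: "B1 \<subseteq> ?a" "card B1 = k"
      "\<Sum>B1 = (\<Sum>i<k. v ! f1 (0 + i))" by (auto simp: comb_xs)
    have "\<exists>B3 \<subseteq> ?c. card B3 = m \<and> \<Sum>B1 + \<Sum>B2 + \<Sum>B3 = val t"
      if B2: "B2 \<subseteq> ?b" "card B2 = l" for B2
    proof (rule ccontr)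
      assume no: "\<not> ?thesis"
      obtain g where g: "\<forall>i<l. g i < ?n" "\<And>F. \<forall>i<l. F (k + i) = g i ==>
        members_of F k l (length a) (length b) \<and> (\<Sum>i<l. v ! F (k + i)) = \<Sum>B2"
        using subset_members(2)[OF B2, of k] by blast
      \<comment> \<open>The distance of the sum from the target: of the two truncated differences at
        least one is 0. By assumption it is nonzero for every candidate.\<close>
      define D where "D B3 = (\<Sum>B1 + \<Sum>B2 + \<Sum>B3 - val t) + (val t - (\<Sum>B1 + \<Sum>B2 + \<Sum>B3))" for B3
      let ?F = "D ` {B3. B3 \<subseteq> ?c \<and> card B3 = m}"
      have fin: "finite {B3. B3 \<subseteq> ?c \<and> card B3 = m}" by simp
      have "card ?F \<le> card (?c) ^ m"
        using card_image_le[OF fin] card_subsets_le[of "?c" m] le_trans by blast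
      also have "\<dots> \<le> L ^ m" using card_length[of "map val c"] by (intro power_mono) (auto simp: L)
      finally have card: "card ?F \<le> L ^ m" .
      have bound: "0 < x \<and> x < 2 ^ L" if x: "x \<in> ?F" for x
      proof -
        obtain B3 where B3: "B3 \<subseteq> ?c" "card B3 = m" "x = D B3" using x by blast
        have "\<Sum>B1 + \<Sum>B2 + \<Sum>B3 \<le> sum_list (map val (a @ b @ c))"
          using subset_sum_le[OF dist(1) B1(1)] subset_sum_le[OF dist(2) B2(1)] subset_sum_le[OF dist(3) B3(1)] by simp
        also have "\<dots> < 2 ^ length (concat (a @ b @ c))" using sum_list_val_less[of "a @ b @ c"] by simp
        also have "\<dots> \<le> 2 ^ L" by (intro power_increasing) (auto simp: L)
        finally have "\<Sum>B1 + \<Sum>B2 + \<Sum>B3 < 2 ^ L" .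
        moreover have "val t < 2 ^ L" using val_less[of t] power_increasing[of "length t" L "2::nat"] by (simp add: L)
        moreover have "\<Sum>B1 + \<Sum>B2 + \<Sum>B3 \<noteq> val t" using no B3 by blast
        ultimately show ?thesis unfolding B3(3) D_def by linarith
      qed
      obtain qs where qs: "length qs = Suc m" "\<forall>q\<in>set qs. 1 \<le> q \<and> q \<le> U" "\<forall>D\<in>?F. \<exists>q\<in>set qs. \<not> q dvd D"
        using separating_residues[OF L1 finite_imageI[OF fin] card bound] unfolding U by blast
      \<comment> \<open>The universal player answers with the positions of \<open>B2\<close> and
        with the separating moduli, decreased by 1 because the element \<open>q\<close> stands for
        the modulus \<open>Suc q\<close>.\<close>
      define f2 where "f2 j = (if j < k + l then g (j - k) else qs ! (j - (k + l)) - 1)" for j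
      have "\<forall>j\<in>set ?ys. f2 j < U"
      proof
        fix j assume j: "j \<in> set ?ys"
        show "f2 j < U"
        proof (cases "j < k + l")
          case True
          then have "g (j - k) < ?n" using g(1) j by auto
          then show ?thesis using True lens by (simp add: f2_def)
        next
          case False
          then have "qs ! (j - (k + l)) \<in> set qs" using j qs(1) by (intro nth_mem) auto
          then show ?thesis using False qs(2) by (auto simp: f2_def)
        qed
      qed
      from f1[OF this] obtain f3 where f3: "M (comb f1 f2 f3 ?w)" by blast
      define F where "F = comb f1 f2 f3 ?w"
      have Fy: "members_of F k l (length a) (length b) \<and> (\<Sum>i<l. v ! F (k + i)) = \<Sum>B2"
        by (rule g(2)) (auto simp: F_def comb_ys f2_def)
      have Fx: "members_of F 0 k 0 (length a)" and Fz: "members_of F (?z) m (?n) (length c)"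
        and ch: "\<forall>i\<le>m. F (partial k l m i 0) = 0 \<and>
        F (partial k l m i (?K)) = val t mod Suc (F (modulus k l i)) \<and>
        (\<forall>j<?K. F (partial k l m i (Suc j)) = (F (partial k l m i j) + val ((a @ b @ c) ! F (summand k l m j)))
            mod Suc (F (modulus k l i)))"
        using f3 Fy unfolding M_def F_def by blast+
      obtain B3 where B3: "B3 \<subseteq> ?c" "card B3 = m" "\<Sum>B3 = (\<Sum>i<m. v ! F (?z + i))"
        using members_subset(3)[OF Fz] by blast
      have sums: "(\<Sum>j<?K. v ! F (summand k l m j)) = \<Sum>B1 + \<Sum>B2 + \<Sum>B3"
        unfolding sum_summand[of "\<lambda>j. v ! F j"] B1(3) B3(3) conjunct2[OF Fy, symmetric]
        by (simp add: F_def comb_xs)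
      have "q dvd D B3" if q_in: "q \<in> set qs" for q
      proof -
        obtain i where i: "i \<le> m" "q = qs ! i" using q_in qs(1) by (metis in_set_conv_nth less_Suc_eq_le)
        have "1 \<le> q" using qs(2) q_in by blast
        then have q: "Suc (F (modulus k l i)) = q"
          using i by (simp add: F_def comb_ys modulus_def f2_def)
        have step: "F (partial k l m i (Suc j)) = (F (partial k l m i j) + v ! F (summand k l m j)) mod q"
          if "j < ?K" for j
          using ch i(1) that vlt[OF summand_less[OF Fx conjunct1[OF Fy] Fz that]] q by simp
        have "F (partial k l m i (?K)) mod q = (\<Sum>j<?K. v ! F (summand k l m j)) mod q"
          by (rule partial_sums_mod[of "F \<circ> partial k l m i" "?K", unfolded comp_def])
            (use ch i(1) step in auto)
        then have "(\<Sum>B1 + \<Sum>B2 + \<Sum>B3) mod q = val t mod q"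
          using ch i(1) q unfolding sums by simp
        then show ?thesis unfolding D_def
          by (cases "val t \<le> \<Sum>B1 + \<Sum>B2 + \<Sum>B3") (metis add.right_neutral add_0 diff_is_0_eq mod_eq_dvd_iff_nat nat_le_linear)+
      qed
      then show False using qs(3) B3(1,2) by blast
    qed
    then show "(val ` set a, k, val ` set b, l, val ` set c, m, val t) \<in> alt3_sss"
      unfolding alt3_sss_def using B1(1,2) by auto
  next
    assume "(val ` set a, k, val ` set b, l, val ` set c, m, val t) \<in> alt3_sss"
    then obtain B1 where B1: "B1 \<subseteq> ?a" "card B1 = k" and B1': "\<And>B2. B2 \<subseteq> ?b ==> card B2 = l ==>
       \<exists>B3 \<subseteq> ?c. card B3 = m \<and> \<Sum>B1 + \<Sum>B2 + \<Sum>B3 = val t"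
      unfolding alt3_sss_def by auto
    obtain g1 where g1: "\<forall>i<k. g1 i < length a" "\<And>F. \<forall>i<k. F (0 + i) = g1 i ==>
        members_of F 0 k 0 (length a) \<and> (\<Sum>i<k. v ! F (0 + i)) = \<Sum>B1"
      using subset_members(1)[OF B1, of 0] by auto
    have "\<exists>f3. (\<forall>j\<in>set ?zs. f3 j < U) \<and> M (comb g1 f2 f3 w)" if f2: "\<forall>j\<in>set ?ys. f2 j < U" for f2 w
    proof -
      have Fx: "members_of (comb g1 f2 f3 w) 0 k 0 (length a) \<and> (\<Sum>i<k. v ! comb g1 f2 f3 w (0 + i)) = \<Sum>B1" for f3
        by (rule g1(2)) (simp add: comb_xs)
      have same: "members_of (comb g1 f2 f3 w) k l d n \<longleftrightarrow> members_of (comb g1 f2 f3' w) k l d n" for f3 f3' d n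
      proof -
        have e: "comb g1 f2 f3 w j = comb g1 f2 f3' w j" if "j \<in> {k..<k + l}" for j
          using that by (simp add: comb_ys)
        have "inj_on (comb g1 f2 f3 w) {k..<k + l} \<longleftrightarrow> inj_on (comb g1 f2 f3' w) {k..<k + l}"
          by (rule inj_on_cong) (rule e)
        moreover have "(\<forall>j\<in>{k..<k + l}. d \<le> comb g1 f2 f3 w j \<and> comb g1 f2 f3 w j < d + n) \<longleftrightarrow>
            (\<forall>j\<in>{k..<k + l}. d \<le> comb g1 f2 f3' w j \<and> comb g1 f2 f3' w j < d + n)"
          by (rule ball_cong[OF refl]) (simp only: e)
        ultimately show ?thesis unfolding members_of_def by (simp only:)
      qed
      show ?thesis
      proof (cases "members_of (comb g1 f2 (\<lambda>_. 0) w) k l (length a) (length b)")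
        case False
        then show ?thesis using Fx lens unfolding M_def by (intro exI[of _ "\<lambda>_. 0"]) simp
      next
        case True
        obtain B2 where B2: "B2 \<subseteq> ?b" "card B2 = l" "\<Sum>B2 = (\<Sum>i<l. v ! f2 (k + i))"
          using members_subset(2)[OF True] by (auto simp: comb_ys)
        obtain B3 where B3: "B3 \<subseteq> ?c" "card B3 = m" "\<Sum>B1 + \<Sum>B2 + \<Sum>B3 = val t"
          using B1'[OF B2(1,2)] by blast
        obtain g3 where g3: "\<forall>i<m. g3 i < ?N" "\<And>F. \<forall>i<m. F (?z + i) = g3 i ==>
          members_of F (?z) m (?n) (length c) \<and> (\<Sum>i<m. v ! F (?z + i)) = \<Sum>B3"
          using subset_members(3)[OF B3(1,2), of "?z"] by blast
        define u where "u j = v ! (if j < k then g1 j else if j < k + l then f2 j else g3 (j - (k + l)))" for j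
        \<comment> \<open>The reply consists of the positions of \<open>B3\<close> and of the true
          partial sums modulo the given moduli; quotient and remainder of \<open>r\<close> recover
          the two indices of \<open>partial\<close>.\<close>
        define f3 where "f3 j = (if j < ?z + m then g3 (j - (?z))
          else let r = j - (?z + m) in
            (\<Sum>x<r mod Suc (?K). u x) mod Suc (f2 (modulus k l (r div Suc (?K)))))" for j
        define F where "F = comb g1 f2 f3 w"
        have Fz: "members_of F (?z) m (?n) (length c)"
          "(\<Sum>i<m. v ! F (?z + i)) = \<Sum>B3"
          using g3(2)[of F] by (auto simp: F_def comb_zs f3_def)
        have Fy: "members_of F k l (length a) (length b)" using True same unfolding F_def by blast
        have Fu: "v ! F (summand k l m j) = u j" if "j < ?K" for j
          using that by (auto simp: F_def summand_def u_def comb_xs comb_ys comb_zs f3_def)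
        have Fm: "F (modulus k l i) = f2 (modulus k l i)" if "i \<le> m" for i
          using that by (simp add: F_def comb_ys modulus_def)
        have Fp: "F (partial k l m i j) = (\<Sum>x<j. u x) mod Suc (F (modulus k l i))" if "i \<le> m" "j \<le> ?K" for i j
        proof -
          let ?r = "i * Suc (?K) + j"
          have "(i * n + j) div n = i \<and> (i * n + j) mod n = j" if "j < n" for n using that by simp
          from this[of "Suc ?K"] have "?r div Suc (?K) = i" "?r mod Suc (?K) = j"
            using that(2) by (simp_all only: less_Suc_eq_le simp_thms)
          then show ?thesis unfolding Fm[OF that(1)] unfolding F_def
            by (subst comb_zs) (use partial_less[OF that] in \<open>auto simp: partial_def f3_def Let_def\<close>)
        qed
        have "f3 j < U" if "j \<in> set ?zs" for j
        proof (cases "j < ?z + m")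
          case True
          then have "j - (?z) < m" using that by auto
          then have "f3 j < ?N" using g3(1) True by (simp add: f3_def)
          then show ?thesis using lens by simp
        next
          case False
          let ?r = "j - (?z + m)"
          have "?r < Suc m * Suc (?K)" using that False by auto
          then have "?r div Suc (?K) < Suc m" by (rule less_mult_imp_div_less)
          then have "f2 (modulus k l (?r div Suc (?K))) < U" using f2 by (auto simp: modulus_def)
          moreover have "f3 j \<le> f2 (modulus k l (?r div Suc (?K)))"
            using False mod_less_divisor[of "Suc (f2 (modulus k l (?r div Suc (?K))))"]
            by (simp add: f3_def Let_def less_Suc_eq_le)
          ultimately show ?thesis by simp
        qed
        moreover have "M F" unfolding M_def
        proof (intro conjI impI allI Fz)
          show "members_of F 0 k 0 (length a)" using Fx unfolding F_def by blast
          fix i assume i: "i \<le> m"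
          show "F (partial k l m i 0) = 0" using Fp[OF i, of 0] by simp
          have "(\<Sum>x<?K. u x) = (\<Sum>j<?K. v ! F (summand k l m j))" using Fu by (intro sum.cong) auto
          also have "\<dots> = \<Sum>B1 + \<Sum>B2 + \<Sum>B3"
            unfolding sum_summand[of "\<lambda>j. v ! F j"] B2(3) Fz(2) using Fx[of f3] by (simp add: F_def comb_ys)
          finally show "F (partial k l m i (?K)) = val t mod Suc (F (modulus k l i))"
            using Fp[OF i, of "?K"] B3(3) by simp
          fix j assume j: "j < ?K"
          have Fx': "members_of F 0 k 0 (length a)" using Fx unfolding F_def by blast
          show less: "F (summand k l m j) < ?N"
            by (rule summand_less[OF Fx' Fy Fz(1) j])
          show "F (partial k l m i (Suc j)) = (F (partial k l m i j) + val ((a @ b @ c) ! F (summand k l m j)))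
              mod Suc (F (modulus k l i))"
            unfolding vlt[OF less, symmetric] Fu[OF j] using Fp[OF i, of "Suc j"] Fp[OF i, of j] j
            by (simp add: mod_add_left_eq)
        qed
        ultimately show ?thesis unfolding F_def by blast
      qed
    qed
    moreover have "\<forall>j\<in>set ?xs. g1 j < U" using g1(1) lens by auto
    ultimately show "models ?A ?\<phi>" unfolding game by blast
  qed
qed

section \<open>The formula and the structure as words\<close>

definition wnum :: "nat => nat list" where "wnum n = bits n @ [2]"
definition wname :: "nat => nat list" where "wname j = replicate j 1 @ [2]"
definition wnode :: "nat list list => nat list" where "wnode ws = 3 # concat ws @ [4]"

lemma enc_words: "enc (Num n) = wnum n" "enc (Num (nm j)) = wname j" "enc (Node ts) = wnode (map enc ts)"
  "enc (nums ns) = wnode (map wnum ns)" "wnum (nm j) = wname j"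
  by (simp_all add: wnum_def[abs_def] wname_def wnode_def nm_def bits_unary nums_def comp_def del: One_nat_def)

lemma ptime_words [ptime]:
  "ptime f ==> ptime (\<lambda>x. wnum (f x))" "ptime f ==> ptime (\<lambda>x. wname (f x))" "ptime g ==> ptime (\<lambda>x. wnode (g x))"
  unfolding wnum_def wname_def wnode_def by (intro ptime; assumption)+

definition word_algebra :: "nat list algebra" where
  "word_algebra = \<lparr>rel = (\<lambda>r js. wnode [wnum 0, wnum r, wnode (map wname js)]),
     equ = (\<lambda>i j. wnode [wnum 1, wname i, wname j]), neg = (\<lambda>w. wnode [wnum 2, w]),
     con = (\<lambda>v w. wnode [wnum 3, v, w]), dis = (\<lambda>v w. wnode [wnum 4, v, w]),
     exi = (\<lambda>j w. wnode [wnum 5, wname j, w]), uni = (\<lambda>j w. wnode [wnum 6, wname j, w])\<rparr>"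

lemma word_algebra_simps [simp]:
  "rel word_algebra r js = wnode [wnum 0, wnum r, wnode (map wname js)]"
  "equ word_algebra i j = wnode [wnum 1, wname i, wname j]"
  "neg word_algebra w = wnode [wnum 2, w]"
  "con word_algebra v w = wnode [wnum 3, v, w]"
  "dis word_algebra v w = wnode [wnum 4, v, w]"
  "exi word_algebra j w = wnode [wnum 5, wname j, w]"
  "uni word_algebra j w = wnode [wnum 6, wname j, w]"
  by (simp_all add: word_algebra_def)

definition form_word :: "form => nat list" where
  "form_word \<phi> = enc (form_tree \<phi>)"

lemma form_word_hom:
  "form_word (rel form_algebra r js) = rel word_algebra r js"
  "form_word (equ form_algebra i j) = equ word_algebra i j"
  "form_word (neg form_algebra \<phi>) = neg word_algebra (form_word \<phi>)"
  "form_word (con form_algebra \<phi> \<psi>) = con word_algebra (form_word \<phi>) (form_word \<psi>)"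
  "form_word (dis form_algebra \<phi> \<psi>) = dis word_algebra (form_word \<phi>) (form_word \<psi>)"
  "form_word (exi form_algebra j \<phi>) = exi word_algebra j (form_word \<phi>)"
  "form_word (uni form_algebra j \<phi>) = uni word_algebra j (form_word \<phi>)"
  by (simp_all add: form_word_def enc_words comp_def del: enc.simps)

lemma form_word_foldr:
  assumes "\<And>a \<phi>. h (f a \<phi>) = g (h' a) (h \<phi>)"
  shows "h (foldr f xs \<phi>) = foldr g (map h' xs) (h \<phi>)"
  using assms by (induction xs) auto

text \<open>Coding is a homomorphism from the algebra of formulas to that of words, and the
  generators use only the operations of the algebra. So the code can be produced without a
  representation of formulas as data.\<close>

lemma form_word_formula: "form_word (formula_gen form_algebra k l m) = formula_gen word_algebra k l m"
proof -
  have dist: "map form_word (distinct_gen form_algebra js) = distinct_gen word_algebra js" for js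
    unfolding distinct_gen_def map_concat map_map comp_def form_word_hom ..
  have mem: "map form_word (members_gen form_algebra r js) = members_gen word_algebra r js" for r js
    unfolding members_gen_def map_append map_map comp_def form_word_hom dist ..
  have chains: "map form_word (chains_gen form_algebra k l m) = chains_gen word_algebra k l m"
    unfolding chains_gen_def map_concat map_map comp_def list.map form_word_hom ..
  have con: "form_word (foldr (con form_algebra) \<phi>s \<psi>) = foldr (con word_algebra) (map form_word \<phi>s) (form_word \<psi>)" for \<phi>s \<psi>
    by (rule form_word_foldr) (rule form_word_hom)
  have exi: "form_word (foldr (exi form_algebra) js \<psi>) = foldr (exi word_algebra) js (form_word \<psi>)" for js \<psi>
    using form_word_foldr[of form_word "exi form_algebra" "exi word_algebra" "\<lambda>j. j" js \<psi>, OF form_word_hom(6)] by simp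
  have uni: "form_word (foldr (uni form_algebra) js \<psi>) = foldr (uni word_algebra) js (form_word \<psi>)" for js \<psi>
    using form_word_foldr[of form_word "uni form_algebra" "uni word_algebra" "\<lambda>j. j" js \<psi>, OF form_word_hom(7)] by simp
  show ?thesis
    unfolding formula_gen_def matrix_gen_def Let_def exi uni con form_word_hom map_append mem chains ..
qed

text \<open>If a step adds to the state only an amount linear in the list entry, the size bound
  required of folds is automatic. The factor 2 accounts for the constant \<open>C\<close> of each
  step, as every entry has positive size.\<close>

lemma ptime_foldr_add:
  fixes xs :: "'x::coded => 'a::coded list" and init :: "'x => 's::coded" and f :: "'x => 'a => 's => 's"
  assumes f: "ptime (\<lambda>p. f (fst p) (snd (snd p)) (fst (snd p)))"
    and xs: "ptime xs" and init: "ptime init"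
    and grow: "\<And>x a s. sz (f x a s) \<le> sz s + C * sz a + C"
  shows "ptime (\<lambda>x. foldr (f x) (xs x) (init x))"
proof (rule ptime_foldr[OF f xs init, where B = "\<lambda>x. sz (init x) + 2 * C * sz (xs x)"])
  show "pbound (\<lambda>x. sz (init x) + 2 * C * sz (xs x)) sz"
    by (intro pbound_add pbound_mult pbound_const ptime_sz xs init)
  fix x us vs assume "xs x = us @ vs"
  then have *: "sz vs \<le> sz (xs x)" using sz_le_append(1)[of vs us] by simp
  have "sz (foldr (f x) vs s) \<le> sz s + 2 * C * sz vs" for s
  proof (induction vs)
    case (Cons a vs)
    have "C * 1 \<le> C * sz a" using sz_pos[of a] by (intro mult_left_mono) auto
    then show ?case using grow[of x a "foldr (f x) vs s"] Cons by (simp add: algebra_simps)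
  qed simp
  also have "sz (init x) + 2 * C * sz vs \<le> sz (init x) + 2 * C * sz (xs x)" using * by simp
  finally show "sz (foldr (f x) vs (init x)) \<le> sz (init x) + 2 * C * sz (xs x)" by simp
qed

lemma sz_words:
  "sz (wnode [wnum 3, v, w]) \<le> sz w + 100 * sz v + 100"
  "sz (wnode [wnum 5, wname j, w]) \<le> sz w + 100 * sz j + 100"
  "sz (wnode [wnum 6, wname j, w]) \<le> sz w + 100 * sz j + 100"
proof -
  have "sz (replicate j (1::nat)) \<le> 4 * j + 1" by (induction j) auto
  then show "sz (wnode [wnum 5, wname j, w]) \<le> sz w + 100 * sz j + 100"
    "sz (wnode [wnum 6, wname j, w]) \<le> sz w + 100 * sz j + 100"
    by (simp_all add: wnode_def wnum_def wname_def bits.simps sz_append)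
  show "sz (wnode [wnum 3, v, w]) \<le> sz w + 100 * sz v + 100"
    by (simp add: wnode_def wnum_def bits.simps sz_append)
qed

lemma ptime_compose_fst: "ptime f ==> ptime (\<lambda>p. f (fst p))"
  by (rule ptime_compose[OF _ ptime_fst_fun])

lemma ptime_range_from [ptime]:
  assumes "ptime f" "ptime g" shows "ptime (\<lambda>x. range_from (f x) (g x))"
  unfolding range_from_def by (intro ptime assms ptime_compose_fst[OF assms(1)])

lemma ptime_word_algebra:
  "ptime f ==> ptime (\<lambda>x. rel word_algebra r (f x))"
  "ptime g ==> ptime h ==> ptime (\<lambda>x. equ word_algebra (g x) (h x))"
  "ptime v ==> ptime (\<lambda>x. neg word_algebra (v x))"
  "ptime v ==> ptime w ==> ptime (\<lambda>x. con word_algebra (v x) (w x))"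
  "ptime v ==> ptime w ==> ptime (\<lambda>x. dis word_algebra (v x) (w x))"
  "ptime g ==> ptime v ==> ptime (\<lambda>x. exi word_algebra (g x) (v x))"
  "ptime g ==> ptime v ==> ptime (\<lambda>x. uni word_algebra (g x) (v x))"
  unfolding word_algebra_simps by (intro ptime; assumption)+

lemma ptime_variables:
  "ptime k ==> ptime l ==> ptime i ==> ptime (\<lambda>x. modulus (k x) (l x) (i x))"
  "ptime k ==> ptime l ==> ptime m ==> ptime i ==> ptime j ==> ptime (\<lambda>x. partial (k x) (l x) (m x) (i x) (j x))"
  "ptime k ==> ptime l ==> ptime m ==> ptime j ==> ptime (\<lambda>x. summand (k x) (l x) (m x) (j x))"
  unfolding modulus_def partial_def summand_def by (intro ptime; assumption)+

lemma ptime_formula: "ptime (\<lambda>p. formula_gen word_algebra (fst p) (fst (snd p)) (snd (snd p)))"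
proof -
  have dist: "ptime (\<lambda>x. distinct_gen word_algebra (js x))" if "ptime js" for js :: "'x::coded => nat list"
    unfolding distinct_gen_def by (intro ptime_word_algebra ptime that ptime_compose_fst[OF that])
  have mem: "ptime (\<lambda>x. members_gen word_algebra r (js x))" if "ptime js" for r and js :: "'x::coded => nat list"
    unfolding members_gen_def by (intro ptime_word_algebra ptime that dist)
  have chains: "ptime (\<lambda>p. chains_gen word_algebra (fst p) (fst (snd p)) (snd (snd p)))"
    unfolding chains_gen_def by (intro ptime_word_algebra ptime_variables ptime)
  have con: "ptime (\<lambda>x. foldr (con word_algebra) (f x) (g x))" if "ptime f" "ptime g" for f g :: "'x::coded => _"
  proof (rule ptime_foldr_add[OF _ that])
    show "ptime (\<lambda>p :: 'x \<times> nat list \<times> nat list. con word_algebra (snd (snd p)) (fst (snd p)))"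
      by (intro ptime_word_algebra ptime)
  qed (unfold word_algebra_simps, rule sz_words)
  have exi: "ptime (\<lambda>x. foldr (exi word_algebra) (f x) (g x))" if "ptime f" "ptime g" for f g :: "'x::coded => _"
  proof (rule ptime_foldr_add[OF _ that])
    show "ptime (\<lambda>p :: 'x \<times> nat list \<times> nat. exi word_algebra (snd (snd p)) (fst (snd p)))"
      by (intro ptime_word_algebra ptime)
  qed (unfold word_algebra_simps, rule sz_words)
  have uni: "ptime (\<lambda>x. foldr (uni word_algebra) (f x) (g x))" if "ptime f" "ptime g" for f g :: "'x::coded => _"
  proof (rule ptime_foldr_add[OF _ that])
    show "ptime (\<lambda>p :: 'x \<times> nat list \<times> nat. uni word_algebra (snd (snd p)) (fst (snd p)))"
      by (intro ptime_word_algebra ptime)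
  qed (unfold word_algebra_simps, rule sz_words)
  have "ptime (\<lambda>p. matrix_gen word_algebra (fst p) (fst (snd p)) (snd (snd p)))"
    unfolding matrix_gen_def Let_def
    by (intro con mem chains ptime_word_algebra ptime_variables ptime)
  then show ?thesis unfolding formula_gen_def
    by (intro exi uni ptime)
qed

section \<open>Recognition of instances and the parameter\<close>

definition component :: "tree => nat => tree" where
  "component T i = nth_or (Num 0) (kids T) i"

definition num_list :: "tree => bool" where
  "num_list t \<longleftrightarrow> \<not> is_num t \<and> list_all is_num (kids t)"

lemma ptime_component [ptime]:
  "ptime f ==> ptime i ==> ptime (\<lambda>x. component (f x) (i x))" "ptime f ==> ptime (\<lambda>x. num_list (f x))"
  unfolding component_def num_list_def by (intro ptime; assumption)+

lemma is_num_iff: "is_num t \<longleftrightarrow> (\<exists>n. t = Num n)"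
  by (cases t) auto

lemma num_list_iff: "num_list t \<longleftrightarrow> (\<exists>ns. t = nums ns)"
proof
  assume *: "num_list t"
  then obtain ts where ts: "t = Node ts" "list_all is_num ts" by (cases t) (auto simp: num_list_def)
  then have "ts = map Num (map (val \<circ> num_bits) ts)"
    by (induction ts arbitrary: t) (auto elim: is_numE)
  then show "\<exists>ns. t = nums ns" using ts by (metis nums_def)
qed (auto simp: num_list_def nums_def list_all_iff)

definition alt3_tree :: "tree => bool" where
  "alt3_tree T \<longleftrightarrow> \<not> is_num T \<and> length (kids T) = 7 \<and>
     list_all (\<lambda>i. num_list (component T i) \<and> distinct (kids (component T i))) [0, 2, 4] \<and>
     list_all (\<lambda>i. is_num (component T i)) [1, 3, 5, 6]"

lemma alt3_tree_iff:
  "alt3_tree T \<longleftrightarrow> (\<exists>xs k ys l zs m t. distinct xs \<and> distinct ys \<and> distinct zs \<and>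
     T = Node [nums xs, Num k, nums ys, Num l, nums zs, Num m, Num t])"
proof
  assume *: "alt3_tree T"
  then obtain t0 t1 t2 t3 t4 t5 t6 where T: "T = Node [t0, t1, t2, t3, t4, t5, t6]"
    by (cases T) (auto simp: alt3_tree_def numeral_eq_Suc length_Suc_conv)
  then have "num_list t0" "num_list t2" "num_list t4" "is_num t1" "is_num t3" "is_num t5" "is_num t6"
    "distinct (kids t0)" "distinct (kids t2)" "distinct (kids t4)"
    using * by (simp_all add: alt3_tree_def component_def nth_or_def)
  moreover have "distinct (kids (nums ns)) = distinct ns" for ns
    by (simp add: nums_def distinct_map inj_on_def)
  ultimately show "\<exists>xs k ys l zs m t. distinct xs \<and> distinct ys \<and> distinct zs \<and>
     T = Node [nums xs, Num k, nums ys, Num l, nums zs, Num m, Num t]"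
    unfolding T num_list_iff is_num_iff by auto
next
  have "distinct (map Num xs) = distinct xs" for xs by (simp add: distinct_map inj_on_def)
  then show "\<exists>xs k ys l zs m t. distinct xs \<and> distinct ys \<and> distinct zs \<and>
     T = Node [nums xs, Num k, nums ys, Num l, nums zs, Num m, Num t] ==> alt3_tree T"
    by (auto simp: alt3_tree_def component_def nth_or_def num_list_def nums_def list_all_iff)
qed

lemma ptime_alt3_tree [ptime]:
  assumes "ptime f" shows "ptime (\<lambda>x. alt3_tree (f x))"
  unfolding alt3_tree_def by (intro ptime assms ptime_compose_fst[OF assms])

text \<open>\<open>k\<close>, \<open>l\<close> and \<open>m\<close> may be exponentially large in
  the length of the word, so the parameter is computed in binary.\<close>

definition parameter_word :: "nat list => nat list" where
  "parameter_word w = (case parse w of [] => [1] | T # _ => if alt3_tree T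
     then (let s = add_bits (num_bits (component T 1)) (add_bits (num_bits (component T 3)) (num_bits (component T 5)))
       in if s = [] then [1] else s)
     else [1])"

text \<open>Splits along the definition of the encoding and provides the outcome of the executable
  test in either case.\<close>

lemma alt3_instance_cases:
  obtains xs k ys l zs m t where "distinct xs" "distinct ys" "distinct zs" "w = enc_alt3 xs k ys l zs m t"
    "parse w = [Node [nums xs, Num k, nums ys, Num l, nums zs, Num m, Num t]]"
    "alt3_tree (Node [nums xs, Num k, nums ys, Num l, nums zs, Num m, Num t])"
  | "\<nexists>xs k ys l zs m t. distinct xs \<and> distinct ys \<and> distinct zs \<and> w = enc_alt3 xs k ys l zs m t"
    "parse w = [] \<or> (\<exists>T. parse w = [T] \<and> \<not> alt3_tree T)"
proof (cases "\<exists>xs k ys l zs m t. distinct xs \<and> distinct ys \<and> distinct zs \<and> w = enc_alt3 xs k ys l zs m t")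
  case True
  then obtain xs k ys l zs m t where *: "distinct xs" "distinct ys" "distinct zs" "w = enc_alt3 xs k ys l zs m t" by blast
  have "parse w = [Node [nums xs, Num k, nums ys, Num l, nums zs, Num m, Num t]]"
    unfolding parse_iff *(4) enc_alt3_def ..
  moreover have "alt3_tree (Node [nums xs, Num k, nums ys, Num l, nums zs, Num m, Num t])"
    using * alt3_tree_iff by blast
  ultimately show ?thesis using * that(1) by blast
next
  case False
  have "\<not> alt3_tree T" if "parse w = [T]" for T
    using that False unfolding parse_iff alt3_tree_iff enc_alt3_def by blast
  then show ?thesis using False parse_cases[of w] that(2) by blast
qed

lemma bits_1: "bits 1 = [1]"
  by (simp add: bits.simps)

lemma parameter_word: "parameter_word w = bits (alt3_param w)"
proof (cases w rule: alt3_instance_cases)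
  case (1 xs k ys l zs m t)
  have "bits (max 1 n) = (if bits n = [] then [1] else bits n)" for n
    by (cases n) (auto simp: bits_1[unfolded One_nat_def] max_def)
  then show ?thesis
    unfolding 1(4) alt3_param_enc[OF 1(1-3)]
    using 1(5,6) by (simp add: parameter_word_def 1(4) component_def nth_or_def add_bits Let_def add.assoc)
next
  case 2
  then have "alt3_param w = 1" unfolding alt3_param_def by (simp only: if_False)
  then show ?thesis using 2(2) bits_1 by (auto simp: parameter_word_def)
qed

lemma alt3_param_pos: "alt3_param w > 0"
proof (cases w rule: alt3_instance_cases)
  case (1 xs k ys l zs m t)
  then show ?thesis by (simp add: alt3_param_enc)
next
  case 2
  then show ?thesis unfolding alt3_param_def by (simp only: if_False)
qed

lemma ptime_parameter_word: "ptime parameter_word"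
proof -
  have "ptime (\<lambda>w. parameter_word w)" unfolding parameter_word_def Let_def by (intro ptime)
  then show ?thesis .
qed

lemma is_param_problem_alt3: "is_param_problem p_alt3_sss"
proof -
  have "finite code_alphabet" "code_alphabet \<noteq> {}" by (simp_all add: code_alphabet_def)
  moreover have "(\<lambda>w. bits (alt3_param w)) ` lists code_alphabet \<subseteq> lists {0, 1}" using bits_in_lists by blast
  then obtain M k where "tm_for code_alphabet M"
    "\<forall>x\<in>lists code_alphabet. tm_outputs_within M x (bits (alt3_param x)) ((length x + 3) ^ k)"
    using ptime_computable_in_time[of "\<lambda>w. bits (alt3_param w)" code_alphabet "{0, 1}"] calculation
      ptime_parameter_word unfolding parameter_word[abs_def] by auto
  then have "\<exists>p :: nat poly. computable_in_time code_alphabet (\<lambda>x. bits (alt3_param x)) (\<lambda>x. poly p (length x))"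
    unfolding computable_in_time_def
    by (intro exI[of _ "[:3, 1:] ^ k"] exI[of _ M] conjI) (simp_all only: poly_power_bound)
  moreover have "yes_instances p_alt3_sss \<subseteq> lists code_alphabet"
    using enc_in_lists unfolding p_alt3_sss_def enc_alt3_def param_problem.select_convs by blast
  ultimately show ?thesis
    using alt3_param_pos by (simp add: is_param_problem_def parameterisation_def p_alt3_sss_def)
qed

text \<open>
  A size above the number of elements can be replaced by that number plus one, which makes the sizes
  available in unary.
\<close>

definition clamp :: "nat => tree => nat" where
  "clamp n t = length (takeWhile (\<lambda>j. Num j \<noteq> t) [0..<Suc n])"

lemma clamp: "clamp n (Num k) = min k (Suc n)"
proof -
  have "length (takeWhile (\<lambda>j. j \<noteq> k) [0..<N]) = min k N" for N
  proof (induction N)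
    case (Suc N)
    show ?case
    proof (cases "k < N")
      case True
      then have "takeWhile (\<lambda>j. j \<noteq> k) ([0..<N] @ [N]) = takeWhile (\<lambda>j. j \<noteq> k) [0..<N]"
        by (intro takeWhile_append1[of k]) auto
      then show ?thesis using Suc True by simp
    next
      case False
      then have "takeWhile (\<lambda>j. j \<noteq> k) ([0..<N] @ [N]) = [0..<N] @ takeWhile (\<lambda>j. j \<noteq> k) [N]"
        by (intro takeWhile_append2) auto
      then show ?thesis using False by auto
    qed
  qed simp
  then show ?thesis by (simp add: clamp_def del: upt_Suc)
qed

lemma ptime_clamp [ptime]:
  assumes "ptime n" "ptime t" shows "ptime (\<lambda>x. clamp (n x) (t x))"
  unfolding clamp_def by (intro ptime assms ptime_compose_fst[OF assms(2)])

text \<open>No subset of a finite set has more elements than the set, so all sizes above the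
  cardinality are equally impossible.\<close>

lemma alt3_sss_clamp:
  assumes "finite A" "finite B" "finite C"
  shows "(A, min k (Suc (card A)), B, min l (Suc (card B)), C, min m (Suc (card C)), t) \<in> alt3_sss \<longleftrightarrow>
    (A, k, B, l, C, m, t) \<in> alt3_sss"
proof -
  have "card X = min n (Suc (card Y)) \<longleftrightarrow> card X = n" if "finite Y" "X \<subseteq> Y" for X Y :: "nat set" and n
    using card_mono[OF that] by (auto simp: min_def)
  note eq = this[OF assms(1)] this[OF assms(2)] this[OF assms(3)]
  show ?thesis unfolding alt3_sss_def by (simp add: assms eq cong: conj_cong imp_cong)
qed

definition sss_word :: "nat list list => nat list list => nat list list => nat => nat => nat => nat list => nat => nat list" where
  "sss_word a b c k l m t U = wnode [wnode (map wname [0..<U]),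
     wnode (map (\<lambda>p. wnode [wnum (fst p), wnode (map (\<lambda>js. wnode (map wname js)) (snd p))]) (sss_relations a b c t U)),
     formula_gen word_algebra k l m]"

text \<open>The empty word is not the code of any instance; as an input of the target problem it is
  a negative instance with parameter 1.\<close>

definition sss_to_mc :: "nat list => nat list" where
  "sss_to_mc w = (case parse w of [] => [] | T # _ => if \<not> alt3_tree T then [] else
     let a = map num_bits (kids (component T 0)); b = map num_bits (kids (component T 2));
       c = map num_bits (kids (component T 4)); t = num_bits (component T 6);
       L = length (concat (a @ b @ c)) + length (a @ b @ c) + length t + 1
     in sss_word a b c (clamp (length a) (component T 1)) (clamp (length b) (component T 3))
       (clamp (length c) (component T 5)) t (16 * (L * L * L)))"

lemma ptime_sss_word:
  assumes "ptime a" "ptime b" "ptime c" "ptime k" "ptime l" "ptime m" "ptime t" "ptime U"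
  shows "ptime (\<lambda>x. sss_word (a x) (b x) (c x) (k x) (l x) (m x) (t x) (U x))"
proof -
  have "ptime (\<lambda>x. formula_gen word_algebra (k x) (l x) (m x))"
    using ptime_apply3[OF ptime_formula assms(4-6)] .
  moreover have "ptime (\<lambda>x. sum_tuples (a x @ b x @ c x) (U x))"
    unfolding sum_tuples_def
    by (intro ptime assms ptime_compose_fst assms)
  ultimately show ?thesis
    unfolding sss_word_def sss_relations_def by (intro ptime assms ptime_compose_fst[OF assms(7)])
qed

definition named :: "(nat \<times> nat list list) list => (nat \<times> nat list list) list" where
  "named Rs = map (\<lambda>(r, X). (r, map (map nm) X)) Rs"

lemma sss_word: "sss_word a b c k l m t U =
    enc_mc (map nm [0..<U]) (named (sss_relations a b c t U)) (formula_gen form_algebra k l m)"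
proof -
  have "enc (nums (map nm js)) = wnode (map wname js)" for js
    by (simp add: enc_words comp_def del: enc.simps)
  then show ?thesis
    unfolding sss_word_def enc_mc_def named_def
    by (simp add: enc_words comp_def case_prod_unfold form_word_formula[symmetric] form_word_def del: enc.simps)
qed

lemma free_vars_foldr:
  "free_vars (foldr (\<lambda>j. Exi (nm j)) js \<phi>) = free_vars \<phi> - nm ` set js"
  "free_vars (foldr (\<lambda>j. Uni (nm j)) js \<phi>) = free_vars \<phi> - nm ` set js"
  "free_vars (foldr Conj \<phi>s \<phi>) = \<Union> (free_vars ` set \<phi>s) \<union> free_vars \<phi>"
  by (induction js; auto; fail)+ (induction \<phi>s; auto)

lemma quantifier_free_conjs: "quantifier_free (foldr Conj \<phi>s \<phi>) \<longleftrightarrow> (\<forall>\<psi>\<in>set \<phi>s. quantifier_free \<psi>) \<and> quantifier_free \<phi>"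
  by (induction \<phi>s) auto

lemma over_foldr:
  "over A (foldr (\<lambda>j. Exi (nm j)) js \<phi>) = over A \<phi>"
  "over A (foldr (\<lambda>j. Uni (nm j)) js \<phi>) = over A \<phi>"
  "over A (foldr Conj \<phi>s \<phi>) \<longleftrightarrow> (\<forall>\<psi>\<in>set \<phi>s. over A \<psi>) \<and> over A \<phi>"
  by (induction js; auto; fail)+ (induction \<phi>s; auto)

lemma free_vars_matrix:
  "free_vars (matrix_gen form_algebra k l m) \<subseteq> nm ` {..<k + l + Suc m + (m + Suc m * Suc (k + l + m))}"
proof -
  define N where "N = k + l + Suc m + (m + Suc m * Suc (k + l + m))"
  have partial: "partial k l m i j < N" if "i \<le> m" "j \<le> k + l + m" for i j
  proof -
    have "i * Suc (k + l + m) \<le> m * Suc (k + l + m)" using that(1) by (rule mult_right_mono) simp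
    then show ?thesis using that(2) by (simp add: partial_def N_def)
  qed
  have modulus: "modulus k l i < N" if "i \<le> m" for i using that by (simp add: modulus_def N_def)
  have summand: "summand k l m j < N" if "j < k + l + m" for j using that by (simp add: summand_def N_def)
  have mem: "free_vars \<phi> \<subseteq> nm ` {..<N}" if "\<phi> \<in> set (members_gen form_algebra r js)" "set js \<subseteq> {..<N}" for \<phi> r js
  proof -
    have "free_vars \<phi> \<subseteq> nm ` set js" using that(1) by (auto simp: members_gen_def distinct_gen_def)
    then show ?thesis using that(2) by blast
  qed
  have chains: "free_vars \<phi> \<subseteq> nm ` {..<N}" if "\<phi> \<in> set (chains_gen form_algebra k l m)" for \<phi>
    using that partial modulus summand unfolding chains_gen_def
    by (auto simp: less_Suc_eq_le simp del: upt_Suc)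
  have m0: "modulus k l 0 < N" using modulus[of 0] by simp
  have sets: "set [0..<k] \<subseteq> {..<N}" "set (range_from k l) \<subseteq> {..<N}" "set (range_from (k + l + Suc m) m) \<subseteq> {..<N}"
    by (auto simp: N_def)
  have parts: "\<Union> (free_vars ` set (members_gen form_algebra 0 [0..<k])) \<subseteq> nm ` {..<N}"
    "\<Union> (free_vars ` set (members_gen form_algebra 1 (range_from k l))) \<subseteq> nm ` {..<N}"
    "\<Union> (free_vars ` set (members_gen form_algebra 2 (range_from (k + l + Suc m) m))) \<subseteq> nm ` {..<N}"
    "\<Union> (free_vars ` set (chains_gen form_algebra k l m)) \<subseteq> nm ` {..<N}"
    using mem[OF _ sets(1)] mem[OF _ sets(2)] mem[OF _ sets(3)] chains by (blast intro: UN_least)+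
  show ?thesis
    unfolding matrix_gen_def Let_def form_algebra_simps free_vars.simps free_vars_foldr N_def[symmetric] set_append image_Un
      Union_Un_distrib
    using parts m0 by (intro Un_least) auto
qed

lemma quantifier_free_matrix: "quantifier_free (matrix_gen form_algebra k l m)"
  unfolding matrix_gen_def Let_def form_algebra_simps quantifier_free.simps quantifier_free_conjs
  by (auto simp: members_gen_def distinct_gen_def chains_gen_def)

lemma sss_formula_sentence: "free_vars (formula_gen form_algebra k l m) = {}"
proof -
  have "{..<k + l + Suc m + (m + Suc m * Suc (k + l + m))} \<subseteq> set [0..<k] \<union> set (range_from k (l + Suc m)) \<union>
     set (range_from (k + l + Suc m) (m + Suc m * Suc (k + l + m)))" by auto
  then show ?thesis using free_vars_matrix[of k l m]
    unfolding formula_gen_def form_algebra_simps free_vars_foldr by blast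
qed

lemma sss_formula_Sigma: "is_Sigma 3 (formula_gen form_algebra k l m)"
proof -
  have "foldr (\<lambda>j. Exi (nm j)) js \<phi> = foldr Exi (map nm js) \<phi>" "foldr (\<lambda>j. Uni (nm j)) js \<phi> = foldr Uni (map nm js) \<phi>" for js \<phi>
    by (simp_all add: foldr_map comp_def)
  then show ?thesis
    unfolding formula_gen_def form_algebra_simps numeral_3_eq_3 is_Sigma.simps is_Pi.simps
    using quantifier_free_matrix by metis
qed

lemma sss_relations_tuples:
  assumes "length a + length b + length c < U" "(r, X) \<in> set (sss_relations a b c t U)" "x \<in> set X"
  shows "length x = r \<and> set x \<subseteq> {..<U} \<and> 1 \<le> r"
proof -
  have "val t mod Suc q < U" "(s + v) mod Suc q < U" if "q < U" for q s v
    using that mod_less_divisor[of "Suc q"] by (metis le_less_trans less_Suc_eq_le zero_less_Suc)+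
  then show ?thesis using assms
    by (auto simp: sss_relations_def set_sum_tuples residue)
qed

lemma sss_relations_distinct: "(r, X) \<in> set (sss_relations a b c t U) ==> distinct X"
  by (auto simp: sss_relations_def distinct_map inj_on_def range_from_def)

lemma over_sss: "over (sss_structure a b c t U) (formula_gen form_algebra k l m)"
proof -
  let ?A = "sss_structure a b c t U"
  have len: "length (relations ?A) = 6" by (simp add: sss_structure_def listed_structure_def sss_relations_def)
  have ar: "fst (relations ?A ! r) = [1, 1, 1, 4, 2, 1] ! r" if "r < 6" for r
    using that by (auto simp: sss_structure_def listed_structure_def sss_relations_def numeral_eq_Suc less_Suc_eq)
  have mem: "over ?A \<phi>" if "\<phi> \<in> set (members_gen form_algebra r js)" "r < 3" for \<phi> r js
    using that by (auto simp: members_gen_def distinct_gen_def len ar numeral_eq_Suc less_Suc_eq)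
  have chains: "over ?A \<phi>" if "\<phi> \<in> set (chains_gen form_algebra k l m)" for \<phi>
    using that by (auto simp: chains_gen_def len ar numeral_eq_Suc)
  show ?thesis
    unfolding formula_gen_def matrix_gen_def Let_def form_algebra_simps over_foldr over.simps
    using mem[of _ 0] mem[of _ 1] mem[of _ 2] chains by auto
qed

lemma sss_mc_instance:
  assumes U: "length a + length b + length c < U"
  shows "mc_instance 3 (map nm [0..<U]) (named (sss_relations a b c t U)) (formula_gen form_algebra k l m)"
proof -
  have A: "listed_structure (map nm [0..<U]) (named (sss_relations a b c t U)) = sss_structure a b c t U"
    by (simp add: sss_structure_def named_def)
  have "wf_structure (sss_structure a b c t U)"
    unfolding wf_structure_def universe_sss
  proof (intro conjI ballI)
    show "nm ` {..<U} \<noteq> {}" using U by auto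
    fix rR assume "rR \<in> set (relations (sss_structure a b c t U))"
    then obtain r X where rX: "(r, X) \<in> set (sss_relations a b c t U)" "rR = (r, map nm ` set X)"
      by (auto simp: sss_structure_def listed_structure_def)
    have "r \<ge> 1" using rX(1) by (auto simp: sss_relations_def)
    then show "case rR of (r, R) => r \<ge> 1 \<and> (\<forall>as\<in>R. length as = r \<and> set as \<subseteq> nm ` {..<U})"
      using sss_relations_tuples[OF U rX(1)] by (auto simp: rX(2))
  qed simp
  moreover have "\<forall>(r, R)\<in>set (named (sss_relations a b c t U)). distinct R"
    using sss_relations_distinct by (fastforce simp: named_def distinct_map inj_on_def)
  moreover have "distinct (map nm [0..<U])" by (simp add: distinct_map inj_on_def)
  ultimately show ?thesis
    unfolding mc_instance_def A using over_sss sss_formula_sentence sss_formula_Sigma by blast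
qed

lemma ptime_sss_to_mc: "ptime sss_to_mc"
proof -
  have "ptime (\<lambda>w. sss_to_mc w)"
    unfolding sss_to_mc_def Let_def by (intro ptime_sss_word ptime)
  then show ?thesis .
qed

lemma sss_to_mc_instance:
  assumes "distinct xs" "distinct ys" "distinct zs"
  obtains a b c U t' where "sss_to_mc (enc_alt3 xs k ys l zs m t) =
     enc_mc (map nm [0..<U]) (named (sss_relations a b c t' U))
       (formula_gen form_algebra (min k (Suc (length xs))) (min l (Suc (length ys))) (min m (Suc (length zs))))"
    "length a + length b + length c < U"
    "models (sss_structure a b c t' U) (formula_gen form_algebra (min k (Suc (length xs))) (min l (Suc (length ys))) (min m (Suc (length zs)))) \<longleftrightarrow>
      (set xs, k, set ys, l, set zs, m, t) \<in> alt3_sss"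
proof -
  let ?T = "Node [nums xs, Num k, nums ys, Num l, nums zs, Num m, Num t]"
  let ?a = "map bits xs" and ?b = "map bits ys" and ?c = "map bits zs"
  let ?L = "length (concat (?a @ ?b @ ?c)) + length (?a @ ?b @ ?c) + length (bits t) + 1"
  let ?U = "16 * ?L ^ 3"
  have p: "parse (enc_alt3 xs k ys l zs m t) = [?T]" unfolding parse_iff enc_alt3_def ..
  have ok: "alt3_tree ?T" using assms alt3_tree_iff by blast
  have kids: "map num_bits (kids (nums ns)) = map bits ns" for ns by (simp add: nums_def)
  have 1: "sss_to_mc (enc_alt3 xs k ys l zs m t) = enc_mc (map nm [0..<?U]) (named (sss_relations ?a ?b ?c (bits t) ?U))
       (formula_gen form_algebra (min k (Suc (length xs))) (min l (Suc (length ys))) (min m (Suc (length zs))))"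
    unfolding sss_word[symmetric] sss_to_mc_def p
    using ok by (simp add: component_def nth_or_def kids clamp Let_def power3_eq_cube)
  have "?L \<le> ?U" using self_le_power[of ?L 3] by simp
  then have 2: "length ?a + length ?b + length ?c < ?U" by simp
  have vals: "map val (map bits ns) = ns" "val ` set (map bits ns) = set ns" for ns
    by (induction ns) auto
  have "models (sss_structure ?a ?b ?c (bits t) ?U) (formula_gen form_algebra (min k (Suc (length xs))) (min l (Suc (length ys))) (min m (Suc (length zs)))) \<longleftrightarrow>
      (set xs, min k (Suc (length xs)), set ys, min l (Suc (length ys)), set zs, min m (Suc (length zs)), t) \<in> alt3_sss"
    using sss_formula[of ?a ?b ?c ?L "bits t" ?U, OF _ _ _ refl refl] assms unfolding vals val_bits by blast
  also have "\<dots> \<longleftrightarrow> (set xs, k, set ys, l, set zs, m, t) \<in> alt3_sss"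
    using alt3_sss_clamp[of "set xs" "set ys" "set zs"] assms by (simp add: distinct_card)
  finally show ?thesis using 1 2 that by blast
qed

lemma enc_mc_in_lists: "enc_mc us Rs \<phi> \<in> lists code_alphabet"
  unfolding enc_mc_def by (rule enc_in_lists)

text \<open>The bound on the new parameter comes from the time bound: the code of the formula is a
  polynomial-time function of \<open>k\<close>, \<open>l\<close>, \<open>m\<close> in unary, so its
  length is polynomial in their sum. Clamping does not increase the sizes.\<close>

lemma sss_reducible_to_mc: "fpt_reducible p_alt3_sss (p_mc 3)"
proof -
  obtain d where d': "\<forall>p. sz (formula_gen word_algebra (fst p) (fst (snd p)) (snd (snd p))) \<le> (sz p + 2) ^ d"
    using ptime_sz[OF ptime_formula] unfolding pbound_def ..
  have d: "sz (formula_gen word_algebra k l m) \<le> (sz (k, l, m) + 2) ^ d" for k l m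
    using spec[OF d', of "(k, l, m)"] unfolding fst_conv snd_conv .
  have Nil_no: "[] \<noteq> enc_mc us Rs \<phi>" for us Rs \<phi> unfolding enc_mc_def enc.simps by (rule list.distinct(1))
  have main: "sss_to_mc w \<in> lists code_alphabet \<and> (w \<in> yes_instances p_alt3_sss \<longleftrightarrow> sss_to_mc w \<in> yes_instances (p_mc 3)) \<and>
     mc_param 3 (sss_to_mc w) \<le> (alt3_param w + 2) ^ (4 * d)" for w
  proof (cases w rule: alt3_instance_cases)
    case (1 xs k ys l zs m t)
    let ?k = "min k (Suc (length xs))" and ?l = "min l (Suc (length ys))" and ?m = "min m (Suc (length zs))"
    obtain a b c U t' where *: "sss_to_mc w = enc_mc (map nm [0..<U]) (named (sss_relations a b c t' U))
       (formula_gen form_algebra ?k ?l ?m)"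
    "length a + length b + length c < U"
    "models (sss_structure a b c t' U) (formula_gen form_algebra ?k ?l ?m) \<longleftrightarrow> (set xs, k, set ys, l, set zs, m, t) \<in> alt3_sss"
      by (rule sss_to_mc_instance[OF 1(1-3), of k l m t, folded 1(4)]) (rule that)
    note inst = sss_mc_instance[OF *(2), of t' ?k ?l ?m]
    have A: "listed_structure (map nm [0..<U]) (named (sss_relations a b c t' U)) = sss_structure a b c t' U"
      by (simp add: sss_structure_def named_def)
    have "w \<in> yes_instances p_alt3_sss \<longleftrightarrow> (set xs, k, set ys, l, set zs, m, t) \<in> alt3_sss"
      using 1(1-3) unfolding p_alt3_sss_def 1(4) by auto
    also have "\<dots> \<longleftrightarrow> sss_to_mc w \<in> yes_instances (p_mc 3)"
      using inst *(3) unfolding p_mc_def *(1) by (auto simp: A)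
    finally have yes: "w \<in> yes_instances p_alt3_sss \<longleftrightarrow> sss_to_mc w \<in> yes_instances (p_mc 3)" .
    have "mc_param 3 (sss_to_mc w) = form_size (formula_gen form_algebra ?k ?l ?m)"
      unfolding *(1) by (rule mc_param_enc[OF inst])
    also have "\<dots> = length (formula_gen word_algebra ?k ?l ?m)"
      unfolding form_size_def form_word_formula[symmetric] form_word_def ..
    also have "\<dots> \<le> (sz (?k, ?l, ?m) + 2) ^ d" using length_le_sz d le_trans by blast
    also have "\<dots> \<le> ((alt3_param w + 2) ^ 4) ^ d"
    proof (rule power_mono)
      let ?p = "alt3_param w"
      have "?k + ?l + ?m \<le> ?p" unfolding 1(4) alt3_param_enc[OF 1(1-3)] by simp
      then have "sz (?k, ?l, ?m) + 2 \<le> 2 * ?p + 7" by simp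
      also have "\<dots> \<le> 8 * (?p + 2)" by simp
      also have "\<dots> \<le> (?p + 2) ^ 3 * (?p + 2)" using power_mono[of 2 "?p + 2" 3] by (intro mult_right_mono) auto
      also have "\<dots> = (?p + 2) ^ 4" by (simp add: numeral_eq_Suc)
      finally show "sz (?k, ?l, ?m) + 2 \<le> (?p + 2) ^ 4" .
    qed simp
    finally have "mc_param 3 (sss_to_mc w) \<le> (alt3_param w + 2) ^ (4 * d)" by (simp add: power_mult)
    then show ?thesis using yes enc_mc_in_lists unfolding *(1) by blast
  next
    case 2
    have "sss_to_mc w = []" using 2(2) by (auto simp: sss_to_mc_def)
    moreover have "mc_param 3 [] = 1" using Nil_no unfolding mc_param_def by (simp only: if_False simp_thms)
    moreover have "w \<notin> yes_instances p_alt3_sss" using 2(1) unfolding p_alt3_sss_def by auto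
    moreover have "[] \<notin> yes_instances (p_mc 3)" using Nil_no unfolding p_mc_def by auto
    moreover have "1 \<le> (alt3_param w + 2) ^ (4 * d)" by (rule one_le_power) simp
    ultimately show ?thesis by simp
  qed
  have "alphabet p_alt3_sss = code_alphabet" "alphabet (p_mc 3) = code_alphabet"
    "parameter p_alt3_sss = alt3_param" "parameter (p_mc 3) = mc_param 3" "finite code_alphabet"
    by (simp_all add: p_alt3_sss_def p_mc_def code_alphabet_def)
  then show ?thesis
    using main by (intro fpt_reducible_ptime[OF ptime_sss_to_mc, where d = "4 * d"]) auto
qed

section \<open>Exact covers as subset sums\<close>


text \<open>
  A set is represented by its characteristic sequence in base \<open>2 ^ (g + 1)\<close>, so that sums of at
  most \<open>g\<close> numbers are free of carries and the all-ones number is the sum of an exact cover.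
\<close>

primrec code :: "nat => 'a list => 'a set => nat" where
  "code g [] S = 0"
| "code g (q # D) S = of_bool (q \<in> S) + 2 ^ Suc g * code g D S"

lemma digit_eq:
  fixes a b c d B :: nat
  assumes "a < B" "c < B" "a + B * b = c + B * d"
  shows "a = c \<and> b = d"
proof -
  have "(a + B * b) mod B = a" "(c + B * d) mod B = c" "(a + B * b) div B = b" "(c + B * d) div B = d"
    using assms(1,2) by auto
  then show ?thesis using assms(3) by metis
qed

lemma code_inj: "code g D S = code g D S' ==> S \<inter> set D = S' \<inter> set D"
proof (induction D)
  case (Cons q D)
  have "of_bool (q \<in> S) < (2::nat) ^ Suc g" "of_bool (q \<in> S') < (2::nat) ^ Suc g"
    using one_less_power[of "2::nat" "Suc g"] by (auto simp: of_bool_def simp del: power_Suc)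
  then have "(of_bool (q \<in> S) :: nat) = of_bool (q \<in> S') \<and> code g D S = code g D S'"
    using Cons.prems unfolding code.simps by (rule digit_eq)
  then have "q \<in> S \<longleftrightarrow> q \<in> S'" "S \<inter> set D = S' \<inter> set D" using Cons.IH by (simp_all only: of_bool_eq_iff)
  then show ?case by (simp add: Int_insert_right)
qed simp

text \<open>The digit at \<open>q\<close> of the sum counts the sets that contain \<open>q\<close>.
  The counts are below the base, so no carries occur and the digits can be compared one by
  one.\<close>

lemma code_sum:
  assumes fin: "finite B" and card: "card B < 2 ^ Suc g"
  shows "(\<Sum>I\<in>B. code g D I) = code g D UNIV \<longleftrightarrow> (\<forall>q\<in>set D. \<exists>!I. I \<in> B \<and> q \<in> I)"
proof (induction D)
  case (Cons q D)
  have unique: "(\<exists>x. \<forall>y. P y \<longleftrightarrow> y = x) \<longleftrightarrow> (\<exists>!y. P y)" for P :: "'a set => bool" by blast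
  have sum: "(\<Sum>I\<in>B. code g (q # D) I) = card {I \<in> B. q \<in> I} + 2 ^ Suc g * (\<Sum>I\<in>B. code g D I)"
    using fin by (simp add: sum.distrib sum_distrib_left Int_def)
  have "card {I \<in> B. q \<in> I} \<le> card B" using fin by (intro card_mono) auto
  then have less: "card {I \<in> B. q \<in> I} < 2 ^ Suc g" "1 < (2::nat) ^ Suc g"
    using card one_less_power[of "2::nat" "Suc g"] by simp_all
  have "(\<Sum>I\<in>B. code g (q # D) I) = code g (q # D) UNIV \<longleftrightarrow>
      card {I \<in> B. q \<in> I} + 2 ^ Suc g * (\<Sum>I\<in>B. code g D I) = 1 + 2 ^ Suc g * code g D UNIV"
    unfolding sum by simp
  also have "\<dots> \<longleftrightarrow> card {I \<in> B. q \<in> I} = 1 \<and> (\<Sum>I\<in>B. code g D I) = code g D UNIV"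
    using digit_eq[OF less, of "\<Sum>I\<in>B. code g D I" "code g D UNIV"] by (intro iffI) (assumption | simp)+
  also have "card {I \<in> B. q \<in> I} = 1 \<longleftrightarrow> (\<exists>!I. I \<in> B \<and> q \<in> I)"
    using unique[of "\<lambda>I. I \<in> B \<and> q \<in> I"]
    unfolding One_nat_def card_1_singleton_iff set_eq_iff[of _ "{_}"] mem_Collect_eq singleton_iff .
  finally show ?case by (simp only: Cons.IH list.set ball_simps)
qed simp

definition cover_game :: "'a list => 'a set set => nat => 'a set set => nat => 'a set set => nat => bool" where
  "cover_game D A1 k A2 l A3 m \<longleftrightarrow>
     (\<exists>B1\<subseteq>A1. card B1 = k \<and> (\<forall>B2\<subseteq>A2. card B2 = l \<longrightarrow> (\<exists>B3\<subseteq>A3. card B3 = m \<and>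
       (\<forall>q\<in>set D. \<exists>!I. I \<in> B1 \<union> B2 \<union> B3 \<and> q \<in> I))))"

text \<open>On sets of keys \<open>code\<close> is injective, so sets of numbers correspond to
  families of sets of the same cardinality. As the three families are disjoint, the three sums add
  up to the sum over the union. The target \<open>f UNIV\<close> has the digit 1 at every
  key.\<close>

lemma cover_game_alt3:
  assumes fin: "finite A1" "finite A2" "finite A3"
    and disj: "A1 \<inter> A2 = {}" "A1 \<inter> A3 = {}" "A2 \<inter> A3 = {}"
    and sub: "\<And>I. I \<in> A1 \<union> A2 \<union> A3 ==> I \<subseteq> set D"
    and f_def: "f = code (k + l + m) D"
  shows "(f ` A1, k, f ` A2, l, f ` A3, m, f UNIV) \<in> alt3_sss \<longleftrightarrow> cover_game D A1 k A2 l A3 m"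
proof -
  have "I = J" if "I \<in> A1 \<union> A2 \<union> A3" "J \<in> A1 \<union> A2 \<union> A3" "f I = f J" for I J
    using sub[OF that(1)] sub[OF that(2)] code_inj[OF that(3)[unfolded f_def]] by blast
  then have inj: "inj_on f (A1 \<union> A2 \<union> A3)" by (intro inj_onI)
  have card: "card (f ` B) = card B" and sums: "\<Sum> (f ` B) = sum f B" if "B \<subseteq> A1 \<or> B \<subseteq> A2 \<or> B \<subseteq> A3" for B
  proof -
    have "inj_on f B" using that by (intro inj_on_subset[OF inj]) blast
    then show "card (f ` B) = card B" "\<Sum> (f ` B) = sum f B" by (simp_all add: card_image sum.reindex)
  qed
  have key: "\<Sum> (f ` B1) + \<Sum> (f ` B2) + \<Sum> (f ` B3) = f UNIV \<longleftrightarrow> (\<forall>q\<in>set D. \<exists>!I. I \<in> B1 \<union> B2 \<union> B3 \<and> q \<in> I)"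
    if B: "B1 \<subseteq> A1" "B2 \<subseteq> A2" "B3 \<subseteq> A3" "card B1 = k" "card B2 = l" "card B3 = m" for B1 B2 B3
  proof -
    have fins: "finite B1" "finite B2" "finite B3" using B fin by (blast intro: finite_subset)+
    have disjs: "B1 \<inter> B2 = {}" "(B1 \<union> B2) \<inter> B3 = {}" using B disj by blast+
    have "card (B1 \<union> B2 \<union> B3) \<le> k + l + m"
      using card_Un_le[of "B1 \<union> B2" B3] card_Un_le[of B1 B2] B by linarith
    moreover have "k + l + m < 2 ^ Suc (k + l + m)"
      using less_exp[of "Suc (k + l + m)"] by linarith
    ultimately have "card (B1 \<union> B2 \<union> B3) < 2 ^ Suc (k + l + m)" by linarith
    moreover have "\<Sum> (f ` B1) + \<Sum> (f ` B2) + \<Sum> (f ` B3) = sum f (B1 \<union> B2 \<union> B3)"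
      using B fins disjs by (simp add: sums sum.union_disjoint)
    ultimately show ?thesis using code_sum[of "B1 \<union> B2 \<union> B3"] fins unfolding f_def by simp
  qed
  have ex_sub: "(\<exists>B\<subseteq>f ` A. Q B) \<longleftrightarrow> (\<exists>B\<subseteq>A. Q (f ` B))" for A Q by (metis image_mono subset_imageE)
  have all_sub: "(\<forall>B\<subseteq>f ` A. Q B) \<longleftrightarrow> (\<forall>B\<subseteq>A. Q (f ` B))" for A Q by (metis image_mono subset_imageE)
  show ?thesis
    unfolding alt3_sss_def cover_game_def mem_Collect_eq prod.case ex_sub all_sub
    using fin key by (simp add: card cong: conj_cong imp_cong)
qed

text \<open>
  After removal of \<open>l\<close> points, a list falls apart into \<open>l + 1\<close> segments. In the game, this lets a number
  of items that is bounded by the parameter cover an arbitrarily large rest.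
\<close>

definition segments :: "'a list => 'a list list" where
  "segments K = concat (map (\<lambda>i. map (\<lambda>j. take j (drop i K)) [0..<Suc (length K)]) [0..<Suc (length K)])"

lemma in_segments: "s \<in> set (segments K) \<longleftrightarrow> (\<exists>us ws. K = us @ s @ ws)"
proof
  assume "s \<in> set (segments K)"
  then obtain i j where "s = take j (drop i K)" by (auto simp: segments_def simp del: upt_Suc)
  then have "K = take i K @ s @ drop j (drop i K)" by (simp only: append_take_drop_id)
  then show "\<exists>us ws. K = us @ s @ ws" by blast
next
  assume "\<exists>us ws. K = us @ s @ ws"
  then obtain us ws where K: "K = us @ s @ ws" by blast
  then have "s = take (length s) (drop (length us) K)" "length s < Suc (length K)" "length us < Suc (length K)" by auto
  then show "s \<in> set (segments K)" unfolding segments_def by (fastforce simp del: upt_Suc)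
qed

lemma segments_avoiding:
  assumes "distinct K" "finite P" "card P \<le> l"
  shows "\<exists>\<sigma>. (\<forall>s\<le>l. \<sigma> s \<in> set (segments K)) \<and> (\<forall>q\<in>set K - P. \<exists>!s. s \<le> l \<and> q \<in> set (\<sigma> s)) \<and>
    (\<forall>s\<le>l. set (\<sigma> s) \<inter> P = {})"
  using assms
proof (induction l arbitrary: K P)
  case 0
  then have "P = {}" by simp
  moreover have "K \<in> set (segments K)" unfolding in_segments by (metis append_Nil append_Nil2)
  ultimately show ?case by (intro exI[of _ "\<lambda>s. K"]) auto
next
  case (Suc l)
  show ?case
  proof (cases "set K \<inter> P = {}")
    case True
    have "[] \<in> set (segments K)" "K \<in> set (segments K)" unfolding in_segments by (metis append_Nil append_Nil2)+
    then show ?thesis using True by (intro exI[of _ "\<lambda>s. if s = 0 then K else []"]) auto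
  next
    case False
    then have "\<exists>p\<in>set K. p \<in> P" by blast
    \<comment> \<open>The list is cut at its first point in \<open>P\<close>: the part before it is
      one segment, and the part behind it has one point less to avoid.\<close>
    then obtain us p ws where K: "K = us @ p # ws" "p \<in> P" "\<forall>u\<in>set us. u \<notin> P"
      using split_list_first_prop[of K "\<lambda>p. p \<in> P"] by blast
    have "card (P - {p}) \<le> l" using Suc.prems K(2) by simp
    then obtain \<sigma> where \<sigma>: "\<forall>s\<le>l. \<sigma> s \<in> set (segments ws)" "\<forall>q\<in>set ws - (P - {p}). \<exists>!s. s \<le> l \<and> q \<in> set (\<sigma> s)"
      "\<forall>s\<le>l. set (\<sigma> s) \<inter> (P - {p}) = {}"
      using Suc.IH[of ws "P - {p}"] Suc.prems K(1) by auto
    have sub: "set (\<sigma> s) \<subseteq> set ws" if "s \<le> l" for s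
      using \<sigma>(1) that by (fastforce simp: in_segments)
    define \<tau> where "\<tau> s = (case s of 0 => us | Suc s => \<sigma> s)" for s
    have t1: "\<tau> s \<in> set (segments K)" if s: "s \<le> Suc l" for s
    proof (cases s)
      case 0
      have "K = [] @ us @ (p # ws)" using K by simp
      then show ?thesis unfolding in_segments 0 \<tau>_def nat.case by blast
    next
      case (Suc s')
      then obtain vs vs' where "ws = vs @ \<sigma> s' @ vs'" using \<sigma>(1) s Suc unfolding in_segments by auto
      then have "K = (us @ p # vs) @ \<sigma> s' @ vs'" using K by simp
      then show ?thesis unfolding in_segments Suc \<tau>_def nat.case by blast
    qed
    have t2: "\<exists>!s. s \<le> Suc l \<and> q \<in> set (\<tau> s)" if q: "q \<in> set K - P" for q
    proof (cases "q \<in> set us")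
      case True
      then have "q \<notin> set ws" using Suc.prems(1) K(1) by auto
      show ?thesis
      proof (rule ex1I[of _ 0])
        show "0 \<le> Suc l \<and> q \<in> set (\<tau> 0)" using True by (simp add: \<tau>_def)
        fix s assume "s \<le> Suc l \<and> q \<in> set (\<tau> s)"
        then show "s = 0" using sub \<open>q \<notin> set ws\<close> by (cases s) (auto simp: \<tau>_def)
      qed
    next
      case False
      then have "q \<in> set ws - (P - {p})" using q K by auto
      then obtain s where s: "s \<le> l" "q \<in> set (\<sigma> s)" "\<And>s'. s' \<le> l ==> q \<in> set (\<sigma> s') ==> s' = s"
        using bspec[OF \<sigma>(2), of q] by auto
      show ?thesis
      proof (rule ex1I[of _ "Suc s"])
        show "Suc s \<le> Suc l \<and> q \<in> set (\<tau> (Suc s))" using s(1,2) by (simp add: \<tau>_def)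
        fix s' assume "s' \<le> Suc l \<and> q \<in> set (\<tau> s')"
        then show "s' = Suc s" using s(3)[of "s' - 1"] False by (cases s') (auto simp: \<tau>_def)
      qed
    qed
    have t3: "set (\<tau> s) \<inter> P = {}" if "s \<le> Suc l" for s
    proof (cases s)
      case 0
      then show ?thesis using K(3) by (auto simp: \<tau>_def)
    next
      case (Suc s')
      have "p \<notin> set ws" using Suc.prems(1) K(1) by auto
      then show ?thesis using \<sigma>(3) sub that unfolding Suc \<tau>_def by fastforce
    qed
    show ?thesis
      by (intro exI[of _ \<tau>] conjI allI impI ballI; (rule t1 | rule t2 | rule t3); assumption)
  qed
qed

text \<open>
  A constraint consists of a list of variables and of a list of patterns; it holds if the values
  of the variables start with one of the patterns. Variables and values are trees: an element or
  a variable of a formula is a leaf, while a node stands for the truth value of a subformula.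
\<close>

type_synonym con = "tree list \<times> tree list list"

datatype group = Mode | Var tree | Con con | Fill con nat | Seg nat

datatype key = Group group | Active group | Xkey tree tree | Ykey tree tree | Occ con nat tree

definition holds :: "(tree => tree) => con => bool" where
  "holds a c \<longleftrightarrow> (\<exists>e\<in>set (snd c). e = map a (take (length e) (fst c)))"

definition scope :: "con => nat => tree" where
  "scope c p = nth_or (Num 0) (fst c) p"

locale csp =
  fixes xs ys zs us :: "tree list" and cs :: "con list"
begin

text \<open>
  The first two players choose values \<open>u\<close> for their variables \<open>v\<close> by covering \<open>Xkey v u\<close> and
  \<open>Ykey v u\<close>. The third player has to take one item from each group. The item for a variable covers
  the values that were not chosen, and \<open>Occ c p u'\<close> for all \<open>u'\<close> other than the value at position
  \<open>p\<close> of the constraint \<open>c\<close>; a pattern of \<open>c\<close> covers \<open>Occ c p u\<close> for its own entries. So a pattern can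
  only be used if it agrees with the values; the remaining keys \<open>Occ c p u\<close> are left to \<open>Fill c p\<close>.
\<close>

definition dom :: "tree => tree list" where
  "dom v = (if is_num v then us else [Num 0, Num 1])"

definition vars :: "tree list" where "vars = xs @ ys @ zs"

definition others :: "tree => tree => tree list" where
  "others v u = filter (\<lambda>u'. u' \<noteq> u) (dom v)"

definition xkeys :: "key list" where "xkeys = concat (map (\<lambda>v. map (Xkey v) (dom v)) xs)"
definition ykeys :: "key list" where "ykeys = concat (map (\<lambda>v. map (Ykey v) (dom v)) ys)"
definition okeys :: "key list" where
  "okeys = concat (map (\<lambda>c. concat (map (\<lambda>p. map (Occ c p) (dom (scope c p))) [0..<length (fst c)])) cs)"
definition actives :: "key list" where
  "actives = map (\<lambda>v. Active (Var v)) vars @ map (\<lambda>c. Active (Con c)) cs"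

text \<open>Their number is the third size in the subset sum instance. It depends on the variables,
  the constraints and the lengths of their scopes, but not on the domains or the number of
  patterns.\<close>

definition groups :: "group list" where
  "groups = Mode # map Var vars @ map Con cs @ concat (map (\<lambda>c. map (Fill c) [0..<length (fst c)]) cs) @
     map Seg [0..<Suc (length ys)]"

definition keys :: "key list" where
  "keys = map Group groups @ actives @ xkeys @ ykeys @ okeys"

text \<open>
  If the second player does not choose exactly one value for each variable, then no value is chosen
  for some \<open>y\<close>, and the third player wins by taking \<open>escape y\<close>. After a proper choice this item
  collides with the chosen key for \<open>y\<close>. The keys \<open>Active g\<close> enforce that null items are used only
  together with an escape.
\<close>

definition escape :: "tree => key list" where
  "escape y = Group Mode # actives @ okeys @ map (Ykey y) (dom y)"

text \<open>The values not chosen by the first player have to be covered after an escape, too. The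
  \<open>Active\<close> and \<open>Occ\<close> keys are then covered by the escape, and the open
  \<open>Ykey\<close> keys by the escape and the segments.\<close>

definition null_item :: "tree => tree => key list" where
  "null_item v u = Group (Var v) # (if v \<in> set xs then map (Xkey v) (others v u) else [])"

definition var_okeys :: "tree => tree => key list" where
  "var_okeys v u = concat (map (\<lambda>c. concat (map
     (\<lambda>p. if scope c p = v then map (Occ c p) (others v u) else []) [0..<length (fst c)])) cs)"

definition var_item :: "tree => tree => key list" where
  "var_item v u = Group (Var v) # Active (Var v) #
     (if v \<in> set xs then map (Xkey v) (others v u) else []) @
     (if v \<in> set ys then map (Ykey v) (others v u) else []) @
     var_okeys v u"

definition con_item :: "con => tree list => key list" where
  "con_item c e = Group (Con c) # Active (Con c) # map (\<lambda>p. Occ c p (nth_or (Num 0) e p)) [0..<length e]"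

definition other_ykeys :: "tree => key list" where
  "other_ykeys y = concat (map (\<lambda>v. if v = y then [] else map (Ykey v) (dom v)) ys)"

definition mode_items :: "key list list" where "mode_items = [Group Mode] # map escape ys"
definition var_items :: "tree => key list list" where
  "var_items v = map (null_item v) (dom v) @ map (var_item v) (dom v)"
definition con_items :: "con => key list list" where
  "con_items c = [Group (Con c)] # map (con_item c) (snd c)"
text \<open>A pattern may be shorter than the scope of its constraint. At a position beyond its end,
  the key of the actual value is covered from here.\<close>

definition fill_items :: "con => nat => key list list" where
  "fill_items c p = [Group (Fill c p)] # map (\<lambda>u. [Group (Fill c p), Occ c p u]) (dom (scope c p))"
text \<open>After \<open>escape y\<close>, the keys of the other variables that the second player
  left out are still to be covered. At most \<open>length ys\<close> of these keys are taken, so the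
  rest can be covered by \<open>length ys + 1\<close> segments.\<close>

definition seg_items :: "nat => key list list" where
  "seg_items s = [Group (Seg s)] # concat (map (\<lambda>y. map (\<lambda>\<sigma>. Group (Seg s) # \<sigma>) (segments (other_ykeys y))) ys)"

definition items1 :: "key list list" where "items1 = map (\<lambda>q. [q]) xkeys"
definition items2 :: "key list list" where "items2 = map (\<lambda>q. [q]) ykeys"
definition items3 :: "key list list" where
  "items3 = mode_items @ concat (map var_items vars) @ concat (map con_items cs) @
     concat (map (\<lambda>c. concat (map (fill_items c) [0..<length (fst c)])) cs) @
     concat (map seg_items [0..<Suc (length ys)])"

definition combine :: "(tree => tree) => (tree => tree) => (tree => tree) => tree => tree" where
  "combine F f h v = (if v \<in> set xs then F v else if v \<in> set ys then f v else h v)"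

definition winning :: bool where
  "winning \<longleftrightarrow> (\<exists>F. (\<forall>v\<in>set xs. F v \<in> set (dom v)) \<and> (\<forall>f. (\<forall>v\<in>set ys. f v \<in> set (dom v)) \<longrightarrow>
     (\<exists>h. (\<forall>v\<in>set zs. h v \<in> set (dom v)) \<and> (\<forall>c\<in>set cs. holds (combine F f h) c))))"

fun choices :: "group => key list list" where
  "choices Mode = mode_items"
| "choices (Var v) = var_items v"
| "choices (Con c) = con_items c"
| "choices (Fill c p) = fill_items c p"
| "choices (Seg s) = seg_items s"

lemmas items_def = mode_items_def var_items_def con_items_def fill_items_def seg_items_def

lemma set_groups: "g \<in> set groups \<longleftrightarrow> (case g of Mode => True | Var v => v \<in> set vars | Con c => c \<in> set cs
    | Fill c p => c \<in> set cs \<and> p < length (fst c) | Seg s => s \<le> length ys)"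
  by (cases g) (auto simp: groups_def image_iff less_Suc_eq_le simp del: upt_Suc split_paired_Ex intro: bexI[rotated])

lemma set_items3: "set items3 = (\<Union>g\<in>set groups. set (choices g))"
  by (auto simp: items3_def groups_def less_Suc_eq_le simp del: upt_Suc)

lemma in_xkeys: "q \<in> set xkeys \<longleftrightarrow> (\<exists>v u. q = Xkey v u \<and> v \<in> set xs \<and> u \<in> set (dom v))"
  by (auto simp: xkeys_def)

lemma in_ykeys: "q \<in> set ykeys \<longleftrightarrow> (\<exists>v u. q = Ykey v u \<and> v \<in> set ys \<and> u \<in> set (dom v))"
  by (auto simp: ykeys_def)

lemma in_okeys: "q \<in> set okeys \<longleftrightarrow>
    (\<exists>c p u. q = Occ c p u \<and> c \<in> set cs \<and> p < length (fst c) \<and> u \<in> set (dom (scope c p)))"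
  by (cases q) (auto simp: okeys_def image_iff intro: bexI[rotated])

lemma in_actives: "q \<in> set actives \<longleftrightarrow> (\<exists>v\<in>set vars. q = Active (Var v)) \<or> (\<exists>c\<in>set cs. q = Active (Con c))"
  by (auto simp: actives_def)

lemma in_other_ykeys:
  "q \<in> set (other_ykeys y) \<longleftrightarrow> (\<exists>v u. q = Ykey v u \<and> v \<in> set ys \<and> v \<noteq> y \<and> u \<in> set (dom v))"
  by (auto simp: other_ykeys_def)

lemma in_others: "u' \<in> set (others v u) \<longleftrightarrow> u' \<in> set (dom v) \<and> u' \<noteq> u"
  by (auto simp: others_def)

lemma in_escape: "q \<in> set (escape y) \<longleftrightarrow>
    q = Group Mode \<or> q \<in> set actives \<or> q \<in> set okeys \<or> (\<exists>u\<in>set (dom y). q = Ykey y u)"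
  by (auto simp: escape_def)

lemma in_null_item: "q \<in> set (null_item v u) \<longleftrightarrow>
    q = Group (Var v) \<or> v \<in> set xs \<and> (\<exists>u'\<in>set (dom v). u' \<noteq> u \<and> q = Xkey v u')"
  by (auto simp: null_item_def in_others)

lemma in_var_item: "q \<in> set (var_item v u) \<longleftrightarrow>
    q = Group (Var v) \<or> q = Active (Var v) \<or>
    v \<in> set xs \<and> (\<exists>u'\<in>set (dom v). u' \<noteq> u \<and> q = Xkey v u') \<or>
    v \<in> set ys \<and> (\<exists>u'\<in>set (dom v). u' \<noteq> u \<and> q = Ykey v u') \<or>
    (\<exists>c\<in>set cs. \<exists>p<length (fst c). scope c p = v \<and> (\<exists>u'\<in>set (dom v). u' \<noteq> u \<and> q = Occ c p u'))"
proof -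
  have "q \<in> set (var_okeys v u) \<longleftrightarrow>
    (\<exists>c\<in>set cs. \<exists>p<length (fst c). scope c p = v \<and> (\<exists>u'\<in>set (dom v). u' \<noteq> u \<and> q = Occ c p u'))"
    by (cases q) (auto simp: var_okeys_def image_iff in_others intro: bexI[rotated])
  then show ?thesis by (auto simp: var_item_def in_others)
qed

lemma in_con_item: "q \<in> set (con_item c e) \<longleftrightarrow>
    q = Group (Con c) \<or> q = Active (Con c) \<or> (\<exists>p<length e. q = Occ c p (e ! p))"
  by (auto simp: con_item_def nth_or_def)

lemma segment_subset: "\<sigma> \<in> set (segments K) ==> set \<sigma> \<subseteq> set K"
  by (auto simp: in_segments)

text \<open>It follows that an exact cover of the \<open>Group\<close> keys takes exactly one item
  of each group.\<close>

lemma group_of_item: "J \<in> set (choices g) ==> Group g' \<in> set J \<longleftrightarrow> g' = g"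
  by (cases g) (auto simp: items_def
      in_escape in_null_item in_var_item in_con_item in_actives in_okeys in_other_ykeys dest!: segment_subset)

text \<open>Once escapes are excluded, the \<open>Active\<close> keys thus rule out the null items
  and the items that consist of a \<open>Con\<close> group alone.\<close>

lemma active_item:
  assumes "J \<in> set (choices g)"
  shows "Active (Var v) \<in> set J ==> (\<exists>u\<in>set (dom v). J = var_item v u) \<or> (\<exists>y\<in>set ys. J = escape y)"
    and "Active (Con c) \<in> set J ==> (\<exists>e\<in>set (snd c). J = con_item c e) \<or> (\<exists>y\<in>set ys. J = escape y)"
  using assms by (cases g; auto simp: items_def
      in_null_item in_var_item in_con_item in_other_ykeys dest!: segment_subset)+

lemma xkey_item: "J \<in> set (choices g) ==> Xkey x u \<in> set J ==> g = Var x"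
  by (cases g) (auto simp: items_def
      in_escape in_actives in_okeys in_null_item in_var_item in_con_item in_other_ykeys dest!: segment_subset)

lemma set_items12:
  "I \<in> set ` set items1 \<longleftrightarrow> (\<exists>v u. I = {Xkey v u} \<and> v \<in> set xs \<and> u \<in> set (dom v))"
  "I \<in> set ` set items2 \<longleftrightarrow> (\<exists>v u. I = {Ykey v u} \<and> v \<in> set ys \<and> u \<in> set (dom v))"
  unfolding items1_def items2_def set_map image_image by (auto simp: in_xkeys in_ykeys image_iff Bex_def)

end

locale wf_csp = csp +
  assumes dist: "distinct vars" and us: "us \<noteq> []" "distinct us"
    and scope_vars: "\<And>c. c \<in> set cs ==> set (fst c) \<subseteq> set vars"
    and patterns: "\<And>c e. c \<in> set cs ==> e \<in> set (snd c) ==>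
      length e \<le> length (fst c) \<and> (\<forall>p<length e. e ! p \<in> set (dom (scope c p)))"
begin

lemma dom_nonempty: "set (dom v) \<noteq> {}"
  using us by (simp add: dom_def)

lemma scope_in_vars: "c \<in> set cs ==> p < length (fst c) ==> scope c p \<in> set vars"
  using scope_vars[of c] nth_mem[of p "fst c"] by (auto simp: scope_def nth_or_def)

lemma xys_disjoint: "v \<in> set xs ==> v \<notin> set ys" "v \<in> set xs ==> v \<notin> set zs" "v \<in> set ys ==> v \<notin> set zs"
  using dist by (auto simp: vars_def)

lemma holds_iff:
  assumes "c \<in> set cs"
  shows "holds a c \<longleftrightarrow> (\<exists>e\<in>set (snd c). \<forall>p<length e. e ! p = a (scope c p))"
  unfolding holds_def
proof (rule bex_cong[OF refl])
  fix e assume "e \<in> set (snd c)"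
  then have len: "length e \<le> length (fst c)" using patterns[OF assms] by blast
  then have "scope c p = fst c ! p" if "p < length e" for p using that by (simp add: scope_def nth_or_def)
  then show "e = map a (take (length e) (fst c)) \<longleftrightarrow> (\<forall>p<length e. e ! p = a (scope c p))"
    using len by (auto simp: list_eq_iff_nth_eq min_def)
qed

text \<open>After a proper choice of the second player an escape would cover some
  \<open>Ykey y (f y)\<close> twice. So the \<open>Active\<close> keys force full items, from which
  \<open>a\<close> is read off; a pattern that disagrees with \<open>a\<close> would share an
  \<open>Occ\<close> key with the item of a variable. The second claim determines \<open>a\<close>
  on \<open>xs\<close> by \<open>B1\<close> alone, which makes the values of the first player
  independent of \<open>f\<close>.\<close>

lemma cover_yields_assignment:
  assumes B1: "B1 \<subseteq> set ` set items1" and B3: "B3 \<subseteq> set ` set items3"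
    and f: "\<forall>y\<in>set ys. f y \<in> set (dom y)" and B2: "B2 = (\<lambda>y. {Ykey y (f y)}) ` set ys"
    and cover: "\<forall>q\<in>set keys. \<exists>!I. I \<in> B1 \<union> B2 \<union> B3 \<and> q \<in> I"
  obtains a where "\<forall>v\<in>set vars. a v \<in> set (dom v)" "\<forall>x\<in>set xs. \<forall>u\<in>set (dom x). {Xkey x u} \<in> B1 \<longleftrightarrow> u = a x"
    "\<forall>y\<in>set ys. a y = f y" "\<forall>c\<in>set cs. holds a c"
proof -
  let ?B = "B1 \<union> B2 \<union> B3"
  have uniq: "I = J" if "q \<in> set keys" "I \<in> ?B" "J \<in> ?B" "q \<in> I" "q \<in> J" for q I J
    using bspec[OF cover that(1)] that(2-5) by blast
  have cov: "\<exists>I\<in>?B. q \<in> I" if "q \<in> set keys" for q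
    using bspec[OF cover that] by blast
  have item: "(\<exists>v u. I = {Xkey v u}) \<or> (\<exists>v u. I = {Ykey v u}) \<or> (\<exists>g\<in>set groups. \<exists>J\<in>set (choices g). I = set J)"
    if I: "I \<in> ?B" for I
  proof -
    consider "I \<in> set ` set items1" | y where "I = {Ykey y (f y)}" | "I \<in> set ` set items3" using I B1 B2 B3 by blast
    then show ?thesis
    proof cases
      case 1
      then show ?thesis unfolding set_items12 by blast
    next
      case 3
      then show ?thesis unfolding set_items3 by blast
    qed blast
  qed
  have group: "\<exists>J\<in>set (choices g). I = set J" if "I \<in> ?B" "Group g \<in> I" for g I
    using item[OF that(1)] that(2) group_of_item by fastforce
  have in_B2: "{Ykey y (f y)} \<in> ?B" if "y \<in> set ys" for y using B2 that by blast
  have "Group Mode \<in> set keys" by (simp add: keys_def groups_def)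
  then obtain I0 where I0: "I0 \<in> ?B" "Group Mode \<in> I0" using cov by blast
  obtain J0 where J0: "J0 \<in> set mode_items" "I0 = set J0" using group[OF I0] by auto
  have no_escape: "set (escape y) \<notin> ?B" if y: "y \<in> set ys" for y
  proof
    assume *: "set (escape y) \<in> ?B"
    have "Ykey y (f y) \<in> set keys" "Ykey y (f y) \<in> set (escape y)" using f y by (auto simp: keys_def in_ykeys in_escape)
    then have "set (escape y) = {Ykey y (f y)}" using uniq[OF _ * in_B2[OF y]] by blast
    then show False by (auto simp: in_escape set_eq_iff)
  qed
  have "\<exists>u\<in>set (dom v). set (var_item v u) \<in> ?B" if v: "v \<in> set vars" for v
  proof -
    have "Active (Var v) \<in> set keys" using v by (auto simp: keys_def in_actives)
    then obtain I where I: "I \<in> ?B" "Active (Var v) \<in> I" using cov by blast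
    then obtain g J where J: "J \<in> set (choices g)" "I = set J" using item by blast
    then show ?thesis using active_item(1)[OF J(1)] I no_escape by blast
  qed
  then have "\<forall>v\<in>set vars. \<exists>u. u \<in> set (dom v) \<and> set (var_item v u) \<in> ?B" by blast
  then obtain a where a: "\<forall>v\<in>set vars. a v \<in> set (dom v) \<and> set (var_item v (a v)) \<in> ?B"
    by (rule bchoice[THEN exE])
  have vars: "set xs \<subseteq> set vars" "set ys \<subseteq> set vars" by (auto simp: vars_def)
  have "{Xkey x u} \<in> B1 \<longleftrightarrow> u = a x" if x: "x \<in> set xs" and u: "u \<in> set (dom x)" for x u
  proof
    have key: "Xkey x u \<in> set keys" using x u by (auto simp: keys_def in_xkeys)
    have x': "a x \<in> set (dom x)" "set (var_item x (a x)) \<in> ?B" using a vars x by auto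
    {
      assume *: "{Xkey x u} \<in> B1"
      show "u = a x"
      proof (rule ccontr)
        assume "u \<noteq> a x"
        then have "Xkey x u \<in> set (var_item x (a x))" using x u by (auto simp: in_var_item)
        then have "set (var_item x (a x)) = {Xkey x u}" using uniq[OF key x'(2), of "{Xkey x u}"] * by blast
        then show False using in_var_item[of "Active (Var x)" x "a x"] by simp
      qed
    next
      assume eq: "u = a x"
      obtain I where I: "I \<in> ?B" "Xkey x u \<in> I" using cov[OF key] by blast
      have "I = {Xkey x u}"
      proof (rule ccontr)
        assume "I \<noteq> {Xkey x u}"
        then obtain g J where J: "g \<in> set groups" "J \<in> set (choices g)" "I = set J" using item[OF I(1)] I(2) by blast
        then have "Group (Var x) \<in> I" using I(2) xkey_item group_of_item by metis
        moreover have "Group (Var x) \<in> set keys" using x vars by (auto simp: keys_def set_groups)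
        ultimately have "I = set (var_item x (a x))" using uniq[OF _ I(1) x'(2)] by (simp add: in_var_item)
        then show False using I(2) eq by (simp add: in_var_item)
      qed
      moreover have "I \<notin> B2" using I(2) B2 by auto
      moreover have "I \<notin> B3"
      proof
        assume "I \<in> B3"
        then obtain g J where "J \<in> set (choices g)" "I = set J" using B3 unfolding set_items3 by blast
        then have "Group g \<in> I" using group_of_item by blast
        then show False using \<open>I = {Xkey x u}\<close> by simp
      qed
      ultimately show "{Xkey x u} \<in> B1" using I by blast
    }
  qed
  moreover have "a y = f y" if y: "y \<in> set ys" for y
  proof (rule ccontr)
    assume "a y \<noteq> f y"
    then have *: "Ykey y (f y) \<in> set (var_item y (a y))" "Ykey y (f y) \<in> set keys"
      using y f by (auto simp: in_var_item keys_def in_ykeys)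
    have "set (var_item y (a y)) \<in> ?B" using a vars y by blast
    then have "set (var_item y (a y)) = {Ykey y (f y)}" using uniq[OF *(2) _ in_B2[OF y] *(1)] by blast
    then show False using in_var_item[of "Active (Var y)" y "a y"] by simp
  qed
  moreover have "holds a c" if c: "c \<in> set cs" for c
  proof -
    have "Active (Con c) \<in> set keys" using c by (auto simp: keys_def in_actives)
    then obtain I where I: "I \<in> ?B" "Active (Con c) \<in> I" using cov by blast
    then obtain g J where J: "J \<in> set (choices g)" "I = set J" using item by blast
    then obtain e where e: "e \<in> set (snd c)" "I = set (con_item c e)"
      using active_item(2)[OF J(1)] I no_escape by blast
    have "e ! p = a (scope c p)" if p: "p < length e" for p
    proof (rule ccontr)
      assume neq: "e ! p \<noteq> a (scope c p)"
      have p': "p < length (fst c)" "e ! p \<in> set (dom (scope c p))" using patterns[OF c e(1)] p by auto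
      then have "Occ c p (e ! p) \<in> set (var_item (scope c p) (a (scope c p)))"
        using neq c by (auto simp: in_var_item)
      moreover have "Occ c p (e ! p) \<in> I" using p unfolding e(2) in_con_item by blast
      moreover have "Occ c p (e ! p) \<in> set keys" using p' c by (auto simp: keys_def in_okeys)
      moreover have "set (var_item (scope c p) (a (scope c p))) \<in> ?B" using a scope_in_vars[OF c p'(1)] by blast
      ultimately have "I = set (var_item (scope c p) (a (scope c p)))" using uniq[OF _ I(1)] by blast
      then have "Active (Con c) \<in> set (var_item (scope c p) (a (scope c p)))" using I(2) by simp
      then show False by (simp add: in_var_item)
    qed
    then show ?thesis using e(1) holds_iff[OF c] by blast
  qed
  ultimately show ?thesis using a that by blast
qed

text \<open>Reduces the construction of a cover to the choice of one item per group. The cardinality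
  is right because items of different groups have different \<open>Group\<close> keys.\<close>

lemma cover_by_groups:
  assumes item: "\<And>g. g \<in> set groups ==> item g \<in> set (choices g)"
    and cover: "\<And>q. q \<in> set keys ==>
      (\<exists>!I. I \<in> B \<and> q \<in> I) \<and> (\<forall>g\<in>set groups. q \<notin> set (item g)) \<or>
      (\<forall>I\<in>B. q \<notin> I) \<and> (\<exists>!g. g \<in> set groups \<and> q \<in> set (item g))"
  obtains B3 where "B3 \<subseteq> set ` set items3" "card B3 = card (set groups)"
    "\<forall>q\<in>set keys. \<exists>!I. I \<in> B \<union> B3 \<and> q \<in> I"
proof
  let ?B3 = "(\<lambda>g. set (item g)) ` set groups"
  show "?B3 \<subseteq> set ` set items3" using item unfolding set_items3 by blast
  have "inj_on (\<lambda>g. set (item g)) (set groups)"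
  proof (rule inj_onI)
    fix g g' assume *: "g \<in> set groups" "g' \<in> set groups" "set (item g) = set (item g')"
    have "Group g \<in> set (item g)" using group_of_item[OF item[OF *(1)]] by simp
    then show "g = g'" using group_of_item[OF item[OF *(2)], of g] *(3) by simp
  qed
  then show "card ?B3 = card (set groups)" by (rule card_image)
  show "\<forall>q\<in>set keys. \<exists>!I. I \<in> B \<union> ?B3 \<and> q \<in> I"
  proof
    fix q assume "q \<in> set keys"
    from cover[OF this] show "\<exists>!I. I \<in> B \<union> ?B3 \<and> q \<in> I"
    proof (elim disjE conjE)
      assume ex: "\<exists>!I. I \<in> B \<and> q \<in> I" and none: "\<forall>g\<in>set groups. q \<notin> set (item g)"
      from ex obtain I0 where "I0 \<in> B \<and> q \<in> I0" and I0: "\<forall>I. I \<in> B \<and> q \<in> I \<longrightarrow> I = I0" by (rule ex1E)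
      then show ?thesis using none by (intro ex1I[of _ I0]) blast+
    next
      assume none: "\<forall>I\<in>B. q \<notin> I" and ex: "\<exists>!g. g \<in> set groups \<and> q \<in> set (item g)"
      from ex obtain g0 where "g0 \<in> set groups \<and> q \<in> set (item g0)"
        and g0: "\<forall>g. g \<in> set groups \<and> q \<in> set (item g) \<longrightarrow> g = g0" by (rule ex1E)
      then show ?thesis using none by (intro ex1I[of _ "set (item g0)"]) blast+
    qed
  qed
qed

lemma distinct_other_ykeys: "distinct (other_ykeys y)"
proof -
  have "distinct (dom v)" for v using us(2) by (simp add: dom_def)
  then have "distinct (concat (map (\<lambda>v. if v = y then [] else map (Ykey v) (dom v)) vs))" if "distinct vs" for vs
    using that by (induction vs) (auto simp: distinct_map inj_on_def)
  then show ?thesis using dist by (simp add: other_ykeys_def vars_def)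
qed

lemma keys_cases:
  assumes "q \<in> set keys"
  obtains g where "q = Group g" "g \<in> set groups" | g where "q = Active g" "q \<in> set actives" "g \<in> set groups"
  | x u where "q = Xkey x u" "x \<in> set xs" "u \<in> set (dom x)" | y u where "q = Ykey y u" "y \<in> set ys" "u \<in> set (dom y)"
  | c p u where "q = Occ c p u" "c \<in> set cs" "p < length (fst c)" "u \<in> set (dom (scope c p))"
  using assms by (auto simp: keys_def in_actives in_xkeys in_ykeys in_okeys set_groups)

lemma in_vars: "x \<in> set xs ==> x \<in> set vars" "y \<in> set ys ==> y \<in> set vars"
  by (simp_all add: vars_def)

lemma assignment_yields_cover:
  assumes a: "\<forall>v\<in>set vars. a v \<in> set (dom v)" and hold: "\<forall>c\<in>set cs. holds a c"
    and B1: "B1 = (\<lambda>x. {Xkey x (a x)}) ` set xs" and B2: "B2 = (\<lambda>y. {Ykey y (a y)}) ` set ys"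
  obtains B3 where "B3 \<subseteq> set ` set items3" "card B3 = card (set groups)"
    "\<forall>q\<in>set keys. \<exists>!I. I \<in> (B1 \<union> B2) \<union> B3 \<and> q \<in> I"
proof -
  have "\<forall>c\<in>set cs. \<exists>e. e \<in> set (snd c) \<and> (\<forall>p<length e. e ! p = a (scope c p))" using hold holds_iff by blast
  then obtain e where e: "\<forall>c\<in>set cs. e c \<in> set (snd c) \<and> (\<forall>p<length (e c). e c ! p = a (scope c p))"
    by (rule bchoice[THEN exE])
  define item where "item g = (case g of Mode => [Group Mode] | Var v => var_item v (a v) | Con c => con_item c (e c)
    | Fill c p => if p < length (e c) then [Group (Fill c p)] else [Group (Fill c p), Occ c p (a (scope c p))]
    | Seg s => [Group (Seg s)])" for g
  have item: "item g \<in> set (choices g)" if "g \<in> set groups" for g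
    using a e scope_in_vars that by (cases g) (auto simp: item_def set_groups items_def)
  show ?thesis
  proof (rule cover_by_groups[of item "B1 \<union> B2", OF item])
    fix q assume "q \<in> set keys"
    then show "(\<exists>!I. I \<in> B1 \<union> B2 \<and> q \<in> I) \<and> (\<forall>g\<in>set groups. q \<notin> set (item g)) \<or>
      (\<forall>I\<in>B1 \<union> B2. q \<notin> I) \<and> (\<exists>!g. g \<in> set groups \<and> q \<in> set (item g))"
    proof (cases rule: keys_cases)
      case (1 g)
      have "g' = g" if "g' \<in> set groups" "Group g \<in> set (item g')" for g'
        using group_of_item[OF item[OF that(1)]] that(2) by simp
      moreover have "Group g \<in> set (item g)" using group_of_item[OF item[OF 1(2)]] by simp
      ultimately show ?thesis using 1 B1 B2 by (intro disjI2 conjI ex1I[of _ g]) auto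
    next
      case (2 g)
      have "g' = g" if "Active g \<in> set (item g')" for g'
        by (cases g') (use that in \<open>auto simp: item_def in_var_item in_con_item split: if_splits\<close>)
      moreover have "Active g \<in> set (item g)" using 2(1,2)
        by (auto simp: in_actives item_def in_var_item in_con_item)
      ultimately show ?thesis using 2 B1 B2 by (intro disjI2 conjI ex1I[of _ g]) auto
    next
      case (3 x u)
      have *: "Xkey x u \<in> set (item g) \<longleftrightarrow> g = Var x \<and> u \<noteq> a x" for g
        using 3 by (cases g) (auto simp: item_def in_var_item in_con_item)
      have "Var x \<in> set groups" using 3(2) in_vars by (simp add: set_groups)
      then show ?thesis using 3 B1 B2 unfolding 3(1) *
        by (cases "u = a x") (auto intro: ex1I[of _ "{Xkey x u}"] ex1I[of _ "Var x"])
    next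
      case (4 y u)
      have *: "Ykey y u \<in> set (item g) \<longleftrightarrow> g = Var y \<and> u \<noteq> a y" for g
        using 4 by (cases g) (auto simp: item_def in_var_item in_con_item)
      have "Var y \<in> set groups" using 4(2) in_vars by (simp add: set_groups)
      then show ?thesis using 4 B1 B2 unfolding 4(1) *
        by (cases "u = a y") (auto intro: ex1I[of _ "{Ykey y u}"] ex1I[of _ "Var y"])
    next
      case (5 c p u)
      \<comment> \<open>The key of a value other than the actual one belongs to the variable. That
        of the actual value belongs to the pattern, or to \<open>Fill\<close> beyond the end of the
        pattern.\<close>
      let ?g = "if u \<noteq> a (scope c p) then Var (scope c p) else if p < length (e c) then Con c else Fill c p"
      have *: "Occ c p u \<in> set (item g) \<longleftrightarrow> g = ?g" for g
        using 5 e by (cases g) (auto simp: item_def in_var_item in_con_item)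
      have "?g \<in> set groups" using 5 scope_in_vars by (simp add: set_groups)
      then show ?thesis using 5 B1 B2 unfolding 5(1) * by (intro disjI2 conjI ex1I[of _ ?g]) auto
    qed
  qed (assumption, erule (2) that)
qed

text \<open>If no value of \<open>y0\<close> was taken, \<open>escape y0\<close> covers all keys of
  \<open>y0\<close>, all \<open>Active\<close> and all \<open>Occ\<close> keys. Null items deal with
  the remaining keys of the first player, and segments that avoid the taken keys with the other
  variables of the second player.\<close>

lemma unhit_block_yields_cover:
  assumes F: "\<forall>x\<in>set xs. F x \<in> set (dom x)" and B1: "B1 = (\<lambda>x. {Xkey x (F x)}) ` set xs"
    and B2: "B2 \<subseteq> set ` set items2" "card B2 = length ys" and y0: "y0 \<in> set ys" "\<And>u. {Ykey y0 u} \<notin> B2"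
  obtains B3 where "B3 \<subseteq> set ` set items3" "card B3 = card (set groups)"
    "\<forall>q\<in>set keys. \<exists>!I. I \<in> (B1 \<union> B2) \<union> B3 \<and> q \<in> I"
proof -
  define P where "P = {q. {q} \<in> B2}"
  have sub: "(\<lambda>q. {q}) ` P \<subseteq> B2" by (auto simp: P_def)
  have "finite B2" using B2(1) by (rule finite_subset) simp
  then have "finite ((\<lambda>q. {q}) ` P)" "card ((\<lambda>q. {q}) ` P) \<le> card B2"
    using sub by (auto intro: finite_subset card_mono)
  moreover have "inj_on (\<lambda>q. {q}) P" by simp
  ultimately have P: "finite P" "card P \<le> length ys" using B2(2) by (simp_all add: card_image finite_image_iff)
  obtain \<sigma> where \<sigma>: "\<forall>s\<le>length ys. \<sigma> s \<in> set (segments (other_ykeys y0))"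
    "\<forall>q\<in>set (other_ykeys y0) - P. \<exists>!s. s \<le> length ys \<and> q \<in> set (\<sigma> s)" "\<forall>s\<le>length ys. set (\<sigma> s) \<inter> P = {}"
    using segments_avoiding[OF distinct_other_ykeys P] by blast
  have in_\<sigma>: "q \<in> set (\<sigma> s) ==> \<exists>y u. q = Ykey y u \<and> y \<noteq> y0" if "s \<le> length ys" for q s
    using segment_subset \<sigma>(1) that in_other_ykeys by blast
  \<comment> \<open>Outside \<open>xs\<close> the value merely names a null item, so any element of
    the domain will do.\<close>
  define a where "a v = (if v \<in> set xs then F v else SOME u. u \<in> set (dom v))" for v
  have a: "a v \<in> set (dom v)" "v \<in> set xs ==> a v = F v" for v
    using F some_in_eq[of "set (dom v)"] dom_nonempty[of v] by (simp_all add: a_def)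
  define item where "item g = (case g of Mode => escape y0 | Var v => null_item v (a v) | Con c => [Group (Con c)]
    | Fill c p => [Group (Fill c p)] | Seg s => Group (Seg s) # \<sigma> s)" for g
  have item: "item g \<in> set (choices g)" if "g \<in> set groups" for g
    using a \<sigma>(1) y0(1) that by (cases g) (auto simp: item_def set_groups items_def image_iff intro: bexI[rotated])
  have B2': "\<exists>y u. I = {Ykey y u} \<and> y \<in> set ys \<and> u \<in> set (dom y)" if "I \<in> B2" for I
    using that B2(1) set_items12(2) by blast
  have B12: "I \<in> B1 \<union> B2 ==> (\<exists>x u. I = {Xkey x u}) \<or> (\<exists>y u. I = {Ykey y u})" for I
    using B1 B2' by blast
  have Mode: "Mode \<in> set groups" by (simp add: set_groups)
  show ?thesis
  proof (rule cover_by_groups[of item "B1 \<union> B2", OF item])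
    fix q assume "q \<in> set keys"
    then show "(\<exists>!I. I \<in> B1 \<union> B2 \<and> q \<in> I) \<and> (\<forall>g\<in>set groups. q \<notin> set (item g)) \<or>
      (\<forall>I\<in>B1 \<union> B2. q \<notin> I) \<and> (\<exists>!g. g \<in> set groups \<and> q \<in> set (item g))"
    proof (cases rule: keys_cases)
      case (1 g)
      have "g' = g" if "g' \<in> set groups" "Group g \<in> set (item g')" for g'
        using group_of_item[OF item[OF that(1)]] that(2) by simp
      moreover have "Group g \<in> set (item g)" using group_of_item[OF item[OF 1(2)]] by simp
      moreover have "\<forall>I\<in>B1 \<union> B2. q \<notin> I" using B12 1(1) by blast
      ultimately show ?thesis unfolding 1(1) using 1(2) by (intro disjI2 conjI ex1I[of _ g]) blast+
    next
      case (2 g)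
      have "g' = Mode" if "g' \<in> set groups" "Active g \<in> set (item g')" for g'
        using in_\<sigma> that by (cases g') (auto simp: item_def in_null_item set_groups)
      moreover have "Active g \<in> set (item Mode)" using 2(1,2) by (simp add: item_def in_escape)
      moreover have "\<forall>I\<in>B1 \<union> B2. q \<notin> I" using B12 2(1) by blast
      ultimately show ?thesis unfolding 2(1) using Mode by (intro disjI2 conjI ex1I[of _ Mode]) blast+
    next
      case (3 x u)
      have *: "Xkey x u \<in> set (item g) \<longleftrightarrow> g = Var x \<and> u \<noteq> F x" if "g \<in> set groups" for g
        using 3 in_\<sigma> a that by (cases g) (auto simp: item_def in_null_item in_escape in_actives in_okeys set_groups)
      have g: "Var x \<in> set groups" using 3(2) in_vars by (simp add: set_groups)
      have **: "I \<in> B1 \<union> B2 \<and> Xkey x u \<in> I \<longleftrightarrow> I = {Xkey x u} \<and> u = F x" for I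
        using B1 B2' 3(2) by blast
      show ?thesis
      proof (cases "u = F x")
        case True
        have "\<exists>!I. I \<in> B1 \<union> B2 \<and> Xkey x u \<in> I" unfolding ** using True by simp
        moreover have "\<forall>g\<in>set groups. Xkey x u \<notin> set (item g)" using * True by simp
        ultimately show ?thesis unfolding 3(1) by (intro disjI1 conjI)
      next
        case False
        have "Xkey x u \<notin> I" if "I \<in> B1 \<union> B2" for I using **[of I] False that by blast
        moreover have "\<exists>!g. g \<in> set groups \<and> Xkey x u \<in> set (item g)"
          using * g False by (intro ex1I[of _ "Var x"]) auto
        ultimately show ?thesis unfolding 3(1) by (intro disjI2 conjI ballI)
      qed
    next
      case (4 y u)
      have **: "I \<in> B1 \<union> B2 \<and> Ykey y u \<in> I \<longleftrightarrow> I = {Ykey y u} \<and> {Ykey y u} \<in> B2" for I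
        using B1 B2' by blast
      show ?thesis
      proof (cases "y = y0")
        case True
        have *: "Ykey y u \<in> set (item g) \<longleftrightarrow> g = Mode" if "g \<in> set groups" for g
          using 4 True in_\<sigma> that
          by (cases g) (auto simp: item_def in_null_item in_escape set_groups)
        have "Ykey y u \<notin> I" if "I \<in> B1 \<union> B2" for I using **[of I] y0(2) True that by blast
        moreover have "\<exists>!g. g \<in> set groups \<and> Ykey y u \<in> set (item g)"
          using * Mode by (intro ex1I[of _ Mode]) auto
        ultimately show ?thesis unfolding 4(1) by (intro disjI2 conjI ballI)
      next
        case False
        have *: "Ykey y u \<in> set (item g) \<longleftrightarrow> (\<exists>s. g = Seg s \<and> Ykey y u \<in> set (\<sigma> s))" if "g \<in> set groups" for g
          using 4 False in_\<sigma> that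
          by (cases g) (auto simp: item_def in_null_item in_escape set_groups in_actives in_okeys)
        have seg: "Seg s \<in> set groups \<longleftrightarrow> s \<le> length ys" for s by (simp add: set_groups)
        show ?thesis
        proof (cases "{Ykey y u} \<in> B2")
          case True
          then have "Ykey y u \<notin> set (item g)" if "g \<in> set groups" for g
            using * \<sigma>(3) that seg by (auto simp: P_def)
          moreover have "\<exists>!I. I \<in> B1 \<union> B2 \<and> Ykey y u \<in> I" unfolding ** using True by simp
          ultimately show ?thesis unfolding 4(1) by (intro disjI1 conjI ballI)
        next
          case notin: False
          then have "Ykey y u \<in> set (other_ykeys y0) - P" using False 4 by (simp add: P_def in_other_ykeys)
          then obtain s where s: "s \<le> length ys" "Ykey y u \<in> set (\<sigma> s)"
            "\<forall>s'. s' \<le> length ys \<and> Ykey y u \<in> set (\<sigma> s') \<longrightarrow> s' = s"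
            using bspec[OF \<sigma>(2)] by blast
          have g: "Seg s \<in> set groups" using s(1) seg by blast
          have "\<exists>!g. g \<in> set groups \<and> Ykey y u \<in> set (item g)"
          proof (rule ex1I[of _ "Seg s"])
            show "Seg s \<in> set groups \<and> Ykey y u \<in> set (item (Seg s))" using g * s(2) by blast
            fix g assume "g \<in> set groups \<and> Ykey y u \<in> set (item g)"
            then show "g = Seg s" using * s(3) seg by blast
          qed
          moreover have "Ykey y u \<notin> I" if "I \<in> B1 \<union> B2" for I using **[of I] notin that by blast
          ultimately show ?thesis unfolding 4(1) by (intro disjI2 conjI ballI)
        qed
      qed
    next
      case (5 c p u)
      have "g' = Mode" if "g' \<in> set groups" "Occ c p u \<in> set (item g')" for g'
        using in_\<sigma> that by (cases g') (auto simp: item_def in_null_item set_groups)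
      moreover have "Occ c p u \<in> set (item Mode)" using 5 by (simp add: item_def in_escape in_okeys)
      moreover have "\<forall>I\<in>B1 \<union> B2. q \<notin> I" using B12 5(1) by blast
      ultimately show ?thesis unfolding 5(1) using Mode by (intro disjI2 conjI ex1I[of _ Mode]) blast+
    qed
  qed (assumption, erule (2) that)
qed

lemma selection_card:
  "card ((\<lambda>x. {Xkey x (f x)}) ` set xs) = length xs" "card ((\<lambda>y. {Ykey y (f y)}) ` set ys) = length ys"
  using dist by (simp_all add: vars_def card_image inj_on_def distinct_card)

theorem cover_game_iff_winning:
  "cover_game keys (set ` set items1) (length xs) (set ` set items2) (length ys) (set ` set items3) (card (set groups))
    \<longleftrightarrow> winning" (is "?game \<longleftrightarrow> _")
proof
  assume ?game
  then obtain B1 where B1: "B1 \<subseteq> set ` set items1" and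
    B2': "\<forall>B2\<subseteq>set ` set items2. card B2 = length ys \<longrightarrow> (\<exists>B3\<subseteq>set ` set items3.
      card B3 = card (set groups) \<and> (\<forall>q\<in>set keys. \<exists>!I. I \<in> B1 \<union> B2 \<union> B3 \<and> q \<in> I))"
    unfolding cover_game_def by (elim exE conjE) (rule that)
  note B2 = B2'[rule_format]
  have reply: "\<exists>a. (\<forall>v\<in>set vars. a v \<in> set (dom v)) \<and>
      (\<forall>x\<in>set xs. \<forall>u\<in>set (dom x). {Xkey x u} \<in> B1 \<longleftrightarrow> u = a x) \<and> (\<forall>y\<in>set ys. a y = f y) \<and> (\<forall>c\<in>set cs. holds a c)"
    if f: "\<forall>y\<in>set ys. f y \<in> set (dom y)" for f
  proof -
    let ?B2 = "(\<lambda>y. {Ykey y (f y)}) ` set ys"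
    have "?B2 \<subseteq> set ` set items2" using f by (auto simp: set_items12)
    from B2[OF this selection_card(2)]
    obtain B3 where B3: "B3 \<subseteq> set ` set items3" "\<forall>q\<in>set keys. \<exists>!I. I \<in> B1 \<union> ?B2 \<union> B3 \<and> q \<in> I"
      by (elim exE conjE) (rule that)
    show ?thesis by (rule cover_yields_assignment[OF B1 B3(1) f refl B3(2)]) blast
  qed
  define F where "F x = (SOME u. u \<in> set (dom x) \<and> {Xkey x u} \<in> B1)" for x
  have F: "F x = a x" if "x \<in> set xs" "a x \<in> set (dom x)" "\<forall>u\<in>set (dom x). {Xkey x u} \<in> B1 \<longleftrightarrow> u = a x" for x a
    unfolding F_def using that by (intro some_equality) auto
  have "(SOME u. u \<in> set (dom y)) \<in> set (dom y)" for y using dom_nonempty[of y] some_in_eq by blast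
  \<comment> \<open>One arbitrary proper choice of the second player is enough to see that
    \<open>B1\<close> selects exactly one value for each variable in \<open>xs\<close>.\<close>
  then obtain a0 where a0: "\<forall>v\<in>set vars. a0 v \<in> set (dom v)"
      "\<forall>x\<in>set xs. \<forall>u\<in>set (dom x). {Xkey x u} \<in> B1 \<longleftrightarrow> u = a0 x"
    using reply[of "\<lambda>y. SOME u. u \<in> set (dom y)"] by blast
  then have "\<forall>x\<in>set xs. F x \<in> set (dom x)" using F[of _ a0] in_vars(1) by simp
  moreover have "\<exists>h. (\<forall>v\<in>set zs. h v \<in> set (dom v)) \<and> (\<forall>c\<in>set cs. holds (combine F f h) c)"
    if f: "\<forall>y\<in>set ys. f y \<in> set (dom y)" for f
  proof -
    obtain a where a: "\<forall>v\<in>set vars. a v \<in> set (dom v)"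
      "\<forall>x\<in>set xs. \<forall>u\<in>set (dom x). {Xkey x u} \<in> B1 \<longleftrightarrow> u = a x" "\<forall>y\<in>set ys. a y = f y" "\<forall>c\<in>set cs. holds a c"
      using reply[OF f] by blast
    have "combine F f a v = a v" for v using F[of v a] a(1-3) in_vars(1) by (simp add: combine_def)
    then have "combine F f a = a" by (rule ext)
    then show ?thesis using a(1,4) by (intro exI[of _ a]) (auto simp: vars_def)
  qed
  ultimately show winning unfolding winning_def by blast
next
  assume winning
  then obtain F where F: "\<forall>x\<in>set xs. F x \<in> set (dom x)" and
    reply: "\<And>f. \<forall>y\<in>set ys. f y \<in> set (dom y) ==> \<exists>h. (\<forall>v\<in>set zs. h v \<in> set (dom v)) \<and> (\<forall>c\<in>set cs. holds (combine F f h) c)"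
    unfolding winning_def by blast
  let ?B1 = "(\<lambda>x. {Xkey x (F x)}) ` set xs"
  have B1: "?B1 \<subseteq> set ` set items1" using F by (auto simp: set_items12)
  have respond: "\<exists>B3\<subseteq>set ` set items3. card B3 = card (set groups) \<and> (\<forall>q\<in>set keys. \<exists>!I. I \<in> ?B1 \<union> B2 \<union> B3 \<and> q \<in> I)"
    if B2: "B2 \<subseteq> set ` set items2" "card B2 = length ys" for B2
  proof (cases "\<exists>y\<in>set ys. \<forall>u. {Ykey y u} \<notin> B2")
    case True
    then obtain y0 where y0: "y0 \<in> set ys" "\<And>u. {Ykey y0 u} \<notin> B2" by blast
    show ?thesis by (rule unhit_block_yields_cover[OF F refl B2 y0]) blast
  next
    case False
    then have "\<forall>y\<in>set ys. \<exists>u. {Ykey y u} \<in> B2" by blast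
    then obtain f where f: "\<forall>y\<in>set ys. {Ykey y (f y)} \<in> B2" by (rule bchoice[THEN exE])
    \<comment> \<open>\<open>B2\<close> contains a key of every variable in \<open>ys\<close> and
      has only \<open>length ys\<close> elements, so it contains nothing else: the choice is
      proper.\<close>
    have B2f: "(\<lambda>y. {Ykey y (f y)}) ` set ys = B2"
    proof (rule card_subset_eq)
      show "finite B2" using B2(1) by (rule finite_subset) simp
      show "(\<lambda>y. {Ykey y (f y)}) ` set ys \<subseteq> B2" using f by blast
    qed (simp only: selection_card B2(2))
    have f': "\<forall>y\<in>set ys. f y \<in> set (dom y)"
    proof
      fix y assume "y \<in> set ys"
      then have "{Ykey y (f y)} \<in> set ` set items2" using f B2(1) by blast
      then show "f y \<in> set (dom y)" unfolding set_items12 by auto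
    qed
    obtain h where h: "\<forall>v\<in>set zs. h v \<in> set (dom v)" "\<forall>c\<in>set cs. holds (combine F f h) c"
      using reply[OF f'] by blast
    have a: "\<forall>v\<in>set vars. combine F f h v \<in> set (dom v)" using F f' h(1) by (auto simp: combine_def vars_def)
    have B1a: "?B1 = (\<lambda>x. {Xkey x (combine F f h x)}) ` set xs" by (auto simp: combine_def)
    have "(\<lambda>y. {Ykey y (f y)}) ` set ys = (\<lambda>y. {Ykey y (combine F f h y)}) ` set ys"
      using xys_disjoint(1) by (intro image_cong) (auto simp: combine_def)
    then have B2a: "B2 = (\<lambda>y. {Ykey y (combine F f h y)}) ` set ys" unfolding B2f .
    show ?thesis by (rule assignment_yields_cover[OF a h(2) B1a B2a]) blast
  qed
  show ?game
    unfolding cover_game_def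
    by (intro exI[of _ ?B1] conjI allI impI B1 selection_card(1) respond)
qed

lemma items_disjoint:
  "set ` set items1 \<inter> set ` set items2 = {}" "set ` set items1 \<inter> set ` set items3 = {}"
  "set ` set items2 \<inter> set ` set items3 = {}"
proof -
  have group: "\<exists>g. Group g \<in> I" if I: "I \<in> set ` set items3" for I
  proof -
    obtain g J where "J \<in> set (choices g)" "I = set J" using I unfolding set_items3 by blast
    then show ?thesis using group_of_item by blast
  qed
  then show "set ` set items1 \<inter> set ` set items3 = {}" "set ` set items2 \<inter> set ` set items3 = {}"
    by (auto simp: set_items12 disjoint_iff dest!: group)
  show "set ` set items1 \<inter> set ` set items2 = {}" by (auto simp: set_items12 disjoint_iff)
qed

lemma items_subset_keys:
  assumes "I \<in> set ` set items1 \<union> set ` set items2 \<union> set ` set items3"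
  shows "I \<subseteq> set keys"
proof -
  consider "I \<in> set ` set items1" | "I \<in> set ` set items2" | g J where "g \<in> set groups" "J \<in> set (choices g)" "I = set J"
    using assms set_items3 by blast
  then show ?thesis
  proof cases
    case (3 g J)
    have scope: "scope c p \<in> set vars" if "c \<in> set cs" "p < length (fst c)" for c p using scope_in_vars that by blast
    have con: "set (con_item c e) \<subseteq> set keys" if "c \<in> set cs" "e \<in> set (snd c)" for c e
    proof
      fix q assume "q \<in> set (con_item c e)"
      then consider "q = Group (Con c)" | "q = Active (Con c)" | p where "p < length e" "q = Occ c p (e ! p)"
        unfolding in_con_item by blast
      then show "q \<in> set keys"
        using that patterns[OF that] by cases (auto simp: keys_def set_groups in_actives in_okeys)
    qed
    have seg: "set \<sigma> \<subseteq> set keys" if "\<sigma> \<in> set (segments (other_ykeys y))" for \<sigma> y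
    proof -
      have "set (other_ykeys y) \<subseteq> set ykeys" by (auto simp: in_other_ykeys in_ykeys)
      then show ?thesis using segment_subset[OF that] by (auto simp: keys_def)
    qed
    have group: "Group g \<in> set keys" using 3(1) by (simp add: keys_def)
    have "set J \<subseteq> set keys"
    proof (cases g)
      case (Con c)
      then show ?thesis using 3(1,2) con[of c] group by (auto simp: con_items_def set_groups)
    next
      case (Seg s)
      then show ?thesis using 3(2) group by (auto simp: seg_items_def dest: subsetD[OF seg])
    next
      case (Var v)
      then show ?thesis using 3(1,2)
        by (auto simp: keys_def set_groups var_items_def in_actives in_okeys in_xkeys in_ykeys in_null_item in_var_item)
    next
      case (Fill c p)
      then have "Occ c p u \<in> set keys" if "u \<in> set (dom (scope c p))" for u
        using 3(1) that by (cases c) (auto simp: keys_def set_groups in_okeys)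
      then show ?thesis using Fill 3(2) group by (auto simp: fill_items_def)
    next
      case Mode
      then show ?thesis using 3(1,2) group
        by (auto simp: keys_def set_groups mode_items_def in_escape in_ykeys)
    qed
    then show ?thesis using 3(3) by simp
  qed (auto simp: set_items12 keys_def in_xkeys in_ykeys)
qed

theorem alt3_sss_iff_winning:
  fixes f m
  defines "m \<equiv> card (set groups)"
  defines "f \<equiv> \<lambda>I. code (length xs + length ys + m) keys (set I)"
  shows "(f ` set items1, length xs, f ` set items2, length ys, f ` set items3, m, code (length xs + length ys + m) keys UNIV)
    \<in> alt3_sss \<longleftrightarrow> winning"
proof -
  have f: "f ` A = code (length xs + length ys + m) keys ` (set ` A)" for A
    unfolding f_def image_image ..
  show ?thesis
    unfolding f cover_game_iff_winning[symmetric] m_def[symmetric]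
    by (rule cover_game_alt3[OF _ _ _ items_disjoint items_subset_keys refl]) simp_all
qed

end

section \<open>From model checking to subset sums\<close>


lemma component_Node [simp]: "component (Node ts) i = nth_or (Num 0) ts i"
  by (simp add: component_def)

lemma nth_or_Cons [simp]:
  "nth_or d (t # ts) 0 = t" "nth_or d (t # ts) (Suc i) = nth_or d ts i"
  "nth_or d (t # ts) (numeral k) = nth_or d ts (pred_numeral k)"
  by (simp_all add: nth_or_def numeral_eq_Suc)

lemma not_is_num_form_tree [simp]: "\<not> is_num (form_tree \<phi>)"
  by (cases \<phi>) auto

text \<open>Atoms are excluded explicitly, because the argument list of a relational atom is a child
  that is not a number.\<close>

definition fchildren :: "tree => tree list" where
  "fchildren t = (if component t 0 = Num 0 \<or> component t 0 = Num 1 then [] else filter (\<lambda>s. \<not> is_num s) (kids t))"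

definition weight :: "tree => nat" where
  "weight t = length (enc t)"

lemma weight_simps: "weight (Node ts) = 2 + sum_list (map weight ts)" "weight t \<ge> 1"
proof -
  show "weight (Node ts) = 2 + sum_list (map weight ts)" by (simp add: weight_def[abs_def] length_concat comp_def)
  show "weight t \<ge> 1" by (cases t) (auto simp: weight_def)
qed

lemma weight_kids: "t \<in> set (kids s) ==> weight t < weight s"
  by (cases s) (auto simp: weight_simps(1) dest!: split_list)

lemma weight_fchildren: "sum_list (map weight (fchildren t)) < weight t"
proof (cases t)
  case (Num n)
  then show ?thesis using weight_simps(2)[of t] by (simp add: fchildren_def component_def nth_or_def)
next
  case (Node ts)
  have "sum_list (map weight (filter P ts)) \<le> sum_list (map weight ts)" for P
    by (induction ts) auto
  then show ?thesis using Node by (auto simp: fchildren_def weight_simps(1) less_Suc_eq_le intro: le_SucI)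
qed

text \<open>The subformulas are collected breadth first; equal subformulas are not distinguished.\<close>

definition expand_layer :: "tree list \<times> tree list => tree list \<times> tree list" where
  "expand_layer p = (fst p @ snd p, concat (map fchildren (snd p)))"

lemma expand_layer:
  "fst (expand_layer p) = fst p @ snd p" "snd (expand_layer p) = concat (map fchildren (snd p))"
  by (simp_all add: expand_layer_def)

definition nodes :: "nat => tree => tree list" where
  "nodes n t = fst ((expand_layer ^^ n) ([], [t]))"

text \<open>A node weighs more than its children together, so each node that is passed frees a unit
  of weight. This bounds both the number of collected nodes and the number of layers by the weight
  of the formula.\<close>

lemma weight_layer: "sum_list (map weight (concat (map fchildren ts))) + length ts \<le> sum_list (map weight ts)"
proof (induction ts)
  case (Cons t ts)
  then show ?case using weight_fchildren[of t] by simp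
qed simp

lemma layers_weight:
  "length (fst ((expand_layer ^^ n) ([], [t]))) + sum_list (map weight (snd ((expand_layer ^^ n) ([], [t])))) \<le> weight t"
proof (induction n)
  case (Suc n)
  then show ?case using weight_layer[of "snd ((expand_layer ^^ n) ([], [t]))"] by (simp add: expand_layer)
qed simp

lemma length_nodes: "length (nodes n t) \<le> weight t"
  using layers_weight[of n t] by (simp add: nodes_def)

lemma last_layer:
  assumes "weight t \<le> n"
  shows "snd ((expand_layer ^^ n) ([], [t])) = []"
proof -
  have "snd ((expand_layer ^^ n) ([], [t])) = [] \<or> n \<le> length (fst ((expand_layer ^^ n) ([], [t])))" for n
  proof (induction n)
    case (Suc n)
    then show ?case by (cases "snd ((expand_layer ^^ n) ([], [t]))") (auto simp: expand_layer)
  qed simp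
  then show ?thesis
  proof (rule disjE[of _ _ ])
    assume "n \<le> length (fst ((expand_layer ^^ n) ([], [t])))"
    then have *: "sum_list (map weight (snd ((expand_layer ^^ n) ([], [t])))) = 0" using layers_weight[of n t] assms by linarith
    show ?thesis
    proof (cases "snd ((expand_layer ^^ n) ([], [t]))")
      case (Cons a ts)
      then show ?thesis using weight_simps(2)[of a] * by simp
    qed
  qed
qed

lemma nodes_closed:
  assumes "weight t \<le> n"
  shows "t \<in> set (nodes n t)" "\<And>s. s \<in> set (nodes n t) ==> set (fchildren s) \<subseteq> set (nodes n t)"
proof -
  let ?L = "\<lambda>n. (expand_layer ^^ n) ([], [t])"
  have *: "t \<in> set (fst (?L n)) \<union> set (snd (?L n)) \<and>
     (\<forall>s\<in>set (fst (?L n)). set (fchildren s) \<subseteq> set (fst (?L n)) \<union> set (snd (?L n)))" for n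
    by (induction n) (auto simp: expand_layer)
  show "t \<in> set (nodes n t)" "\<And>s. s \<in> set (nodes n t) ==> set (fchildren s) \<subseteq> set (nodes n t)"
    using *[of n] last_layer[OF assms] by (auto simp: nodes_def)
qed

lemma nodes_subset:
  assumes "t \<in> S" "\<And>s. s \<in> S ==> set (fchildren s) \<subseteq> S"
  shows "set (nodes n t) \<subseteq> S"
proof -
  have "set (fst ((expand_layer ^^ n) ([], [t]))) \<union> set (snd ((expand_layer ^^ n) ([], [t]))) \<subseteq> S"
    using assms by (induction n) (auto simp: expand_layer)
  then show ?thesis by (simp add: nodes_def)
qed

text \<open>A local test on trees, since formulas themselves are not data for the programs. The
  relation symbol is compared with the valid indices one by one: it is given in binary and may be
  too large to be expanded to a unary position.\<close>

definition node_ok :: "tree list => tree list => tree => bool" where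
  "node_ok Rs vs t \<longleftrightarrow> \<not> is_num t \<and>
    (component t 0 = Num 0 \<and> length (kids t) = 3 \<and> is_num (component t 1) \<and> num_list (component t 2) \<and>
       list_all (\<lambda>v. v \<in> set vs) (kids (component t 2)) \<and>
       list_ex (\<lambda>j. Num j = component t 1 \<and> component (nth_or (Num 0) Rs j) 0 = Num (length (kids (component t 2))))
         [0..<length Rs] \<or>
     component t 0 = Num 1 \<and> length (kids t) = 3 \<and> component t 1 \<in> set vs \<and> component t 2 \<in> set vs \<or>
     component t 0 = Num 2 \<and> length (kids t) = 2 \<and> \<not> is_num (component t 1) \<or>
     (component t 0 = Num 3 \<or> component t 0 = Num 4) \<and> length (kids t) = 3 \<and>
       \<not> is_num (component t 1) \<and> \<not> is_num (component t 2))"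

definition rel_tree :: "nat \<times> nat list list => tree" where
  "rel_tree = (\<lambda>(r, R). Node [Num r, Node (map nums R)])"

definition good :: "(nat \<times> nat list list) list => nat set => form => bool" where
  "good Rs V \<phi> \<longleftrightarrow> quantifier_free \<phi> \<and> over (listed_structure [] Rs) \<phi> \<and> free_vars \<phi> \<subseteq> V"

lemma good_simps [simp]:
  "good Rs V (Rel i xs) \<longleftrightarrow> i < length Rs \<and> length xs = fst (Rs ! i) \<and> set xs \<subseteq> V"
  "good Rs V (Equ x y) \<longleftrightarrow> x \<in> V \<and> y \<in> V"
  "good Rs V (Neg \<phi>) \<longleftrightarrow> good Rs V \<phi>"
  "good Rs V (Conj \<phi> \<psi>) \<longleftrightarrow> good Rs V \<phi> \<and> good Rs V \<psi>"
  "good Rs V (Disj \<phi> \<psi>) \<longleftrightarrow> good Rs V \<phi> \<and> good Rs V \<psi>"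
  "\<not> good Rs V (Exi x \<phi>)" "\<not> good Rs V (Uni x \<phi>)"
  by (auto simp: good_def listed_structure_def case_prod_unfold)

lemma over_listed: "over (listed_structure us Rs) \<phi> \<longleftrightarrow> over (listed_structure us' Rs) \<phi>"
  by (induction \<phi>) (auto simp: listed_structure_def)

lemma kids_nums [simp]: "kids (nums ns) = map Num ns"
  by (simp add: nums_def)

lemma num_list_nums [simp]: "num_list (nums ns)"
  using num_list_iff by blast

lemma rel_index:
  "list_ex (\<lambda>j. Num j = Num i \<and> component (nth_or (Num 0) (map rel_tree Rs) j) 0 = Num r) [0..<length (map rel_tree Rs)]
    \<longleftrightarrow> i < length Rs \<and> fst (Rs ! i) = r"
  by (auto simp: list_ex_iff nth_or_def rel_tree_def case_prod_unfold)

lemma good_node_ok: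
  assumes "good Rs V \<phi>" "Num ` V = set vs"
  shows "node_ok (map rel_tree Rs) vs (form_tree \<phi>)"
proof (cases \<phi>)
  case (Rel i xs)
  then show ?thesis using assms rel_index[of i Rs "length xs"] by (auto simp: node_ok_def list_all_iff simp del: upt_Suc)
qed (use assms in \<open>auto simp: node_ok_def\<close>)

lemma good_children: "good Rs V \<phi> ==> s \<in> set (fchildren (form_tree \<phi>)) ==> \<exists>\<psi>. s = form_tree \<psi> \<and> good Rs V \<psi>"
  by (cases \<phi>) (auto simp: fchildren_def)

lemma kids_3: "\<not> is_num t ==> length (kids t) = 3 ==> t = Node [component t 0, component t 1, component t 2]"
  by (cases t) (auto simp: numeral_3_eq_3 length_Suc_conv)

lemma kids_2: "\<not> is_num t ==> length (kids t) = 2 ==> t = Node [component t 0, component t 1]"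
  by (cases t) (auto simp: numeral_2_eq_2 length_Suc_conv)

text \<open>By induction on the weight: closure under \<open>fchildren\<close> passes the local test
  on to all subformulas.\<close>

lemma node_ok_good:
  assumes N: "t \<in> N" "\<And>s. s \<in> N ==> set (fchildren s) \<subseteq> N" "\<And>s. s \<in> N ==> node_ok (map rel_tree Rs) vs s"
    and V: "Num ` V = set vs"
  shows "\<exists>\<phi>. t = form_tree \<phi> \<and> good Rs V \<phi>"
  using N(1)
proof (induction "weight t" arbitrary: t rule: less_induct)
  case less
  note ok = N(3)[OF less.prems] and closed = N(2)[OF less.prems]
  have child: "\<exists>\<phi>. s = form_tree \<phi> \<and> good Rs V \<phi>" if "s \<in> set (fchildren t)" for s
    using less.hyps[of s] weight_kids[of s t] closed that by (auto simp: fchildren_def split: if_splits)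
  have nt: "\<not> is_num t" using ok by (simp add: node_ok_def)
  have inV: "\<exists>x\<in>V. v = Num x" if "v \<in> set vs" for v using that unfolding V[symmetric] by blast
  consider
    (rel) "component t 0 = Num 0" "length (kids t) = 3" "is_num (component t 1)" "num_list (component t 2)"
      "\<forall>v\<in>set (kids (component t 2)). v \<in> set vs"
      "list_ex (\<lambda>j. Num j = component t 1 \<and> component (nth_or (Num 0) (map rel_tree Rs) j) 0 = Num (length (kids (component t 2))))
         [0..<length (map rel_tree Rs)]"
    | (equ) "component t 0 = Num 1" "length (kids t) = 3" "component t 1 \<in> set vs" "component t 2 \<in> set vs"
    | (neg) "component t 0 = Num 2" "length (kids t) = 2" "\<not> is_num (component t 1)"
    | (con) "component t 0 = Num 3" "length (kids t) = 3" "\<not> is_num (component t 1)" "\<not> is_num (component t 2)"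
    | (dis) "component t 0 = Num 4" "length (kids t) = 3" "\<not> is_num (component t 1)" "\<not> is_num (component t 2)"
    using ok unfolding node_ok_def list_all_iff by blast
  then show ?case
  proof cases
    case rel
    obtain i where i: "component t 1 = Num i" using rel(3) is_num_iff by blast
    obtain xs where xs: "component t 2 = nums xs" using rel(4) num_list_iff by blast
    have "t = form_tree (Rel i xs)" using kids_3[OF nt rel(2)] rel(1) i xs by simp
    moreover have "good Rs V (Rel i xs)"
      using rel(5,6) unfolding i xs rel_index using inV by (fastforce simp: V[symmetric])
    ultimately show ?thesis by blast
  next
    case equ
    obtain x y where xy: "x \<in> V" "y \<in> V" "component t 1 = Num x" "component t 2 = Num y" using inV equ(3,4) by blast
    have "t = form_tree (Equ x y)" using kids_3[OF nt equ(2)] equ(1) xy by simp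
    then show ?thesis using xy(1,2) by (intro exI[of _ "Equ x y"]) simp
  next
    case neg
    obtain a where t: "t = Node [Num 2, a]" using kids_2[OF nt neg(2)] unfolding neg(1) by (rule that)
    then have "fchildren t = [a]" using neg(3) by (simp add: fchildren_def)
    then obtain \<phi> where "a = form_tree \<phi>" "good Rs V \<phi>" using child[of a] by auto
    then show ?thesis using t by (intro exI[of _ "Neg \<phi>"]) simp
  next
    case con
    obtain a b where t: "t = Node [Num 3, a, b]" using kids_3[OF nt con(2)] unfolding con(1) by (rule that)
    then have "fchildren t = [a, b]" using con(3,4) by (simp add: fchildren_def)
    then obtain \<phi> \<psi> where "a = form_tree \<phi>" "good Rs V \<phi>" "b = form_tree \<psi>" "good Rs V \<psi>"
      using child[of a] child[of b] by auto
    then show ?thesis using t by (intro exI[of _ "Conj \<phi> \<psi>"]) simp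
  next
    case dis
    obtain a b where t: "t = Node [Num 4, a, b]" using kids_3[OF nt dis(2)] unfolding dis(1) by (rule that)
    then have "fchildren t = [a, b]" using dis(3,4) by (simp add: fchildren_def)
    then obtain \<phi> \<psi> where "a = form_tree \<phi>" "good Rs V \<phi>" "b = form_tree \<psi>" "good Rs V \<psi>"
      using child[of a] child[of b] by auto
    then show ?thesis using t by (intro exI[of _ "Disj \<phi> \<psi>"]) simp
  qed
qed

lemma nodes_good:
  assumes "good Rs V \<phi>" "s \<in> set (nodes n (form_tree \<phi>))"
  obtains \<psi> where "s = form_tree \<psi>" "good Rs V \<psi>"
proof -
  have "set (nodes n (form_tree \<phi>)) \<subseteq> {form_tree \<psi> | \<psi>. good Rs V \<psi>}"
    by (rule nodes_subset) (use assms(1) good_children in blast)+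
  then show ?thesis using assms(2) that by blast
qed

lemma nodes_ok_iff:
  assumes "weight t \<le> n" "Num ` V = set vs"
  shows "list_all (node_ok (map rel_tree Rs) vs) (nodes n t) \<longleftrightarrow> (\<exists>\<phi>. t = form_tree \<phi> \<and> good Rs V \<phi>)"
proof
  assume "list_all (node_ok (map rel_tree Rs) vs) (nodes n t)"
  then show "\<exists>\<phi>. t = form_tree \<phi> \<and> good Rs V \<phi>"
    using node_ok_good[of t "set (nodes n t)"] nodes_closed[OF assms(1)] assms(2) unfolding list_all_iff by blast
next
  assume "\<exists>\<phi>. t = form_tree \<phi> \<and> good Rs V \<phi>"
  then obtain \<phi> where \<phi>: "t = form_tree \<phi>" "good Rs V \<phi>" by blast
  have "node_ok (map rel_tree Rs) vs s" if s: "s \<in> set (nodes n t)" for s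
  proof -
    obtain \<psi> where "s = form_tree \<psi>" "good Rs V \<psi>" using nodes_good[OF \<phi>(2)] s unfolding \<phi>(1) by blast
    then show ?thesis using good_node_ok[OF _ assms(2)] by blast
  qed
  then show "list_all (node_ok (map rel_tree Rs) vs) (nodes n t)" unfolding list_all_iff by blast
qed

text \<open>5 and 6 are the tags of the quantifiers in \<open>form_tree\<close>, so existential and
  universal prefixes can be stripped by the same function.\<close>

definition quant :: "nat => nat => form => form" where
  "quant j = (if j = 5 then Exi else Uni)"

definition strip_step :: "nat => tree list \<times> tree => tree list \<times> tree" where
  "strip_step j p = (if \<not> is_num (snd p) \<and> component (snd p) 0 = Num j \<and> length (kids (snd p)) = 3 \<and> is_num (component (snd p) 1)
     then (fst p @ [component (snd p) 1], component (snd p) 2) else p)"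

definition strip :: "nat => nat => tree => tree list \<times> tree" where
  "strip j n t = (strip_step j ^^ n) ([], t)"

lemma form_tree_quant: "j = 5 \<or> j = 6 ==> form_tree (quant j x \<phi>) = Node [Num j, Num x, form_tree \<phi>]"
  by (auto simp: quant_def)

lemma strip_foldr:
  assumes j: "j = 5 \<or> j = 6" and n: "length xs \<le> n" and \<chi>: "\<And>x \<psi>. \<chi> \<noteq> quant j x \<psi>"
  shows "strip j n (form_tree (foldr (quant j) xs \<chi>)) = (map Num xs, form_tree \<chi>)"
proof -
  have stop: "strip_step j (acc, form_tree \<chi>) = (acc, form_tree \<chi>)" for acc
  proof (cases \<chi>)
    case (Exi x \<psi>)
    then show ?thesis using j \<chi>[of x \<psi>] by (auto simp: strip_step_def quant_def)
  next
    case (Uni x \<psi>)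
    then show ?thesis using j \<chi>[of x \<psi>] by (auto simp: strip_step_def quant_def)
  qed (use j in \<open>auto simp: strip_step_def\<close>)
  have "(strip_step j ^^ n) (acc, form_tree (foldr (quant j) xs \<chi>)) = (acc @ map Num xs, form_tree \<chi>)" for acc
    using n
  proof (induction n arbitrary: acc xs)
    case (Suc n)
    show ?case
    proof (cases xs)
      case Nil
      then show ?thesis using Suc.IH[of "[]" acc] stop by (simp add: funpow_Suc_right del: funpow.simps)
    next
      case (Cons x xs')
      then have "strip_step j (acc, form_tree (foldr (quant j) xs \<chi>)) = (acc @ [Num x], form_tree (foldr (quant j) xs' \<chi>))"
        by (simp add: strip_step_def form_tree_quant[OF j])
      then show ?thesis using Suc.IH[of xs' "acc @ [Num x]"] Suc.prems Cons by (simp add: funpow_Suc_right del: funpow.simps)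
    qed
  qed simp
  then show ?thesis by (simp add: strip_def)
qed

lemma strip_inverse:
  assumes j: "j = 5 \<or> j = 6"
  obtains xs where "fst (strip j n t) = map Num xs"
    "\<And>\<chi>. snd (strip j n t) = form_tree \<chi> ==> t = form_tree (foldr (quant j) xs \<chi>)"
proof -
  have "\<exists>xs. fst ((strip_step j ^^ n) (acc, t)) = acc @ map Num xs \<and>
    (\<forall>\<chi>. snd ((strip_step j ^^ n) (acc, t)) = form_tree \<chi> \<longrightarrow> t = form_tree (foldr (quant j) xs \<chi>))" for acc
  proof (induction n arbitrary: acc t)
    case (Suc n)
    show ?case
    proof (cases "\<not> is_num t \<and> component t 0 = Num j \<and> length (kids t) = 3 \<and> is_num (component t 1)")
      case True
      then obtain x where x: "component t 1 = Num x" using is_num_iff by blast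
      have t: "t = Node [Num j, Num x, component t 2]" using True kids_3[of t] x by simp
      have step: "strip_step j (acc, t) = (acc @ [Num x], component t 2)" using True x by (simp add: strip_step_def)
      obtain xs where xs: "fst ((strip_step j ^^ n) (acc @ [Num x], component t 2)) = (acc @ [Num x]) @ map Num xs"
        "\<forall>\<chi>. snd ((strip_step j ^^ n) (acc @ [Num x], component t 2)) = form_tree \<chi> \<longrightarrow>
          component t 2 = form_tree (foldr (quant j) xs \<chi>)"
        using Suc.IH[of "acc @ [Num x]" "component t 2"] by blast
      then show ?thesis using t
        by (intro exI[of _ "x # xs"]) (auto simp: funpow_Suc_right step form_tree_quant[OF j] simp del: funpow.simps)
    next
      case False
      then have step: "strip_step j (acc, t) = (acc, t)" by (simp add: strip_step_def)
      show ?thesis using Suc.IH[of acc t] by (simp add: funpow_Suc_right step del: funpow.simps)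
    qed
  qed simp
  from this[of "[]"] show ?thesis using that by (auto simp: strip_def)
qed

lemma strip_weight: "length (fst (strip j n t)) + weight (snd (strip j n t)) \<le> weight t"
proof -
  have step: "length (fst (strip_step j p)) + weight (snd (strip_step j p)) \<le> length (fst p) + weight (snd p)" for p
  proof (cases "\<not> is_num (snd p) \<and> component (snd p) 0 = Num j \<and> length (kids (snd p)) = 3 \<and> is_num (component (snd p) 1)")
    case True
    then have "component (snd p) 2 \<in> set (kids (snd p))" by (simp add: component_def nth_or_def)
    then show ?thesis using weight_kids[of "component (snd p) 2" "snd p"] True by (simp add: strip_step_def)
  next
    case False
    then have "strip_step j p = p" unfolding strip_step_def by (rule if_not_P)
    then show ?thesis by simp
  qed
  have "length (fst ((strip_step j ^^ n) ([], t))) + weight (snd ((strip_step j ^^ n) ([], t))) \<le> weight t"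
  proof (induction n)
    case (Suc n)
    then show ?case using step[of "(strip_step j ^^ n) ([], t)"] by simp
  qed simp
  then show ?thesis by (simp add: strip_def)
qed

definition outer :: "nat => tree => tree list \<times> tree" where "outer n t = strip 5 n t"
definition middle :: "nat => tree => tree list \<times> tree" where "middle n t = strip 6 n (snd (outer n t))"
definition inner :: "nat => tree => tree list \<times> tree" where "inner n t = strip 5 n (snd (middle n t))"

definition rel_ok :: "tree list => tree => bool" where
  "rel_ok us R \<longleftrightarrow> \<not> is_num R \<and> length (kids R) = 2 \<and> is_num (component R 0) \<and> component R 0 \<noteq> Num 0 \<and>
     \<not> is_num (component R 1) \<and> distinct (kids (component R 1)) \<and>
     list_all (\<lambda>\<tau>. num_list \<tau> \<and> Num (length (kids \<tau>)) = component R 0 \<and> list_all (\<lambda>u. u \<in> set us) (kids \<tau>))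
       (kids (component R 1))"

text \<open>\<open>n\<close> limits the number of iterations in stripping prefixes and in collecting
  subformulas; the length of the input word is large enough.\<close>

definition mc_tree :: "nat => tree => bool" where
  "mc_tree n T \<longleftrightarrow> \<not> is_num T \<and> length (kids T) = 3 \<and> num_list (component T 0) \<and>
     distinct (kids (component T 0)) \<and> kids (component T 0) \<noteq> [] \<and>
     \<not> is_num (component T 1) \<and> list_all (rel_ok (kids (component T 0))) (kids (component T 1)) \<and>
     list_all (node_ok (kids (component T 1))
         (fst (outer n (component T 2)) @ fst (middle n (component T 2)) @ fst (inner n (component T 2))))
       (nodes n (snd (inner n (component T 2))))"

definition wf_rel :: "nat list => nat \<times> nat list list => bool" where
  "wf_rel us = (\<lambda>(r, X). r \<ge> 1 \<and> distinct X \<and> (\<forall>\<tau>\<in>set X. length \<tau> = r \<and> set \<tau> \<subseteq> set us))"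

lemma rel_ok_iff: "rel_ok (map Num us) R \<longleftrightarrow> (\<exists>p. R = rel_tree p \<and> wf_rel us p)"
proof
  assume ok: "rel_ok (map Num us) R"
  then obtain r where r: "component R 0 = Num r" using is_num_iff by (auto simp: rel_ok_def)
  obtain ts where ts: "component R 1 = Node ts" using ok by (cases "component R 1") (auto simp: rel_ok_def)
  have "\<forall>\<tau>\<in>set ts. \<exists>ns. \<tau> = nums ns" using ok ts num_list_iff by (auto simp: rel_ok_def list_all_iff)
  then obtain X where X: "ts = map nums X" by (metis ex_map_conv)
  have "R = rel_tree (r, X)" using kids_2[of R] ok r ts X by (simp add: rel_ok_def rel_tree_def)
  moreover have "wf_rel us (r, X)"
    using ok unfolding rel_ok_def r ts X by (auto simp: wf_rel_def list_all_iff distinct_map)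
  ultimately show "\<exists>p. R = rel_tree p \<and> wf_rel us p" by blast
next
  assume "\<exists>p. R = rel_tree p \<and> wf_rel us p"
  then obtain r X where "R = rel_tree (r, X)" "wf_rel us (r, X)" by auto
  then show "rel_ok (map Num us) R"
    by (auto simp: rel_ok_def rel_tree_def wf_rel_def list_all_iff distinct_map inj_on_def)
qed

lemma quant_simps: "over A (quant j x \<phi>) = over A \<phi>" "free_vars (quant j x \<phi>) = free_vars \<phi> - {x}"
  by (simp_all add: quant_def)

lemma over_foldr_quant: "over A (foldr (quant j) xs \<phi>) = over A \<phi>"
  by (induction xs) (simp_all add: quant_simps)

lemma free_vars_foldr_quant: "free_vars (foldr (quant j) xs \<phi>) = free_vars \<phi> - set xs"
proof (induction xs)
  case (Cons x xs)
  then show ?case unfolding foldr.simps comp_apply quant_simps by auto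
qed simp

lemma quant_5_6: "Exi = quant 5" "Uni = quant 6"
  by (simp_all add: quant_def)

lemma mc_instance_iff:
  "mc_instance 3 us Rs (foldr Exi xs (foldr Uni ys (foldr Exi zs \<psi>))) \<and> quantifier_free \<psi> \<longleftrightarrow>
    distinct us \<and> us \<noteq> [] \<and> (\<forall>p\<in>set Rs. wf_rel us p) \<and> good Rs (set xs \<union> set ys \<union> set zs) \<psi>"
proof -
  have "is_Sigma 3 (foldr Exi xs (foldr Uni ys (foldr Exi zs \<psi>)))" if "quantifier_free \<psi>"
    using that unfolding numeral_3_eq_3 is_Sigma.simps is_Pi.simps by blast
  moreover have "wf_structure (listed_structure us Rs) \<and> (\<forall>(r, R)\<in>set Rs. distinct R) \<longleftrightarrow> us \<noteq> [] \<and> (\<forall>p\<in>set Rs. wf_rel us p)"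
    by (simp add: wf_structure_def listed_structure_def wf_rel_def case_prod_unfold ball_conj_distrib) (rule conj_cong[OF refl], blast)
  moreover have "over (listed_structure us Rs) \<psi> \<longleftrightarrow> over (listed_structure [] Rs) \<psi>" by (rule over_listed)
  ultimately show ?thesis
    unfolding mc_instance_def good_def quant_5_6 over_foldr_quant free_vars_foldr_quant by blast
qed

definition mc_to_tree :: "nat list => (nat \<times> nat list list) list => form => tree" where
  "mc_to_tree us Rs \<phi> = Node [nums us, Node (map rel_tree Rs), form_tree \<phi>]"

lemma enc_mc_tree: "enc_mc us Rs \<phi> = enc (mc_to_tree us Rs \<phi>)"
  by (simp only: enc_mc_def mc_to_tree_def rel_tree_def)

lemma prefix_weight:
  "length (fst (outer n t)) + length (fst (middle n t)) + length (fst (inner n t)) + weight (snd (inner n t)) \<le> weight t"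
  using strip_weight[of 5 n t, folded outer_def] strip_weight[of 6 n "snd (outer n t)", folded middle_def]
    strip_weight[of 5 n "snd (middle n t)", folded inner_def]
  by linarith

lemma mc_tree_sound:
  assumes n: "weight T \<le> n" and T: "mc_tree n T"
  obtains us Rs xs ys zs \<psi> where "T = mc_to_tree us Rs (foldr Exi xs (foldr Uni ys (foldr Exi zs \<psi>)))"
    "fst (outer n (component T 2)) = map Num xs" "fst (middle n (component T 2)) = map Num ys"
    "fst (inner n (component T 2)) = map Num zs" "snd (inner n (component T 2)) = form_tree \<psi>"
    "distinct us" "us \<noteq> []" "\<forall>p\<in>set Rs. wf_rel us p" "good Rs (set xs \<union> set ys \<union> set zs) \<psi>"
proof -
  let ?F = "component T 2"
  obtain us where us: "component T 0 = nums us" using T num_list_iff by (auto simp: mc_tree_def)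
  obtain rs where rs: "component T 1 = Node rs" using T by (cases "component T 1") (auto simp: mc_tree_def)
  have "\<forall>R\<in>set rs. \<exists>p. R = rel_tree p \<and> wf_rel us p"
    using T unfolding mc_tree_def us rs kids_nums rel_ok_iff[symmetric] by (simp add: list_all_iff)
  then obtain p where p: "\<forall>R\<in>set rs. R = rel_tree (p R) \<and> wf_rel us (p R)" by (rule bchoice[THEN exE])
  define Rs where "Rs = map p rs"
  have Rs: "rs = map rel_tree Rs" "\<forall>p\<in>set Rs. wf_rel us p" using p by (simp_all add: Rs_def map_idI)
  obtain xs where xs: "fst (outer n ?F) = map Num xs"
    "\<And>\<chi>. snd (outer n ?F) = form_tree \<chi> ==> ?F = form_tree (foldr Exi xs \<chi>)"
    using strip_inverse[of 5 n ?F] unfolding outer_def quant_5_6 by blast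
  obtain ys where ys: "fst (middle n ?F) = map Num ys"
    "\<And>\<chi>. snd (middle n ?F) = form_tree \<chi> ==> snd (outer n ?F) = form_tree (foldr Uni ys \<chi>)"
    using strip_inverse[of 6 n "snd (outer n ?F)"] unfolding middle_def quant_5_6 by blast
  obtain zs where zs: "fst (inner n ?F) = map Num zs"
    "\<And>\<chi>. snd (inner n ?F) = form_tree \<chi> ==> snd (middle n ?F) = form_tree (foldr Exi zs \<chi>)"
    using strip_inverse[of 5 n "snd (middle n ?F)"] unfolding inner_def quant_5_6 by blast
  have T3: "T = Node [nums us, Node rs, ?F]" using kids_3[of T] T unfolding us rs mc_tree_def by blast
  have "weight ?F \<le> weight T" by (subst (2) T3) (simp add: weight_simps(1))
  then have "weight (snd (inner n ?F)) \<le> n"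
    using n prefix_weight[of n ?F] by linarith
  then obtain \<psi> where \<psi>: "snd (inner n ?F) = form_tree \<psi>" "good Rs (set xs \<union> set ys \<union> set zs) \<psi>"
    using T nodes_ok_iff[of "snd (inner n ?F)" n "set xs \<union> set ys \<union> set zs" "map Num xs @ map Num ys @ map Num zs" Rs]
    unfolding mc_tree_def rs Rs(1) xs(1) ys(1) zs(1) by (auto simp: image_Un Un_assoc)
  have "?F = form_tree (foldr Exi xs (foldr Uni ys (foldr Exi zs \<psi>)))" using xs(2) ys(2) zs(2) \<psi>(1) by blast
  then have "T = mc_to_tree us Rs (foldr Exi xs (foldr Uni ys (foldr Exi zs \<psi>)))"
    using T3 unfolding Rs(1) mc_to_tree_def by simp
  moreover have "distinct us" "us \<noteq> []" using T unfolding mc_tree_def us by (auto simp: distinct_map)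
  ultimately show ?thesis using that xs(1) ys(1) zs(1) \<psi> Rs(2) by blast
qed

lemma weight_foldr_quant:
  "j = 5 \<or> j = 6 ==> length xs + weight (form_tree \<chi>) \<le> weight (form_tree (foldr (quant j) xs \<chi>))"
  by (induction xs) (auto simp: form_tree_quant weight_simps(1))

lemma mc_tree_complete:
  assumes inst: "mc_instance 3 us Rs \<phi>" and n: "weight (mc_to_tree us Rs \<phi>) \<le> n"
  shows "mc_tree n (mc_to_tree us Rs \<phi>)"
proof -
  obtain xs' ys zs' \<psi> where \<phi>': "\<phi> = foldr Exi xs' (foldr Uni ys (foldr Exi zs' \<psi>))" "quantifier_free \<psi>"
    using inst unfolding mc_instance_def numeral_3_eq_3 is_Sigma.simps is_Pi.simps by blast
  \<comment> \<open>Stripping is greedy. If the universal block is empty, the first pass consumes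
    both existential blocks, so they are merged beforehand.\<close>
  have "\<exists>xs zs. \<phi> = foldr Exi xs (foldr Uni ys (foldr Exi zs \<psi>)) \<and> (ys = [] \<longrightarrow> zs = [])"
  proof (cases "ys = []")
    case True
    then show ?thesis using \<phi>'(1) by (intro exI[of _ "xs' @ zs'"] exI[of _ "[]"]) simp
  next
    case False
    then show ?thesis using \<phi>'(1) by blast
  qed
  then obtain xs zs where \<phi>: "\<phi> = foldr Exi xs (foldr Uni ys (foldr Exi zs \<psi>))" "quantifier_free \<psi>" "ys = [] ==> zs = []"
    using \<phi>'(2) by blast
  let ?c1 = "foldr Uni ys (foldr Exi zs \<psi>)" and ?c2 = "foldr Exi zs \<psi>"
  have ok: "distinct us \<and> us \<noteq> [] \<and> (\<forall>p\<in>set Rs. wf_rel us p) \<and> good Rs (set xs \<union> set ys \<union> set zs) \<psi>"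
    using mc_instance_iff inst \<phi>(1,2) by blast
  have \<psi>: "\<psi> \<noteq> Exi x \<chi>" "\<psi> \<noteq> Uni x \<chi>" for x \<chi> using \<phi>(2) by auto
  have "?c1 \<noteq> quant 5 x \<chi>" for x \<chi> using \<phi>(3) \<psi> by (cases ys) (auto simp: quant_def)
  moreover have "?c2 \<noteq> quant 6 x \<chi>" for x \<chi> using \<psi> by (cases zs) (auto simp: quant_def)
  moreover have "\<psi> \<noteq> quant 5 x \<chi>" for x \<chi> using \<psi> by (simp add: quant_def)
  moreover have "weight (form_tree \<phi>) \<le> n" using n by (simp add: mc_to_tree_def weight_simps(1))
  then have "length xs + weight (form_tree ?c1) \<le> n" "length ys + weight (form_tree ?c2) \<le> weight (form_tree ?c1)"
    "length zs + weight (form_tree \<psi>) \<le> weight (form_tree ?c2)"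
    using weight_foldr_quant[of 5 xs ?c1] weight_foldr_quant[of 6 ys ?c2] weight_foldr_quant[of 5 zs \<psi>]
    unfolding \<phi>(1) quant_5_6[symmetric] by simp_all
  then have le: "length xs \<le> n" "length ys \<le> n" "length zs \<le> n" "weight (form_tree \<psi>) \<le> n" by linarith+
  ultimately have outer: "outer n (form_tree \<phi>) = (map Num xs, form_tree ?c1)"
    and middle: "middle n (form_tree \<phi>) = (map Num ys, form_tree ?c2)"
    and inner: "inner n (form_tree \<phi>) = (map Num zs, form_tree \<psi>)"
    unfolding outer_def middle_def inner_def \<phi>(1) quant_5_6 using strip_foldr[of 5 xs n] strip_foldr[of 6 ys n] strip_foldr[of 5 zs n]
    by simp_all
  have "list_all (node_ok (map rel_tree Rs) (map Num xs @ map Num ys @ map Num zs)) (nodes n (form_tree \<psi>))"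
    by (rule iffD2[OF nodes_ok_iff[OF le(4), of "set xs \<union> set ys \<union> set zs"]]) (use ok in \<open>auto simp: image_Un\<close>)
  moreover have "rel_ok (map Num us) (rel_tree p)" if "p \<in> set Rs" for p using ok that unfolding rel_ok_iff by blast
  then have "list_all (rel_ok (map Num us)) (map rel_tree Rs)" by (simp add: list_all_iff)
  ultimately show ?thesis
    unfolding mc_tree_def mc_to_tree_def
    using ok outer middle inner by (simp add: distinct_map inj_on_def)
qed

definition rel_tuples :: "tree list => tree => tree list list" where
  "rel_tuples Rs i = concat (map (\<lambda>j. if Num j = i then map kids (kids (component (nth_or (Num 0) Rs j) 1)) else [])
     [0..<length Rs])"

lemma set_rel_tuples: "i < length Rs ==> set (rel_tuples (map rel_tree Rs) (Num i)) = map Num ` set (snd (Rs ! i))"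
  by (auto simp: rel_tuples_def nth_or_def rel_tree_def case_prod_unfold image_iff)

text \<open>
  A relation can have exponentially many tuples in its complement, but each of them has a prefix that
  leaves the tree of the prefixes of the tuples in the relation, and there are few minimal ones.
\<close>

definition exits :: "'a list => 'a list list => 'a list list" where
  "exits us R = filter (\<lambda>e. \<not> list_ex (\<lambda>\<tau>. take (length e) \<tau> = e) R)
     (concat (map (\<lambda>p. map (\<lambda>u. p @ [u]) us) ([] # concat (map (\<lambda>\<tau>. map (\<lambda>i. take i \<tau>) [0..<length \<tau>]) R))))"

lemma in_exits: "e \<in> set (exits us R) \<longleftrightarrow> (\<exists>p. \<exists>u\<in>set us. e = p @ [u] \<and>
    (p = [] \<or> (\<exists>\<tau>\<in>set R. \<exists>i<length \<tau>. p = take i \<tau>)) \<and> (\<forall>\<tau>\<in>set R. take (length e) \<tau> \<noteq> e))"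
proof -
  let ?ps = "[] # concat (map (\<lambda>\<tau>. map (\<lambda>i. take i \<tau>) [0..<length \<tau>]) R)"
  have ps: "p \<in> set ?ps \<longleftrightarrow> p = [] \<or> (\<exists>\<tau>\<in>set R. \<exists>i<length \<tau>. p = take i \<tau>)" for p
    by (auto simp: image_iff simp del: take_eq_Nil take_eq_Nil2) (blast | metis atLeastLessThan_iff le0)+
  have "e \<in> set (concat (map (\<lambda>p. map (\<lambda>u. p @ [u]) us) ps)) \<longleftrightarrow> (\<exists>p. \<exists>u\<in>set us. e = p @ [u] \<and> p \<in> set ps)" for ps
    by auto
  then show ?thesis unfolding exits_def set_filter mem_Collect_eq list_ex_iff ps[symmetric] by blast
qed

lemma exits_iff:
  assumes R: "\<And>\<tau>. \<tau> \<in> set R ==> length \<tau> = length w" and w: "set w \<subseteq> set us" "w \<noteq> []"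
  shows "(\<exists>e\<in>set (exits us R). e = take (length e) w) \<longleftrightarrow> w \<notin> set R"
proof
  assume "\<exists>e\<in>set (exits us R). e = take (length e) w"
  then obtain e where e: "e \<in> set (exits us R)" "e = take (length e) w" by (elim bexE)
  have "\<forall>\<tau>\<in>set R. take (length e) \<tau> \<noteq> e" using e(1) unfolding in_exits by (elim exE bexE conjE)
  from bspec[OF this, of w] show "w \<notin> set R" using e(2)[symmetric] by (intro notI) simp
next
  assume notin: "w \<notin> set R"
  define P where "P i \<longleftrightarrow> (\<forall>\<tau>\<in>set R. take (Suc i) \<tau> \<noteq> take (Suc i) w)" for i
  have "P (length w - 1)" using notin w(2) R by (auto simp: P_def)
  \<comment> \<open>\<open>Suc i\<close> is the length of the shortest prefix of \<open>w\<close>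
    that is no prefix of a tuple in \<open>R\<close>. Without its last entry it is empty or still a
    prefix of such a tuple.\<close>
  define i where "i = (LEAST i. P i)"
  have i: "P i" "i \<le> length w - 1" using \<open>P (length w - 1)\<close> unfolding i_def by (auto intro: LeastI Least_le)
  then have "i < length w" using w(2) by (cases w) auto
  have "take i w = [] \<or> (\<exists>\<tau>\<in>set R. \<exists>j<length \<tau>. take i w = take j \<tau>)"
  proof (cases i)
    case (Suc j)
    then have "\<not> P j" using not_less_Least[of j P] unfolding i_def by simp
    then obtain \<tau> where "\<tau> \<in> set R" "take i \<tau> = take i w" unfolding P_def Suc by blast
    then show ?thesis using R[of \<tau>] \<open>i < length w\<close> by metis
  qed simp
  moreover have "take (Suc i) w = take i w @ [w ! i]" using \<open>i < length w\<close> by (rule take_Suc_conv_app_nth)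
  moreover have "w ! i \<in> set us" using w(1) \<open>i < length w\<close> by auto
  moreover have "\<forall>\<tau>\<in>set R. take (length (take (Suc i) w)) \<tau> \<noteq> take (Suc i) w"
    using i(1) \<open>i < length w\<close> by (simp add: P_def)
  ultimately have "take (Suc i) w \<in> set (exits us R)" unfolding in_exits by blast
  then show "\<exists>e\<in>set (exits us R). e = take (length e) w" using \<open>i < length w\<close> by (intro bexI) auto
qed

lemma exits_bound:
  assumes "\<And>\<tau>. \<tau> \<in> set R ==> length \<tau> = r \<and> set \<tau> \<subseteq> set us" "r \<ge> 1" "e \<in> set (exits us R)"
  shows "length e \<le> r" "set e \<subseteq> set us"
proof -
  obtain p u where e: "e = p @ [u]" "u \<in> set us" "p = [] \<or> (\<exists>\<tau>\<in>set R. \<exists>i<length \<tau>. p = take i \<tau>)"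
    using assms(3) unfolding in_exits by blast
  have "length p < r \<and> set p \<subseteq> set us"
    using e(3) assms(1,2) by (auto dest: in_set_takeD)
  then show "length e \<le> r" "set e \<subseteq> set us" using e(1,2) by auto
qed

text \<open>The rows of the truth tables of negation, conjunction and disjunction, with the value of
  the compound formula in front; 2 and 3 are the tags of \<open>Neg\<close> and
  \<open>Conj\<close>.\<close>

definition gate :: "tree => tree list list" where
  "gate t = (if t = Num 2 then [[Num 0, Num 1], [Num 1, Num 0]]
     else if t = Num 3 then [[Num 1, Num 1, Num 1], [Num 0, Num 1, Num 0], [Num 0, Num 0, Num 1], [Num 0, Num 0, Num 0]]
     else [[Num 1, Num 1, Num 1], [Num 1, Num 1, Num 0], [Num 1, Num 0, Num 1], [Num 0, Num 0, Num 0]])"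

text \<open>The number of patterns is polynomial in the structure: for a relational atom the tuples
  of the relation and the \<open>exits\<close>, for an equation all pairs, for a connective the rows
  of its truth table.\<close>

definition node_con :: "tree list => tree list => tree => con" where
  "node_con us Rs \<nu> =
     (if component \<nu> 0 = Num 0 then (\<nu> # kids (component \<nu> 2),
        map (\<lambda>\<tau>. Num 1 # \<tau>) (rel_tuples Rs (component \<nu> 1)) @
        map (\<lambda>e. Num 0 # e) (exits us (rel_tuples Rs (component \<nu> 1))))
      else if component \<nu> 0 = Num 1 then ([\<nu>, component \<nu> 1, component \<nu> 2],
        concat (map (\<lambda>u. map (\<lambda>u'. [if u = u' then Num 1 else Num 0, u, u']) us) us))
      else (\<nu> # fchildren \<nu>, gate (component \<nu> 0)))"

definition truth :: "fo_structure => (nat => nat) => form => tree" where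
  "truth A w \<phi> = Num (if sat A w \<phi> then 1 else 0)"

lemma holds_two_blocks:
  "holds a (\<nu> # ts, map (\<lambda>e. b # e) P @ map (\<lambda>e. c # e) Q) \<longleftrightarrow>
    b = a \<nu> \<and> (\<exists>e\<in>set P. e = take (length e) (map a ts)) \<or> c = a \<nu> \<and> (\<exists>e\<in>set Q. e = take (length e) (map a ts))"
  unfolding holds_def by (simp add: bex_Un take_map)

lemma holds_node_con:
  assumes good: "good Rs V \<chi>" and Rs: "\<forall>p\<in>set Rs. wf_rel us p"
    and a: "\<And>x. x \<in> V ==> a (Num x) = Num (w x) \<and> w x \<in> set us"
    and bool: "a (form_tree \<chi>) \<in> {Num 0, Num 1}"
    and children: "\<And>\<psi>. form_tree \<psi> \<in> set (fchildren (form_tree \<chi>)) ==> a (form_tree \<psi>) = truth (listed_structure us Rs) w \<psi>"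
  shows "holds a (node_con (map Num us) (map rel_tree Rs) (form_tree \<chi>)) \<longleftrightarrow>
    a (form_tree \<chi>) = truth (listed_structure us Rs) w \<chi>"
proof (cases \<chi>)
  case (Rel i xs)
  let ?R = "rel_tuples (map rel_tree Rs) (Num i)" and ?w = "map Num (map w xs)"
  have i: "i < length Rs" and V: "set xs \<subseteq> V" and len: "length xs = fst (Rs ! i)" using good Rel by simp_all
  have wf: "wf_rel us (Rs ! i)" using Rs i by simp
  have R: "set ?R = map Num ` set (snd (Rs ! i))" using i by (rule set_rel_tuples)
  have aw: "map a (map Num xs) = ?w" using a V by auto
  have "?w \<in> set ?R \<longleftrightarrow> map w xs \<in> set (snd (Rs ! i))"
    unfolding R by (rule inj_image_mem_iff) (simp add: inj_def)
  also have "\<dots> \<longleftrightarrow> sat (listed_structure us Rs) w \<chi>" using i Rel by (simp add: listed_structure_def case_prod_unfold)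
  finally have sat: "?w \<in> set ?R \<longleftrightarrow> sat (listed_structure us Rs) w \<chi>" .
  have lenR: "length \<tau> = length ?w" if "\<tau> \<in> set ?R" for \<tau> using that wf len by (auto simp: R wf_rel_def case_prod_unfold)
  have "set ?w \<subseteq> set (map Num us)" "?w \<noteq> []" using a V wf len by (auto simp: wf_rel_def case_prod_unfold)
  note exits = exits_iff[OF lenR this, of ?R]
  have "node_con (map Num us) (map rel_tree Rs) (form_tree \<chi>) =
      (form_tree \<chi> # map Num xs, map (\<lambda>\<tau>. Num 1 # \<tau>) ?R @ map (\<lambda>e. Num 0 # e) (exits (map Num us) ?R))"
    using Rel by (simp add: node_con_def)
  then have "holds a (node_con (map Num us) (map rel_tree Rs) (form_tree \<chi>)) \<longleftrightarrow>
      Num 1 = a (form_tree \<chi>) \<and> (\<exists>\<tau>\<in>set ?R. \<tau> = take (length \<tau>) ?w) \<or>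
      Num 0 = a (form_tree \<chi>) \<and> (\<exists>e\<in>set (exits (map Num us) ?R). e = take (length e) ?w)"
    by (simp only: holds_two_blocks aw)
  also have "(\<exists>\<tau>\<in>set ?R. \<tau> = take (length \<tau>) ?w) \<longleftrightarrow> ?w \<in> set ?R"
    using lenR by auto
  also note exits
  finally show ?thesis unfolding sat truth_def using bool by auto
next
  case (Equ x y)
  then show ?thesis using good bool a[of x] a[of y]
    by (auto simp: holds_def node_con_def truth_def image_iff)
next
  case (Neg \<phi>)
  then show ?thesis using children[of \<phi>] bool
    by (auto simp: holds_def node_con_def gate_def fchildren_def truth_def)
next
  case (Conj \<phi> \<psi>)
  then show ?thesis using children[of \<phi>] children[of \<psi>] bool
    by (auto simp: holds_def node_con_def gate_def fchildren_def truth_def)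
next
  case (Disj \<phi> \<psi>)
  then show ?thesis using children[of \<phi>] children[of \<psi>] bool
    by (auto simp: holds_def node_con_def gate_def fchildren_def truth_def)
qed (use good in auto)

text \<open>Inner quantifiers shadow outer ones; the truth values of subformulas are chosen last.\<close>

definition csp_xs :: "tree list => tree list => tree list => tree list" where
  "csp_xs xs ys zs = remdups (filter (\<lambda>v. v \<notin> set ys \<and> v \<notin> set zs) xs)"

definition csp_ys :: "tree list => tree list => tree list" where
  "csp_ys ys zs = remdups (filter (\<lambda>v. v \<notin> set zs) ys)"

definition csp_zs :: "tree list => tree list => tree list" where
  "csp_zs zs N = remdups zs @ remdups N"

definition csp_cons :: "tree list => tree list => tree list => tree => con list" where
  "csp_cons us Rs N t = ([t], [[Num 1]]) # map (node_con us Rs) N"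

lemma holds_root: "holds a ([t], [[Num 1]]) \<longleftrightarrow> a t = Num 1"
  by (auto simp: holds_def)

lemma inv_Num [simp]: "inv Num (Num x) = x"
  by (rule inv_f_f) (simp add: inj_def)

lemma inv_form_tree [simp]: "inv form_tree (form_tree \<phi>) = \<phi>"
  by (rule inv_f_f) (simp add: inj_def)

lemma quantified_sat:
  "sat A v (foldr Exi xs (foldr Uni ys (foldr Exi zs \<psi>))) \<longleftrightarrow>
    (\<exists>F. (\<forall>x\<in>set xs. F x \<in> universe A) \<and> (\<forall>f. (\<forall>y\<in>set ys. f y \<in> universe A) \<longrightarrow>
      (\<exists>h. (\<forall>z\<in>set zs. h z \<in> universe A) \<and>
        sat A (\<lambda>x. if x \<in> set zs then h x else if x \<in> set ys then f x else if x \<in> set xs then F x else v x) \<psi>)))"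
  unfolding sat_Exis sat_Unis ..

section \<open>The sentence as a game on constraints\<close>

locale mc_csp =
  fixes us :: "nat list" and Rs :: "(nat \<times> nat list list) list" and xs ys zs :: "nat list" and \<psi> :: form and n :: nat
  assumes dist: "distinct us" and nonempty: "us \<noteq> []" and Rs: "\<forall>p\<in>set Rs. wf_rel us p"
    and good: "good Rs (set xs \<union> set ys \<union> set zs) \<psi>" and n: "weight (form_tree \<psi>) \<le> n"
begin

abbreviation "A \<equiv> listed_structure us Rs"
abbreviation "V \<equiv> set xs \<union> set ys \<union> set zs"
abbreviation "N \<equiv> nodes n (form_tree \<psi>)"
abbreviation "X \<equiv> csp_xs (map Num xs) (map Num ys) (map Num zs)"
abbreviation "Y \<equiv> csp_ys (map Num ys) (map Num zs)"
abbreviation "Z \<equiv> csp_zs (map Num zs) N"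
abbreviation "U \<equiv> map Num us"
abbreviation "C \<equiv> csp_cons U (map rel_tree Rs) N (form_tree \<psi>)"

lemma node_form:
  assumes "\<nu> \<in> set N" obtains \<chi> where "\<nu> = form_tree \<chi>" "good Rs V \<chi>"
  using nodes_good[OF good assms] .

lemma in_sets:
  "Num x \<in> set X \<longleftrightarrow> x \<in> set xs \<and> x \<notin> set ys \<and> x \<notin> set zs" "Num x \<in> set Y \<longleftrightarrow> x \<in> set ys \<and> x \<notin> set zs"
  "Num x \<in> set Z \<longleftrightarrow> x \<in> set zs"
  "form_tree \<chi> \<notin> set X" "form_tree \<chi> \<notin> set Y" "form_tree \<chi> \<in> set Z \<longleftrightarrow> form_tree \<chi> \<in> set N"
proof -
  have "form_tree \<chi> \<noteq> Num z" for z \<chi> by (cases \<chi>) auto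
  note [simp] = this this[symmetric]
  have "Num x \<notin> set N"
  proof
    assume "Num x \<in> set N"
    then obtain \<chi> where "Num x = form_tree \<chi>" by (rule node_form)
    then show False by simp
  qed
  then show "Num x \<in> set Z \<longleftrightarrow> x \<in> set zs" by (auto simp: csp_zs_def)
  show "Num x \<in> set X \<longleftrightarrow> x \<in> set xs \<and> x \<notin> set ys \<and> x \<notin> set zs" "Num x \<in> set Y \<longleftrightarrow> x \<in> set ys \<and> x \<notin> set zs"
    "form_tree \<chi> \<notin> set X" "form_tree \<chi> \<notin> set Y" "form_tree \<chi> \<in> set Z \<longleftrightarrow> form_tree \<chi> \<in> set N"
    by (auto simp: csp_xs_def csp_ys_def csp_zs_def)
qed

lemma in_var_sets: "t \<in> set X ==> \<exists>x. t = Num x" "t \<in> set Y ==> \<exists>x. t = Num x"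
  "t \<in> set Z ==> (\<exists>x. t = Num x) \<or> (\<exists>\<chi>. t = form_tree \<chi>)"
  by (auto simp: csp_xs_def csp_ys_def csp_zs_def elim!: node_form)

lemma dom_simps: "csp.dom U (Num x) = U" "csp.dom U (form_tree \<chi>) = [Num 0, Num 1]"
  by (simp_all add: csp.dom_def)

lemma root: "form_tree \<psi> \<in> set N"
  using nodes_closed(1)[OF n] .

lemma children: "\<nu> \<in> set N ==> s \<in> set (fchildren \<nu>) ==> s \<in> set N"
  using nodes_closed(2)[OF n] by blast

text \<open>As in the Tseitin transformation, the constraints determine the values of all
  subformulas from the bottom up. So the third player gains nothing from the choice of truth
  values.\<close>

lemma node_constraints:
  assumes a: "\<And>x. x \<in> V ==> a (Num x) = Num (w x) \<and> w x \<in> set us"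
    and bool: "\<And>\<nu>. \<nu> \<in> set N ==> a \<nu> \<in> {Num 0, Num 1}"
  shows "(\<forall>c\<in>set C. holds a c) \<longleftrightarrow> sat A w \<psi> \<and> (\<forall>\<chi>. form_tree \<chi> \<in> set N \<longrightarrow> a (form_tree \<chi>) = truth A w \<chi>)"
proof -
  have step: "holds a (node_con U (map rel_tree Rs) (form_tree \<chi>)) \<longleftrightarrow> a (form_tree \<chi>) = truth A w \<chi>"
    if "form_tree \<chi> \<in> set N" and children: "\<And>\<chi>'. form_tree \<chi>' \<in> set (fchildren (form_tree \<chi>)) ==> a (form_tree \<chi>') = truth A w \<chi>'" for \<chi>
  proof -
    have "good Rs V \<chi>" using that(1) by (rule node_form) simp
    then show ?thesis by (rule holds_node_con[OF _ Rs a bool[OF that(1)] children])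
  qed
  have "(\<forall>\<nu>\<in>set N. holds a (node_con U (map rel_tree Rs) \<nu>)) \<longleftrightarrow> (\<forall>\<chi>. form_tree \<chi> \<in> set N \<longrightarrow> a (form_tree \<chi>) = truth A w \<chi>)"
  proof (intro iffI allI impI ballI)
    fix \<chi> assume hold: "\<forall>\<nu>\<in>set N. holds a (node_con U (map rel_tree Rs) \<nu>)" and "form_tree \<chi> \<in> set N"
    then show "a (form_tree \<chi>) = truth A w \<chi>"
    proof (induction "weight (form_tree \<chi>)" arbitrary: \<chi> rule: less_induct)
      case less
      have "a (form_tree \<chi>') = truth A w \<chi>'" if c: "form_tree \<chi>' \<in> set (fchildren (form_tree \<chi>))" for \<chi>'
      proof (rule less.hyps)
        show "weight (form_tree \<chi>') < weight (form_tree \<chi>)"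
          using c by (intro weight_kids) (auto simp: fchildren_def split: if_splits)
      qed (use children[OF less.prems(2) c] less.prems in auto)
      then show ?case using step[OF less.prems(2)] less.prems by blast
    qed
  next
    fix \<nu> assume *: "\<forall>\<chi>. form_tree \<chi> \<in> set N \<longrightarrow> a (form_tree \<chi>) = truth A w \<chi>" and \<nu>: "\<nu> \<in> set N"
    then obtain \<chi> where "\<nu> = form_tree \<chi>" using node_form by metis
    then show "holds a (node_con U (map rel_tree Rs) \<nu>)" using step[of \<chi>] * \<nu> children by blast
  qed
  moreover have "truth A w \<psi> = Num 1 \<longleftrightarrow> sat A w \<psi>" by (simp add: truth_def)
  moreover have "(\<forall>c\<in>set C. holds a c) \<longleftrightarrow> a (form_tree \<psi>) = Num 1 \<and> (\<forall>\<nu>\<in>set N. holds a (node_con U (map rel_tree Rs) \<nu>))"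
    unfolding csp_cons_def by (simp only: list.set set_map ball_simps holds_root)
  ultimately show ?thesis using root by metis
qed

lemma winning_iff_models:
  "csp.winning X Y Z U C \<longleftrightarrow> models A (foldr Exi xs (foldr Uni ys (foldr Exi zs \<psi>)))"
proof -
  have univ: "universe A = set us" by (simp add: listed_structure_def)
  obtain u0 where u0: "u0 \<in> set us" using nonempty by (cases us) auto
  show ?thesis
  proof
    assume win: "csp.winning X Y Z U C"
    then obtain F' where F': "\<forall>v\<in>set X. F' v \<in> set (csp.dom U v)" and
      reply: "\<And>f. \<forall>v\<in>set Y. f v \<in> set (csp.dom U v) ==>
        \<exists>h. (\<forall>v\<in>set Z. h v \<in> set (csp.dom U v)) \<and> (\<forall>c\<in>set C. holds (csp.combine X Y F' f h) c)"
      unfolding csp.winning_def by blast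
    \<comment> \<open>A variable of \<open>xs\<close> that is shadowed has no counterpart in
      \<open>X\<close>. Its quantifier still asks for a value, and \<open>u0\<close> supplies
      one.\<close>
    define F where "F x = (if Num x \<in> set X then inv Num (F' (Num x)) else u0)" for x
    have F: "F x \<in> set us" "Num x \<in> set X ==> F' (Num x) = Num (F x)" for x
      using F' u0 by (auto simp: F_def dom_simps dest!: bspec[of _ _ "Num x"])
    show "models A (foldr Exi xs (foldr Uni ys (foldr Exi zs \<psi>)))"
      unfolding models_def quantified_sat univ
    proof (intro allI impI, rule exI[of _ F], intro conjI allI impI)
      fix v f :: "nat => nat" assume f: "\<forall>y\<in>set ys. f y \<in> set us"
      define f' where "f' t = Num (f (inv Num t))" for t
      have "\<forall>v\<in>set Y. f' v \<in> set (csp.dom U v)"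
      proof
        fix t assume t: "t \<in> set Y"
        then obtain y where "t = Num y" using in_var_sets by blast
        then show "f' t \<in> set (csp.dom U t)" using t f in_sets(2) by (simp add: f'_def dom_simps)
      qed
      then obtain h' where h': "\<forall>v\<in>set Z. h' v \<in> set (csp.dom U v)" "\<forall>c\<in>set C. holds (csp.combine X Y F' f' h') c"
        using reply by blast
      define h where "h x = inv Num (h' (Num x))" for x
      have h: "h x \<in> set us \<and> h' (Num x) = Num (h x)" if "x \<in> set zs" for x
        using bspec[OF h'(1), of "Num x"] in_sets(3) that by (auto simp: h_def dom_simps)
      let ?w = "\<lambda>x. if x \<in> set zs then h x else if x \<in> set ys then f x else if x \<in> set xs then F x else v x"
      have "csp.combine X Y F' f' h' (Num x) = Num (?w x) \<and> ?w x \<in> set us" if "x \<in> V" for x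
        using that F(2)[of x] F(1)[of x] f h[of x] by (auto simp: csp.combine_def in_sets f'_def)
      moreover have "csp.combine X Y F' f' h' \<nu> \<in> {Num 0, Num 1}" if \<nu>: "\<nu> \<in> set N" for \<nu>
      proof -
        obtain \<chi> where \<chi>: "\<nu> = form_tree \<chi>" using \<nu> by (rule node_form)
        then show ?thesis using bspec[OF h'(1), of \<nu>] \<nu> by (auto simp: csp.combine_def in_sets dom_simps simp del: form_tree.simps)
      qed
      ultimately have "sat A ?w \<psi>" using node_constraints[of "csp.combine X Y F' f' h'" ?w] h'(2) by blast
      then show "\<exists>h. (\<forall>z\<in>set zs. h z \<in> set us) \<and>
        sat A (\<lambda>x. if x \<in> set zs then h x else if x \<in> set ys then f x else if x \<in> set xs then F x else v x) \<psi>"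
        using h by blast
    qed (simp add: F(1))
  next
    assume "models A (foldr Exi xs (foldr Uni ys (foldr Exi zs \<psi>)))"
    moreover have "range (\<lambda>x. u0) \<subseteq> universe A" using u0 univ by auto
    ultimately have "sat A (\<lambda>x. u0) (foldr Exi xs (foldr Uni ys (foldr Exi zs \<psi>)))" unfolding models_def by blast
    then obtain F where F: "\<forall>x\<in>set xs. F x \<in> set us" and
      reply: "\<And>f. \<forall>y\<in>set ys. f y \<in> set us ==> \<exists>h. (\<forall>z\<in>set zs. h z \<in> set us) \<and>
        sat A (\<lambda>x. if x \<in> set zs then h x else if x \<in> set ys then f x else if x \<in> set xs then F x else u0) \<psi>"
      unfolding quantified_sat univ by blast
    define F' where "F' t = Num (F (inv Num t))" for t
    show "csp.winning X Y Z U C"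
      unfolding csp.winning_def
    proof (rule exI[of _ F'], intro conjI allI impI, rule ballI)
      fix t assume t: "t \<in> set X"
      then obtain x where "t = Num x" using in_var_sets by blast
      then show "F' t \<in> set (csp.dom U t)" using t F in_sets(1) by (simp add: F'_def dom_simps)
    next
      fix f' assume f': "\<forall>v\<in>set Y. f' v \<in> set (csp.dom U v)"
      define f where "f y = (if Num y \<in> set Y then inv Num (f' (Num y)) else u0)" for y
      have f: "f y \<in> set us" "Num y \<in> set Y ==> f' (Num y) = Num (f y)" for y
        using f' u0 by (auto simp: f_def dom_simps dest!: bspec[of _ _ "Num y"])
      obtain h where h: "\<forall>z\<in>set zs. h z \<in> set us"
        "sat A (\<lambda>x. if x \<in> set zs then h x else if x \<in> set ys then f x else if x \<in> set xs then F x else u0) \<psi>"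
        using reply[of f] f(1) by blast
      let ?w = "\<lambda>x. if x \<in> set zs then h x else if x \<in> set ys then f x else if x \<in> set xs then F x else u0"
      \<comment> \<open>The third player answers with the values for the innermost block and with
        the actual truth values of the subformulas.\<close>
      define h' where "h' t = (if is_num t then Num (h (inv Num t)) else truth A ?w (inv form_tree t))" for t
      have h'_simps: "h' (Num x) = Num (h x)" "h' (form_tree \<chi>) = truth A ?w \<chi>" for x \<chi>
        by (simp_all add: h'_def)
      have bool: "truth A ?w \<chi> = Num 0 \<or> truth A ?w \<chi> = Num 1" for \<chi> by (simp add: truth_def)
      have "h' t \<in> set (csp.dom U t)" if t: "t \<in> set Z" for t
        using in_var_sets(3)[OF t]
      proof (elim disjE exE)
        fix x assume "t = Num x"
        then show ?thesis using t h(1) by (simp add: h'_simps dom_simps in_sets)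
      next
        fix \<chi> assume "t = form_tree \<chi>"
        then show ?thesis using bool[of \<chi>] by (simp only: h'_simps dom_simps) auto
      qed
      moreover have "csp.combine X Y F' f' h' (Num x) = Num (?w x) \<and> ?w x \<in> set us" if "x \<in> V" for x
        using that F f[of x] h(1) by (auto simp: csp.combine_def in_sets F'_def h'_simps)
      moreover have comb: "csp.combine X Y F' f' h' (form_tree \<chi>) = truth A ?w \<chi>" for \<chi>
        by (simp add: csp.combine_def in_sets h'_simps del: form_tree.simps)
      moreover have "csp.combine X Y F' f' h' \<nu> \<in> {Num 0, Num 1}" if \<nu>: "\<nu> \<in> set N" for \<nu>
      proof -
        obtain \<chi> where "\<nu> = form_tree \<chi>" using \<nu> by (rule node_form)
        then show ?thesis using comb bool by auto
      qed
      ultimately show "\<exists>h. (\<forall>v\<in>set Z. h v \<in> set (csp.dom U v)) \<and> (\<forall>c\<in>set C. holds (csp.combine X Y F' f' h) c)"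
        using node_constraints[of "csp.combine X Y F' f' h'" ?w] h(2) by (intro exI[of _ h']) blast
    qed
  qed
qed

definition pattern_ok :: "tree list => tree list => bool" where
  "pattern_ok e ts \<longleftrightarrow> length e \<le> length ts \<and> (\<forall>p<length e. e ! p \<in> set (csp.dom U (nth_or (Num 0) ts p)))"

lemma pattern_ok_simps [simp]:
  "pattern_ok [] ts"
  "pattern_ok (b # e) (t # ts) \<longleftrightarrow> b \<in> set (csp.dom U t) \<and> pattern_ok e ts"
proof -
  have all: "(\<forall>p<Suc m. P p) \<longleftrightarrow> P 0 \<and> (\<forall>p<m. P (Suc p))" for P and m :: nat
    by (metis Suc_less_eq less_Suc_eq_0_disj zero_less_Suc)
  show "pattern_ok (b # e) (t # ts) \<longleftrightarrow> b \<in> set (csp.dom U t) \<and> pattern_ok e ts"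
    unfolding pattern_ok_def list.size add_0_right add_Suc_right all by (simp add: conj_ac)
qed (simp add: pattern_ok_def)

lemma con_ok:
  assumes "c \<in> set C"
  shows "set (fst c) \<subseteq> set (csp.vars X Y Z)"
    and "e \<in> set (snd c) ==> length e \<le> length (fst c) \<and> (\<forall>p<length e. e ! p \<in> set (csp.dom U (scope c p)))"
proof -
  have Num: "Num x \<in> set (csp.vars X Y Z)" if "x \<in> V" for x using that in_sets by (auto simp: csp.vars_def)
  have node: "form_tree \<chi> \<in> set (csp.vars X Y Z)" if "form_tree \<chi> \<in> set N" for \<chi>
    using that in_sets(6) by (simp add: csp.vars_def)
  have bool: "b \<in> set (csp.dom U (form_tree \<chi>)) \<longleftrightarrow> b = Num 0 \<or> b = Num 1" for b \<chi> by (simp add: dom_simps)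
  have "set (fst c) \<subseteq> set (csp.vars X Y Z) \<and>
    (\<forall>e\<in>set (snd c). pattern_ok e (fst c))"
  proof (cases "c = ([form_tree \<psi>], [[Num 1]])")
    case True
    then show ?thesis using node[OF root] by (simp add: dom_simps del: form_tree.simps)
  next
    case False
    then obtain \<nu> where \<nu>: "\<nu> \<in> set N" "c = node_con U (map rel_tree Rs) \<nu>" using assms by (auto simp: csp_cons_def)
    obtain \<chi> where \<chi>: "\<nu> = form_tree \<chi>" "good Rs V \<chi>" using \<nu>(1) by (rule node_form)
    have \<chi>N: "form_tree \<chi> \<in> set N" using \<nu>(1) \<chi>(1) by simp
    note child = children[OF \<chi>N]
    note c = \<nu>(2)[unfolded \<chi>(1)]
    show ?thesis
    proof (cases \<chi>)
      case (Rel i xs')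
      let ?R = "rel_tuples (map rel_tree Rs) (Num i)"
      have i: "i < length Rs" and len: "length xs' = fst (Rs ! i)" and V: "set xs' \<subseteq> V" using \<chi>(2) Rel by auto
      have wf: "wf_rel us (Rs ! i)" using Rs i by simp
      have c': "c = (form_tree \<chi> # map Num xs', map (\<lambda>\<tau>. Num 1 # \<tau>) ?R @ map (\<lambda>e. Num 0 # e) (exits U ?R))"
        unfolding c using Rel by (simp add: node_con_def)
      have R: "length \<tau> = length xs' \<and> set \<tau> \<subseteq> set U" if \<tau>R: "\<tau> \<in> set ?R" for \<tau>
      proof -
        obtain \<tau>' where "\<tau>' \<in> set (snd (Rs ! i))" and \<tau>: "\<tau> = map Num \<tau>'" using \<tau>R unfolding set_rel_tuples[OF i] by blast
        then have "length \<tau>' = length xs'" "set \<tau>' \<subseteq> set us" using wf len by (auto simp: wf_rel_def case_prod_unfold)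
        then show ?thesis unfolding \<tau> set_map by (simp add: image_mono)
      qed
      have ge: "length xs' \<ge> 1" using wf len by (auto simp: wf_rel_def case_prod_unfold)
      have E: "length e \<le> length xs'" "set e \<subseteq> set U" if "e \<in> set (exits U ?R)" for e
        by (rule exits_bound[OF R ge that]; assumption)+
      have pat: "pattern_ok e (map Num xs')" if "length e \<le> length xs'" "set e \<subseteq> set U" for e
        using that nth_mem by (auto simp: pattern_ok_def nth_or_def dom_simps)
      have "set (form_tree \<chi> # map Num xs') \<subseteq> set (csp.vars X Y Z)" using node[OF \<chi>N] Num V by auto
      moreover have "pattern_ok e (form_tree \<chi> # map Num xs')" if "e \<in> set (snd c)" for e
      proof -
        from that[unfolded c'] consider \<tau> where "e = Num 1 # \<tau>" "\<tau> \<in> set ?R" | e' where "e = Num 0 # e'" "e' \<in> set (exits U ?R)"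
          by auto
        then show ?thesis
        proof cases
          case 1
          then show ?thesis unfolding 1(1) pattern_ok_simps bool using pat[of \<tau>] R[OF 1(2)] by simp
        next
          case 2
          then show ?thesis unfolding 2(1) pattern_ok_simps bool using pat[of e'] E[OF 2(2)] by simp
        qed
      qed
      ultimately show ?thesis unfolding c' fst_conv by blast
    next
      case (Equ x y)
      have c': "c = ([form_tree \<chi>, Num x, Num y], concat (map (\<lambda>u. map (\<lambda>u'. [if u = u' then Num 1 else Num 0, u, u']) U) U))"
        unfolding c using Equ by (simp add: node_con_def)
      have "set [form_tree \<chi>, Num x, Num y] \<subseteq> set (csp.vars X Y Z)" using node[OF \<chi>N] Num \<chi>(2) Equ by auto
      moreover have "pattern_ok e [form_tree \<chi>, Num x, Num y]" if "e \<in> set (snd c)" for e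
      proof -
        obtain u u' where "e = [if u = u' then Num 1 else Num 0, u, u']" "u \<in> set U" "u' \<in> set U"
          using \<open>e \<in> set (snd c)\<close> unfolding c' by auto
        then show ?thesis by (simp add: bool dom_simps(1) del: form_tree.simps)
      qed
      ultimately show ?thesis unfolding c' fst_conv by blast
    next
      case (Neg \<phi>)
      have c': "c = ([form_tree \<chi>, form_tree \<phi>], [[Num 0, Num 1], [Num 1, Num 0]])"
        unfolding c using Neg by (simp add: node_con_def gate_def fchildren_def)
      have "form_tree \<phi> \<in> set N" using child[of "form_tree \<phi>"] Neg by (simp add: fchildren_def)
      then show ?thesis using node node[OF \<chi>N] unfolding c' by (simp add: bool del: form_tree.simps)
    next
      case (Conj \<phi> \<phi>')
      have c': "c = ([form_tree \<chi>, form_tree \<phi>, form_tree \<phi>'], gate (Num 3))"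
        unfolding c using Conj by (simp add: node_con_def gate_def fchildren_def)
      have "form_tree \<phi> \<in> set N" "form_tree \<phi>' \<in> set N"
        using child[of "form_tree \<phi>"] child[of "form_tree \<phi>'"] Conj by (simp_all add: fchildren_def)
      then show ?thesis using node node[OF \<chi>N]
        unfolding c' by (simp add: gate_def bool del: form_tree.simps)
    next
      case (Disj \<phi> \<phi>')
      have c': "c = ([form_tree \<chi>, form_tree \<phi>, form_tree \<phi>'], gate (Num 4))"
        unfolding c using Disj by (simp add: node_con_def gate_def fchildren_def)
      have "form_tree \<phi> \<in> set N" "form_tree \<phi>' \<in> set N"
        using child[of "form_tree \<phi>"] child[of "form_tree \<phi>'"] Disj by (simp_all add: fchildren_def)
      then show ?thesis using node node[OF \<chi>N]
        unfolding c' by (simp add: gate_def bool del: form_tree.simps)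
    qed (use \<chi>(2) in auto)
  qed
  then show "set (fst c) \<subseteq> set (csp.vars X Y Z)"
    "e \<in> set (snd c) ==> length e \<le> length (fst c) \<and> (\<forall>p<length e. e ! p \<in> set (csp.dom U (scope c p)))"
    unfolding scope_def pattern_ok_def by blast+
qed

lemma wf_csp: "wf_csp X Y Z U C"
proof
  have "t \<notin> set Y \<and> t \<notin> set Z" if t: "t \<in> set X" for t
  proof -
    obtain x where "t = Num x" using in_var_sets(1)[OF t] by blast
    then show ?thesis using t in_sets by simp
  qed
  moreover have "t \<notin> set Z" if t: "t \<in> set Y" for t
  proof -
    obtain x where "t = Num x" using in_var_sets(2)[OF t] by blast
    then show ?thesis using t in_sets by simp
  qed
  moreover have "distinct X" "distinct Y" by (simp_all add: csp_xs_def csp_ys_def)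
  moreover have "distinct Z"
  proof -
    have "Num x \<notin> set N" for x
    proof
      assume "Num x \<in> set N"
      then obtain \<chi> where "Num x = form_tree \<chi>" by (rule node_form)
      then show False by (cases \<chi>) auto
    qed
    then show ?thesis by (auto simp: csp_zs_def)
  qed
  ultimately show "distinct (csp.vars X Y Z)" by (auto simp: csp.vars_def)
  show "U \<noteq> []" "distinct U" using nonempty dist by (simp_all add: distinct_map inj_on_def)
qed (rule con_ok; assumption)+

end

section \<open>Polynomial time of the translation of sentences\<close>

definition group_code :: "group => nat \<times> tree \<times> con \<times> nat" where
  "group_code g = (case g of Mode => (0, Num 0, ([], []), 0) | Var v => (1, v, ([], []), 0) | Con c => (2, Num 0, c, 0)
     | Fill c p => (3, Num 0, c, p) | Seg s => (4, Num 0, ([], []), s))"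

instantiation group :: coded
begin
definition "dat_of_group g = dat_of (group_code g)"
instance by standard (auto simp: dat_of_group_def group_code_def split: group.splits)
end

definition key_code :: "key => nat \<times> group \<times> tree \<times> tree" where
  "key_code q = (case q of Group g => (0, g, Num 0, Num 0) | Active g => (1, g, Num 0, Num 0)
     | Xkey v u => (2, Mode, v, u) | Ykey v u => (3, Mode, v, u) | Occ c p u => (4, Fill c p, u, Num 0))"

instantiation key :: coded
begin
definition "dat_of_key q = dat_of (key_code q)"
instance by standard (auto simp: dat_of_key_def key_code_def split: key.splits)
end

text \<open>Under the binder of a \<open>map\<close> or \<open>filter\<close> the context is paired
  with the bound variable. These rules lift a function of the context under one and under two
  binders.\<close>

lemmas on_fst = ptime_compose_fst
lemmas on_fst2 = on_fst[THEN on_fst]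

lemma ptime_group_code: "ptime (\<lambda>x. group_code (g x)) ==> ptime g"
  by (rule ptime_recode[of "\<lambda>x. group_code (g x)"]) (simp_all add: dat_of_group_def)

lemma ptime_key_code: "ptime (\<lambda>x. key_code (k x)) ==> ptime k"
  by (rule ptime_recode[of "\<lambda>x. key_code (k x)"]) (simp_all add: dat_of_key_def)

lemma ptime_group [ptime]:
  "ptime f ==> ptime (\<lambda>x. Var (f x))" "ptime c ==> ptime (\<lambda>x. Con (c x))"
  "ptime c ==> ptime p ==> ptime (\<lambda>x. Fill (c x) (p x))" "ptime p ==> ptime (\<lambda>x. Seg (p x))"
  by (rule ptime_group_code, unfold group_code_def group.case, intro ptime; assumption)+

lemma ptime_key [ptime]:
  "ptime g ==> ptime (\<lambda>x. Group (g x))" "ptime g ==> ptime (\<lambda>x. Active (g x))"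
  "ptime v ==> ptime u ==> ptime (\<lambda>x. Xkey (v x) (u x))" "ptime v ==> ptime u ==> ptime (\<lambda>x. Ykey (v x) (u x))"
  "ptime c ==> ptime p ==> ptime u ==> ptime (\<lambda>x. Occ (c x) (p x) (u x))"
  by (rule ptime_key_code, unfold key_code_def key.case, intro ptime; assumption)+

lemma ptime_scope [ptime]: "ptime c ==> ptime p ==> ptime (\<lambda>x. scope (c x) (p x))"
  unfolding scope_def by (intro ptime)

lemma ptime_segments [ptime]:
  assumes "ptime k"
  shows "ptime (\<lambda>x. segments (k x))"
  unfolding segments_def by (intro ptime assms assms[THEN on_fst] assms[THEN on_fst2])

lemma ptime_dom [ptime]: "ptime us ==> ptime v ==> ptime (\<lambda>x. csp.dom (us x) (v x))"
  unfolding csp.dom_def by (intro ptime)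

lemma ptime_vars [ptime]: "ptime xs ==> ptime ys ==> ptime zs ==> ptime (\<lambda>x. csp.vars (xs x) (ys x) (zs x))"
  unfolding csp.vars_def by (intro ptime)

lemma ptime_others [ptime]:
  assumes "ptime us" "ptime v" "ptime u"
  shows "ptime (\<lambda>x. csp.others (us x) (v x) (u x))"
  unfolding csp.others_def by (intro ptime assms assms[THEN on_fst] assms[THEN on_fst2])

lemma ptime_xkeys [ptime]:
  assumes "ptime xs" "ptime us"
  shows "ptime (\<lambda>x. csp.xkeys (xs x) (us x))"
  unfolding csp.xkeys_def by (intro ptime assms assms[THEN on_fst] assms[THEN on_fst2])

lemma ptime_ykeys [ptime]:
  assumes "ptime ys" "ptime us"
  shows "ptime (\<lambda>x. csp.ykeys (ys x) (us x))"
  unfolding csp.ykeys_def by (intro ptime assms assms[THEN on_fst] assms[THEN on_fst2])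

lemma ptime_okeys [ptime]:
  assumes "ptime us" "ptime cs"
  shows "ptime (\<lambda>x. csp.okeys (us x) (cs x))"
  unfolding csp.okeys_def by (intro ptime assms assms[THEN on_fst] assms[THEN on_fst2])

lemma ptime_actives [ptime]:
  assumes "ptime xs" "ptime ys" "ptime zs" "ptime cs"
  shows "ptime (\<lambda>x. csp.actives (xs x) (ys x) (zs x) (cs x))"
  unfolding csp.actives_def by (intro ptime assms assms[THEN on_fst] assms[THEN on_fst2])

lemma ptime_groups [ptime]:
  assumes "ptime xs" "ptime ys" "ptime zs" "ptime cs"
  shows "ptime (\<lambda>x. csp.groups (xs x) (ys x) (zs x) (cs x))"
  unfolding csp.groups_def by (intro ptime assms assms[THEN on_fst] assms[THEN on_fst2])

lemma ptime_keys [ptime]: "ptime xs ==> ptime ys ==> ptime zs ==> ptime us ==> ptime cs ==> ptime (\<lambda>x. csp.keys (xs x) (ys x) (zs x) (us x) (cs x))"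
  unfolding csp.keys_def by (intro ptime)

lemma ptime_escape [ptime]:
  assumes "ptime xs" "ptime ys" "ptime zs" "ptime us" "ptime cs" "ptime y"
  shows "ptime (\<lambda>x. csp.escape (xs x) (ys x) (zs x) (us x) (cs x) (y x))"
  unfolding csp.escape_def by (intro ptime assms assms[THEN on_fst] assms[THEN on_fst2])

lemma ptime_null_item [ptime]:
  assumes "ptime xs" "ptime us" "ptime v" "ptime u"
  shows "ptime (\<lambda>x. csp.null_item (xs x) (us x) (v x) (u x))"
  unfolding csp.null_item_def by (intro ptime assms assms[THEN on_fst] assms[THEN on_fst2])

lemma ptime_var_okeys [ptime]:
  assumes "ptime us" "ptime cs" "ptime v" "ptime u"
  shows "ptime (\<lambda>x. csp.var_okeys (us x) (cs x) (v x) (u x))"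
  unfolding csp.var_okeys_def by (intro ptime assms assms[THEN on_fst] assms[THEN on_fst2])

lemma ptime_var_item [ptime]:
  assumes "ptime xs" "ptime ys" "ptime us" "ptime cs" "ptime v" "ptime u"
  shows "ptime (\<lambda>x. csp.var_item (xs x) (ys x) (us x) (cs x) (v x) (u x))"
  unfolding csp.var_item_def by (intro ptime assms assms[THEN on_fst] assms[THEN on_fst2])

lemma ptime_con_item [ptime]:
  assumes "ptime c" "ptime e"
  shows "ptime (\<lambda>x. csp.con_item (c x) (e x))"
  unfolding csp.con_item_def by (intro ptime assms assms[THEN on_fst] assms[THEN on_fst2])

lemma ptime_other_ykeys [ptime]:
  assumes "ptime ys" "ptime us" "ptime y"
  shows "ptime (\<lambda>x. csp.other_ykeys (ys x) (us x) (y x))"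
  unfolding csp.other_ykeys_def by (intro ptime assms assms[THEN on_fst] assms[THEN on_fst2])

lemma ptime_mode_items [ptime]:
  assumes "ptime xs" "ptime ys" "ptime zs" "ptime us" "ptime cs"
  shows "ptime (\<lambda>x. csp.mode_items (xs x) (ys x) (zs x) (us x) (cs x))"
  unfolding csp.mode_items_def by (intro ptime assms assms[THEN on_fst] assms[THEN on_fst2])

lemma ptime_var_items [ptime]:
  assumes "ptime xs" "ptime ys" "ptime us" "ptime cs" "ptime v"
  shows "ptime (\<lambda>x. csp.var_items (xs x) (ys x) (us x) (cs x) (v x))"
  unfolding csp.var_items_def by (intro ptime assms assms[THEN on_fst] assms[THEN on_fst2])

lemma ptime_con_items [ptime]:
  assumes "ptime c"
  shows "ptime (\<lambda>x. csp.con_items (c x))"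
  unfolding csp.con_items_def by (intro ptime assms assms[THEN on_fst] assms[THEN on_fst2])

lemma ptime_fill_items [ptime]:
  assumes "ptime us" "ptime c" "ptime p"
  shows "ptime (\<lambda>x. csp.fill_items (us x) (c x) (p x))"
  unfolding csp.fill_items_def by (intro ptime assms assms[THEN on_fst] assms[THEN on_fst2])

lemma ptime_seg_items [ptime]:
  assumes "ptime ys" "ptime us" "ptime p"
  shows "ptime (\<lambda>x. csp.seg_items (ys x) (us x) (p x))"
  unfolding csp.seg_items_def by (intro ptime assms assms[THEN on_fst] assms[THEN on_fst2])

lemma ptime_items1 [ptime]: "ptime xs ==> ptime us ==> ptime (\<lambda>x. csp.items1 (xs x) (us x))"
  unfolding csp.items1_def by (intro ptime)

lemma ptime_items2 [ptime]: "ptime ys ==> ptime us ==> ptime (\<lambda>x. csp.items2 (ys x) (us x))"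
  unfolding csp.items2_def by (intro ptime)

lemma ptime_items3 [ptime]:
  assumes "ptime xs" "ptime ys" "ptime zs" "ptime us" "ptime cs"
  shows "ptime (\<lambda>x. csp.items3 (xs x) (ys x) (zs x) (us x) (cs x))"
  unfolding csp.items3_def by (intro ptime assms assms[THEN on_fst] assms[THEN on_fst2])

lemma ptime_fchildren [ptime]:
  assumes "ptime t"
  shows "ptime (\<lambda>x. fchildren (t x))"
  unfolding fchildren_def by (intro ptime assms assms[THEN on_fst] assms[THEN on_fst2])

lemma length_le_weight: "length ts \<le> sum_list (map weight ts)"
proof (induction ts)
  case (Cons t ts)
  then show ?case using weight_simps(2)[of t] by simp
qed simp

lemma weight_le_sz: "weight t \<le> sz t"
proof (induction t)
  case (Num n)
  then show ?case using length_le_sz[of "bits n"] by (simp add: weight_def)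
next
  case (Node ts)
  then have "sum_list (map weight ts) \<le> sz ts" by (induction ts) (auto simp: le_SucI add_mono)
  then show ?case by (simp add: weight_simps(1))
qed

lemma sz_kids: "s \<in> set (kids t) ==> sz s \<le> sz t"
  by (cases t) (auto dest: sz_elem)

text \<open>All trees in a state are no larger than \<open>t\<close>, and their number is bounded by
  the weight of \<open>t\<close>.\<close>

lemma sz_layers:
  "sz ((expand_layer ^^ i) ([], [t])) \<le> 2 * (sz t * (sz t + 1) + 1) + 1"
proof -
  let ?L = "(expand_layer ^^ i) ([], [t])"
  have elems: "set (fst ?L) \<union> set (snd ?L) \<subseteq> {s. sz s \<le> sz t}"
    by (induction i) (auto simp: expand_layer fchildren_def split: if_splits dest!: sz_kids)
  have len: "length (fst ?L) \<le> sz t" "length (snd ?L) \<le> sz t"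
    using layers_weight[of i t] weight_le_sz[of t] length_le_weight[of "snd ?L"] by linarith+
  have "sz ts \<le> sz t * (sz t + 1) + 1" if "set ts \<subseteq> {s. sz s \<le> sz t}" "length ts \<le> sz t" for ts :: "tree list"
  proof -
    have "sz ts \<le> length ts * (sz t + 1) + 1" using that(1) by (intro sz_list_le) auto
    also have "\<dots> \<le> sz t * (sz t + 1) + 1" using that(2) by (intro add_mono mult_right_mono) auto
    finally show ?thesis .
  qed
  then have "sz (fst ?L) \<le> sz t * (sz t + 1) + 1" "sz (snd ?L) \<le> sz t * (sz t + 1) + 1" using elems len by auto
  then show ?thesis by (cases ?L) simp
qed

lemma ptime_nodes [ptime]:
  assumes "ptime n" "ptime t"
  shows "ptime (\<lambda>x. nodes (n x) (t x))"
proof -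
  have "ptime (\<lambda>x. (expand_layer ^^ n x) ([], [t x]))"
  proof (rule ptime_funpow[where B = "\<lambda>x. 2 * (sz (t x) * (sz (t x) + 1) + 1) + 1"])
    show "ptime (\<lambda>p. expand_layer (snd p))" unfolding expand_layer_def by (intro ptime)
  qed (intro ptime assms sz_layers)+
  then show ?thesis unfolding nodes_def by (rule ptime_fst)
qed

text \<open>A step moves a variable from the tree to the list and drops the quantifier, so the state
  does not grow.\<close>

lemma sz_strip: "sz ((strip_step j ^^ i) ([], t)) \<le> sz t + 2"
proof -
  have step: "sz (strip_step j p) \<le> sz p" for p
  proof (cases "\<not> is_num (snd p) \<and> component (snd p) 0 = Num j \<and> length (kids (snd p)) = 3 \<and> is_num (component (snd p) 1)")
    case True
    then have "snd p = Node [component (snd p) 0, component (snd p) 1, component (snd p) 2]" using kids_3 by blast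
    then obtain a b c where abc: "snd p = Node [a, b, c]" by blast
    then show ?thesis using True by (cases p) (simp add: strip_step_def sz_append)
  next
    case False
    then show ?thesis unfolding strip_step_def by (simp only: if_False)
  qed
  show ?thesis
  proof (induction i)
    case (Suc i)
    then show ?case using step[of "(strip_step j ^^ i) ([], t)"] by simp
  qed simp
qed

lemma ptime_strip [ptime]:
  assumes "ptime n" "ptime t"
  shows "ptime (\<lambda>x. strip j (n x) (t x))"
proof -
  have "ptime (\<lambda>x. (strip_step j ^^ n x) ([], t x))"
  proof (rule ptime_funpow[where B = "\<lambda>x. sz (t x) + 2"])
    show "ptime (\<lambda>p. strip_step j (snd p))" unfolding strip_step_def by (intro ptime)
  qed (intro ptime assms sz_strip)+
  then show ?thesis unfolding strip_def .
qed

lemma ptime_outer [ptime]: "ptime n ==> ptime t ==> ptime (\<lambda>x. outer (n x) (t x))"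
  unfolding outer_def by (intro ptime)

lemma ptime_middle [ptime]: "ptime n ==> ptime t ==> ptime (\<lambda>x. middle (n x) (t x))"
  unfolding middle_def by (intro ptime)

lemma ptime_inner [ptime]: "ptime n ==> ptime t ==> ptime (\<lambda>x. inner (n x) (t x))"
  unfolding inner_def by (intro ptime)

lemma ptime_node_ok [ptime]:
  assumes "ptime rs" "ptime vs" "ptime t"
  shows "ptime (\<lambda>x. node_ok (rs x) (vs x) (t x))"
  unfolding node_ok_def by (intro ptime assms assms[THEN on_fst] assms[THEN on_fst2])

lemma ptime_rel_ok [ptime]:
  assumes "ptime us" "ptime t"
  shows "ptime (\<lambda>x. rel_ok (us x) (t x))"
  unfolding rel_ok_def by (intro ptime assms assms[THEN on_fst] assms[THEN on_fst2])

lemma ptime_mc_tree [ptime]: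
  assumes "ptime n" "ptime t"
  shows "ptime (\<lambda>x. mc_tree (n x) (t x))"
  unfolding mc_tree_def by (intro ptime assms assms[THEN on_fst] assms[THEN on_fst2])

lemma ptime_rel_tuples [ptime]:
  assumes "ptime rs" "ptime i"
  shows "ptime (\<lambda>x. rel_tuples (rs x) (i x))"
  unfolding rel_tuples_def by (intro ptime assms assms[THEN on_fst] assms[THEN on_fst2])

lemma ptime_exits [ptime]:
  assumes "ptime us" "ptime R"
  shows "ptime (\<lambda>x. exits (us x) (R x))"
  unfolding exits_def by (intro ptime assms assms[THEN on_fst] assms[THEN on_fst2])

lemma ptime_gate [ptime]: "ptime t ==> ptime (\<lambda>x. gate (t x))"
  unfolding gate_def by (intro ptime)

lemma ptime_node_con [ptime]:
  assumes "ptime us" "ptime rs" "ptime t"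
  shows "ptime (\<lambda>x. node_con (us x) (rs x) (t x))"
  unfolding node_con_def by (intro ptime assms assms[THEN on_fst] assms[THEN on_fst2])

lemma ptime_csp_xs [ptime]:
  assumes "ptime xs" "ptime ys" "ptime zs"
  shows "ptime (\<lambda>x. csp_xs (xs x) (ys x) (zs x))"
  unfolding csp_xs_def by (intro ptime assms assms[THEN on_fst] assms[THEN on_fst2])

lemma ptime_csp_ys [ptime]:
  assumes "ptime ys" "ptime zs"
  shows "ptime (\<lambda>x. csp_ys (ys x) (zs x))"
  unfolding csp_ys_def by (intro ptime assms assms[THEN on_fst] assms[THEN on_fst2])

lemma ptime_csp_zs [ptime]: "ptime zs ==> ptime N ==> ptime (\<lambda>x. csp_zs (zs x) (N x))"
  unfolding csp_zs_def by (intro ptime)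

lemma ptime_csp_cons [ptime]:
  assumes "ptime us" "ptime rs" "ptime N" "ptime t"
  shows "ptime (\<lambda>x. csp_cons (us x) (rs x) (N x) (t x))"
  unfolding csp_cons_def by (intro ptime assms assms[THEN on_fst] assms[THEN on_fst2])

text \<open>A digit in base \<open>2 ^ (g + 1)\<close> is a block of \<open>Suc g\<close> bits, so
  these numbers are written down without arithmetic.\<close>

definition code_bits :: "nat => key list => key list => nat list" where
  "code_bits g D I = concat (map (\<lambda>q. (if q \<in> set I then 1 else 0) # replicate g 0) D)"

text \<open>Different lists of keys can have the same set of keys and then give the same number. The
  duplicates are removed on the normal forms, since a set has to be listed without
  repetition.\<close>

definition item_words :: "nat => key list => key list list => nat list list" where
  "item_words g D items = map (\<lambda>b. b @ [2]) (remdups (map (\<lambda>I. trim (code_bits g D I)) items))"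

definition csp_word :: "tree list => tree list => tree list => tree list => con list => nat list" where
  "csp_word xs ys zs us cs =
     (let m = length (remdups (csp.groups xs ys zs cs)); g = length xs + length ys + m; D = csp.keys xs ys zs us cs
      in wnode [wnode (item_words g D (csp.items1 xs us)), wnum (length xs),
        wnode (item_words g D (csp.items2 ys us)), wnum (length ys),
        wnode (item_words g D (csp.items3 xs ys zs us cs)), wnum m, trim (code_bits g D D) @ [2]])"

definition mc_to_sss :: "nat list => nat list" where
  "mc_to_sss w = (case parse w of [] => [] | T # _ =>
     if \<not> mc_tree (length w) T then []
     else let us = kids (component T 0); Rs = kids (component T 1); F = component T 2; n = length w;
         xs = fst (outer n F); ys = fst (middle n F); zs = fst (inner n F); t = snd (inner n F); N = nodes n t
       in csp_word (csp_xs xs ys zs) (csp_ys ys zs) (csp_zs zs N) us (csp_cons us Rs N t))"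

lemma ptime_code_bits [ptime]:
  assumes "ptime g" "ptime D" "ptime i"
  shows "ptime (\<lambda>x. code_bits (g x) (D x) (i x))"
  unfolding code_bits_def by (intro ptime assms assms[THEN on_fst] assms[THEN on_fst2])

lemma ptime_item_words [ptime]:
  assumes "ptime g" "ptime D" "ptime i"
  shows "ptime (\<lambda>x. item_words (g x) (D x) (i x))"
  unfolding item_words_def by (intro ptime assms assms[THEN on_fst] assms[THEN on_fst2])

lemma ptime_csp_word [ptime]:
  assumes "ptime xs" "ptime ys" "ptime zs" "ptime us" "ptime cs"
  shows "ptime (\<lambda>x. csp_word (xs x) (ys x) (zs x) (us x) (cs x))"
  unfolding csp_word_def Let_def by (intro ptime assms assms[THEN on_fst] assms[THEN on_fst2])

lemma ptime_mc_to_sss: "ptime mc_to_sss"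
proof -
  have "ptime (\<lambda>w. mc_to_sss w)" unfolding mc_to_sss_def Let_def by (intro ptime)
  then show ?thesis .
qed

lemma val_code_bits: "val (code_bits g D I) = code g D (set I)"
proof (induction D)
  case (Cons q D)
  have "val (replicate m 0 @ bs) = 2 ^ m * val bs" for m bs by (induction m) (auto simp: bit_of_def)
  then show ?case using Cons by (simp add: code_bits_def bit_of_def)
qed (simp add: code_bits_def)

lemma remdups_map_inj: "inj f ==> map f (remdups xs) = remdups (map f xs)"
  by (induction xs) (auto simp: inj_image_mem_iff)

lemma item_words: "item_words g D items = map wnum (remdups (map (\<lambda>I. code g D (set I)) items))"
proof -
  have "map bits (remdups ns) = remdups (map bits ns)" for ns
    using bits_inj by (intro remdups_map_inj injI)
  then have "map wnum (remdups ns) = map (\<lambda>b. b @ [2]) (remdups (map bits ns))" for ns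
    by (simp add: wnum_def comp_def flip: \<open>\<And>ns. map bits (remdups ns) = remdups (map bits ns)\<close>)
  then show ?thesis by (simp add: item_words_def comp_def val_code_bits[symmetric] bits_val)
qed

lemma code_set: "set D \<subseteq> S ==> code g D S = code g D UNIV"
  by (induction D) auto

lemma csp_word:
  assumes "wf_csp xs ys zs us cs"
  obtains ns1 ns2 ns3 t where
    "csp_word xs ys zs us cs = enc_alt3 ns1 (length xs) ns2 (length ys) ns3 (card (set (csp.groups xs ys zs cs))) t"
    "distinct ns1" "distinct ns2" "distinct ns3"
    "(set ns1, length xs, set ns2, length ys, set ns3, card (set (csp.groups xs ys zs cs)), t) \<in> alt3_sss
      \<longleftrightarrow> csp.winning xs ys zs us cs"
proof -
  let ?m = "card (set (csp.groups xs ys zs cs))"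
  let ?g = "length xs + length ys + ?m" and ?D = "csp.keys xs ys zs us cs"
  let ?ns = "\<lambda>items. remdups (map (\<lambda>I. code ?g ?D (set I)) items)"
  have m: "length (remdups (csp.groups xs ys zs cs)) = ?m" by (rule length_remdups_card_conv)
  have "trim (code_bits ?g ?D ?D) = bits (code ?g ?D UNIV)"
    using bits_val[of "code_bits ?g ?D ?D"] by (simp only: val_code_bits code_set[OF order_refl])
  then have "csp_word xs ys zs us cs = enc_alt3 (?ns (csp.items1 xs us)) (length xs) (?ns (csp.items2 ys us)) (length ys)
      (?ns (csp.items3 xs ys zs us cs)) ?m (code ?g ?D UNIV)"
    unfolding csp_word_def Let_def m item_words enc_alt3_def
    by (simp add: enc_words wnum_def[symmetric] del: enc.simps)
  moreover have "(set (?ns (csp.items1 xs us)), length xs, set (?ns (csp.items2 ys us)), length ys,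
      set (?ns (csp.items3 xs ys zs us cs)), ?m, code ?g ?D UNIV) \<in> alt3_sss \<longleftrightarrow> csp.winning xs ys zs us cs"
    using wf_csp.alt3_sss_iff_winning[OF assms] by simp
  ultimately show ?thesis using that by simp
qed

lemma weight_nodes: "\<nu> \<in> set (nodes n t) ==> weight \<nu> \<le> weight t"
proof -
  have "set (nodes n t) \<subseteq> {s. weight s \<le> weight t}"
    by (rule nodes_subset) (auto simp: fchildren_def split: if_splits dest!: weight_kids)
  then show "\<nu> \<in> set (nodes n t) ==> weight \<nu> \<le> weight t" by blast
qed

lemma length_kids: "length (kids t) \<le> weight t"
  using length_le_weight[of "kids t"] by (cases t) (auto simp: weight_simps(1))

lemma length_node_con: "length (fst (node_con us Rs \<nu>)) \<le> weight \<nu> + 3"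
proof -
  have "weight (component \<nu> 2) \<le> weight \<nu>"
  proof (cases "2 < length (kids \<nu>)")
    case True
    then have "component \<nu> 2 \<in> set (kids \<nu>)" by (simp add: component_def nth_or_def)
    then show ?thesis using weight_kids less_imp_le by blast
  next
    case False
    then have "weight (component \<nu> 2) = 1" by (simp add: component_def nth_or_def weight_def bits.simps)
    then show ?thesis using weight_simps(2) by simp
  qed
  moreover have "length (fchildren \<nu>) \<le> weight \<nu>"
    using le_trans[OF length_filter_le length_kids] by (simp add: fchildren_def)
  ultimately show ?thesis using length_kids[of "component \<nu> 2"] by (simp add: node_con_def)
qed

text \<open>The third size depends on the sentence alone: the number of subformulas is at most
  \<open>weight t\<close>, and the scope of a constraint exceeds the weight of its subformula by at
  most 3. The universe and the relations enter only the keys and the items.\<close>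

lemma groups_bound:
  fixes n t us Rs
  defines "N \<equiv> nodes n t"
  shows "card (set (csp.groups (csp_xs xs ys zs) (csp_ys ys zs) (csp_zs zs N) (csp_cons us Rs N t))) \<le>
    length xs + 2 * length ys + length zs + weight t * (weight t + 6) + 4"
proof -
  let ?C = "csp_cons us Rs N t"
  have N: "length N \<le> weight t" using length_nodes by (simp add: N_def)
  have remdups: "length (remdups (filter P vs)) \<le> length vs" for P and vs :: "tree list"
    using length_remdups_leq[of "filter P vs"] length_filter_le[of P vs] by linarith
  have "sum_list (map (\<lambda>c. length (fst c)) ?C) \<le> 1 + length N * (weight t + 3)"
  proof -
    have "sum_list (map (\<lambda>\<nu>. length (fst (node_con us Rs \<nu>))) L) \<le> length L * (weight t + 3)" if "set L \<subseteq> set N" for L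
      using that
    proof (induction L)
      case (Cons \<nu> L)
      then show ?case using length_node_con[of us Rs \<nu>] weight_nodes[of \<nu> n t] by (simp add: N_def)
    qed simp
    from this[OF order_refl] show ?thesis by (simp add: csp_cons_def comp_def)
  qed
  also have "length N * (weight t + 3) \<le> weight t * (weight t + 3)" using N by (rule mult_right_mono) simp
  finally have fills: "sum_list (map (\<lambda>c. length (fst c)) ?C) \<le> 1 + weight t * (weight t + 3)" by simp
  have "card (set (csp.groups (csp_xs xs ys zs) (csp_ys ys zs) (csp_zs zs N) ?C)) \<le>
      length (csp.groups (csp_xs xs ys zs) (csp_ys ys zs) (csp_zs zs N) ?C)" by (rule card_length)
  also have "\<dots> = 2 + (length (csp_xs xs ys zs) + 2 * length (csp_ys ys zs) + length (csp_zs zs N)) + length ?C +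
      sum_list (map (\<lambda>c. length (fst c)) ?C)"
    by (simp add: csp.groups_def csp.vars_def length_concat comp_def del: upt_Suc)
  also have "\<dots> \<le> 2 + (length xs + 2 * length ys + (length zs + weight t)) + (1 + weight t) + (1 + weight t * (weight t + 3))"
  proof -
    have "length (csp_xs xs ys zs) \<le> length xs" "length (csp_ys ys zs) \<le> length ys" unfolding csp_xs_def csp_ys_def by (rule remdups)+
    moreover have "length (csp_zs zs N) \<le> length zs + weight t"
      using length_remdups_leq[of zs] length_remdups_leq[of N] N unfolding csp_zs_def length_append by linarith
    moreover have "length ?C \<le> 1 + weight t" using N by (simp add: csp_cons_def)
    ultimately show ?thesis using fills by linarith
  qed
  also have "\<dots> \<le> length xs + 2 * length ys + length zs + weight t * (weight t + 6) + 4" by (simp add: algebra_simps)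
  finally show ?thesis .
qed

lemma mc_to_sss_instance:
  assumes "parse w = [T]" "mc_tree (length w) T"
  obtains us Rs \<phi> ns1 k ns2 l ns3 m t where "w = enc_mc us Rs \<phi>" "mc_instance 3 us Rs \<phi>"
    "mc_to_sss w = enc_alt3 ns1 k ns2 l ns3 m t" "distinct ns1" "distinct ns2" "distinct ns3"
    "(set ns1, k, set ns2, l, set ns3, m, t) \<in> alt3_sss \<longleftrightarrow> models (listed_structure us Rs) \<phi>"
    "k + l + m \<le> (form_size \<phi> + 2) ^ 4"
proof -
  have w: "w = enc T" using assms(1) parse_iff by blast
  let ?n = "length w" and ?F = "component T 2"
  have n: "weight T \<le> ?n" by (simp add: w weight_def)
  obtain us Rs xs ys zs \<psi> where T: "T = mc_to_tree us Rs (foldr Exi xs (foldr Uni ys (foldr Exi zs \<psi>)))"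
    and parts: "fst (outer ?n ?F) = map Num xs" "fst (middle ?n ?F) = map Num ys"
      "fst (inner ?n ?F) = map Num zs" "snd (inner ?n ?F) = form_tree \<psi>"
    and ok: "distinct us" "us \<noteq> []" "\<forall>p\<in>set Rs. wf_rel us p" "good Rs (set xs \<union> set ys \<union> set zs) \<psi>"
    using mc_tree_sound[OF n assms(2)] by blast
  let ?\<phi> = "foldr Exi xs (foldr Uni ys (foldr Exi zs \<psi>))"
  have F: "?F = form_tree ?\<phi>" "component T 0 = nums us" "component T 1 = Node (map rel_tree Rs)"
    by (simp_all add: T mc_to_tree_def)
  have size: "length xs + length ys + length zs + weight (form_tree \<psi>) \<le> form_size ?\<phi>"
    using prefix_weight[of ?n ?F] unfolding parts by (simp add: F(1) form_size_def weight_def)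
  have "form_size ?\<phi> \<le> ?n" using n by (simp add: T mc_to_tree_def weight_simps(1)) (simp add: weight_def form_size_def)
  then interpret mc_csp us Rs xs ys zs \<psi> ?n using ok size by unfold_locales linarith+
  have word: "mc_to_sss w = csp_word X Y Z U C"
    unfolding mc_to_sss_def assms(1) list.case Let_def parts F(2,3) using assms(2) by simp
  obtain ns1 ns2 ns3 t where enc:
    "csp_word X Y Z U C = enc_alt3 ns1 (length X) ns2 (length Y) ns3 (card (set (csp.groups X Y Z C))) t"
    "distinct ns1" "distinct ns2" "distinct ns3"
    "(set ns1, length X, set ns2, length Y, set ns3, card (set (csp.groups X Y Z C)), t) \<in> alt3_sss \<longleftrightarrow> csp.winning X Y Z U C"
    using csp_word[OF wf_csp] by blast
  have "mc_instance 3 us Rs ?\<phi>" using mc_instance_iff[of us Rs xs ys zs \<psi>] ok by blast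
  moreover have "length X + length Y + card (set (csp.groups X Y Z C)) \<le> (form_size ?\<phi> + 2) ^ 4"
  proof -
    let ?s = "form_size ?\<phi>" and ?q = "weight (form_tree \<psi>)"
    have "length X \<le> length xs" "length Y \<le> length ys"
      using length_remdups_leq length_filter_le le_trans unfolding csp_xs_def csp_ys_def by (metis length_map)+
    moreover have "card (set (csp.groups X Y Z C)) \<le> length xs + 2 * length ys + length zs + ?q * (?q + 6) + 4"
      using groups_bound[of "map Num xs" "map Num ys" "map Num zs" ?n "form_tree \<psi>"] by simp
    moreover have "?q * (?q + 6) \<le> ?s * (?s + 6)" using size by (intro mult_mono) linarith+
    ultimately have "length X + length Y + card (set (csp.groups X Y Z C)) \<le> 3 * ?s + ?s * (?s + 6) + 4"
      using size by linarith
    also have "\<dots> \<le> 4 * (?s + 2) ^ 2" by (simp add: power2_eq_square algebra_simps)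
    also have "\<dots> \<le> (?s + 2) ^ 2 * (?s + 2) ^ 2" using power_mono[of 2 "?s + 2" 2] by (intro mult_right_mono) auto
    also have "\<dots> = (?s + 2) ^ 4" by (simp add: power_add[symmetric])
    finally show ?thesis .
  qed
  moreover have "w = enc_mc us Rs ?\<phi>" unfolding enc_mc_tree w T ..
  ultimately show ?thesis using that[OF _ _ word[unfolded enc(1)] enc(2-4)] enc(5) winning_iff_models by blast
qed

lemma reducible_mc_to_sss:
  assumes Q: "fpt_reducible Q (p_mc 3)"
  shows "fpt_reducible Q p_alt3_sss"
proof -
  have alphabets: "alphabet (p_mc 3) = code_alphabet" "alphabet p_alt3_sss = code_alphabet" "finite code_alphabet"
    by (simp_all add: p_mc_def p_alt3_sss_def code_alphabet_def)
  have main: "mc_to_sss w \<in> lists code_alphabet \<and> (w \<in> yes_instances (p_mc 3) \<longleftrightarrow> mc_to_sss w \<in> yes_instances p_alt3_sss) \<and>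
    alt3_param (mc_to_sss w) \<le> (mc_param 3 w + 2) ^ 4" for w
  proof (cases "\<exists>T. parse w = [T] \<and> mc_tree (length w) T")
    case True
    then obtain T where "parse w = [T]" "mc_tree (length w) T" by blast
    then obtain us Rs \<phi> ns1 k ns2 l ns3 m t where w: "w = enc_mc us Rs \<phi>" "mc_instance 3 us Rs \<phi>"
      and enc: "mc_to_sss w = enc_alt3 ns1 k ns2 l ns3 m t" and dist: "distinct ns1" "distinct ns2" "distinct ns3"
      and iff: "(set ns1, k, set ns2, l, set ns3, m, t) \<in> alt3_sss \<longleftrightarrow> models (listed_structure us Rs) \<phi>"
      and le: "k + l + m \<le> (form_size \<phi> + 2) ^ 4"
      by (rule mc_to_sss_instance)
    have "w \<in> yes_instances (p_mc 3) \<longleftrightarrow> models (listed_structure us Rs) \<phi>" unfolding p_mc_def using w by auto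
    moreover have "mc_to_sss w \<in> yes_instances p_alt3_sss \<longleftrightarrow> (set ns1, k, set ns2, l, set ns3, m, t) \<in> alt3_sss"
      unfolding p_alt3_sss_def enc using dist by auto
    moreover have "mc_to_sss w \<in> lists code_alphabet" unfolding enc enc_alt3_def by (rule enc_in_lists)
    moreover have "alt3_param (mc_to_sss w) \<le> (mc_param 3 w + 2) ^ 4"
    proof -
      have "alt3_param (mc_to_sss w) = max 1 (k + l + m)" unfolding enc by (rule alt3_param_enc[OF dist])
      moreover have "mc_param 3 w = form_size \<phi>" unfolding w(1) by (rule mc_param_enc[OF w(2)])
      moreover have "1 \<le> (form_size \<phi> + 2) ^ 4" by (rule one_le_power) simp
      ultimately show ?thesis using le by simp
    qed
    ultimately show ?thesis using iff by blast
  next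
    case False
    then have nil: "mc_to_sss w = []" using parse_cases[of w] by (auto simp: mc_to_sss_def)
    have "\<not> mc_instance 3 us Rs \<phi>" if w: "w = enc_mc us Rs \<phi>" for us Rs \<phi>
    proof
      assume "mc_instance 3 us Rs \<phi>"
      moreover have "parse w = [mc_to_tree us Rs \<phi>]" unfolding parse_iff w enc_mc_tree ..
      moreover have "weight (mc_to_tree us Rs \<phi>) \<le> length w" unfolding w enc_mc_tree weight_def ..
      ultimately show False using mc_tree_complete False by blast
    qed
    then have "w \<notin> yes_instances (p_mc 3)" unfolding p_mc_def by auto
    moreover have "[] \<noteq> enc_alt3 xs k ys l zs m t" for xs k ys l zs m t unfolding enc_alt3_def by simp
    then have "[] \<notin> yes_instances p_alt3_sss" "alt3_param [] = 1" unfolding p_alt3_sss_def alt3_param_def by auto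
    moreover have "1 \<le> (mc_param 3 w + 2) ^ 4" by (rule one_le_power) simp
    ultimately show ?thesis unfolding nil by simp
  qed
  have parameters: "parameter p_alt3_sss = alt3_param" "parameter (p_mc 3) = mc_param 3"
    by (simp_all add: p_mc_def p_alt3_sss_def)
  show ?thesis
  proof (rule fpt_reducible_compose[OF Q ptime_mc_to_sss])
    show "finite (alphabet (p_mc 3))" "finite (alphabet p_alt3_sss)" unfolding alphabets(1,2) by (rule alphabets(3))+
    show "mc_to_sss ` lists (alphabet (p_mc 3)) \<subseteq> lists (alphabet p_alt3_sss)" unfolding alphabets(1,2) using main by blast
    show "w \<in> yes_instances (p_mc 3) \<longleftrightarrow> mc_to_sss w \<in> yes_instances p_alt3_sss" for w using main by blast
    show "parameter p_alt3_sss (mc_to_sss w) \<le> (parameter (p_mc 3) w + 2) ^ 4" for w unfolding parameters using main by blast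
  qed
qed

theorem theorem2:
  shows "fpt_complete (A_class 3) p_alt3_sss"
  unfolding fpt_complete_def A_class_def
  using is_param_problem_alt3 sss_reducible_to_mc reducible_mc_to_sss by blast

end
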